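(* Let $d\in\mathbb{N}$, let $k\ge2$ be an integer, let $1\le p,q\le\infty$ and $s<0$. Let either $\mathcal{M}=\mathbb{R}^d$, or $\mathcal{M}=\mathbb{T}^d$ and $p=q$. For $\sigma\in\mathbb{R}$ let $$X^{p,q}_\sigma(\mathcal{M})=\begin{cases}\widehat{w}^{\,p,q}_\sigma(\mathbb{R}^d)&\text{if }\mathcal{M}=\mathbb{R}^d,\\ \mathcal{F}L^{\sigma,q}(\mathbb{T}^d)&\text{if }\mathcal{M}=\mathbb{T}^d\text{ and }p=q,\end{cases}$$ and $\mathcal{X}^{p,q}_s(\mathcal{M})=X^{p,q}_s(\mathcal{M})\times X^{p,q}_{s-1}(\mathcal{M})$. Consider the nonlinear wave equation $\partial_t^2u-\Delta u=\pm u^k$ on $\mathbb{R}\times\mathcal{M}$, with either choice of sign. Fix $(u_0,u_1)\in\mathcal{X}^{p,q}_s(\mathcal{M})$. Then, given any $\varepsilon>0$, there exist a solution $u_\varepsilon$ to this equation on $\mathcal{M}$ and a time $t_\varepsilon\in(0,\varepsilon)$ such that $$\|(u_\varepsilon(0),\partial_tu_\varepsilon(0))-(u_0,u_1)\|_{\mathcal{X}^{p,q}_s(\mathcal{M})}<\varepsilon\qquad\text{and}\qquad\|u_\varepsilon(t_\varepsilon)\|_{X^{p,q}_s(\mathcal{M})}>\varepsilon^{-1}.$$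
   Context: $\mathbb{N}=\{1,2,\dots\}$, $\mathbb{T}=\mathbb{R}/2\pi\mathbb{Z}$; functions may be complex-valued. $\widehat{f}$ is the Fourier transform on $\mathcal{M}$ (any fixed standard normalization), a function on $\widehat{\mathcal{M}}$, where $\widehat{\mathcal{M}}=\mathbb{R}^d$ (Lebesgue measure) if $\mathcal{M}=\mathbb{R}^d$ and $\widehat{\mathcal{M}}=\mathbb{Z}^d$ (counting measure) if $\mathcal{M}=\mathbb{T}^d$. $\langle\xi\rangle=(1+|\xi|^2)^{1/2}$. $\mathcal{S}(\mathcal{M})$ is the Schwartz space if $\mathcal{M}=\mathbb{R}^d$ and $C^\infty(\mathbb{T}^d)$ if $\mathcal{M}=\mathbb{T}^d$. Fourier-Lebesgue space: $\mathcal{F}L^{s,q}(\mathcal{M})$ is the closure of $\mathcal{S}(\mathcal{M})$ under $\|f\|_{\mathcal{F}L^{s,q}}=\|\langle\xi\rangle^s\widehat{f}\|_{L^q(\widehat{\mathcal{M}})}$; $\mathcal{F}L^1=\mathcal{F}L^{0,1}$. Fourier-amalgam space: $\widehat{w}^{\,p,q}_s(\mathbb{R}^d)$ is the closure of $\mathcal{S}(\mathbb{R}^d)$ under $$\|f\|_{\widehat{w}^{\,p,q}_s(\mathbb{R}^d)}=\Big\|\langle n\rangle^s\|\chi_{n+Q}(\xi)\widehat{f}(\xi)\|_{L^p_\xi(\mathbb{R}^d)}\Big\|_{\ell^q_n(\mathbb{Z}^d)},\qquad Q=[-\tfrac12,\tfrac12)^d,$$ with $\chi_{n+Q}$ the indicator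 function of $n+Q$. Notion of solution: $u\in C([0,T];\mathcal{F}L^1(\mathcal{M}))$ for some $T\ge t_\varepsilon$, with initial data $(u,\partial_tu)|_{t=0}=(v_0,v_1)\in\mathcal{F}L^{0,1}\times\mathcal{F}L^{-1,1}$, satisfying the Duhamel formulation $$u(t)=\cos(t|\nabla|)v_0+\frac{\sin(t|\nabla|)}{|\nabla|}v_1\pm\int_0^t\frac{\sin((t-t')|\nabla|)}{|\nabla|}\big[u(t')^k\big]\,dt',\qquad 0\le t\le T,$$ where $m(|\nabla|)$ is the Fourier multiplier with symbol $m(|\xi|)$ and $\frac{\sin(t|0|)}{|0|}:=t$. Writing a norm of a function presupposes that the function belongs to the corresponding space. *)

theory Defs
  imports "HOL-Analysis.Analysis" "HOL-Probability.Essential_Supremum"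
begin

section \<open>The underlying space and its dual\<close>

text \<open>
  The dimension is the cardinality of the index type of \<open>real ^ 'd\<close>.  Functions on the torus are
  functions on \<open>real ^ 'd\<close> that are \<open>2 * pi\<close>-periodic in every coordinate, and functions on its
  dual are functions on \<open>real ^ 'd\<close> of which only the values on the integer lattice matter.
\<close>

datatype base_space = Euclidean | Torus

definition lattice :: "(real ^ 'd) set" where
  "lattice = {n. \<forall>i. n $ i \<in> \<int>}"

definition periodic :: "(real ^ 'd \<Rightarrow> complex) \<Rightarrow> bool" where
  "periodic f \<longleftrightarrow> (\<forall>x i. f (x + axis i (2 * pi)) = f x)"

definition space_measure :: "base_space \<Rightarrow> (real ^ 'd) measure" where
  "space_measure M = (case M of
      Euclidean \<Rightarrow> lborel
    | Torus \<Rightarrow> restrict_space lborel (cbox 0 (\<chi> i. 2 * pi)))"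

definition dual_measure :: "base_space \<Rightarrow> (real ^ 'd) measure" where
  "dual_measure M = (case M of Euclidean \<Rightarrow> lborel | Torus \<Rightarrow> count_space lattice)"

definition bracket :: "real ^ 'd \<Rightarrow> real" where
  "bracket \<xi> = sqrt (1 + (norm \<xi>)\<^sup>2)"


section \<open>Test functions and distributions\<close>

primrec pderivs :: "'d list \<Rightarrow> (real ^ 'd \<Rightarrow> complex) \<Rightarrow> real ^ 'd \<Rightarrow> complex" where
  "pderivs [] f = f"
| "pderivs (i # is) f = (\<lambda>x. frechet_derivative (pderivs is f) (at x) (axis i 1))"

definition smooth :: "(real ^ 'd \<Rightarrow> complex) \<Rightarrow> bool" where
  "smooth f \<longleftrightarrow> (\<forall>is x. pderivs is f differentiable at x)"

definition test_functions :: "base_space \<Rightarrow> (real ^ 'd \<Rightarrow> complex) set" where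
  "test_functions M = (case M of
      Euclidean \<Rightarrow> {f. smooth f \<and>
        (\<forall>m is. \<exists>C. \<forall>x. (1 + norm x) ^ m * norm (pderivs is f x) \<le> C)}
    | Torus \<Rightarrow> {f. smooth f \<and> periodic f})"

text \<open>
  The suprema below are over bounded sets when the argument is a test function.
\<close>

definition test_seminorm :: "base_space \<Rightarrow> nat \<Rightarrow> (real ^ 'd \<Rightarrow> complex) \<Rightarrow> real" where
  "test_seminorm M N f = (SUP (is, x) \<in> {is. length is \<le> N} \<times> UNIV.
     (case M of Euclidean \<Rightarrow> (1 + norm x) ^ N | Torus \<Rightarrow> 1) * norm (pderivs is f x))"

text \<open>
  A distribution is a functional of which only the values on test functions matter.
\<close>

type_synonym 'd distr = "(real ^ 'd \<Rightarrow> complex) \<Rightarrow> complex"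

definition distributions :: "base_space \<Rightarrow> 'd::finite distr set" where
  "distributions M = {T.
     (\<forall>\<phi>\<in>test_functions M. \<forall>\<psi>\<in>test_functions M. T (\<lambda>x. \<phi> x + \<psi> x) = T \<phi> + T \<psi>) \<and>
     (\<forall>\<phi>\<in>test_functions M. \<forall>c. T (\<lambda>x. c * \<phi> x) = c * T \<phi>) \<and>
     (\<exists>N C. \<forall>\<phi>\<in>test_functions M. norm (T \<phi>) \<le> C * test_seminorm M N \<phi>)}"

text \<open>
  Functions that define a distribution by integration, and the distribution they define.
\<close>

definition admissible :: "base_space \<Rightarrow> (real ^ 'd \<Rightarrow> complex) \<Rightarrow> bool" where
  "admissible M f \<longleftrightarrow> f \<in> borel_measurable borel \<and> (M = Torus \<longrightarrow> periodic f) \<and>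
     (\<forall>\<phi>\<in>test_functions M. integrable (space_measure M) (\<lambda>x. f x * \<phi> x))"

definition fdist :: "base_space \<Rightarrow> (real ^ 'd \<Rightarrow> complex) \<Rightarrow> 'd::finite distr" where
  "fdist M f = (\<lambda>\<phi>. LINT x|space_measure M. f x * \<phi> x)"


section \<open>Fourier transform\<close>

text \<open>
  The unitary normalization is used on both spaces.
\<close>

definition fourier_const :: "'d::finite itself \<Rightarrow> complex" where
  "fourier_const _ = of_real ((2 * pi) powr (- real CARD('d) / 2))"

definition fourier_fun :: "base_space \<Rightarrow> (real ^ 'd \<Rightarrow> complex) \<Rightarrow> real ^ 'd \<Rightarrow> complex" where
  "fourier_fun M \<phi> \<xi> =
     fourier_const TYPE('d) * (LINT x|space_measure M. \<phi> x * cis (- (x \<bullet> \<xi>)))"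

text \<open>
  \<open>is_fourier M T g\<close>: the Fourier transform of the distribution \<open>T\<close> is the function \<open>g\<close>.
  On Euclidean space this is the duality definition; on the torus \<open>g\<close> is the family of Fourier
  coefficients.
\<close>

definition is_fourier :: "base_space \<Rightarrow> 'd::finite distr \<Rightarrow> (real ^ 'd \<Rightarrow> complex) \<Rightarrow> bool" where
  "is_fourier M T g \<longleftrightarrow> (case M of
      Euclidean \<Rightarrow> g \<in> borel_measurable borel \<and>
        (\<forall>\<psi>\<in>test_functions Euclidean.
           integrable lborel (\<lambda>\<xi>. g \<xi> * \<psi> \<xi>) \<and>
           T (fourier_fun Euclidean \<psi>) = (LINT \<xi>|lborel. g \<xi> * \<psi> \<xi>))
    | Torus \<Rightarrow> (\<forall>n\<in>lattice. g n = fourier_const TYPE('d) * T (\<lambda>x. cis (- (x \<bullet> n)))))"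

text \<open>
  The choice is unique up to a null set of the dual measure; it is meaningful only for
  distributions whose Fourier transform is a function.
\<close>

definition fourier :: "base_space \<Rightarrow> 'd::finite distr \<Rightarrow> real ^ 'd \<Rightarrow> complex" where
  "fourier M T = (SOME g. is_fourier M T g)"

text \<open>
  The distribution with Fourier transform \<open>g\<close>.  Its value at \<open>\<phi>\<close> is the integral of \<open>g\<close> against
  the inverse Fourier transform of \<open>\<phi>\<close>, which is the reflected Fourier transform.
\<close>

definition inv_fourier :: "base_space \<Rightarrow> (real ^ 'd \<Rightarrow> complex) \<Rightarrow> 'd::finite distr" where
  "inv_fourier M g = (\<lambda>\<phi>. LINT \<xi>|dual_measure M. g \<xi> * fourier_fun M \<phi> (- \<xi>))"

definition multiplier :: "base_space \<Rightarrow> (real \<Rightarrow> real) \<Rightarrow> 'd::finite distr \<Rightarrow> 'd::finite distr" where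
  "multiplier M m T = inv_fourier M (\<lambda>\<xi>. of_real (m (norm \<xi>)) * fourier M T \<xi>)"


section \<open>Function spaces\<close>

definition ennpow :: "ennreal \<Rightarrow> real \<Rightarrow> ennreal" where
  "ennpow a r = (if a = \<infinity> then \<infinity> else ennreal (enn2real a powr r))"

definition Lp_norm :: "ennreal \<Rightarrow> 'a measure \<Rightarrow> ('a \<Rightarrow> ennreal) \<Rightarrow> ennreal" where
  "Lp_norm p \<mu> h = (if p = \<infinity> then esssup \<mu> h
     else ennpow (\<integral>\<^sup>+ x. ennpow (h x) (enn2real p) \<partial>\<mu>) (1 / enn2real p))"

definition FL_norm :: "base_space \<Rightarrow> real \<Rightarrow> ennreal \<Rightarrow> 'd::finite distr \<Rightarrow> ennreal" where
  "FL_norm M s q T =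
     Lp_norm q (dual_measure M) (\<lambda>\<xi>. ennreal (bracket \<xi> powr s * norm (fourier M T \<xi>)))"

definition unit_cell :: "real ^ 'd \<Rightarrow> (real ^ 'd) set" where
  "unit_cell n = {\<xi>. \<forall>i. n $ i - 1/2 \<le> \<xi> $ i \<and> \<xi> $ i < n $ i + 1/2}"

definition amalgam_norm :: "ennreal \<Rightarrow> ennreal \<Rightarrow> real \<Rightarrow> 'd::finite distr \<Rightarrow> ennreal" where
  "amalgam_norm p q s T =
     Lp_norm q (count_space lattice) (\<lambda>n. ennreal (bracket n powr s) *
       Lp_norm p lborel (\<lambda>\<xi>. ennreal (indicator (unit_cell n) \<xi> * norm (fourier Euclidean T \<xi>))))"

text \<open>
  Closure of the test functions, realized inside the space of distributions.
\<close>

definition test_closure :: "base_space \<Rightarrow> ('d::finite distr \<Rightarrow> ennreal) \<Rightarrow> 'd::finite distr set" where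
  "test_closure M nrm = {T \<in> distributions M. (\<exists>g. is_fourier M T g) \<and>
     (\<forall>\<delta>>0. \<exists>\<phi>\<in>test_functions M. nrm (T - fdist M \<phi>) < ennreal \<delta>)}"

definition FL :: "base_space \<Rightarrow> real \<Rightarrow> ennreal \<Rightarrow> 'd::finite distr set" where
  "FL M s q = test_closure M (FL_norm M s q)"

definition amalgam :: "ennreal \<Rightarrow> ennreal \<Rightarrow> real \<Rightarrow> 'd::finite distr set" where
  "amalgam p q s = test_closure Euclidean (amalgam_norm p q s)"

text \<open>
  On the torus the parameter \<open>p\<close> is not used; there one assumes \<open>p = q\<close>.
\<close>

definition X_norm :: "base_space \<Rightarrow> ennreal \<Rightarrow> ennreal \<Rightarrow> real \<Rightarrow> 'd::finite distr \<Rightarrow> ennreal" where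
  "X_norm M p q s = (case M of Euclidean \<Rightarrow> amalgam_norm p q s | Torus \<Rightarrow> FL_norm Torus s q)"

definition X_space :: "base_space \<Rightarrow> ennreal \<Rightarrow> ennreal \<Rightarrow> real \<Rightarrow> 'd::finite distr set" where
  "X_space M p q s = (case M of Euclidean \<Rightarrow> amalgam p q s | Torus \<Rightarrow> FL Torus s q)"

definition data_norm ::
  "base_space \<Rightarrow> ennreal \<Rightarrow> ennreal \<Rightarrow> real \<Rightarrow> 'd::finite distr \<times> 'd::finite distr \<Rightarrow> ennreal" where
  "data_norm M p q s v = X_norm M p q s (fst v) + X_norm M p q (s - 1) (snd v)"

definition data_space ::
  "base_space \<Rightarrow> ennreal \<Rightarrow> ennreal \<Rightarrow> real \<Rightarrow> ('d::finite distr \<times> 'd::finite distr) set" where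
  "data_space M p q s = X_space M p q s \<times> X_space M p q (s - 1)"


section \<open>Solutions of the nonlinear wave equation\<close>

definition sinc_symbol :: "real \<Rightarrow> real \<Rightarrow> real" where
  "sinc_symbol t r = (if r = 0 then t else sin (t * r) / r)"

text \<open>
  Elements of \<open>FL M 0 1\<close> are functions, so \<open>u t\<close> is a function and its power is pointwise.
  The time derivative at \<open>0\<close> is taken in the sense of distributions in the space variable.
  The Duhamel integral of the \<open>FL M 0 1\<close>-valued continuous integrand is evaluated by testing
  against test functions, where its integrand is a continuous scalar function.
\<close>

definition wave_solution ::
  "base_space \<Rightarrow> real \<Rightarrow> nat \<Rightarrow> real \<Rightarrow> (real \<Rightarrow> real ^ 'd \<Rightarrow> complex) \<Rightarrow>
    'd::finite distr \<Rightarrow> 'd::finite distr \<Rightarrow> bool" where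
  "wave_solution M sg k T u v0 v1 \<longleftrightarrow>
     v0 \<in> FL M 0 1 \<and> v1 \<in> FL M (- 1) 1 \<and>
     (\<forall>t\<in>{0..T}. admissible M (u t) \<and> fdist M (u t) \<in> FL M 0 1) \<and>
     (\<forall>t\<in>{0..T}.
        ((\<lambda>t'. FL_norm M 0 1 (fdist M (u t') - fdist M (u t))) \<longlongrightarrow> 0) (at t within {0..T})) \<and>
     (\<forall>\<phi>\<in>test_functions M.
        fdist M (u 0) \<phi> = v0 \<phi> \<and>
        ((\<lambda>t. fdist M (u t) \<phi>) has_vector_derivative v1 \<phi>) (at 0 within {0..T})) \<and>
     (\<forall>t\<in>{0..T}. \<forall>\<phi>\<in>test_functions M.
        fdist M (u t) \<phi> =
          multiplier M (\<lambda>r. cos (t * r)) v0 \<phi> +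
          multiplier M (sinc_symbol t) v1 \<phi> +
          of_real sg * integral {0..t} (\<lambda>t'.
            multiplier M (sinc_symbol (t - t')) (fdist M (\<lambda>x. u t' x ^ k)) \<phi>))"

end

theory Submission
  imports Defs "HOL-Probability.Probability"
begin

text \<open>
  The proof takes place on the Fourier side.  By density one may replace the data by functions whose
  Fourier transforms decay rapidly.  To these one adds, on the Fourier side, two pulses of height \<open>A\<close>
  at the frequencies \<open>a\<close> and \<open>- (k - 1) a\<close> with \<open>|a| = N\<close>, and initial velocities for which each pulse
  evolves as a single half wave.  In the \<open>k\<close>-fold convolution of the free evolution the product of
  \<open>k - 1\<close> factors of the first pulse and one of the second has frequency \<open>0\<close>, and there the phases
  cancel, while all other products are supported away from \<open>0\<close> when \<open>N\<close> is large.  The second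
  Picard iterate is therefore of size \<open>t\<^sup>2 A\<^sup>k\<close> near frequency \<open>0\<close>.  With \<open>t\<^sup>2 A\<^sup>k\<^sup>-\<^sup>1\<close> equal to
  a small constant, the contraction argument in the Fourier-Lebesgue algebra still applies on \<open>[0, t]\<close>,
  and the second iterate dominates the other terms and tends to infinity with \<open>A\<close>.  Since \<open>s < 0\<close>,
  the pulses become small in the data norm as \<open>N\<close> tends to infinity with \<open>A\<close> fixed.
\<close>

text \<open>The order of the choices closes the argument: \<open>A\<close> and \<open>T\<close> are
  fixed from constants that do not see the position of the pulses, and \<open>N\<close> comes last.
  So the existence time must not depend on \<open>N\<close>, although weighted bounds on the data
  grow with \<open>N\<close>. For this reason two sizes are carried along: an integral norm uniform
  under translations, which alone enters the smallness conditions, and a pointwise decay bound,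
  which justifies limits, exchanges of integrals and membership in the spaces. A pulse is not
  exactly a half wave, but on a ball of radius 1 the length of the frequency varies by at most 1, so
  the deviation after time \<open>T\<close> has relative size \<open>T\<close>, uniformly in
  \<open>N\<close>. With \<gamma> proportional to \<open>T^2 * A^(k-1)\<close>, the second iterate
  has size \<open>\<gamma> * A\<close>, while the errors have sizes \<open>\<gamma>^2 * A\<close>,
  \<open>\<gamma> * T * A\<close> and a bounded multiple of the smooth data; hence \<gamma> is
  chosen small against the mass of the main term, then \<open>A\<close> large. Both spaces are
  treated at once: profiles are continuous on all of \<open>real ^ 'd\<close>, and the torus sees
  only their lattice values.\<close>

type_synonym 'd cfun = "real ^ 'd => complex"

abbreviation jointly_continuous :: "(real => 'd::finite cfun) => bool" where
  "jointly_continuous F \<equiv> continuous_on UNIV (\<lambda>(t, z). F t z)"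

abbreviation character :: "real ^ 'd => 'd cfun" where
  "character z x \<equiv> cis (- (x \<bullet> z))"

lemmas integral_cmult = Bochner_Integration.integral_mult_right_zero
  and integrable_majorant = Bochner_Integration.integrable_bound

section \<open>Weights and measures on the dual group\<close>

definition wt :: "nat => real ^ 'd::finite => real" where
  "wt n z = (1 + (norm z)^2) ^ n"

lemma wt_ge_1: "1 \<le> wt n z"
  by (simp add: wt_def)

lemma wt_pos [simp]: "0 < wt n z"
  using wt_ge_1[of n z] by linarith

lemma wt_nonneg [simp]: "0 \<le> wt n z"
  using wt_pos[of n z] by linarith

lemma wt_neq_0 [simp]: "wt n z \<noteq> 0"
  using wt_pos[of n z] by linarith

lemma wt_mono: "m \<le> n ==> wt m z \<le> wt n z"
  unfolding wt_def by (rule power_increasing) auto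

lemma wt_mono_norm: "norm x \<le> norm y ==> wt n x \<le> wt n y"
  unfolding wt_def by (intro power_mono add_mono) auto

lemma wt_minus [simp]: "wt n (- x) = wt n x"
  by (simp add: wt_def)

lemma wt_minus_commute: "wt n (x - y) = wt n (y - x)"
  by (simp add: wt_def norm_minus_commute)

lemma wt_Suc: "wt (Suc n) x = (1 + (norm x)^2) * wt n x"
  by (simp add: wt_def)

lemma wt_plus: "wt (m + n) x = wt m x * wt n x"
  by (simp add: wt_def power_add)

lemma continuous_on_wt [continuous_intros]:
  "continuous_on S f ==> continuous_on S (\<lambda>x. wt n (f x))"
  unfolding wt_def by (intro continuous_intros)

lemma borel_measurable_wt [measurable]: "wt n \<in> borel_measurable borel"
  by (intro borel_measurable_continuous_onI continuous_intros)

lemma norm_add_square_le: "(norm (x + y))^2 \<le> 2 * (norm x)^2 + 2 * (norm (y::'a::real_normed_vector))^2"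
proof -
  have "(norm (x + y))^2 \<le> (norm x + norm y)^2"
    by (intro power_mono norm_triangle_ineq) auto
  also have "... \<le> 2 * (norm x)^2 + 2 * (norm y)^2"
    using sum_squares_bound[of "norm x" "norm y"] by (simp add: power2_sum)
  finally show ?thesis .
qed

text \<open>The bracket of a sum is at most four times the larger of the two brackets. The additive
  form is what makes the convolution estimates tame: in each term the weight falls on one factor
  only.\<close>

lemma wt_add_le: "wt n (x + y) \<le> 4 ^ n * (wt n x + wt n y)"
proof -
  let ?a = "1 + (norm x)^2" and ?b = "1 + (norm y)^2"
  have "1 + (norm (x + y))^2 \<le> 4 * max ?a ?b"
    using norm_add_square_le[of x y] zero_le_power2[of "norm x"] zero_le_power2[of "norm y"]
    unfolding max_def by (smt (verit))
  then have "wt n (x + y) \<le> (4 * max ?a ?b) ^ n"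
    unfolding wt_def by (intro power_mono) auto
  also have "... \<le> 4 ^ n * (?a ^ n + ?b ^ n)"
    by (auto simp: power_mult_distrib max_def)
  finally show ?thesis by (simp add: wt_def)
qed

text \<open>Peetre's inequality. It costs the product of both weights and so serves where one of the
  two points is confined or strongly damped: fixed translations, unit cells, Gaussian
  mollification.\<close>

lemma wt_add_mult_le: "wt n (x + y) \<le> 2 ^ n * (wt n x * wt n y)"
proof -
  let ?a = "(norm x)^2" and ?b = "(norm y)^2"
  have "1 + (norm (x + y))^2 \<le> 2 * ((1 + ?a) * (1 + ?b))"
  proof -
    have "2 * ((1 + ?a) * (1 + ?b)) = 2 + 2 * ?a + 2 * ?b + 2 * (?a * ?b)" by (simp add: algebra_simps)
    moreover have "0 \<le> ?a * ?b" by simp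
    ultimately show ?thesis using norm_add_square_le[of x y] by linarith
  qed
  then have "wt n (x + y) \<le> (2 * ((1 + ?a) * (1 + ?b))) ^ n"
    unfolding wt_def by (intro power_mono) auto
  then show ?thesis by (simp add: wt_def power_mult_distrib)
qed

section \<open>The dual group, its measure and the symmetries of that measure\<close>

definition dgrp :: "base_space => (real ^ 'd::finite) set" where
  "dgrp M = (case M of Euclidean => UNIV | Torus => lattice)"

text \<open>The counting measure on the lattice is pushed forward to the Borel sets of \<open>real ^ 'd\<close>, so
  that both dual measures are \<open>\<sigma>\<close>-finite Borel measures and continuous functions serve as integrands.\<close>

definition dm :: "base_space => (real ^ 'd::finite) measure" where
  "dm M = distr (dual_measure M) borel (\<lambda>x. x)"

lemma sets_dm [simp, measurable_cong]: "sets (dm M) = sets borel"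
  by (simp add: dm_def)

lemma space_dm [simp]: "space (dm M) = UNIV"
  by (simp add: dm_def)

lemma measurable_dual_measure: "f \<in> borel_measurable borel ==> f \<in> borel_measurable (dual_measure M)"
  by (cases M) (simp_all add: dual_measure_def)

lemma measurable_id_dual_measure [simp]: "(\<lambda>x. x) \<in> dual_measure M \<rightarrow>\<^sub>M borel"
  by (cases M) (simp_all add: dual_measure_def)

lemma nn_integral_dm:
  "f \<in> borel_measurable borel ==> (\<integral>\<^sup>+x. f x \<partial>dm M) = (\<integral>\<^sup>+x. f x \<partial>dual_measure M)"
  unfolding dm_def by (subst nn_integral_distr) auto

lemma integrable_dm:
  fixes f :: "'d::finite cfun"
  shows "f \<in> borel_measurable borel ==> integrable (dm M) f \<longleftrightarrow> integrable (dual_measure M) f"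
  unfolding dm_def by (subst integrable_distr_eq) auto

lemma integral_dm:
  fixes f :: "'d::finite cfun"
  shows "f \<in> borel_measurable borel ==> (LINT x|dm M. f x) = (LINT x|dual_measure M. f x)"
  unfolding dm_def by (subst integral_distr) auto

lemma dm_Euclidean: "dm Euclidean = lborel"
  by (simp add: dm_def dual_measure_def distr_id2)

lemma countable_lattice: "countable (lattice :: (real ^ 'd::finite) set)"
proof -
  have "lattice \<subseteq> (\<lambda>f. \<chi> i. real_of_int (f i)) ` (UNIV :: ('d => int) set)"
  proof
    fix n :: "real ^ 'd" assume "n \<in> lattice"
    then have "n = (\<chi> i. real_of_int \<lfloor>n $ i\<rfloor>)"
      by (auto simp: lattice_def vec_eq_iff elim: Ints_cases)
    then show "n \<in> (\<lambda>f. \<chi> i. real_of_int (f i)) ` UNIV" by (metis rangeI)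
  qed
  then show ?thesis
    by (rule countable_subset) (simp add: countable_image)
qed

lemma lattice_borel [measurable]: "lattice \<in> sets borel"
  by (rule sets.countable[OF _ countable_lattice]) (simp) 

lemma dgrp_borel [measurable]: "dgrp M \<in> sets borel"
  by (cases M) (simp_all add: dgrp_def lattice_borel)

lemma AE_dm_dgrp: "AE z in (dm M :: (real ^ 'd::finite) measure). z \<in> dgrp M"
proof -
  have "AE z in (dual_measure M :: (real ^ 'd) measure). z \<in> dgrp M"
  proof (cases M)
    case Euclidean
    then show ?thesis by (simp add: dgrp_def)
  next
    case Torus
    have *: "dual_measure Torus = count_space (lattice :: (real ^ 'd) set)"
      by (simp add: dual_measure_def)
    show ?thesis unfolding Torus * by (simp add: AE_count_space dgrp_def)
  qed
  moreover have "{x \<in> space borel. x \<in> (dgrp M :: (real ^ 'd) set)} \<in> sets borel"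
    using dgrp_borel by simp
  ultimately show ?thesis
    unfolding dm_def by (subst AE_distr_iff[OF measurable_id_dual_measure])
qed

lemma dgrp_0 [simp]: "0 \<in> dgrp M"
  by (cases M) (auto simp: dgrp_def lattice_def)

lemma dgrp_add: "a \<in> dgrp M ==> b \<in> dgrp M ==> a + b \<in> dgrp M"
  by (cases M) (auto simp: dgrp_def lattice_def)

lemma dgrp_uminus: "a \<in> dgrp M ==> - a \<in> dgrp M"
  by (cases M) (auto simp: dgrp_def lattice_def)

lemma dgrp_diff: "a \<in> dgrp M ==> b \<in> dgrp M ==> a - b \<in> dgrp M"
  by (cases M) (auto simp: dgrp_def lattice_def)

interpretation dm: sigma_finite_measure "dm M :: (real ^ 'd::finite) measure" for M
proof (cases M)
  case Euclidean
  then show "sigma_finite_measure (dm M :: (real ^ 'd) measure)"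
    by (simp add: dm_Euclidean sigma_finite_lborel)
next
  case Torus
  \<comment> \<open>The atoms of the lattice and the complement of the lattice, a null set, form a
    countable cover by sets of finite measure.\<close>
  let ?A = "insert (- lattice) ((\<lambda>n. {n}) ` lattice) :: (real ^ 'd) set set"
  have em: "emeasure (dm M) S = emeasure (count_space lattice) (S \<inter> lattice)"
    if "S \<in> sets borel" for S :: "(real ^ 'd) set"
    unfolding dm_def using that
    by (subst emeasure_distr) (auto simp: dual_measure_def Torus)
  show "sigma_finite_measure (dm M :: (real ^ 'd) measure)"
  proof
    show "\<exists>A::(real ^ 'd) set set. countable A \<and> A \<subseteq> sets (dm M) \<and> \<Union> A = space (dm M) \<and>
        (\<forall>a\<in>A. emeasure (dm M) a \<noteq> \<infinity>)"
    proof (intro exI[of _ ?A] conjI ballI)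
      show "countable ?A" by (simp add: countable_lattice)
      show "?A \<subseteq> sets (dm M)" using lattice_borel by (auto simp: borel_comp)
      show "\<Union> ?A = space (dm M)" by auto
      fix a assume "a \<in> ?A"
      then show "emeasure (dm M) a \<noteq> \<infinity>"
      proof
        assume "a = - lattice"
        then show ?thesis using lattice_borel by (simp add: em borel_comp)
      next
        assume "a \<in> (\<lambda>n. {n}) ` lattice"
        then obtain n where "n \<in> lattice" "a = {n}" by auto
        then show ?thesis by (simp add: em)
      qed
    qed
  qed
qed

interpretation dm2: pair_sigma_finite "dm M :: (real ^ 'd::finite) measure" "dm M :: (real ^ 'd) measure" for M ..

lemma measurable_dm_borel [simp]: "measurable (dm M) borel = measurable borel borel"
  by (rule measurable_cong_sets) simp_all

lemma lborel_distr_reflect: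
  "distr lborel borel (\<lambda>x. a - x) = (lborel :: 'a::euclidean_space measure)"
  by (subst (2) lborel_affine[of "-1" a]) (simp_all add: density_1)

text \<open>For a lattice vector \<open>a\<close> the reflection permutes the lattice and so
  preserves the counting measure; the Lebesgue case is affine invariance.\<close>

lemma distr_dm_reflect:
  assumes "a \<in> dgrp M"
  shows "distr (dm M) borel (\<lambda>z. a - z) = (dm M :: (real ^ 'd::finite) measure)"
proof (cases M)
  case Euclidean
  then show ?thesis by (simp add: dm_Euclidean lborel_distr_reflect)
next
  case Torus
  have bij: "bij_betw (\<lambda>z. a - z) lattice (lattice :: (real ^ 'd) set)"
    using assms Torus by (intro bij_betwI[where g="\<lambda>z. a - z"]) (auto simp: dgrp_def lattice_def)
  have "distr (dm M) borel (\<lambda>z. a - z) = distr (count_space lattice) borel (\<lambda>z. a - z)"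
    unfolding dm_def by (subst distr_distr) (auto simp: dual_measure_def Torus o_def)
  also have "... = distr (distr (count_space lattice) (count_space lattice) (\<lambda>z. a - z)) borel (\<lambda>x. x)"
    using bij by (subst distr_distr) (auto simp: o_def bij_betw_def)
  also have "... = dm M"
    by (simp add: distr_bij_count_space[OF bij] dm_def dual_measure_def Torus)
  finally show ?thesis .
qed

text \<open>A translation is the composition of the reflections \<open>z \<mapsto> 0 - z\<close> and
  \<open>z \<mapsto> a - z\<close>.\<close>

lemma distr_dm_translate:
  assumes "a \<in> dgrp M"
  shows "distr (dm M) borel (\<lambda>z. z + a) = (dm M :: (real ^ 'd::finite) measure)"
proof -
  have "distr (dm M) borel (\<lambda>z. z + a) = distr (distr (dm M) borel (\<lambda>z. 0 - z)) borel (\<lambda>z. a - z)"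
    by (subst distr_distr) (auto simp: o_def algebra_simps intro!: borel_measurable_diff borel_measurable_const)
  then show ?thesis using assms by (simp only: distr_dm_reflect dgrp_0)
qed

lemma nn_integral_dm_reflect:
  assumes "a \<in> dgrp M" and [measurable]: "f \<in> borel_measurable borel"
  shows "(\<integral>\<^sup>+z. f (a - z) \<partial>dm M) = (\<integral>\<^sup>+z. f z \<partial>dm M)"
  by (subst (2) distr_dm_reflect[OF assms(1), symmetric]) (subst nn_integral_distr; simp)

lemma nn_integral_dm_translate:
  assumes "a \<in> dgrp M" and [measurable]: "f \<in> borel_measurable borel"
  shows "(\<integral>\<^sup>+z. f (z + a) \<partial>dm M) = (\<integral>\<^sup>+z. f z \<partial>dm M)"
  by (subst (2) distr_dm_translate[OF assms(1), symmetric]) (subst nn_integral_distr; simp)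

lemma integral_dm_translate:
  fixes f :: "'d::finite cfun"
  assumes "a \<in> dgrp M" and [measurable]: "f \<in> borel_measurable borel"
  shows "(LINT z|dm M. f (z + a)) = (LINT z|dm M. f z)"
  by (subst (2) distr_dm_translate[OF assms(1), symmetric]) (subst integral_distr; simp)

section \<open>Integrability of the weights, and comparison of the lattice with unit cells\<close>

lemma nn_integral_inverse_1_plus_square: "(\<integral>\<^sup>+x. ennreal (1 / (1 + x^2)) \<partial>lborel) < \<infinity>"
proof -
  have "integrable lborel (\<lambda>x::real. inverse (1 + x^2))"
    using integrable_inverse_1_plus_square by (simp add: set_integrable_def)
  from has_bochner_integral_implies_finite_norm[OF has_bochner_integral_integrable[OF this]]
  show ?thesis by (simp add: inverse_eq_divide)
qed

lemma inner_Basis_square_le: "b \<in> Basis ==> (x \<bullet> b)^2 \<le> (norm (x::'a::euclidean_space))^2"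
  using Basis_le_norm[of b x] by (metis abs_le_square_iff abs_norm_cancel)

text \<open>Each of the \<open>CARD('d)\<close> factors \<open>1 + (norm z)^2\<close> dominates
  \<open>1 + (z \<bullet> b)^2\<close> for one basis vector \<open>b\<close>, so the majorant splits
  into one-dimensional integrals.\<close>

lemma nn_integral_lborel_wt: "(\<integral>\<^sup>+z. ennreal (1 / wt CARD('d) z) \<partial>(lborel :: (real ^ 'd::finite) measure)) < \<infinity>"
proof -
  have "1 / wt CARD('d) z \<le> (\<Prod>b\<in>Basis. 1 / (1 + (z \<bullet> b)^2))" for z :: "real ^ 'd"
  proof -
    have "(\<Prod>b\<in>(Basis::(real^'d) set). 1 / (1 + (norm z)^2)) \<le> (\<Prod>b\<in>Basis. 1 / (1 + (z \<bullet> b)^2))"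
    proof (rule prod_mono)
      fix b :: "real ^ 'd" assume "b \<in> Basis"
      then have "1 / (1 + (norm z)^2) \<le> 1 / (1 + (z \<bullet> b)^2)"
        using inner_Basis_square_le[of b z] by (intro divide_left_mono) (auto intro!: mult_pos_pos add_pos_nonneg)
      then show "0 \<le> 1 / (1 + (norm z)^2) \<and> 1 / (1 + (norm z)^2) \<le> 1 / (1 + (z \<bullet> b)^2)"
        by simp
    qed
    then show ?thesis by (simp add: wt_def power_one_over)
  qed
  then have "(\<integral>\<^sup>+(z::real^'d). ennreal (1 / wt CARD('d) z) \<partial>lborel)
      \<le> (\<integral>\<^sup>+(z::real^'d). (\<Prod>b\<in>Basis. ennreal (1 / (1 + (z \<bullet> b)^2))) \<partial>lborel)"
    by (intro nn_integral_mono) (subst prod_ennreal; simp add: ennreal_leI)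
  also have "... = (\<Prod>b\<in>(Basis::(real^'d) set). (\<integral>\<^sup>+x. ennreal (1 / (1 + x^2)) \<partial>lborel))"
    by (rule nn_integral_lborel_prod) auto
  also have "... < \<infinity>"
    using nn_integral_inverse_1_plus_square by (simp add: power_less_top_ennreal)
  finally show ?thesis .
qed

lemma unit_cell_borel [measurable]: "unit_cell n \<in> sets borel"
  unfolding unit_cell_def by measurable

lemma emeasure_unit_cell: "emeasure lborel (unit_cell n) = 1"
proof (rule antisym)
  let ?l = "n - (\<chi> i. 1/2)" and ?u = "n + (\<chi> i. 1/2)"
  have ul: "?u - ?l = (\<chi> i. 1)" by (simp add: vec_eq_iff)
  have pos: "?l \<bullet> b \<le> ?u \<bullet> b" and one: "(?u - ?l) \<bullet> b = 1" if "b \<in> Basis" for b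
    using that by (auto simp: ul inner_axis Basis_vec_def inner_left_distrib inner_diff_left)
  have "emeasure lborel (unit_cell n) \<le> emeasure lborel (cbox ?l ?u)"
    by (intro emeasure_mono) (auto simp: unit_cell_def mem_box_cart less_imp_le)
  also have "... = 1" using pos one by simp
  finally show "emeasure lborel (unit_cell n) \<le> 1" .
  have "1 = emeasure lborel (box ?l ?u)" using pos one by simp
  also have "... \<le> emeasure lborel (unit_cell n)"
    by (intro emeasure_mono) (auto simp: unit_cell_def mem_box_cart less_imp_le)
  finally show "1 \<le> emeasure lborel (unit_cell n)" .
qed

lemma unit_cell_disjoint:
  assumes "n \<in> lattice" "m \<in> lattice" "z \<in> unit_cell n" "z \<in> unit_cell m"
  shows "n = m"
proof -
  have "n $ i = m $ i" for i
  proof -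
    have "n $ i \<in> \<int>" "m $ i \<in> \<int>"
      using assms(1,2) by (auto simp: lattice_def)
    then obtain a b :: int where "n $ i = of_int a" "m $ i = of_int b"
      by (auto elim!: Ints_cases)
    moreover have "n $ i - 1/2 \<le> z $ i" "z $ i < n $ i + 1/2" "m $ i - 1/2 \<le> z $ i" "z $ i < m $ i + 1/2"
      using assms(3,4) by (auto simp: unit_cell_def)
    ultimately have "\<bar>real_of_int a - real_of_int b\<bar> < 1" by linarith
    then have "a = b" by linarith
    then show ?thesis using \<open>n $ i = of_int a\<close> \<open>m $ i = of_int b\<close> by simp
  qed
  then show ?thesis by (simp add: vec_eq_iff)
qed

lemma norm_unit_cell:
  assumes "z \<in> unit_cell (n :: real ^ 'd::finite)"
  shows "(norm (n - z))^2 \<le> real CARD('d)"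
proof -
  have "(norm (n - z))^2 = (\<Sum>i\<in>UNIV. (n $ i - z $ i)^2)"
    by (simp add: norm_vec_def L2_set_def sum_nonneg)
  also have "... \<le> (\<Sum>i\<in>(UNIV::'d set). 1)"
  proof (rule sum_mono)
    fix i
    have "n $ i - 1/2 \<le> z $ i" "z $ i < n $ i + 1/2"
      using assms by (auto simp: unit_cell_def)
    then have "\<bar>n $ i - z $ i\<bar> \<le> 1" by linarith
    then show "(n $ i - z $ i)^2 \<le> 1" by (simp add: abs_square_le_1)
  qed
  finally show ?thesis by simp
qed

text \<open>A point of a cell has squared distance at most \<open>CARD('d)\<close> from the centre,
  so Peetre's inequality compares the weights at both, in either direction, with a constant that
  depends on the dimension and the power only.\<close>

lemma wt_unit_cell_le:
  assumes "z \<in> unit_cell (n :: real ^ 'd::finite)"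
  shows "wt m (a - z) \<le> (2 * (1 + real CARD('d))) ^ m * wt m (a - n)"
    and "wt m (a - n) \<le> (2 * (1 + real CARD('d))) ^ m * wt m (a - z)"
proof -
  have *: "wt m (n - z) \<le> (1 + real CARD('d)) ^ m"
    unfolding wt_def using norm_unit_cell[OF assms] by (intro power_mono) auto
  have "wt m (a - z) \<le> 2 ^ m * (wt m (a - n) * wt m (n - z))"
    using wt_add_mult_le[of m "a - n" "n - z"] by simp
  also have "... \<le> 2 ^ m * (wt m (a - n) * (1 + real CARD('d)) ^ m)"
    by (intro mult_left_mono *) auto
  finally show "wt m (a - z) \<le> (2 * (1 + real CARD('d))) ^ m * wt m (a - n)"
    by (simp only: power_mult_distrib mult_ac)
  have "wt m (a - n) \<le> 2 ^ m * (wt m (a - z) * wt m (n - z))"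
    using wt_add_mult_le[of m "a - z" "z - n"] by (simp add: wt_minus_commute)
  also have "... \<le> 2 ^ m * (wt m (a - z) * (1 + real CARD('d)) ^ m)"
    by (intro mult_left_mono *) auto
  finally show "wt m (a - n) \<le> (2 * (1 + real CARD('d))) ^ m * wt m (a - z)"
    by (simp only: power_mult_distrib mult_ac)
qed

text \<open>Each term of the sum is at most \<open>C\<close> times the mean of the same weight over
  its unit cell. The cells are disjoint, so the sum is dominated by the Lebesgue integral, which no
  longer depends on \<open>z\<close>.\<close>

lemma nn_integral_lattice_wt_le:
  fixes z :: "real ^ 'd::finite"
  defines "C \<equiv> (2 * (1 + real CARD('d))) ^ CARD('d)"
  shows "(\<integral>\<^sup>+n. ennreal (1 / wt CARD('d) (z - n)) \<partial>count_space lattice)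
    \<le> ennreal C * (\<integral>\<^sup>+(\<zeta>::real^'d). ennreal (1 / wt CARD('d) \<zeta>) \<partial>lborel)"
proof -
  have C: "C > 0" by (simp add: C_def)
  have "(\<integral>\<^sup>+n. ennreal (1 / wt CARD('d) (z - n)) \<partial>count_space lattice)
      \<le> (\<integral>\<^sup>+n. (\<integral>\<^sup>+\<zeta>. ennreal (C / wt CARD('d) (z - \<zeta>)) * indicator (unit_cell n) \<zeta> \<partial>lborel) \<partial>count_space lattice)"
  proof (rule nn_integral_mono)
    fix n :: "real ^ 'd"
    have "ennreal (1 / wt CARD('d) (z - n)) = (\<integral>\<^sup>+\<zeta>. ennreal (1 / wt CARD('d) (z - n)) * indicator (unit_cell n) \<zeta> \<partial>lborel)"
      by (subst nn_integral_cmult_indicator) (auto simp: emeasure_unit_cell)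
    also have "... \<le> (\<integral>\<^sup>+\<zeta>. ennreal (C / wt CARD('d) (z - \<zeta>)) * indicator (unit_cell n) \<zeta> \<partial>lborel)"
    proof (rule nn_integral_mono)
      fix \<zeta>
      show "ennreal (1 / wt CARD('d) (z - n)) * indicator (unit_cell n) \<zeta> \<le> ennreal (C / wt CARD('d) (z - \<zeta>)) * indicator (unit_cell n) \<zeta>"
      proof (cases "\<zeta> \<in> unit_cell n")
        case True
        from wt_unit_cell_le(1)[OF this, of "CARD('d)" z]
        have "1 / wt CARD('d) (z - n) \<le> C / wt CARD('d) (z - \<zeta>)"
          by (simp add: C_def field_simps)
        then show ?thesis using True by (simp add: ennreal_leI)
      qed simp
    qed
    finally show "ennreal (1 / wt CARD('d) (z - n)) \<le> (\<integral>\<^sup>+\<zeta>. ennreal (C / wt CARD('d) (z - \<zeta>)) * indicator (unit_cell n) \<zeta> \<partial>lborel)" .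
  qed
  also have "... = (\<integral>\<^sup>+\<zeta>. (\<integral>\<^sup>+n. ennreal (C / wt CARD('d) (z - \<zeta>)) * indicator (unit_cell n) \<zeta> \<partial>count_space lattice) \<partial>lborel)"
    by (rule nn_integral_count_space_nn_integral[symmetric]) (auto simp: countable_lattice)
  also have "... \<le> (\<integral>\<^sup>+\<zeta>. ennreal (C / wt CARD('d) (z - \<zeta>)) \<partial>lborel)"
  proof (rule nn_integral_mono)
    fix \<zeta> :: "real ^ 'd"
    have "(\<integral>\<^sup>+n. indicator (unit_cell n) \<zeta> \<partial>count_space lattice) \<le> (1::ennreal)"
    proof (cases "\<exists>n\<in>lattice. \<zeta> \<in> unit_cell n")
      case True
      then obtain n where n: "n \<in> lattice" "\<zeta> \<in> unit_cell n" by auto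
      have "indicator (unit_cell m) \<zeta> = (indicator {n} m :: ennreal)" if "m \<in> lattice" for m
      proof (cases "m = n")
        case False
        then have "\<zeta> \<notin> unit_cell m" using unit_cell_disjoint[OF n(1) that n(2)] by blast
        then show ?thesis using False by simp
      qed (use n in simp)
      then have "(\<integral>\<^sup>+m. indicator (unit_cell m) \<zeta> \<partial>count_space lattice) = (\<integral>\<^sup>+m. indicator {n} m \<partial>count_space (lattice::(real^'d) set))"
        by (intro nn_integral_cong) simp
      also have "... = 1" using n by simp
      finally show ?thesis by simp
    next
      case False
      then have "(\<integral>\<^sup>+m. indicator (unit_cell m) \<zeta> \<partial>count_space lattice) = (\<integral>\<^sup>+m. 0 \<partial>count_space (lattice::(real^'d) set))"
        by (intro nn_integral_cong) (simp add: indicator_def)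
      then show ?thesis by simp
    qed
    then show "(\<integral>\<^sup>+n. ennreal (C / wt CARD('d) (z - \<zeta>)) * indicator (unit_cell n) \<zeta> \<partial>count_space lattice) \<le> ennreal (C / wt CARD('d) (z - \<zeta>))"
      by (subst nn_integral_cmult) (auto dest: mult_left_mono[where c="ennreal (C / wt CARD('d) (z - \<zeta>))"])
  qed
  also have "... = (\<integral>\<^sup>+(\<zeta>::real^'d). ennreal (C / wt CARD('d) \<zeta>) \<partial>lborel)"
    using nn_integral_dm_reflect[of z Euclidean "\<lambda>\<zeta>. ennreal (C / wt CARD('d) \<zeta>)"] by (simp add: dm_Euclidean dgrp_def)
  also have "... = ennreal C * (\<integral>\<^sup>+(\<zeta>::real^'d). ennreal (1 / wt CARD('d) \<zeta>) \<partial>lborel)"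
    using C by (subst nn_integral_cmult[symmetric]) (auto simp: ennreal_mult[symmetric])
  finally show ?thesis .
qed

text \<open>Uniformity over every real \<open>z\<close>, on the torus also off the lattice, is the
  point: convolutions are evaluated at all points of \<open>real ^ 'd\<close>.\<close>

lemma nn_integral_dm_wt_bounded:
  "\<exists>K\<ge>0. \<forall>z :: real ^ 'd::finite. (\<integral>\<^sup>+\<eta>. ennreal (1 / wt CARD('d) (z - \<eta>)) \<partial>dm M) \<le> ennreal K"
proof -
  let ?I = "(\<integral>\<^sup>+\<eta>. ennreal (1 / wt CARD('d) \<eta>) \<partial>(lborel :: (real ^ 'd) measure))"
  let ?C = "(2 * (1 + real CARD('d))) ^ CARD('d)"
  have le: "(\<integral>\<^sup>+\<eta>. ennreal (1 / wt CARD('d) (z - \<eta>)) \<partial>dm M) \<le> ennreal ?C * ?I" for z :: "real ^ 'd"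
  proof (cases M)
    case Euclidean
    have "1 * ?I \<le> ennreal ?C * ?I"
      by (intro mult_right_mono) (auto simp: ennreal_ge_1)
    then show ?thesis
      using nn_integral_dm_reflect[of z Euclidean "\<lambda>\<zeta>. ennreal (1 / wt CARD('d) \<zeta>)"]
      by (simp only: dm_Euclidean dgrp_def Euclidean) simp
  next
    case Torus
    then show ?thesis
      using nn_integral_lattice_wt_le[of z] by (subst nn_integral_dm) (auto simp: dual_measure_def)
  qed
  have lt: "ennreal ?C * ?I < top"
    using nn_integral_lborel_wt[where 'd='d] by (intro ennreal_mult_less_top[THEN iffD2]) auto
  show ?thesis
  proof (intro exI conjI allI)
    show "0 \<le> enn2real (ennreal ?C * ?I)" by (rule enn2real_nonneg)
    show "(\<integral>\<^sup>+\<eta>. ennreal (1 / wt CARD('d) (z - \<eta>)) \<partial>dm M) \<le> ennreal (enn2real (ennreal ?C * ?I))" for z :: "real ^ 'd"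
      unfolding ennreal_enn2real[OF lt] by (rule le)
  qed
qed

section \<open>Convolution\<close>

text \<open>A fixed constant that converts decay bounds into integral bounds. The dummy type
  argument carries the dimension.\<close>

definition dmK :: "base_space => 'd::finite itself => real" where
  "dmK M _ = (SOME K. 0 \<le> K \<and>
     (\<forall>z :: real ^ 'd. (\<integral>\<^sup>+\<eta>. ennreal (1 / wt CARD('d) (z - \<eta>)) \<partial>dm M) \<le> ennreal K))"

lemma dmK: "0 \<le> dmK M TYPE('d::finite)"
    "(\<integral>\<^sup>+\<eta>. ennreal (1 / wt CARD('d) (z - \<eta>)) \<partial>dm M) \<le> ennreal (dmK M TYPE('d))"
  for z :: "real ^ 'd::finite"
proof -
  have "0 \<le> dmK M TYPE('d) \<and>
     (\<forall>z :: real ^ 'd. (\<integral>\<^sup>+\<eta>. ennreal (1 / wt CARD('d) (z - \<eta>)) \<partial>dm M) \<le> ennreal (dmK M TYPE('d)))"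
    unfolding dmK_def by (rule someI_ex) (use nn_integral_dm_wt_bounded[where 'd='d and M=M] in blast)
  then show "0 \<le> dmK M TYPE('d)"
    "(\<integral>\<^sup>+\<eta>. ennreal (1 / wt CARD('d) (z - \<eta>)) \<partial>dm M) \<le> ennreal (dmK M TYPE('d))" by auto
qed

lemma dmK_nonneg [simp]: "0 \<le> dmK M TYPE('d::finite)"
  by (rule dmK(1))

text \<open>The supremum over all translations, rather than the norm in \<open>L\<^sup>1\<close>, is used because on the torus
  the functions live on \<open>real ^ 'd\<close> but the measure is only invariant under the lattice.\<close>

definition unif_int :: "base_space => real => 'd::finite cfun => bool" where
  "unif_int M R f \<longleftrightarrow> (\<forall>z. (\<integral>\<^sup>+\<eta>. ennreal (norm (f (z - \<eta>))) \<partial>dm M) \<le> ennreal R)"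

text \<open>Continuity is part of the notion because on the torus the measure sees lattice points
  only, while convolutions and limits are taken at every real point. It also supplies measurability
  throughout.\<close>

definition decay :: "nat => real => 'd::finite cfun => bool" where
  "decay n K f \<longleftrightarrow> continuous_on UNIV f \<and> (\<forall>z. norm (f z) \<le> K / wt n z)"

lemma decayD: "decay n K f ==> norm (f z) \<le> K / wt n z"
  by (simp add: decay_def)

lemma decay_nonneg: "decay n K f ==> 0 \<le> K"
  using order_trans[OF norm_ge_zero decayD[of n K f 0]] by (simp add: zero_le_divide_iff wt_def)

lemma decay_bounded: assumes "decay n K f" shows "norm (f z) \<le> K"
proof -
  have "K / wt n z \<le> K / 1"
    using decay_nonneg[OF assms] wt_ge_1[of n z] by (intro divide_left_mono) auto
  then show ?thesis using decayD[OF assms, of z] by simp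
qed

lemma decay_borel: "decay n K f ==> f \<in> borel_measurable borel"
  unfolding decay_def by (blast intro: borel_measurable_continuous_onI)

lemma decay_continuous: "decay n K f ==> continuous_on S g ==> continuous_on S (\<lambda>x. f (g x))"
  unfolding decay_def using continuous_on_compose2[of UNIV f S g] by blast

lemma decay_mono:
  fixes f :: "'d::finite cfun"
  shows "decay n K f ==> K \<le> K' ==> m \<le> n ==> decay m K' f"
  unfolding decay_def
proof safe
  fix z :: "real ^ 'd" assume *: "\<forall>z. norm (f z) \<le> K / wt n z" "K \<le> K'" "m \<le> n" "continuous_on UNIV f"
  then have "0 \<le> K" using decay_nonneg[of n K f] by (simp add: decay_def)
  then have "K / wt n z \<le> K' / wt m z"
    using * wt_mono[of m n z] by (intro frac_le) auto
  then show "norm (f z) \<le> K' / wt m z" using *(1) order_trans by blast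
qed

lemma decay_add: "decay n K f ==> decay n L g ==> decay n (K + L) (\<lambda>z. f z + g z)"
  unfolding decay_def
  by (auto intro!: continuous_intros norm_triangle_le add_mono simp: add_divide_distrib)

lemma decay_cmult: "decay n K f ==> decay n (norm c * K) (\<lambda>z. c * f z)"
  unfolding decay_def
  by (auto intro!: continuous_intros mult_left_mono simp: norm_mult simp flip: times_divide_eq_right)

lemma decay_diff: "decay n K f ==> decay n L g ==> decay n (K + L) (\<lambda>z. f z - g z)"
  using decay_add[of n K f L "\<lambda>z. - 1 * g z"] decay_cmult[of n L g "-1"] by simp

lemma unif_int_add:
  assumes "unif_int M R f" "unif_int M S g" "0 \<le> R" "0 \<le> S"
    and [measurable]: "f \<in> borel_measurable borel" "g \<in> borel_measurable borel"
  shows "unif_int M (R + S) (\<lambda>z. f z + g z)"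
  unfolding unif_int_def
proof
  fix z
  have "(\<integral>\<^sup>+\<eta>. ennreal (norm (f (z - \<eta>) + g (z - \<eta>))) \<partial>dm M)
      \<le> (\<integral>\<^sup>+\<eta>. ennreal (norm (f (z - \<eta>))) + ennreal (norm (g (z - \<eta>))) \<partial>dm M)"
    by (intro nn_integral_mono) (simp add: norm_triangle_ineq ennreal_leI flip: ennreal_plus)
  also have "... = (\<integral>\<^sup>+\<eta>. ennreal (norm (f (z - \<eta>))) \<partial>dm M) + (\<integral>\<^sup>+\<eta>. ennreal (norm (g (z - \<eta>))) \<partial>dm M)"
    by (intro nn_integral_add) simp_all
  also have "... \<le> ennreal R + ennreal S"
    using assms(1,2) unfolding unif_int_def by (intro add_mono) auto
  finally show "(\<integral>\<^sup>+\<eta>. ennreal (norm (f (z - \<eta>) + g (z - \<eta>))) \<partial>dm M) \<le> ennreal (R + S)"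
    using assms(3,4) by simp
qed

lemma unif_int_mono: "unif_int M R f ==> (\<And>z. norm (g z) \<le> norm (f z)) ==> R \<le> S ==> unif_int M S g"
  unfolding unif_int_def
  by (meson ennreal_leI nn_integral_mono order_trans)

lemma unif_int_cmult:
  assumes "unif_int M R f" and [measurable]: "f \<in> borel_measurable borel"
  shows "unif_int M (norm c * R) (\<lambda>z. c * f z)"
  unfolding unif_int_def
proof
  fix z
  have "(\<integral>\<^sup>+\<eta>. ennreal (norm (c * f (z - \<eta>))) \<partial>dm M) = ennreal (norm c) * (\<integral>\<^sup>+\<eta>. ennreal (norm (f (z - \<eta>))) \<partial>dm M)"
    by (subst nn_integral_cmult[symmetric]) (simp_all add: norm_mult ennreal_mult)
  also have "... \<le> ennreal (norm c) * ennreal R"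
    using assms(1) unfolding unif_int_def by (intro mult_left_mono) auto
  finally show "(\<integral>\<^sup>+\<eta>. ennreal (norm (c * f (z - \<eta>))) \<partial>dm M) \<le> ennreal (norm c * R)"
    by (simp add: ennreal_mult')
qed

text \<open>Since all translates are allowed in the norm, the centre \<open>a\<close> disappears
  from the bound. This is why the pulses have integral norms independent of their frequency.\<close>

lemma unif_int_shifted_decay:
  fixes f :: "'d::finite cfun"
  assumes "CARD('d) \<le> n" "0 \<le> K" "\<And>z. norm (f z) \<le> K / wt n (z - a)"
  shows "unif_int M (K * dmK M TYPE('d)) f"
  unfolding unif_int_def
proof
  fix z
  have "norm (f \<zeta>) \<le> K * (1 / wt CARD('d) (\<zeta> - a))" for \<zeta>
  proof -
    have "K / wt n (\<zeta> - a) \<le> K / wt CARD('d) (\<zeta> - a)"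
      using assms(1,2) by (intro divide_left_mono wt_mono) auto
    then show ?thesis using assms(3)[of \<zeta>] by simp
  qed
  then have "(\<integral>\<^sup>+\<eta>. ennreal (norm (f (z - \<eta>))) \<partial>dm M) \<le> (\<integral>\<^sup>+\<eta>. ennreal K * ennreal (1 / wt CARD('d) ((z - a) - \<eta>)) \<partial>dm M)"
  proof (intro nn_integral_mono)
    fix \<eta>
    have eq: "z - \<eta> - a = z - a - \<eta>" by simp
    have "norm (f (z - \<eta>)) \<le> K * (1 / wt CARD('d) (z - a - \<eta>))"
      using \<open>\<And>\<zeta>. norm (f \<zeta>) \<le> K * (1 / wt CARD('d) (\<zeta> - a))\<close>[of "z - \<eta>"] unfolding eq .
    then show "ennreal (norm (f (z - \<eta>))) \<le> ennreal K * ennreal (1 / wt CARD('d) (z - a - \<eta>))"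
      using assms(2) by (simp add: ennreal_leI flip: ennreal_mult)
  qed
  also have "... = ennreal K * (\<integral>\<^sup>+\<eta>. ennreal (1 / wt CARD('d) ((z - a) - \<eta>)) \<partial>dm M)"
    by (intro nn_integral_cmult) simp
  also have "... \<le> ennreal K * ennreal (dmK M TYPE('d))"
    by (intro mult_left_mono dmK) simp
  finally show "(\<integral>\<^sup>+\<eta>. ennreal (norm (f (z - \<eta>))) \<partial>dm M) \<le> ennreal (K * dmK M TYPE('d))"
    using assms(2) by (simp add: ennreal_mult)
qed

lemma unif_int_decay: "decay n K f ==> CARD('d) \<le> n ==> unif_int M (K * dmK M TYPE('d)) f"
  for f :: "'d::finite cfun"
  using unif_int_shifted_decay[of n K f 0] decay_nonneg[of n K f] by (simp add: decay_def)

lemma unif_int_nn_integral: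
  fixes f :: "'d::finite cfun"
  assumes "unif_int M R f" and [measurable]: "f \<in> borel_measurable borel"
  shows "(\<integral>\<^sup>+\<eta>. ennreal (norm (f \<eta>)) \<partial>dm M) \<le> ennreal R"
proof -
  have "(\<integral>\<^sup>+\<eta>. ennreal (norm (f (0 - \<eta>))) \<partial>dm M) = (\<integral>\<^sup>+\<eta>. ennreal (norm (f \<eta>)) \<partial>dm M)"
    by (rule nn_integral_dm_reflect) simp_all
  moreover have "(\<integral>\<^sup>+\<eta>. ennreal (norm (f (0 - \<eta>))) \<partial>dm M) \<le> ennreal R"
    using assms(1) unfolding unif_int_def by blast
  ultimately show ?thesis by simp
qed

lemma unif_int_integrable:
  assumes "unif_int M R f" "f \<in> borel_measurable borel"
  shows "integrable (dm M) f"
  using unif_int_nn_integral[OF assms] assms(2)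
  by (intro integrableI_bounded) (auto intro: le_less_trans)

lemma integrable_decay: "decay n K f ==> CARD('d) \<le> n ==> integrable (dm M) f"
  for f :: "'d::finite cfun"
  by (rule unif_int_integrable[OF unif_int_decay decay_borel])

lemma integrable_wt: "CARD('d) \<le> n ==> integrable (dm M) (\<lambda>z :: real ^ 'd::finite. 1 / wt n z)"
proof -
  assume n: "CARD('d) \<le> n"
  have "decay n 1 (\<lambda>z :: real ^ 'd. complex_of_real (1 / wt n z))"
    by (auto simp: decay_def norm_divide intro!: continuous_intros)
  then have "integrable (dm M) (\<lambda>z :: real ^ 'd. complex_of_real (1 / wt n z))"
    using n by (rule integrable_decay)
  then show ?thesis by (simp only: complex_of_real_integrable_eq)
qed

text \<open>This covers non-integrable functions as well, because their Bochner integral has the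
  default value 0.\<close>

lemma norm_lebesgue_integral_le_nn: "ennreal (norm (integral\<^sup>L N f)) \<le> (\<integral>\<^sup>+x. ennreal (norm (f x)) \<partial>N)"
  by (cases "integrable N f") (auto simp: integral_norm_bound_ennreal not_integrable_integral_eq)

section \<open>Convolution powers, with tame and Lipschitz estimates\<close>

definition conv :: "base_space => 'd::finite cfun => 'd cfun => 'd cfun" where
  "conv M f g z = (LINT \<eta>|dm M. f (z - \<eta>) * g \<eta>)"

text \<open>The exponent is shifted: \<open>cpow M f n\<close> is the convolution of \<open>n + 1\<close> copies of \<open>f\<close>.\<close>

primrec cpow :: "base_space => 'd::finite cfun => nat => 'd cfun" where
  "cpow M f 0 = f"
| "cpow M f (Suc n) = conv M f (cpow M f n)"

text \<open>Dominated convergence with the majorant \<open>K * (L / wt n \<eta>)\<close>: the factor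
  that carries \<open>z\<close> is merely bounded, and the decay of the other one makes the
  integrand integrable.\<close>

lemma continuous_on_conv_param:
  fixes F G :: "real => 'd::finite cfun"
  assumes F: "jointly_continuous F" and G: "jointly_continuous G"
    and Fb: "\<And>t z. norm (F t z) \<le> K" and Gb: "\<And>t z. norm (G t z) \<le> L / wt n z"
    and n: "CARD('d) \<le> n"
  shows "continuous_on UNIV (\<lambda>(t, z). conv M (F t) (G t) z)"
proof (rule continuous_on_sequentiallyI)
  fix u :: "nat => real \<times> (real ^ 'd)" and a
  assume u: "u \<longlonglongrightarrow> a"
  have F': "continuous_on UNIV (\<lambda>\<eta>. F (fst p) (snd p - \<eta>))" for p :: "real \<times> (real ^ 'd)"
    by (rule continuous_on_compose2[OF F, of _ "\<lambda>\<eta>. (fst p, snd p - \<eta>)", simplified]) (intro continuous_intros)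
  have G': "continuous_on UNIV (\<lambda>\<eta>. G (fst p) \<eta>)" for p :: "real \<times> (real ^ 'd)"
    by (rule continuous_on_compose2[OF G, of _ "\<lambda>\<eta>. (fst p, \<eta>)", simplified]) (intro continuous_intros)
  have meas: "(\<lambda>\<eta>. F (fst p) (snd p - \<eta>) * G (fst p) \<eta>) \<in> borel_measurable (dm M)" for p :: "real \<times> (real ^ 'd)"
    by (simp, intro borel_measurable_continuous_onI continuous_on_mult F' G')
  have K: "0 \<le> K" using norm_ge_zero[of "F 0 0"] Fb[of 0 0] by linarith
  have "(\<lambda>k. LINT \<eta>|dm M. F (fst (u k)) (snd (u k) - \<eta>) * G (fst (u k)) \<eta>)
      \<longlonglongrightarrow> (LINT \<eta>|dm M. F (fst a) (snd a - \<eta>) * G (fst a) \<eta>)"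
  proof (rule integral_dominated_convergence)
    show "integrable (dm M) (\<lambda>\<eta> :: real ^ 'd. K * (L * (1 / wt n \<eta>)))"
      by (intro integrable_mult_right integrable_wt n)
    show "AE \<eta> in dm M. (\<lambda>k. F (fst (u k)) (snd (u k) - \<eta>) * G (fst (u k)) \<eta>)
        \<longlonglongrightarrow> F (fst a) (snd a - \<eta>) * G (fst a) \<eta>"
    proof (intro AE_I2 tendsto_mult)
      fix \<eta>
      show "(\<lambda>k. F (fst (u k)) (snd (u k) - \<eta>)) \<longlonglongrightarrow> F (fst a) (snd a - \<eta>)"
      proof -
        have "(\<lambda>k. (fst (u k), snd (u k) - \<eta>)) \<longlonglongrightarrow> (fst a, snd a - \<eta>)"
          by (intro tendsto_Pair tendsto_diff tendsto_fst tendsto_snd u tendsto_const)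
        from continuous_on_tendsto_compose[OF F this] show ?thesis by simp
      qed
      show "(\<lambda>k. G (fst (u k)) \<eta>) \<longlonglongrightarrow> G (fst a) \<eta>"
      proof -
        have "(\<lambda>k. (fst (u k), \<eta>)) \<longlonglongrightarrow> (fst a, \<eta>)"
          by (intro tendsto_Pair tendsto_fst u tendsto_const)
        from continuous_on_tendsto_compose[OF G this] show ?thesis by simp
      qed
    qed
    show "AE \<eta> in dm M. norm (F (fst (u k)) (snd (u k) - \<eta>) * G (fst (u k)) \<eta>) \<le> K * (L * (1 / wt n \<eta>))" for k
    proof (rule AE_I2)
      fix \<eta>
      have "norm (F (fst (u k)) (snd (u k) - \<eta>)) * norm (G (fst (u k)) \<eta>) \<le> K * (L / wt n \<eta>)"
        using Fb Gb K by (intro mult_mono) auto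
      then show "norm (F (fst (u k)) (snd (u k) - \<eta>) * G (fst (u k)) \<eta>) \<le> K * (L * (1 / wt n \<eta>))"
        by (simp add: norm_mult)
    qed
  qed (rule meas)+
  then show "(\<lambda>k. case u k of (t, z) => conv M (F t) (G t) z) \<longlonglongrightarrow> (case a of (t, z) => conv M (F t) (G t) z)"
    by (simp add: conv_def case_prod_unfold)
qed

lemma continuous_on_conv:
  fixes f g :: "'d::finite cfun"
  assumes "decay n K f" "decay n L g" "CARD('d) \<le> n"
  shows "continuous_on UNIV (conv M f g)"
proof -
  have "continuous_on UNIV (\<lambda>(t::real, z). conv M f g z)"
    using assms decay_bounded[OF assms(1)] decayD[OF assms(2)]
    by (intro continuous_on_conv_param[where K=K and L=L and n=n])
       (auto simp: case_prod_unfold intro!: decay_continuous[OF assms(1)] decay_continuous[OF assms(2)] continuous_intros)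
  moreover have "continuous_on UNIV (\<lambda>z :: real ^ 'd. (0 :: real, z))"
    by (intro continuous_on_Pair continuous_on_const continuous_on_id)
  ultimately show ?thesis
    using continuous_on_compose2[of UNIV "\<lambda>(t::real, z). conv M f g z" UNIV "\<lambda>z. (0, z)"] by simp
qed

text \<open>Young's inequality through Tonelli. The inner integral of \<open>f\<close> runs over the
  translate by \<open>z - \<zeta>\<close>, possibly off the lattice, and is controlled because the
  norm is uniform over all translates.\<close>

lemma nn_integral_conv_le:
  fixes f g :: "'d::finite cfun"
  assumes "unif_int M R f" "unif_int M S g"
    and [measurable]: "f \<in> borel_measurable borel" "g \<in> borel_measurable borel"
  shows "(\<integral>\<^sup>+\<eta>. (\<integral>\<^sup>+\<zeta>. ennreal (norm (f (z - \<eta> - \<zeta>) * g \<zeta>)) \<partial>dm M) \<partial>dm M) \<le> ennreal R * ennreal S"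
proof -
  have "(\<integral>\<^sup>+\<eta>. (\<integral>\<^sup>+\<zeta>. ennreal (norm (f (z - \<eta> - \<zeta>) * g \<zeta>)) \<partial>dm M) \<partial>dm M)
      = (\<integral>\<^sup>+\<zeta>. (\<integral>\<^sup>+\<eta>. ennreal (norm (f (z - \<eta> - \<zeta>) * g \<zeta>)) \<partial>dm M) \<partial>dm M)"
    by (rule dm2.Fubini') measurable
  also have "... = (\<integral>\<^sup>+\<zeta>. (\<integral>\<^sup>+\<eta>. ennreal (norm (f ((z - \<zeta>) - \<eta>))) \<partial>dm M) * ennreal (norm (g \<zeta>)) \<partial>dm M)"
    by (intro nn_integral_cong, subst nn_integral_multc[symmetric]) (simp_all add: norm_mult ennreal_mult algebra_simps)
  also have "... \<le> (\<integral>\<^sup>+\<zeta>. ennreal R * ennreal (norm (g \<zeta>)) \<partial>dm M)"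
    using assms(1) unfolding unif_int_def by (intro nn_integral_mono mult_right_mono) auto
  also have "... = ennreal R * (\<integral>\<^sup>+\<zeta>. ennreal (norm (g \<zeta>)) \<partial>dm M)"
    by (intro nn_integral_cmult) simp
  also have "... \<le> ennreal R * ennreal S"
    by (intro mult_left_mono unif_int_nn_integral assms) auto
  finally show ?thesis .
qed

lemma unif_int_conv:
  fixes f g :: "'d::finite cfun"
  assumes "unif_int M R f" "unif_int M S g" "0 \<le> R"
    and "f \<in> borel_measurable borel" "g \<in> borel_measurable borel"
  shows "unif_int M (R * S) (conv M f g)"
  unfolding unif_int_def
proof
  fix z
  have "(\<integral>\<^sup>+\<eta>. ennreal (norm (conv M f g (z - \<eta>))) \<partial>dm M)
      \<le> (\<integral>\<^sup>+\<eta>. (\<integral>\<^sup>+\<zeta>. ennreal (norm (f (z - \<eta> - \<zeta>) * g \<zeta>)) \<partial>dm M) \<partial>dm M)"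
    unfolding conv_def by (intro nn_integral_mono norm_lebesgue_integral_le_nn)
  also have "... \<le> ennreal R * ennreal S"
    by (rule nn_integral_conv_le) fact+
  finally show "(\<integral>\<^sup>+\<eta>. ennreal (norm (conv M f g (z - \<eta>))) \<partial>dm M) \<le> ennreal (R * S)"
    using assms(3) by (simp add: ennreal_mult')
qed

text \<open>\<open>wt_add_le\<close> moves the weight at \<open>z\<close> to one of the two factors,
  which is then estimated pointwise while the other is integrated. The result is linear in the decay
  constants, with the integral norms as coefficients.\<close>

lemma norm_conv_le:
  fixes f g :: "'d::finite cfun"
  assumes f: "\<And>z. norm (f z) \<le> K / wt n z" and g: "\<And>z. norm (g z) \<le> L / wt n z"
    and R: "unif_int M R f" and S: "unif_int M S g" and "0 \<le> R" "0 \<le> S"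
    and [measurable]: "f \<in> borel_measurable borel" "g \<in> borel_measurable borel"
  shows "norm (conv M f g z) \<le> 4 ^ n * (K * S + R * L) / wt n z"
proof -
  have K: "0 \<le> K" using order_trans[OF norm_ge_zero f[of 0]] by (simp add: wt_def)
  have L: "0 \<le> L" using order_trans[OF norm_ge_zero g[of 0]] by (simp add: wt_def)
  let ?c = "4 ^ n :: real"
  have f': "norm (f x) * wt n x \<le> K" for x using f[of x] by (simp add: field_simps)
  have g': "norm (g x) * wt n x \<le> L" for x using g[of x] by (simp add: field_simps)
  have ptw: "wt n z * norm (f (z - \<eta>) * g \<eta>) \<le> ?c * K * norm (g \<eta>) + ?c * L * norm (f (z - \<eta>))" for \<eta>
  proof -
    have "wt n z * norm (f (z - \<eta>) * g \<eta>) \<le> (?c * (wt n (z - \<eta>) + wt n \<eta>)) * norm (f (z - \<eta>) * g \<eta>)"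
      using wt_add_le[of n "z - \<eta>" \<eta>] by (intro mult_right_mono) auto
    also have "... = ?c * ((norm (f (z - \<eta>)) * wt n (z - \<eta>)) * norm (g \<eta>)) + ?c * ((norm (g \<eta>) * wt n \<eta>) * norm (f (z - \<eta>)))"
      by (simp add: norm_mult algebra_simps)
    also have "... \<le> ?c * (K * norm (g \<eta>)) + ?c * (L * norm (f (z - \<eta>)))"
      by (intro add_mono mult_left_mono mult_right_mono f' g') auto
    finally show ?thesis by simp
  qed
  have "ennreal (wt n z * norm (conv M f g z)) \<le> ennreal (wt n z) * (\<integral>\<^sup>+\<eta>. ennreal (norm (f (z - \<eta>) * g \<eta>)) \<partial>dm M)"
    unfolding conv_def by (simp add: ennreal_mult mult_left_mono norm_lebesgue_integral_le_nn)
  also have "... = (\<integral>\<^sup>+\<eta>. ennreal (wt n z * norm (f (z - \<eta>) * g \<eta>)) \<partial>dm M)"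
    by (subst nn_integral_cmult[symmetric]) (simp_all add: ennreal_mult)
  also have "... \<le> (\<integral>\<^sup>+\<eta>. ennreal (?c * K) * ennreal (norm (g \<eta>)) + ennreal (?c * L) * ennreal (norm (f (z - \<eta>))) \<partial>dm M)"
    using ptw K L by (intro nn_integral_mono) (simp flip: ennreal_mult ennreal_plus add: ennreal_leI)
  also have "... = ennreal (?c * K) * (\<integral>\<^sup>+\<eta>. ennreal (norm (g \<eta>)) \<partial>dm M) + ennreal (?c * L) * (\<integral>\<^sup>+\<eta>. ennreal (norm (f (z - \<eta>))) \<partial>dm M)"
    by (simp add: nn_integral_add nn_integral_cmult)
  also have "... \<le> ennreal (?c * K) * ennreal S + ennreal (?c * L) * ennreal R"
    by (intro add_mono mult_left_mono unif_int_nn_integral S R[unfolded unif_int_def, rule_format]) simp_all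
  also have "... = ennreal (?c * (K * S + R * L))"
    using K L assms(5,6) by (simp flip: ennreal_mult ennreal_plus add: algebra_simps)
  finally have "wt n z * norm (conv M f g z) \<le> ?c * (K * S + R * L)"
    using K L assms(5,6) by (subst (asm) ennreal_le_iff) auto
  then show ?thesis by (simp add: field_simps)
qed

lemma decay_conv:
  fixes f g :: "'d::finite cfun"
  assumes "decay n K f" "decay n L g" "unif_int M R f" "unif_int M S g" "0 \<le> R" "0 \<le> S" "CARD('d) \<le> n"
  shows "decay n (4 ^ n * (K * S + R * L)) (conv M f g)"
  unfolding decay_def
  using continuous_on_conv[OF assms(1,2,7)] norm_conv_le[OF decayD[OF assms(1)] decayD[OF assms(2)] assms(3-6)] assms(1,2)
  by (blast intro: decay_borel)

lemma integrable_conv: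
  fixes f g :: "'d::finite cfun"
  assumes "decay n K f" "decay n L g" "CARD('d) \<le> n"
  shows "integrable (dm M) (\<lambda>\<eta>. f (z - \<eta>) * g \<eta>)"
proof (rule integrable_majorant[where f="\<lambda>\<eta>. K * (L * (1 / wt n \<eta>))"])
  show "integrable (dm M) (\<lambda>\<eta> :: real ^ 'd. K * (L * (1 / wt n \<eta>)))"
    by (intro integrable_mult_right integrable_wt assms)
  show "(\<lambda>\<eta>. f (z - \<eta>) * g \<eta>) \<in> borel_measurable (dm M)"
    by (simp, intro borel_measurable_continuous_onI continuous_intros decay_continuous[OF assms(1)] decay_continuous[OF assms(2)])
  show "AE \<eta> in dm M. norm (f (z - \<eta>) * g \<eta>) \<le> norm (K * (L * (1 / wt n \<eta>)))"
  proof (rule AE_I2)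
    fix \<eta>
    have "norm (f (z - \<eta>)) * norm (g \<eta>) \<le> K * (L / wt n \<eta>)"
      using decay_bounded[OF assms(1)] decayD[OF assms(2)] decay_nonneg[OF assms(1)] by (intro mult_mono) auto
    then show "norm (f (z - \<eta>) * g \<eta>) \<le> norm (K * (L * (1 / wt n \<eta>)))"
      using decay_nonneg[OF assms(1)] decay_nonneg[OF assms(2)] by (simp add: norm_mult abs_mult)
  qed
qed

text \<open>The bilinear telescoping identity that drives the two difference estimates for
  convolution powers.\<close>

lemma conv_diff_diff:
  fixes f f' g g' :: "'d::finite cfun"
  assumes "decay n K f" "decay n K' f'" "decay n L g" "decay n L' g'" "CARD('d) \<le> n"
  shows "conv M f g z - conv M f' g' z = conv M (\<lambda>z. f z - f' z) g z + conv M f' (\<lambda>z. g z - g' z) z"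
proof -
  note i = integrable_conv[OF _ _ assms(5), of _ _ _ _ M z]
  show ?thesis
    unfolding conv_def
    by (simp add: left_diff_distrib right_diff_distrib i[OF assms(1,3)] i[OF assms(2,3)] i[OF assms(2,4)])
qed

text \<open>The recursion is that of the tame estimate:
  \<open>K * R^(m+1) + R * (c * R^m * K)\<close> equals \<open>(1 + c) * R^(m+1) * K\<close>, and
  each convolution adds a factor \<open>4 ^ n\<close>.\<close>

primrec cpow_const :: "nat => nat => real" where
  "cpow_const n 0 = 1"
| "cpow_const n (Suc m) = 4 ^ n * (1 + cpow_const n m)"

lemma cpow_const_nonneg: "0 \<le> cpow_const n m"
  by (induction m) auto

text \<open>Both norms are propagated in one induction. The decay constant \<open>K\<close> enters
  only once and linearly; all other factors are powers of \<open>R\<close>.\<close>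

lemma cpow_bounds:
  fixes f :: "'d::finite cfun"
  assumes f: "decay n K f" "unif_int M R f" "0 \<le> R" "CARD('d) \<le> n"
  shows "unif_int M (R ^ Suc m) (cpow M f m) \<and> decay n (cpow_const n m * R ^ m * K) (cpow M f m)"
proof (induction m)
  case 0
  then show ?case using f by simp
next
  case (Suc m)
  have "unif_int M (R * R ^ Suc m) (conv M f (cpow M f m))"
    using Suc f by (intro unif_int_conv) (auto intro: decay_borel)
  moreover have "decay n (4 ^ n * (K * R ^ Suc m + R * (cpow_const n m * R ^ m * K))) (conv M f (cpow M f m))"
    using Suc f by (intro decay_conv) auto
  ultimately show ?case by (simp add: algebra_simps)
qed

lemma cpow_bounds':
  fixes f :: "'d::finite cfun"
  assumes "decay n K f" "CARD('d) \<le> n"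
  shows "decay n (cpow_const n m * (K * dmK M TYPE('d)) ^ m * K) (cpow M f m)"
  using cpow_bounds[OF assms(1) unif_int_decay[OF assms] _ assms(2)] decay_nonneg[OF assms(1)] by simp

text \<open>Exchanging the \<open>m + 1\<close> factors one at a time produces \<open>m + 1\<close>
  differences, each of size \<open>e\<close> times \<open>m\<close> factors bounded by
  \<open>R\<close>.\<close>

lemma unif_int_cpow_diff:
  fixes f g :: "'d::finite cfun"
  assumes f: "decay n K f" "unif_int M R f" and g: "decay n L g" "unif_int M R g"
    and e: "unif_int M e (\<lambda>z. f z - g z)" "0 \<le> e" and R: "0 \<le> R" and n: "CARD('d) \<le> n"
  shows "unif_int M (real (Suc m) * R ^ m * e) (\<lambda>z. cpow M f m z - cpow M g m z)"
proof (induction m)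
  case 0
  then show ?case using e by simp
next
  case (Suc m)
  note fm = cpow_bounds[OF f R n, of m] and gm = cpow_bounds[OF g R n, of m]
  have d: "decay n (K + L) (\<lambda>z. f z - g z)" by (rule decay_diff[OF f(1) g(1)])
  have dm: "decay n (cpow_const n m * R ^ m * K + cpow_const n m * R ^ m * L) (\<lambda>z. cpow M f m z - cpow M g m z)"
    using fm gm by (intro decay_diff) auto
  have u1: "unif_int M (e * R ^ Suc m) (conv M (\<lambda>z. f z - g z) (cpow M f m))"
    using fm d by (intro unif_int_conv e) (auto intro: decay_borel)
  have u2: "unif_int M (R * (real (Suc m) * R ^ m * e)) (conv M g (\<lambda>z. cpow M f m z - cpow M g m z))"
    using dm g by (intro unif_int_conv Suc R) (auto intro: decay_borel)
  have b1: "conv M (\<lambda>z. f z - g z) (cpow M f m) \<in> borel_measurable borel"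
    using continuous_on_conv[OF d _ n] fm by (intro borel_measurable_continuous_onI) blast
  have b2: "conv M g (\<lambda>z. cpow M f m z - cpow M g m z) \<in> borel_measurable borel"
    using continuous_on_conv[OF g(1) dm n] by (intro borel_measurable_continuous_onI)
  have eq: "cpow M f (Suc m) z - cpow M g (Suc m) z = conv M (\<lambda>z. f z - g z) (cpow M f m) z + conv M g (\<lambda>z. cpow M f m z - cpow M g m z) z" for z
    using conv_diff_diff[OF f(1) g(1) _ _ n] fm gm by simp blast
  have "unif_int M (e * R ^ Suc m + R * (real (Suc m) * R ^ m * e)) (\<lambda>z. cpow M f (Suc m) z - cpow M g (Suc m) z)"
    unfolding eq using R e(2) by (intro unif_int_add u1 u2 b1 b2) auto
  then show ?case by (simp add: algebra_simps)
qed

text \<open>The constant may depend on \<open>K\<close> in any way, because the exponential weight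
  in time later beats it. The sign of \<delta> follows from the difference bound itself.\<close>

lemma cpow_lipschitz:
  fixes K :: real
  assumes n: "CARD('d::finite) \<le> n" and K: "0 \<le> K"
  shows "\<exists>\<Lambda>\<ge>0. \<forall>(f :: 'd cfun) g \<delta>. decay n K f \<longrightarrow> decay n K g \<longrightarrow>
    (\<forall>z. norm (f z - g z) \<le> \<delta> / wt n z) \<longrightarrow> (\<forall>z. norm (cpow M f m z - cpow M g m z) \<le> \<Lambda> * \<delta> / wt n z)"
proof (induction m)
  case 0
  then show ?case by (intro exI[of _ 1]) auto
next
  case (Suc m)
  then obtain \<Lambda> where \<Lambda>: "\<Lambda> \<ge> 0" and IH: "\<And>(f :: 'd cfun) g \<delta> z. decay n K f ==> decay n K g ==>
    (\<And>z. norm (f z - g z) \<le> \<delta> / wt n z) ==> norm (cpow M f m z - cpow M g m z) \<le> \<Lambda> * \<delta> / wt n z"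
    by blast
  let ?k = "dmK M TYPE('d)"
  define C where "C = cpow_const n m * (K * ?k) ^ m * K"
  have C: "0 \<le> C" unfolding C_def using K cpow_const_nonneg by (intro mult_nonneg_nonneg zero_le_power) auto
  show ?case
  proof (intro exI[of _ "4 ^ n * (2 * ?k * C) + 4 ^ n * (2 * ?k * K * \<Lambda>)"] conjI allI impI)
    show "0 \<le> 4 ^ n * (2 * ?k * C) + 4 ^ n * (2 * ?k * K * \<Lambda>)" using C K \<Lambda> by simp
    fix f g :: "'d cfun" and \<delta> z
    assume f: "decay n K f" and g: "decay n K g" and fg: "\<forall>z. norm (f z - g z) \<le> \<delta> / wt n z"
    have d: "decay n \<delta> (\<lambda>z. f z - g z)"
      using decay_diff[OF f g] fg by (simp add: decay_def)
    have fm: "decay n C (cpow M f m)" and gm: "decay n C (cpow M g m)"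
      unfolding C_def by (rule cpow_bounds'[OF f n] cpow_bounds'[OF g n])+
    have dm: "decay n (\<Lambda> * \<delta>) (\<lambda>z. cpow M f m z - cpow M g m z)"
      using decay_diff[OF fm gm] IH[OF f g] fg by (simp add: decay_def)
    note u = unif_int_decay[OF _ n, of _ _ M]
    have nn: "0 \<le> \<delta> * ?k" "0 \<le> C * ?k" "0 \<le> K * ?k" "0 \<le> \<Lambda> * \<delta> * ?k"
      using decay_nonneg[OF d] K C \<Lambda> by auto
    have "norm (conv M (\<lambda>z. f z - g z) (cpow M f m) z) \<le> 4 ^ n * (\<delta> * (C * ?k) + \<delta> * ?k * C) / wt n z"
      by (rule norm_conv_le[OF decayD[OF d] decayD[OF fm] u[OF d] u[OF fm] nn(1,2) decay_borel[OF d] decay_borel[OF fm]])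
    moreover have "norm (conv M g (\<lambda>z. cpow M f m z - cpow M g m z) z) \<le> 4 ^ n * (K * (\<Lambda> * \<delta> * ?k) + K * ?k * (\<Lambda> * \<delta>)) / wt n z"
      by (rule norm_conv_le[OF decayD[OF g] decayD[OF dm] u[OF g] u[OF dm] nn(3,4) decay_borel[OF g] decay_borel[OF dm]])
    moreover have "cpow M f (Suc m) z - cpow M g (Suc m) z = conv M (\<lambda>z. f z - g z) (cpow M f m) z + conv M g (\<lambda>z. cpow M f m z - cpow M g m z) z"
      using conv_diff_diff[OF f g fm gm n] by simp
    ultimately have "norm (cpow M f (Suc m) z - cpow M g (Suc m) z) \<le>
        4 ^ n * (\<delta> * (C * ?k) + \<delta> * ?k * C) / wt n z + 4 ^ n * (K * (\<Lambda> * \<delta> * ?k) + K * ?k * (\<Lambda> * \<delta>)) / wt n z"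
      by (simp only:) (rule norm_triangle_le, linarith)
    also have "... = (4 ^ n * (2 * ?k * C) + 4 ^ n * (2 * ?k * K * \<Lambda>)) * \<delta> / wt n z"
      by (simp add: field_simps)
    finally show "norm (cpow M f (Suc m) z - cpow M g (Suc m) z) \<le> (4 ^ n * (2 * ?k * C) + 4 ^ n * (2 * ?k * K * \<Lambda>)) * \<delta> / wt n z" .
  qed
qed

lemma continuous_on_cpow_param:
  fixes F :: "real => 'd::finite cfun"
  assumes F: "jointly_continuous F" and Fb: "\<And>t z. norm (F t z) \<le> K / wt n z"
    and n: "CARD('d) \<le> n"
  shows "continuous_on UNIV (\<lambda>(t, z). cpow M (F t) m z)"
proof (induction m)
  case 0
  then show ?case using F by simp
next
  case (Suc m)
  have "continuous_on UNIV (\<lambda>z :: real ^ 'd. (t, z))" for t :: real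
    by (intro continuous_on_Pair continuous_on_const continuous_on_id)
  then have d: "decay n K (F t)" for t
    unfolding decay_def
    using Fb continuous_on_compose2[OF F, of UNIV "\<lambda>z. (t, z)"] by simp
  show ?case
    using continuous_on_conv_param[OF F Suc decay_bounded[OF d] decayD[OF cpow_bounds'[OF d n]] n] by simp
qed

section \<open>The Duhamel equation on the Fourier side\<close>

lemma sinc_symbol_0 [simp]: "sinc_symbol 0 r = 0"
  by (simp add: sinc_symbol_def)

text \<open>As \<open>t\<close> times \<open>sin x / x\<close> at \<open>x = t * r\<close>, with
  value 1 at \<open>x = 0\<close>, the symbol is visibly continuous in \<open>t\<close> and
  \<open>r\<close> jointly, also where \<open>r = 0\<close>.\<close>

lemma sinc_symbol_eq: "sinc_symbol t r = t * (if t * r = 0 then 1 else sin (t * r) / (t * r))"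
  by (auto simp: sinc_symbol_def)

lemma continuous_on_sinc_symbol [continuous_intros]:
  "continuous_on S f ==> continuous_on S g ==> continuous_on S (\<lambda>x. sinc_symbol (f x) (g x))"
  unfolding sinc_symbol_eq by (intro continuous_on_mult continuous_on_sinc)

lemma abs_sinc_symbol_le: "\<bar>sinc_symbol t r\<bar> \<le> \<bar>t\<bar>"
proof (cases "r = 0")
  case False
  then show ?thesis
    using abs_sin_x_le_abs_x[of "t * r"]
    by (simp add: sinc_symbol_def abs_mult field_simps)
qed (simp add: sinc_symbol_def)

lemma norm_integral_le_nn:
  fixes f :: "real => complex"
  assumes "continuous_on {a..b} f"
  shows "ennreal (norm (integral {a..b} f)) \<le> (\<integral>\<^sup>+s. indicator {a..b} s * ennreal (norm (f s)) \<partial>lborel)"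
proof -
  have "integral {a..b} f = (LINT s|lborel. indicator {a..b} s *\<^sub>R f s)"
    using set_borel_integral_eq_integral(2)[OF borel_integrable_atLeastAtMost'[OF assms]]
    by (simp add: set_lebesgue_integral_def)
  also have "ennreal (norm ...) \<le> (\<integral>\<^sup>+s. ennreal (norm (indicator {a..b} s *\<^sub>R f s)) \<partial>lborel)"
    by (rule norm_lebesgue_integral_le_nn)
  also have "... = (\<integral>\<^sup>+s. indicator {a..b} s * ennreal (norm (f s)) \<partial>lborel)"
    by (intro nn_integral_cong) (simp split: split_indicator)
  finally show ?thesis .
qed

interpretation lborel_dm: pair_sigma_finite "lborel :: real measure" "dm M :: (real ^ 'd::finite) measure" for M ..

definition duhamel :: "(real => 'd::finite cfun) => real => 'd cfun" where
  "duhamel G t z = integral {0..t} (\<lambda>s. of_real (sinc_symbol (t - s) (norm z)) * G s z)"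

lemma continuous_on_section:
  assumes "jointly_continuous G"
  shows "continuous_on S (\<lambda>t. G t z)" "continuous_on S' (\<lambda>z. G t z)"
proof -
  have "continuous_on S (\<lambda>t. (t, z))" "continuous_on S' (\<lambda>z. (t, z))"
    by (intro continuous_on_Pair continuous_on_const continuous_on_id)+
  then show "continuous_on S (\<lambda>t. G t z)" "continuous_on S' (\<lambda>z. G t z)"
    using continuous_on_compose2[OF assms, of S "\<lambda>t. (t, z)"]
      continuous_on_compose2[OF assms, of S' "\<lambda>z. (t, z)"] by auto
qed

lemma continuous_on_joint:
  assumes "jointly_continuous G" "continuous_on S f" "continuous_on S g"
  shows "continuous_on S (\<lambda>x. G (f x) (g x))"
  using continuous_on_compose2[OF assms(1) continuous_on_Pair[OF assms(2,3)]] by simp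

lemma continuous_on_duhamel_integrand:
  assumes "jointly_continuous G"
  shows "continuous_on S (\<lambda>s. complex_of_real (sinc_symbol (t - s) (norm z)) * G s z)"
  by (intro continuous_intros continuous_on_section[OF assms])

text \<open>The kernel vanishes at coinciding times, so the upper limit of integration can be fixed.\<close>

lemma duhamel_fixed_limit:
  fixes G :: "real => 'd::finite cfun"
  assumes G: "jointly_continuous G" and t: "0 \<le> t" "t \<le> T"
  shows "duhamel G t z = integral {0..T} (\<lambda>s. of_real (sinc_symbol (max 0 (t - s)) (norm z)) * G s z)"
proof -
  let ?f = "\<lambda>s. complex_of_real (sinc_symbol (max 0 (t - s)) (norm z)) * G s z"
  have "continuous_on {0..T} ?f"
    by (intro continuous_intros continuous_on_section[OF G])
  then have "integral {0..t} ?f + integral {t..T} ?f = integral {0..T} ?f"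
    using t by (intro Henstock_Kurzweil_Integration.integral_combine integrable_continuous_interval) auto
  moreover have "integral {t..T} ?f = integral {t..T} (\<lambda>_. 0)"
    by (intro integral_cong) auto
  moreover have "integral {0..t} ?f = duhamel G t z"
    unfolding duhamel_def by (intro integral_cong) auto
  ultimately show ?thesis by simp
qed

text \<open>Clamping the time to \<open>[0, T]\<close> gives a function on the whole line. With the
  fixed upper limit it is an integral over a compact interval of an integrand continuous in all
  variables.\<close>

lemma continuous_on_duhamel:
  fixes G :: "real => 'd::finite cfun"
  assumes G: "jointly_continuous G" and T: "0 \<le> T"
  shows "continuous_on UNIV (\<lambda>(t, z). duhamel G (max 0 (min T t)) z)"
proof -
  have "continuous_on UNIV (\<lambda>p :: real \<times> (real ^ 'd). integral (cbox 0 T)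
      (\<lambda>s. of_real (sinc_symbol (max 0 (max 0 (min T (fst p)) - s)) (norm (snd p))) * G s (snd p)))"
  proof (rule integral_continuous_on_param)
    have "continuous_on (UNIV \<times> cbox 0 T) (\<lambda>q :: (real \<times> (real ^ 'd)) \<times> real. G (snd q) (snd (fst q)))"
      by (intro continuous_on_joint[OF G] continuous_intros)
    then show "continuous_on (UNIV \<times> cbox 0 T) (\<lambda>(p, s). complex_of_real
        (sinc_symbol (max 0 (max 0 (min T (fst p)) - s)) (norm (snd p))) * G s (snd (p :: real \<times> (real ^ 'd))))"
      unfolding case_prod_unfold by (intro continuous_intros)
  qed
  moreover have "duhamel G (max 0 (min T t)) z = integral (cbox 0 T)
      (\<lambda>s. of_real (sinc_symbol (max 0 (max 0 (min T t) - s)) (norm z)) * G s z)" for t z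
    using T by (subst duhamel_fixed_limit[OF G, where T=T]) auto
  ultimately show ?thesis by (simp add: case_prod_unfold)
qed

text \<open>One factor \<open>t\<close> bounds the kernel and the other is the length of the
  interval. This square is what later ties the time to the amplitude.\<close>

lemma norm_duhamel_le:
  fixes G :: "real => 'd::finite cfun"
  assumes G: "jointly_continuous G" and t: "0 \<le> t"
    and b: "\<And>s. 0 \<le> s ==> s \<le> t ==> norm (G s z) \<le> B"
  shows "norm (duhamel G t z) \<le> t^2 * B"
proof -
  have B: "0 \<le> B" using order_trans[OF norm_ge_zero b[of 0]] t by simp
  have "norm (integral (cbox 0 t) (\<lambda>s. complex_of_real (sinc_symbol (t - s) (norm z)) * G s z)) \<le> (t * B) * measure lborel (cbox 0 t)"
  proof (rule has_integral_bound)
    show "0 \<le> t * B" using t B by simp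
    show "((\<lambda>s. complex_of_real (sinc_symbol (t - s) (norm z)) * G s z) has_integral
        integral (cbox 0 t) (\<lambda>s. complex_of_real (sinc_symbol (t - s) (norm z)) * G s z)) (cbox 0 t)"
      unfolding box_real by (intro integrable_integral integrable_continuous_interval continuous_on_duhamel_integrand G)
    fix s assume "s \<in> cbox 0 t"
    then show "norm (complex_of_real (sinc_symbol (t - s) (norm z)) * G s z) \<le> t * B"
      using abs_sinc_symbol_le[of "t - s" "norm z"] b[of s] B by (auto simp: norm_mult intro!: mult_mono)
  qed
  then show ?thesis using t by (simp add: duhamel_def power2_eq_square mult_ac)
qed

text \<open>The count is the same as for the pointwise bound, after Tonelli has exchanged time and
  frequency.\<close>

lemma nn_integral_duhamel_le:
  fixes G :: "real => 'd::finite cfun"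
  assumes G: "jointly_continuous G" and t: "0 \<le> t"
    and b: "\<And>s. 0 \<le> s ==> s \<le> t ==> unif_int M B (G s)" and B: "0 \<le> B"
  shows "unif_int M (t^2 * B) (duhamel G t)"
  unfolding unif_int_def
proof
  fix z :: "real ^ 'd"
  have G2 [measurable]: "(\<lambda>p. G (fst p) (z - snd p)) \<in> borel_measurable (lborel \<Otimes>\<^sub>M dm M)"
  proof -
    have "continuous_on UNIV (\<lambda>p :: real \<times> (real ^ 'd). G (fst p) (z - snd p))"
      by (intro continuous_on_joint[OF G] continuous_intros)
    then have "(\<lambda>p. G (fst p) (z - snd p)) \<in> borel_measurable (borel \<Otimes>\<^sub>M borel)"
      unfolding borel_prod by (rule borel_measurable_continuous_onI)
    moreover have "sets (lborel \<Otimes>\<^sub>M (dm M :: (real ^ 'd) measure)) = sets (borel \<Otimes>\<^sub>M borel)"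
      by (intro sets_pair_measure_cong) simp_all
    ultimately show ?thesis by (simp cong: measurable_cong_sets)
  qed
  have "(\<integral>\<^sup>+\<eta>. ennreal (norm (duhamel G t (z - \<eta>))) \<partial>dm M)
      \<le> (\<integral>\<^sup>+\<eta>. (\<integral>\<^sup>+s. indicator {0..t} s * (ennreal t * ennreal (norm (G s (z - \<eta>)))) \<partial>lborel) \<partial>dm M)"
  proof (rule nn_integral_mono)
    fix \<eta>
    have "ennreal (norm (duhamel G t (z - \<eta>))) \<le> (\<integral>\<^sup>+s. indicator {0..t} s *
        ennreal (norm (complex_of_real (sinc_symbol (t - s) (norm (z - \<eta>))) * G s (z - \<eta>))) \<partial>lborel)"
      unfolding duhamel_def by (intro norm_integral_le_nn continuous_on_duhamel_integrand G)
    also have "... \<le> (\<integral>\<^sup>+s. indicator {0..t} s * (ennreal t * ennreal (norm (G s (z - \<eta>)))) \<partial>lborel)"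
    proof (rule nn_integral_mono)
      fix s
      show "indicator {0..t} s * ennreal (norm (complex_of_real (sinc_symbol (t - s) (norm (z - \<eta>))) * G s (z - \<eta>)))
          \<le> indicator {0..t} s * (ennreal t * ennreal (norm (G s (z - \<eta>))))"
      proof (cases "s \<in> {0..t}")
        case True
        have "\<bar>sinc_symbol (t - s) (norm (z - \<eta>))\<bar> * norm (G s (z - \<eta>)) \<le> t * norm (G s (z - \<eta>))"
          using abs_sinc_symbol_le[of "t - s" "norm (z - \<eta>)"] True by (intro mult_right_mono) auto
        then show ?thesis
          using True t by (simp add: norm_mult ennreal_leI flip: ennreal_mult)
      qed simp
    qed
    finally show "ennreal (norm (duhamel G t (z - \<eta>))) \<le> (\<integral>\<^sup>+s. indicator {0..t} s * (ennreal t * ennreal (norm (G s (z - \<eta>)))) \<partial>lborel)" .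
  qed
  also have "... = (\<integral>\<^sup>+s. (\<integral>\<^sup>+\<eta>. indicator {0..t} s * (ennreal t * ennreal (norm (G s (z - \<eta>)))) \<partial>dm M) \<partial>lborel)"
    by (rule lborel_dm.Fubini') (simp add: case_prod_unfold)
  also have "... \<le> (\<integral>\<^sup>+s. ennreal (t * B) * indicator {0..t} s \<partial>lborel)"
  proof (rule nn_integral_mono)
    fix s
    show "(\<integral>\<^sup>+\<eta>. indicator {0..t} s * (ennreal t * ennreal (norm (G s (z - \<eta>)))) \<partial>dm M) \<le> ennreal (t * B) * indicator {0..t} s"
    proof (cases "s \<in> {0..t}")
      case True
      have "(\<lambda>\<eta>. G s (z - \<eta>)) \<in> borel_measurable borel"
        by (intro borel_measurable_continuous_onI continuous_on_joint[OF G] continuous_intros)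
      then have "(\<integral>\<^sup>+\<eta>. ennreal t * ennreal (norm (G s (z - \<eta>))) \<partial>dm M) = ennreal t * (\<integral>\<^sup>+\<eta>. ennreal (norm (G s (z - \<eta>))) \<partial>dm M)"
        by (intro nn_integral_cmult) simp
      also have "... \<le> ennreal t * ennreal B"
        using b[of s] True unfolding unif_int_def by (intro mult_left_mono) auto
      finally show ?thesis using True t B by (simp add: ennreal_mult)
    qed simp
  qed
  also have "... = ennreal (t^2 * B)"
    using t B by (simp add: nn_integral_cmult_indicator power2_eq_square mult_ac flip: ennreal_mult)
  finally show "(\<integral>\<^sup>+\<eta>. ennreal (norm (duhamel G t (z - \<eta>))) \<partial>dm M) \<le> ennreal (t^2 * B)" .
qed

lemma duhamel_diff:
  fixes G H :: "real => 'd::finite cfun"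
  assumes G: "jointly_continuous G" and H: "jointly_continuous H"
  shows "duhamel G t z - duhamel H t z = duhamel (\<lambda>s z. G s z - H s z) t z"
  unfolding duhamel_def right_diff_distrib
  by (intro integral_diff[symmetric] integrable_continuous_interval continuous_on_duhamel_integrand G H)

text \<open>Integrating \<open>exp (\<omega> * s)\<close> gains a factor
  \<open>1 / \<omega>\<close>, by which a large \<omega> absorbs any Lipschitz constant.\<close>

lemma norm_duhamel_le_exp:
  fixes G :: "real => 'd::finite cfun"
  assumes G: "jointly_continuous G" and t: "0 \<le> t" and \<omega>: "0 < \<omega>"
    and b: "\<And>s. 0 \<le> s ==> s \<le> t ==> norm (G s z) \<le> B * exp (\<omega> * s)" and B: "0 \<le> B"
  shows "norm (duhamel G t z) \<le> t * B / \<omega> * exp (\<omega> * t)"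
proof -
  have I: "((\<lambda>s. t * B * exp (\<omega> * s)) has_integral (t * B / \<omega> * exp (\<omega> * t) - t * B / \<omega> * exp (\<omega> * 0))) {0..t}"
    using t \<omega> by (intro fundamental_theorem_of_calculus)
      (auto intro!: derivative_eq_intros simp: has_real_derivative_iff_has_vector_derivative[symmetric])
  have "norm (duhamel G t z) \<le> integral {0..t} (\<lambda>s. t * B * exp (\<omega> * s))"
    unfolding duhamel_def
  proof (rule Henstock_Kurzweil_Integration.integral_norm_bound_integral)
    show "(\<lambda>s. complex_of_real (sinc_symbol (t - s) (norm z)) * G s z) integrable_on {0..t}"
      by (intro integrable_continuous_interval continuous_on_duhamel_integrand G)
    show "(\<lambda>s. t * B * exp (\<omega> * s)) integrable_on {0..t}" using I by blast
    fix s assume "s \<in> {0..t}"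
    then have "\<bar>sinc_symbol (t - s) (norm z)\<bar> * norm (G s z) \<le> t * (B * exp (\<omega> * s))"
      using abs_sinc_symbol_le[of "t - s" "norm z"] b[of s] B by (intro mult_mono) auto
    then show "norm (complex_of_real (sinc_symbol (t - s) (norm z)) * G s z) \<le> t * B * exp (\<omega> * s)"
      by (simp add: norm_mult mult_ac)
  qed
  also have "... = t * B / \<omega> * exp (\<omega> * t) - t * B / \<omega> * exp (\<omega> * 0)"
    using I by (rule integral_unique)
  also have "... \<le> t * B / \<omega> * exp (\<omega> * t)" using t B \<omega> by simp
  finally show ?thesis .
qed

text \<open>Fatou's lemma. It makes the uniform integral bound a closed condition, as the
  fixed-point argument requires.\<close>

lemma unif_int_limit:
  fixes f :: "nat => 'd::finite cfun"
  assumes "\<And>k. unif_int M R (f k)" and [measurable]: "\<And>k. f k \<in> borel_measurable borel"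
    and lim: "\<And>z. (\<lambda>k. f k z) \<longlonglongrightarrow> g z"
  shows "unif_int M R g"
  unfolding unif_int_def
proof
  fix z
  have "(\<integral>\<^sup>+\<eta>. ennreal (norm (g (z - \<eta>))) \<partial>dm M) = (\<integral>\<^sup>+\<eta>. liminf (\<lambda>k. ennreal (norm (f k (z - \<eta>)))) \<partial>dm M)"
  proof (intro nn_integral_cong)
    fix \<eta>
    have "(\<lambda>k. ennreal (norm (f k (z - \<eta>)))) \<longlonglongrightarrow> ennreal (norm (g (z - \<eta>)))"
      by (intro tendsto_ennrealI tendsto_norm lim)
    then show "ennreal (norm (g (z - \<eta>))) = liminf (\<lambda>k. ennreal (norm (f k (z - \<eta>))))"
      by (rule lim_imp_Liminf[OF trivial_limit_sequentially, symmetric])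
  qed
  also have "... \<le> liminf (\<lambda>k. (\<integral>\<^sup>+\<eta>. ennreal (norm (f k (z - \<eta>))) \<partial>dm M))"
    by (rule nn_integral_liminf) simp
  also have "... \<le> liminf (\<lambda>k::nat. ennreal R)"
    using assms(1) unfolding unif_int_def by (intro Liminf_mono) auto
  finally show "(\<integral>\<^sup>+\<eta>. ennreal (norm (g (z - \<eta>))) \<partial>dm M) \<le> ennreal R"
    by (simp only: Liminf_const[OF trivial_limit_sequentially])
qed

text \<open>The smallness condition only involves the translation-uniform integral norm \<open>R\<close>, by the tame
  estimate for convolution powers; an exponential weight in time gives contraction in the decay
  norm whatever the size of \<open>K\<close>.\<close>

theorem duhamel_equation_solvable:
  fixes lin :: "real => 'd::finite cfun" and \<kappa> :: real
  assumes n: "CARD('d) \<le> n" and T: "0 < T" and R: "0 \<le> R"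
    and cont: "jointly_continuous lin"
    and bound: "\<And>t z. 0 \<le> t ==> t \<le> T ==> norm (lin t z) \<le> K / wt n z"
    and uni: "\<And>t. 0 \<le> t ==> t \<le> T ==> unif_int M R (lin t)"
    and small1: "\<bar>\<kappa>\<bar> * T^2 * (2 * R) ^ Suc m \<le> R"
    and small2: "\<bar>\<kappa>\<bar> * T^2 * (cpow_const n m * (2 * R) ^ m) \<le> 1 / 2"
  shows "\<exists>u. jointly_continuous u \<and>
     (\<forall>t z. norm (u t z) \<le> 2 * K / wt n z) \<and> (\<forall>t. unif_int M (2 * R) (u t)) \<and>
     (\<forall>t\<in>{0..T}. \<forall>z. u t z = lin t z + of_real \<kappa> * duhamel (\<lambda>s. cpow M (u s) m) t z)"
proof -
  \<comment> \<open>Times outside \<open>[0, T]\<close> are frozen at the nearer endpoint, so that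
    all profiles live on the whole line.\<close>
  define c where "c t = max 0 (min T t)" for t
  have c: "0 \<le> c t" "c t \<le> T" for t using T by (auto simp: c_def)
  have c_id: "c t = t" if "0 \<le> t" "t \<le> T" for t using that by (auto simp: c_def)
  have c_cont: "continuous_on S (\<lambda>x. c (f x))" if "continuous_on S f" for S and f :: "real \<times> (real ^ 'd) => real"
    unfolding c_def by (intro continuous_intros that)
  have K: "0 \<le> K" using order_trans[OF norm_ge_zero bound[of 0 0]] T by (simp add: wt_def)
  obtain \<Lambda> where \<Lambda>: "0 \<le> \<Lambda>" and lip: "\<And>(f :: 'd cfun) g \<delta> z. decay n (2 * K) f ==> decay n (2 * K) g ==>
      (\<And>z. norm (f z - g z) \<le> \<delta> / wt n z) ==> norm (cpow M f m z - cpow M g m z) \<le> \<Lambda> * \<delta> / wt n z"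
    using cpow_lipschitz[OF n, of "2 * K" M m] K by (metis mult_nonneg_nonneg zero_le_numeral)
  \<comment> \<open>Chosen so that the contraction factor
    \<open>\<bar>\<kappa>\<bar> * T * \<Lambda> / \<omega>\<close> is at most 1/2; the added 1 keeps
    \<omega> positive when \<open>\<Lambda>\<close> or \<kappa> is 0.\<close>
  define \<omega> where "\<omega> = 2 * (\<bar>\<kappa>\<bar> * T * \<Lambda>) + 1"
  have \<omega>: "0 < \<omega>" using T \<Lambda> by (simp add: \<omega>_def add_nonneg_pos)
  \<comment> \<open>\<open>pre\<close> multiplies a profile by \<open>wt n z\<close> and divides it
    by \<open>exp (\<omega> * t)\<close>; \<open>dec\<close> undoes this. The sup norm of bounded
    continuous functions thereby becomes the decay norm with an exponential weight in time.\<close>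
  define dec where "dec h t z = complex_of_real (exp (\<omega> * c t) / wt n z) * apply_bcontfun h (c t, z)"
    for h :: "(real \<times> (real ^ 'd)) \<Rightarrow>\<^sub>C complex" and t z
  define pre where "pre U = (\<lambda>(t, z). complex_of_real (exp (- \<omega> * c t) * wt n z) * U (c t) z)"
    for U :: "real => 'd cfun"
  define ok where "ok U \<longleftrightarrow> continuous_on UNIV (\<lambda>(t, z). U (c t) z) \<and> (\<forall>t z. norm (U (c t) z) \<le> 2 * K / wt n z)
      \<and> (\<forall>t. unif_int M (2 * R) (U (c t)))" for U :: "real => 'd cfun"
  \<comment> \<open>The invariant set: twice the bounds of the linear part, in the decay norm and in
    the integral norm together.\<close>
  define S where "S = {h. ok (dec h)}"
  have cc [simp]: "c (c t) = c t" for t using c by (intro c_id) auto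
  have dec_c [simp]: "dec h (c t) = dec h t" for h t by (simp add: dec_def fun_eq_iff)
  have dec_cont: "jointly_continuous (dec h)" for h
    unfolding dec_def case_prod_unfold
    by (intro continuous_intros c_cont continuous_on_compose2[OF continuous_on_apply_bcontfun[of UNIV h]]) auto
  have pre_bcontfun: "pre U \<in> bcontfun" if "ok U" for U
  proof -
    have "continuous_on UNIV (pre U)"
      using that unfolding pre_def ok_def case_prod_unfold by (intro continuous_intros c_cont) auto
    moreover have "norm (pre U p) \<le> 2 * K" for p
    proof -
      obtain t z where p: "p = (t, z)" by (cases p)
      have "norm (pre U p) = exp (- \<omega> * c t) * (wt n z * norm (U (c t) z))"
        by (simp add: pre_def p norm_mult)
      also have "... \<le> 1 * (wt n z * (2 * K / wt n z))"
        using that c[of t] \<omega> unfolding ok_def by (intro mult_mono mult_left_mono) auto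
      finally show ?thesis by simp
    qed
    ultimately show ?thesis unfolding bcontfun_def by (auto intro!: boundedI)
  qed
  have dec_enc: "dec (Bcontfun (pre U)) t = U (c t)" if "ok U" for U t
  proof
    fix z :: "real ^ 'd"
    have "complex_of_real (exp (\<omega> * c t) / wt n z) * complex_of_real (exp (- \<omega> * c t) * wt n z) = 1"
      unfolding of_real_mult[symmetric] by (simp add: exp_minus)
    then show "dec (Bcontfun (pre U)) t z = U (c t) z"
      unfolding dec_def Bcontfun_inverse[OF pre_bcontfun[OF that]] by (simp add: pre_def flip: mult.assoc)
  qed
  define \<Phi> where "\<Phi> h t z = lin t z + of_real \<kappa> * duhamel (\<lambda>s. cpow M (dec h s) m) t z" for h t z
  have ok_dec: "norm (dec h t z) \<le> 2 * K / wt n z" "unif_int M (2 * R) (dec h t)" "decay n (2 * K) (dec h t)" if "h \<in> S" for h t z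
  proof -
    have "ok (dec h)" using that by (simp add: S_def)
    then have *: "norm (dec h t z) \<le> 2 * K / wt n z" "unif_int M (2 * R) (dec h t)" for t z by (simp_all add: ok_def)
    then show "norm (dec h t z) \<le> 2 * K / wt n z" "unif_int M (2 * R) (dec h t)" by blast+
    show "decay n (2 * K) (dec h t)" using * continuous_on_section(2)[OF dec_cont[of h], of UNIV t] by (simp add: decay_def)
  qed
  have pow_cont: "continuous_on UNIV (\<lambda>(t, z). cpow M (dec h t) m z)" if "h \<in> S" for h
    by (rule continuous_on_cpow_param[OF dec_cont ok_dec(1)[OF that] n])
  have pow_bounds: "unif_int M ((2 * R) ^ Suc m) (cpow M (dec h t) m)" "decay n (cpow_const n m * (2 * R) ^ m * (2 * K)) (cpow M (dec h t) m)"
    if "h \<in> S" for h t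
    using cpow_bounds[OF ok_dec(3)[OF that] ok_dec(2)[OF that] _ n] R by auto
  have duh_cont: "continuous_on UNIV (\<lambda>(t, z). duhamel (\<lambda>s. cpow M (dec h s) m) (c t) z)" if "h \<in> S" for h
    unfolding c_def using T by (intro continuous_on_duhamel pow_cont that) auto
  have lin_cont: "continuous_on UNIV (\<lambda>(t, z). lin (c t) z)"
    unfolding case_prod_unfold by (intro continuous_on_joint[OF cont] continuous_intros c_cont)
  have T2: "(c t)^2 \<le> T^2" for t using c[of t] by (intro power_mono) auto
  have ok_\<Phi>: "ok (\<Phi> h)" if h: "h \<in> S" for h
    unfolding ok_def
  proof (intro conjI allI)
    show "continuous_on UNIV (\<lambda>(t, z). \<Phi> h (c t) z)"
      unfolding \<Phi>_def case_prod_unfold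
      using lin_cont duh_cont[OF h] by (intro continuous_intros) (simp_all add: case_prod_unfold)
    fix t
    show "norm (\<Phi> h (c t) z) \<le> 2 * K / wt n z" for z
    proof -
      let ?B = "cpow_const n m * (2 * R) ^ m * (2 * K)"
      have B: "0 \<le> ?B" using cpow_const_nonneg R K by (intro mult_nonneg_nonneg) auto
      have "norm (duhamel (\<lambda>s. cpow M (dec h s) m) (c t) z) \<le> (c t)^2 * (?B / wt n z)"
        by (intro norm_duhamel_le pow_cont h c decayD pow_bounds)
      also have "... \<le> T^2 * (?B / wt n z)" using B by (intro mult_right_mono T2) auto
      finally have "\<bar>\<kappa>\<bar> * norm (duhamel (\<lambda>s. cpow M (dec h s) m) (c t) z) \<le> \<bar>\<kappa>\<bar> * (T^2 * (?B / wt n z))"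
        by (rule mult_left_mono) simp
      also have "... = (\<bar>\<kappa>\<bar> * T^2 * (cpow_const n m * (2 * R) ^ m)) * (2 * K / wt n z)" by simp
      also have "... \<le> 1 / 2 * (2 * K / wt n z)" using K by (intro mult_right_mono small2) auto
      finally have "norm (complex_of_real \<kappa> * duhamel (\<lambda>s. cpow M (dec h s) m) (c t) z) \<le> K / wt n z"
        by (simp add: norm_mult)
      then have "norm (\<Phi> h (c t) z) \<le> K / wt n z + K / wt n z"
        unfolding \<Phi>_def using bound[OF c, of t z] by (intro norm_triangle_le add_mono)
      then show ?thesis by simp
    qed
    have "unif_int M ((c t)^2 * (2 * R) ^ Suc m) (duhamel (\<lambda>s. cpow M (dec h s) m) (c t))"
      using R by (intro nn_integral_duhamel_le pow_cont h c pow_bounds) auto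
    moreover have dm: "duhamel (\<lambda>s. cpow M (dec h s) m) (c t) \<in> borel_measurable borel"
      using continuous_on_section(2)[OF duh_cont[OF h], of UNIV t] by (rule borel_measurable_continuous_onI)
    ultimately have "unif_int M (\<bar>\<kappa>\<bar> * ((c t)^2 * (2 * R) ^ Suc m)) (\<lambda>z. of_real \<kappa> * duhamel (\<lambda>s. cpow M (dec h s) m) (c t) z)"
      using unif_int_cmult[of M "(c t)^2 * (2 * R) ^ Suc m" _ "of_real \<kappa>"] by (simp del: power_Suc)
    moreover have "\<bar>\<kappa>\<bar> * ((c t)^2 * (2 * R) ^ Suc m) \<le> R"
    proof -
      have "(c t)^2 * (2 * R) ^ Suc m \<le> T^2 * (2 * R) ^ Suc m" using R by (intro mult_right_mono T2) auto
      then have "\<bar>\<kappa>\<bar> * ((c t)^2 * (2 * R) ^ Suc m) \<le> \<bar>\<kappa>\<bar> * (T^2 * (2 * R) ^ Suc m)" by (rule mult_left_mono) simp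
      then show ?thesis using small1 by (simp add: mult_ac)
    qed
    ultimately have "unif_int M R (\<lambda>z. of_real \<kappa> * duhamel (\<lambda>s. cpow M (dec h s) m) (c t) z)"
      by (blast intro: unif_int_mono order_refl)
    moreover have "lin (c t) \<in> borel_measurable borel"
      using continuous_on_section(2)[OF lin_cont, of UNIV t] by (rule borel_measurable_continuous_onI)
    ultimately have "unif_int M (R + R) (\<Phi> h (c t))"
      unfolding \<Phi>_def using uni[OF c] R dm by (intro unif_int_add) auto
    then show "unif_int M (2 * R) (\<Phi> h (c t))" by simp
  qed
  have S_I: "h \<in> S" if dU: "\<And>t. dec h t = U (c t)" and U: "ok U" for h U
    unfolding S_def mem_Collect_eq ok_def dec_c
  proof (intro conjI allI)
    show "jointly_continuous (dec h)" by (rule dec_cont)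
    show "norm (dec h t z) \<le> 2 * K / wt n z" "unif_int M (2 * R) (dec h t)" for t z
      using U unfolding ok_def dU by blast+
  qed
  define F where "F h = Bcontfun (pre (\<Phi> h))" for h
  have dec_F: "dec (F h) t = \<Phi> h (c t)" if "h \<in> S" for h t
    unfolding F_def by (rule dec_enc[OF ok_\<Phi>[OF that]])
  have F_S: "F h \<in> S" if "h \<in> S" for h
    by (rule S_I[OF dec_F[OF that] ok_\<Phi>[OF that]])
  \<comment> \<open>Uniform convergence of the encoded functions gives pointwise convergence of the
    profiles, and both defining bounds survive pointwise limits.\<close>
  have "closed S"
    unfolding closed_sequential_limits
  proof safe
    fix x l assume x: "\<forall>k. x k \<in> S" and xl: "x \<longlonglongrightarrow> l"
    have lim: "(\<lambda>k. dec (x k) t z) \<longlonglongrightarrow> dec l t z" for t z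
      unfolding dec_def using tendsto_uniform_limitI[OF tendsto_bcontfun_uniform_limit[OF xl], of "(c t, z)"]
      by (intro tendsto_intros) auto
    show "l \<in> S" unfolding S_def mem_Collect_eq ok_def dec_c
    proof (intro conjI allI)
      show "continuous_on UNIV (\<lambda>(t, z). dec l t z)" by (rule dec_cont)
      fix t
      show "norm (dec l t z) \<le> 2 * K / wt n z" for z
        using x ok_dec(1) by (intro tendsto_upperbound[OF tendsto_norm[OF lim]]) auto
      show "unif_int M (2 * R) (dec l t)"
        using x ok_dec decay_borel by (intro unif_int_limit[OF _ _ lim]) blast+
    qed
  qed
  have "\<exists>!h\<in>S. F h = h"
  proof (rule Banach_fix[OF complete_eq_closed[THEN iffD2, OF \<open>closed S\<close>], where c="1/2"])
    have "ok lin" unfolding ok_def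
    proof (intro conjI allI)
      show "continuous_on UNIV (\<lambda>(t, z). lin (c t) z)" by (rule lin_cont)
      fix t
      show "norm (lin (c t) z) \<le> 2 * K / wt n z" for z
        using order_trans[OF bound[OF c, of t z], of "2 * K / wt n z"] K by (simp add: divide_right_mono)
      show "unif_int M (2 * R) (lin (c t))"
        using unif_int_mono[OF uni[OF c, of t], of "lin (c t)" "2 * R"] R by simp
    qed
    then have "Bcontfun (pre lin) \<in> S"
      by (intro S_I[where U=lin] dec_enc[where U=lin])
    then show "S \<noteq> {}" by blast
    show "F ` S \<subseteq> S" using F_S by blast
    fix g h assume g: "g \<in> S" and h: "h \<in> S"
    show "dist (F g) (F h) \<le> 1 / 2 * dist g h"
    proof (rule dist_bound)
      fix p :: "real \<times> (real ^ 'd)"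
      obtain t z where p: "p = (t, z)" by (cases p)
      let ?D = "\<Lambda> * dist g h / wt n z"
      have "norm (cpow M (dec g s) m z - cpow M (dec h s) m z) \<le> ?D * exp (\<omega> * s)" if "0 \<le> s" "s \<le> c t" for s
      proof -
        have s: "c s = s" using that c[of t] by (intro c_id) auto
        have "norm (dec g s \<zeta> - dec h s \<zeta>) \<le> (exp (\<omega> * s) * dist g h) / wt n \<zeta>" for \<zeta>
        proof -
          have "dec g s \<zeta> - dec h s \<zeta> = complex_of_real (exp (\<omega> * s) / wt n \<zeta>) * (apply_bcontfun g (s, \<zeta>) - apply_bcontfun h (s, \<zeta>))"
            by (simp add: dec_def s right_diff_distrib)
          also have "norm ... = exp (\<omega> * s) / wt n \<zeta> * dist (apply_bcontfun g (s, \<zeta>)) (apply_bcontfun h (s, \<zeta>))"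
            by (simp only: norm_mult norm_of_real dist_norm) simp
          also have "... \<le> exp (\<omega> * s) / wt n \<zeta> * dist g h"
            by (intro mult_left_mono dist_bounded) auto
          finally show ?thesis by simp
        qed
        from lip[OF ok_dec(3)[OF g] ok_dec(3)[OF h] this, of z] show ?thesis by (simp add: mult_ac)
      qed
      then have "norm (duhamel (\<lambda>s z. cpow M (dec g s) m z - cpow M (dec h s) m z) (c t) z) \<le> c t * ?D / \<omega> * exp (\<omega> * c t)"
        using pow_cont[OF g] pow_cont[OF h] c \<omega> \<Lambda>
        by (intro norm_duhamel_le_exp) (auto simp: case_prod_unfold intro!: continuous_intros)
      also have "... \<le> T * ?D / \<omega> * exp (\<omega> * c t)"
        using c \<omega> \<Lambda> by (intro mult_right_mono divide_right_mono) auto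
      finally have D: "norm (duhamel (\<lambda>s. cpow M (dec g s) m) (c t) z - duhamel (\<lambda>s. cpow M (dec h s) m) (c t) z) \<le> T * ?D / \<omega> * exp (\<omega> * c t)"
        by (simp add: duhamel_diff[OF pow_cont[OF g] pow_cont[OF h]])
      have ap: "apply_bcontfun (F h) p = complex_of_real (exp (- \<omega> * c t) * wt n z) * \<Phi> h (c t) z" if "h \<in> S" for h
        unfolding F_def Bcontfun_inverse[OF pre_bcontfun[OF ok_\<Phi>[OF that]]] by (simp add: pre_def p)
      have "dist (apply_bcontfun (F g) p) (apply_bcontfun (F h) p) = norm (complex_of_real (exp (- \<omega> * c t) * wt n z) *
          (of_real \<kappa> * (duhamel (\<lambda>s. cpow M (dec g s) m) (c t) z - duhamel (\<lambda>s. cpow M (dec h s) m) (c t) z)))"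
        unfolding ap[OF g] ap[OF h] dist_norm by (simp add: \<Phi>_def right_diff_distrib distrib_left)
      also have "... = exp (- \<omega> * c t) * wt n z *
          (\<bar>\<kappa>\<bar> * norm (duhamel (\<lambda>s. cpow M (dec g s) m) (c t) z - duhamel (\<lambda>s. cpow M (dec h s) m) (c t) z))"
        by (simp only: norm_mult norm_of_real) (simp add: abs_mult)
      also have "... \<le> exp (- \<omega> * c t) * wt n z * (\<bar>\<kappa>\<bar> * (T * ?D / \<omega> * exp (\<omega> * c t)))"
        by (intro mult_left_mono D) auto
      also have "... = (\<bar>\<kappa>\<bar> * T * \<Lambda> / \<omega>) * dist g h"
        by (simp add: exp_minus field_simps)
      also have "... \<le> 1 / 2 * dist g h"
        using \<omega> by (intro mult_right_mono) (auto simp: \<omega>_def field_simps)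
      finally show "dist (apply_bcontfun (F g) p) (apply_bcontfun (F h) p) \<le> 1 / 2 * dist g h" .
    qed
  qed auto
  then obtain h where h: "h \<in> S" "F h = h" by blast
  show ?thesis
  proof (intro exI[of _ "dec h"] conjI allI ballI)
    show "jointly_continuous (dec h)" by (rule dec_cont)
    show "norm (dec h t z) \<le> 2 * K / wt n z" "unif_int M (2 * R) (dec h t)" for t z using ok_dec[OF h(1)] by auto
    fix t z assume "t \<in> {0..T}"
    then show "dec h t z = lin t z + of_real \<kappa> * duhamel (\<lambda>s. cpow M (dec h s) m) t z"
      using dec_F[OF h(1), of t] h(2) c_id[of t] by (simp add: \<Phi>_def)
  qed
qed

section \<open>Test functions and their Fourier transforms\<close>

lemma pderivs_append: "pderivs (is @ js) f = pderivs is (pderivs js f)"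
  by (induction "is") simp_all

text \<open>The device behind the smoothness proofs: it suffices to exhibit a family of
  differentiable functions that contains its first partial derivatives.\<close>

lemma pderivs_closed_family:
  assumes "\<And>f i. f \<in> F ==> pderivs [i] f \<in> F" "f \<in> F"
  shows "pderivs is f \<in> F"
  using assms by (induction "is") simp_all

lemma smooth_differentiable: "smooth f ==> f differentiable (at x)"
  unfolding smooth_def by (metis pderivs.simps(1))

lemma smooth_continuous: "smooth f ==> continuous_on S f"
  by (meson smooth_differentiable continuous_at_imp_continuous_on differentiable_imp_continuous_within)

lemma smooth_pderivs: "smooth f ==> smooth (pderivs is f)"
  unfolding smooth_def by (metis pderivs_append)

lemma test_functions_smooth: "\<phi> \<in> test_functions M ==> smooth \<phi>"
  by (cases M) (simp_all add: test_functions_def)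

lemma periodic_pderivs:
  assumes "periodic f" "smooth f"
  shows "periodic (pderivs is f)"
proof (induction "is")
  case (Cons i "is")
  let ?g = "pderivs is f"
  have "frechet_derivative ?g (at (x + axis j (2 * pi))) = frechet_derivative ?g (at x)" for x j
  proof -
    let ?a = "axis j (2 * pi)"
    have "(?g has_derivative frechet_derivative ?g (at (x + ?a))) (at (x + ?a))"
      using assms(2) unfolding smooth_def by (simp add: frechet_derivative_works)
    moreover have "((\<lambda>y. y + ?a) has_derivative (\<lambda>h. h)) (at x)"
      by (auto intro!: derivative_eq_intros)
    ultimately have "((\<lambda>y. ?g (y + ?a)) has_derivative frechet_derivative ?g (at (x + ?a))) (at x)"
      using has_derivative_compose[of "\<lambda>y. y + ?a" "\<lambda>h. h" x UNIV ?g "frechet_derivative ?g (at (x + ?a))"] by simp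
    then have "(?g has_derivative frechet_derivative ?g (at (x + ?a))) (at x)"
      using Cons.IH by (simp add: periodic_def)
    then show ?thesis by (rule frechet_derivative_at)
  qed
  then show ?case by (simp add: periodic_def)
qed (use assms in simp)

lemma pderivs_test_functions: "\<phi> \<in> test_functions M ==> pderivs is \<phi> \<in> test_functions M"
  by (cases M) (auto simp: test_functions_def smooth_pderivs periodic_pderivs simp flip: pderivs_append)

lemma axis_0: "axis i (0::real) = 0"
  by (simp add: vec_eq_iff axis_def)

lemma norm_axis_real: "norm (axis i r) = \<bar>r::real\<bar>"
  by (simp add: norm_eq_sqrt_inner inner_axis_axis)

lemma periodic_lattice:
  fixes f :: "'d::finite cfun"
  assumes f: "periodic f" and n: "n \<in> lattice"
  shows "f (x + (2 * pi) *\<^sub>R n) = f x"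
proof -
  have nat: "f (x + axis i (2 * pi * real m)) = f x" for x i m
  proof (induction m)
    case (Suc m)
    have "x + axis i (2 * pi * real (Suc m)) = (x + axis i (2 * pi * real m)) + axis i (2 * pi)"
      by (simp add: vec_eq_iff axis_def algebra_simps)
    then show ?case using f Suc unfolding periodic_def by metis
  qed (simp add: axis_0)
  have int: "f (x + axis i (2 * pi * r)) = f x" if r: "r \<in> \<int>" for x i r
  proof (cases "0 \<le> r")
    case True
    obtain Z where "r = of_int Z" using r by (auto elim: Ints_cases)
    then have "r = real (nat Z)" using True by simp
    then show ?thesis using nat by simp
  next
    case False
    obtain Z where "r = of_int Z" using r by (auto elim: Ints_cases)
    then have m: "- r = real (nat (- Z))" using False by simp
    let ?m = "nat (- Z)"
    have eq: "(x + axis i (2 * pi * r)) + axis i (2 * pi * real ?m) = x"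
      by (simp add: vec_eq_iff axis_def m[symmetric])
    show ?thesis using nat[of "x + axis i (2 * pi * r)" i ?m] unfolding eq by simp
  qed
  have "f (x + (\<Sum>i\<in>A. axis i (2 * pi * n $ i))) = f x" if "finite A" for A
    using that
  proof (induction A)
    case (insert i A)
    have "n $ i \<in> \<int>" using n by (simp add: lattice_def)
    from int[OF this, of "x + (\<Sum>i\<in>A. axis i (2 * pi * n $ i))" i] insert show ?case by (simp add: algebra_simps)
  qed simp
  moreover have "(\<Sum>i\<in>UNIV. axis i (2 * pi * n $ i)) = (2 * pi) *\<^sub>R n"
    by (simp add: vec_eq_iff axis_def sum.delta')
  ultimately show ?thesis by (metis finite)
qed

text \<open>Subtracting the integer part of each coordinate, measured in periods, moves every point
  into the compact period cube.\<close>

lemma periodic_bounded: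
  fixes f :: "'d::finite cfun"
  assumes f: "periodic f" and c: "continuous_on UNIV f"
  shows "\<exists>C. \<forall>x. norm (f x) \<le> C"
proof -
  let ?Q = "cbox 0 (\<chi> i. 2 * pi) :: (real ^ 'd) set"
  have "compact (f ` ?Q)"
    by (intro compact_continuous_image continuous_on_subset[OF c]) auto
  then have "bounded (f ` ?Q)" by (rule compact_imp_bounded)
  then obtain C where C: "\<forall>y\<in>f ` ?Q. norm y \<le> C" unfolding bounded_iff by auto
  have "norm (f x) \<le> C" for x
  proof -
    let ?n = "\<chi> i. of_int (- \<lfloor>x $ i / (2 * pi)\<rfloor>) :: real ^ 'd"
    have "?n \<in> lattice" by (simp add: lattice_def)
    then have "f x = f (x + (2 * pi) *\<^sub>R ?n)" by (rule periodic_lattice[OF f, symmetric])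
    moreover have "x + (2 * pi) *\<^sub>R ?n \<in> ?Q"
    proof -
      have "of_int \<lfloor>x $ i / (2 * pi)\<rfloor> * (2 * pi) \<le> x $ i" "x $ i \<le> (of_int \<lfloor>x $ i / (2 * pi)\<rfloor> + 1) * (2 * pi)" for i
        using floor_divide_lower[of "2 * pi" "x $ i"] floor_divide_upper[of "2 * pi" "x $ i"] pi_gt_zero by auto
      then show ?thesis by (simp add: mem_box_cart algebra_simps)
    qed
    ultimately show ?thesis using C by simp
  qed
  then show ?thesis by blast
qed

text \<open>An integrable majorant, up to a constant, of every test function and each of its
  derivatives. It lets the two spaces share their dominated convergence arguments.\<close>

definition test_weight :: "base_space => real ^ 'd::finite => real" where
  "test_weight M x = (case M of Euclidean => 1 / wt CARD('d) x | Torus => 1)"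

lemma test_weight_pos: "0 < test_weight M x"
  by (cases M) (simp_all add: test_weight_def)

lemma measurable_space_measure: "f \<in> borel_measurable borel ==> f \<in> borel_measurable (space_measure M)"
  by (cases M) (auto simp: space_measure_def intro: measurable_restrict_space1)

lemma continuous_measurable_space_measure:
  "continuous_on UNIV f ==> f \<in> borel_measurable (space_measure M)"
  by (intro measurable_space_measure borel_measurable_continuous_onI)

lemma integrable_test_weight: "integrable (space_measure M) (test_weight M :: real ^ 'd::finite => real)"
proof (cases M)
  case Euclidean
  then show ?thesis
    using integrable_wt[where n="CARD('d)" and M=Euclidean and 'd='d]
    by (simp add: dm_Euclidean test_weight_def[abs_def] space_measure_def)
next
  case Torus
  have "emeasure lborel (cbox 0 (\<chi> i. 2 * pi) :: (real ^ 'd) set) < \<infinity>"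
    by (rule emeasure_lborel_cbox_finite)
  then have "finite_measure (restrict_space lborel (cbox 0 (\<chi> i. 2 * pi) :: (real ^ 'd) set))"
    by (intro finite_measureI) (simp add: emeasure_restrict_space space_restrict_space)
  then show ?thesis
    by (simp add: Torus test_weight_def[abs_def] space_measure_def finite_measure.integrable_const)
qed

lemma test_functions_bound:
  fixes \<phi> :: "'d::finite cfun"
  assumes "\<phi> \<in> test_functions M"
  shows "\<exists>C. \<forall>x. norm (pderivs is \<phi> x) \<le> C * test_weight M x"
proof (cases M)
  case Euclidean
  then obtain C where C: "(1 + norm x) ^ (2 * CARD('d)) * norm (pderivs is \<phi> x) \<le> C" for x
    using assms by (simp add: test_functions_def) blast
  have "norm (pderivs is \<phi> x) \<le> C * test_weight M x" for x
  proof -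
    have "1 + (norm x)^2 \<le> (1 + norm x)^2" by (simp add: power2_sum)
    then have "wt CARD('d) x \<le> (1 + norm x) ^ (2 * CARD('d))"
      unfolding wt_def power_mult by (intro power_mono) auto
    then have "wt CARD('d) x * norm (pderivs is \<phi> x) \<le> C"
      using C[of x] by (meson mult_right_mono norm_ge_zero order_trans)
    then show ?thesis by (simp add: test_weight_def Euclidean field_simps)
  qed
  then show ?thesis by blast
next
  case Torus
  then have "periodic \<phi>" "smooth \<phi>" using assms by (auto simp: test_functions_def)
  then show ?thesis
    using periodic_bounded[OF periodic_pderivs smooth_continuous[OF smooth_pderivs]]
    by (simp add: test_weight_def Torus)
qed

lemma integrable_mult_test_weight:
  fixes f g :: "'d::finite cfun"
  assumes "\<And>x. norm (g x) \<le> C * test_weight M x" "\<And>x. norm (f x) \<le> B"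
    and f: "f \<in> borel_measurable borel" and g: "g \<in> borel_measurable borel"
  shows "integrable (space_measure M) (\<lambda>x. f x * g x)"
proof (rule integrable_majorant[where f="\<lambda>x. B * (C * test_weight M x)"])
  show "integrable (space_measure M) (\<lambda>x :: real ^ 'd. B * (C * test_weight M x))"
    by (intro integrable_mult_right integrable_test_weight)
  show "(\<lambda>x. f x * g x) \<in> borel_measurable (space_measure M)"
    by (intro measurable_space_measure borel_measurable_times f g)
  show "AE x in space_measure M. norm (f x * g x) \<le> norm (B * (C * test_weight M x))"
  proof (rule AE_I2)
    fix x
    have B: "0 \<le> B" using assms(2)[of x] norm_ge_zero order_trans by blast
    have "norm (f x) * norm (g x) \<le> B * (C * test_weight M x)"
      using assms(1,2)[of x] B by (intro mult_mono) auto
    then show "norm (f x * g x) \<le> norm (B * (C * test_weight M x))" by (simp add: norm_mult)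
  qed
qed

lemma test_functions_borel: "\<phi> \<in> test_functions M ==> \<phi> \<in> borel_measurable borel"
  by (intro borel_measurable_continuous_onI smooth_continuous test_functions_smooth)

lemma integrable_bounded_test:
  fixes f \<phi> :: "'d::finite cfun"
  assumes "\<phi> \<in> test_functions M" "f \<in> borel_measurable borel" "\<And>x. norm (f x) \<le> B"
  shows "integrable (space_measure M) (\<lambda>x. f x * \<phi> x)"
proof -
  obtain C where "norm (pderivs [] \<phi> x) \<le> C * test_weight M x" for x
    using test_functions_bound[OF assms(1), of "[]"] by blast
  then show ?thesis
    using assms by (intro integrable_mult_test_weight[where C=C]) (auto intro: test_functions_borel)
qed

lemma integrable_test_function: "\<phi> \<in> test_functions M ==> integrable (space_measure M) \<phi>"
  using integrable_bounded_test[of \<phi> M "\<lambda>_. 1" 1] by simp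

lemma finite_short_lists: "finite {is :: 'd::finite list. length is \<le> N}"
  using finite_lists_length_le[of "UNIV :: 'd set" N] by simp

text \<open>Only finitely many lists of directions occur, each with a finite supremum, so the set is
  bounded above and the real supremum is a genuine one.\<close>

lemma test_seminorm_upper:
  fixes \<phi> :: "'d::finite cfun"
  assumes "\<phi> \<in> test_functions M" "length js \<le> N"
  shows "(case M of Euclidean => (1 + norm x) ^ N | Torus => 1) * norm (pderivs js \<phi> x) \<le> test_seminorm M N \<phi>"
proof -
  let ?g = "\<lambda>is x. (case M of Euclidean => (1 + norm x) ^ N | Torus => 1) * norm (pderivs is \<phi> x)"
  have "\<exists>C. \<forall>x. ?g is x \<le> C" for "is"
  proof (cases M)
    case Euclidean
    then show ?thesis using assms(1) by (simp add: test_functions_def)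
  next
    case Torus
    then show ?thesis using test_functions_bound[OF assms(1), of "is"] by (simp add: test_weight_def)
  qed
  then obtain C where C: "?g is x \<le> C is" for "is" x by metis
  have "bdd_above ((\<lambda>(is, x). ?g is x) ` ({is. length is \<le> N} \<times> UNIV))"
  proof (rule bdd_aboveI2)
    fix p :: "'d list \<times> (real ^ 'd)" assume p: "p \<in> {is. length is \<le> N} \<times> UNIV"
    obtain "is" y where q: "p = (is, y)" by (cases p)
    have "?g is y \<le> C is" by (rule C)
    also have "... \<le> Max (C ` {is. length is \<le> N})"
      using p q by (intro Max_ge) (auto simp: finite_short_lists)
    finally show "(case p of (is, x) => ?g is x) \<le> Max (C ` {is. length is \<le> N})" by (simp add: q)
  qed
  then have "(\<lambda>(is, x). ?g is x) (js, x) \<le> test_seminorm M N \<phi>"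
    unfolding test_seminorm_def
    by (intro cSUP_upper[where f="\<lambda>(is, x). ?g is x" and x="(js, x)"]) (use assms(2) in auto)
  then show ?thesis by simp
qed

text \<open>The order \<open>2 * CARD('d)\<close> comes from comparing \<open>wt CARD('d) x\<close>
  with \<open>(1 + norm x) ^ (2 * CARD('d))\<close>.\<close>

lemma test_seminorm_dominates:
  "\<exists>N. \<forall>\<phi> \<in> test_functions M. \<forall>x :: real ^ 'd::finite. norm (\<phi> x) \<le> test_seminorm M N \<phi> * test_weight M x"
proof (intro exI[of _ "2 * CARD('d)"] ballI allI)
  fix \<phi> :: "'d cfun" and x assume \<phi>: "\<phi> \<in> test_functions M"
  show "norm (\<phi> x) \<le> test_seminorm M (2 * CARD('d)) \<phi> * test_weight M x"
  proof (cases M)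
    case Euclidean
    have "1 + (norm x)^2 \<le> (1 + norm x)^2" by (simp add: power2_sum)
    then have "wt CARD('d) x \<le> (1 + norm x) ^ (2 * CARD('d))"
      unfolding wt_def power_mult by (intro power_mono) auto
    then have "wt CARD('d) x * norm (\<phi> x) \<le> (1 + norm x) ^ (2 * CARD('d)) * norm (\<phi> x)"
      by (rule mult_right_mono) simp
    also have "... \<le> test_seminorm M (2 * CARD('d)) \<phi>"
      using test_seminorm_upper[OF \<phi>, of "[]" "2 * CARD('d)" x] by (simp add: Euclidean)
    finally show ?thesis by (simp add: test_weight_def Euclidean field_simps)
  next
    case Torus
    then show ?thesis using test_seminorm_upper[OF \<phi>, of "[]" "2 * CARD('d)" x] by (simp add: test_weight_def)
  qed
qed

subsection \<open>Translation invariance and differentiation\<close>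

text \<open>A fundamental domain: its translates by periods tile the space exactly, which turns the
  cut-and-shift argument into an identity of indicator functions.\<close>

definition half_open_cube :: "(real ^ 'd::finite) set" where
  "half_open_cube = {x. \<forall>i. 0 \<le> x $ i \<and> x $ i < 2 * pi}"

lemma half_open_cube_borel [measurable]: "half_open_cube \<in> sets borel"
  unfolding half_open_cube_def by measurable

lemma AE_half_open_cube:
  "AE x in lborel. x \<in> cbox 0 (\<chi> i. 2 * pi) \<longleftrightarrow> x \<in> (half_open_cube :: (real ^ 'd::finite) set)"
proof -
  let ?C = "cbox 0 (\<chi> i. 2 * pi) :: (real ^ 'd) set" and ?B = "box 0 (\<chi> i. 2 * pi) :: (real ^ 'd) set"
  have sub: "?B \<subseteq> half_open_cube" "half_open_cube \<subseteq> ?C"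
    by (auto simp: half_open_cube_def mem_box_cart less_imp_le)
  have "emeasure lborel (?C - ?B) = emeasure lborel ?C - emeasure lborel ?B"
    by (intro emeasure_Diff) (auto simp: emeasure_lborel_box_eq box_subset_cbox)
  also have "... = 0"
    by (simp add: emeasure_lborel_box_eq emeasure_lborel_cbox_eq)
  finally have "?C - ?B \<in> null_sets lborel" by (simp add: null_sets_def)
  then show ?thesis
    by (rule AE_I') (use sub in auto)
qed

lemma integral_Torus:
  fixes f :: "'d::finite cfun"
  assumes "f \<in> borel_measurable borel"
  shows "(LINT x|space_measure Torus. f x) = (LINT x|lborel. indicator half_open_cube x *\<^sub>R f x)"
proof -
  have "(LINT x|space_measure Torus. f x) = (LINT x|lborel. indicator (cbox 0 (\<chi> i. 2 * pi)) x *\<^sub>R f x)"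
    by (simp add: space_measure_def integral_restrict_space)
  also have "... = (LINT x|lborel. indicator half_open_cube x *\<^sub>R f x)"
  proof (rule integral_cong_AE)
    show "AE x in lborel. indicator (cbox 0 (\<chi> i. 2 * pi)) x *\<^sub>R f x = indicator half_open_cube x *\<^sub>R f x"
      using AE_half_open_cube by eventually_elim (simp add: indicator_def)
  qed (use assms in simp_all)
  finally show ?thesis .
qed

lemma integral_lborel_translate:
  fixes f :: "'d::finite cfun"
  assumes "f \<in> borel_measurable borel"
  shows "(LINT x|lborel. f (x + a)) = (LINT x|lborel. f x)"
  using integral_dm_translate[of a Euclidean f] assms by (simp add: dm_Euclidean dgrp_def)

text \<open>The shifted cube is cut at \<open>y $ i = 2 * pi\<close>, and periodicity carries the
  part beyond the cut back by one period. For \<open>h\<close> in \<open>[0, 2 * pi]\<close> a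
  single period is enough.\<close>

lemma integral_space_measure_translate:
  fixes f :: "'d::finite cfun"
  assumes f: "continuous_on UNIV f" and per: "M = Torus ==> periodic f" and h: "0 \<le> h" "h \<le> 2 * pi"
  shows "(LINT x|space_measure M. f (x + axis i h)) = (LINT x|space_measure M. f x)"
proof (cases M)
  case Euclidean
  then show ?thesis
    using integral_lborel_translate[of f "axis i h"] borel_measurable_continuous_onI[OF f] by (simp add: space_measure_def)
next
  case Torus
  have fb [measurable]: "f \<in> borel_measurable borel" by (rule borel_measurable_continuous_onI[OF f])
  have p: "f (x + axis i (2 * pi)) = f x" for x using per Torus by (simp add: periodic_def)
  obtain C where C: "norm (f x) \<le> C" for x using periodic_bounded[OF per[OF Torus] f] by blast
  let ?Q = "half_open_cube :: (real ^ 'd) set"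
  define A where "A = {y \<in> ?Q. h \<le> y $ i}"
  define D where "D = {y \<in> ?Q. y $ i < h}"
  \<comment> \<open>\<open>B\<close> is the overhang of the shifted cube, and one period carries it
    onto \<open>D\<close>, the strip vacated by the shift.\<close>
  define B where "B = {y. y - axis i (2 * pi) \<in> D}"
  have meas [measurable]: "A \<in> sets borel" "D \<in> sets borel" "B \<in> sets borel"
    unfolding A_def B_def D_def half_open_cube_def by measurable
  have Q: "indicator ?Q y = (indicator A y + indicator D y :: real)" for y
    by (auto simp: A_def D_def indicator_def)
  have mem: "y - axis i c \<in> ?Q \<longleftrightarrow> (\<forall>j. j \<noteq> i \<longrightarrow> 0 \<le> y $ j \<and> y $ j < 2 * pi) \<and> c \<le> y $ i \<and> y $ i < 2 * pi + c" for y c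
  proof -
    have "y - axis i c \<in> ?Q \<longleftrightarrow> (\<forall>j. 0 \<le> y $ j - axis i c $ j \<and> y $ j - axis i c $ j < 2 * pi)"
      by (simp add: half_open_cube_def)
    also have "... \<longleftrightarrow> (\<forall>j. if j = i then c \<le> y $ j \<and> y $ j < 2 * pi + c else 0 \<le> y $ j \<and> y $ j < 2 * pi)"
      by (intro iff_allI) (simp add: axis_def algebra_simps)
    also have "... \<longleftrightarrow> (\<forall>j. j \<noteq> i \<longrightarrow> 0 \<le> y $ j \<and> y $ j < 2 * pi) \<and> c \<le> y $ i \<and> y $ i < 2 * pi + c"
      by (auto split: if_splits)
    finally show ?thesis .
  qed
  have Qh: "indicator ?Q (y - axis i h) = (indicator A y + indicator B y :: real)" for y
  proof -
    define P where "P \<longleftrightarrow> (\<forall>j. j \<noteq> i \<longrightarrow> 0 \<le> y $ j \<and> y $ j < 2 * pi)"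
    note mem = mem[of y, folded P_def]
    have Q': "y - axis i h \<in> ?Q \<longleftrightarrow> P \<and> h \<le> y $ i \<and> y $ i < 2 * pi + h" by (rule mem)
    have A': "y \<in> A \<longleftrightarrow> P \<and> h \<le> y $ i \<and> y $ i < 2 * pi"
    proof -
      have "y \<in> A \<longleftrightarrow> y - axis i 0 \<in> ?Q \<and> h \<le> y $ i" by (simp add: A_def axis_0)
      then show ?thesis unfolding mem using h by auto
    qed
    have B': "y \<in> B \<longleftrightarrow> P \<and> 2 * pi \<le> y $ i \<and> y $ i < 2 * pi + h"
    proof -
      have "y \<in> B \<longleftrightarrow> y - axis i (2 * pi) \<in> ?Q \<and> y $ i - 2 * pi < h" by (simp add: B_def D_def)
      then show ?thesis unfolding mem using h by auto
    qed
    show ?thesis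
    proof (cases "y $ i < 2 * pi")
      case True
      then have "y \<notin> B" "y - axis i h \<in> ?Q \<longleftrightarrow> y \<in> A" unfolding Q' A' B' using h by auto
      then show ?thesis by (simp add: indicator_def)
    next
      case False
      then have "y \<notin> A" "y - axis i h \<in> ?Q \<longleftrightarrow> y \<in> B" unfolding Q' A' B' using h by auto
      then show ?thesis by (simp add: indicator_def)
    qed
  qed
  have int: "integrable lborel (\<lambda>x. indicator S x *\<^sub>R f x)" if S: "S \<in> sets borel" "S \<subseteq> cbox a b" for S a b
  proof (rule integrableI_bounded_set_indicator[where B=C])
    have "emeasure lborel S \<le> emeasure lborel (cbox a b)" using S by (intro emeasure_mono) auto
    then show "emeasure lborel S < \<infinity>" using emeasure_lborel_cbox_finite le_less_trans by blast
  qed (use S C in auto)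
  have "?Q \<subseteq> cbox 0 (\<chi> j. 2 * pi)"
    by (auto simp: half_open_cube_def mem_box_cart less_imp_le)
  then have sub: "A \<subseteq> cbox 0 (\<chi> j. 2 * pi)" "D \<subseteq> cbox 0 (\<chi> j. 2 * pi)"
    unfolding A_def D_def by auto
  have sub3: "B \<subseteq> cbox 0 (\<chi> j. 4 * pi)"
  proof
    fix y assume "y \<in> B"
    then have *: "0 \<le> (y - axis i (2 * pi)) $ j" "(y - axis i (2 * pi)) $ j < 2 * pi" for j
      by (auto simp: B_def D_def half_open_cube_def simp del: vector_minus_component)
    have "0 \<le> y $ j \<and> y $ j \<le> 4 * pi" for j
      using *[of j] pi_gt_zero by (cases "j = i") (auto simp: axis_def)
    then show "y \<in> cbox 0 (\<chi> j. 4 * pi)" by (simp add: mem_box_cart)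
  qed
  have "(LINT x|space_measure M. f (x + axis i h)) = (LINT x|lborel. indicator ?Q x *\<^sub>R f (x + axis i h))"
    unfolding Torus by (intro integral_Torus) simp
  also have "... = (LINT y|lborel. indicator ?Q (y - axis i h) *\<^sub>R f y)"
    using integral_lborel_translate[of "\<lambda>y. indicator ?Q (y - axis i h) *\<^sub>R f y" "axis i h"] by simp
  also have "... = (LINT y|lborel. indicator A y *\<^sub>R f y + indicator B y *\<^sub>R f y)"
    unfolding Qh scaleR_left_distrib ..
  also have "... = (LINT y|lborel. indicator A y *\<^sub>R f y) + (LINT y|lborel. indicator B y *\<^sub>R f y)"
    by (intro Bochner_Integration.integral_add int[OF meas(1) sub(1)] int[OF meas(3) sub3])
  also have "(LINT y|lborel. indicator B y *\<^sub>R f y) = (LINT y|lborel. indicator B (y + axis i (2 * pi)) *\<^sub>R f (y + axis i (2 * pi)))"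
    by (rule integral_lborel_translate[symmetric]) simp
  also have "... = (LINT y|lborel. indicator D y *\<^sub>R f y)"
    by (simp add: p B_def indicator_def)
  also have "(LINT y|lborel. indicator A y *\<^sub>R f y) + (LINT y|lborel. indicator D y *\<^sub>R f y)
      = (LINT y|lborel. indicator A y *\<^sub>R f y + indicator D y *\<^sub>R f y)"
    by (intro Bochner_Integration.integral_add[symmetric] int[OF meas(1) sub(1)] int[OF meas(2) sub(2)])
  also have "... = (LINT y|lborel. indicator ?Q y *\<^sub>R f y)"
    unfolding Q scaleR_left_distrib ..
  also have "... = (LINT x|space_measure M. f x)"
    unfolding Torus by (intro integral_Torus[symmetric]) simp
  finally show ?thesis .
qed

lemma has_vector_derivative_quotient:
  fixes f :: "real => complex"
  assumes "(f has_vector_derivative D) (at 0)"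
  shows "((\<lambda>h. (f h - f 0) / of_real h) \<longlongrightarrow> D) (at 0)"
proof -
  have "((\<lambda>h. norm (f (0 + h) - f 0 - h *\<^sub>R D) / norm h) \<longlongrightarrow> 0) (at 0)"
    using assms unfolding has_vector_derivative_def has_derivative_at by blast
  moreover have "norm (f (0 + h) - f 0 - h *\<^sub>R D) / norm h = norm ((f h - f 0) / of_real h - D)" if "h \<noteq> 0" for h
  proof -
    have "(f h - f 0) / of_real h - D = (f (0 + h) - f 0 - h *\<^sub>R D) / of_real h"
      using that by (simp add: field_simps scaleR_conv_of_real)
    then show ?thesis by (simp add: norm_divide)
  qed
  then have "\<forall>\<^sub>F h in at 0. norm (f (0 + h) - f 0 - h *\<^sub>R D) / norm h = norm ((f h - f 0) / of_real h - D)"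
    by (simp add: eventually_at_filter)
  ultimately have "((\<lambda>h. norm ((f h - f 0) / of_real h - D)) \<longlongrightarrow> 0) (at 0)"
    by (rule Lim_transform_eventually)
  then show ?thesis by (rule LIM_zero_cancel[OF tendsto_norm_zero_cancel])
qed

lemma smooth_directional_derivative:
  fixes f :: "'d::finite cfun"
  assumes "smooth f"
  shows "((\<lambda>t. f (x + axis i t)) has_vector_derivative pderivs [i] f (x + axis i t)) (at t within S)"
proof -
  let ?D = "frechet_derivative f (at (x + axis i t))"
  have ax: "axis i t = t *\<^sub>R axis i (1::real)" for t by (simp add: vec_eq_iff axis_def)
  have D: "(f has_derivative ?D) (at (x + axis i t))"
    using smooth_differentiable[OF assms] by (simp add: frechet_derivative_works)
  have "linear (axis i :: real => real ^ 'd)"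
    by (rule linearI) (simp_all add: vec_eq_iff axis_def)
  then have "bounded_linear (axis i :: real => real ^ 'd)" by (simp add: linear_conv_bounded_linear)
  from bounded_linear_imp_has_derivative[OF this]
  have "((\<lambda>t. x + axis i t) has_derivative axis i) (at t within S)"
    using has_derivative_add[OF has_derivative_const[of x]] by fastforce
  from has_derivative_compose[OF this D]
  have "((\<lambda>t. f (x + axis i t)) has_derivative (\<lambda>h. ?D (axis i h))) (at t within S)" .
  moreover have "(\<lambda>h. ?D (axis i h)) = (\<lambda>h. h *\<^sub>R ?D (axis i 1))"
    by (rule ext, subst ax, rule linear_cmul[OF has_derivative_linear[OF D]])
  ultimately show ?thesis unfolding has_vector_derivative_def pderivs.simps by (rule back_subst)
qed

section \<open>Fourier transforms of test functions: derivatives and decay\<close>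

lemma inner_axis_eq: "axis i h \<bullet> z = h * z $ i" for z :: "real ^ 'd::finite"
  by (simp add: inner_axis' )

text \<open>The difference quotient of \<phi> is integrated against the character. Translation
  invariance converts this into the difference quotient of \<open>cis (h * z $ i)\<close> times the
  transform of \<phi>, and both sides converge. On the torus invariance needs a periodic integrand,
  hence a lattice frequency.\<close>

lemma fourier_fun_pderiv:
  fixes \<phi> :: "'d::finite cfun"
  assumes \<phi>: "\<phi> \<in> test_functions M" and z: "z \<in> dgrp M"
  shows "fourier_fun M (pderivs [i] \<phi>) z = \<i> * of_real (z $ i) * fourier_fun M \<phi> z"
proof -
  have sm: "smooth \<phi>" by (rule test_functions_smooth[OF \<phi>])
  note cont = smooth_continuous[OF sm]
  obtain C where C: "norm (pderivs [i] \<phi> x) \<le> C * test_weight M x" for x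
    using test_functions_bound[OF \<phi>, of "[i]"] by blast
  have C0: "0 \<le> C"
    using order_trans[OF norm_ge_zero C[of 0]] test_weight_pos[of M "0 :: real ^ 'd"] by (simp add: zero_le_mult_iff)
  let ?I = "LINT x|space_measure M. \<phi> x * character z x"
  let ?h = "\<lambda>n. 1 / real (Suc n)"
  let ?q = "\<lambda>n x. (\<phi> (x + axis i (?h n)) - \<phi> x) / of_real (?h n) * character z x"
  have ccis: "continuous_on UNIV (\<lambda>x :: real ^ 'd. character z x)" by (intro continuous_intros)
  have cshift: "continuous_on UNIV (\<lambda>x. \<phi> (x + axis i h))" for h
    by (intro continuous_on_compose2[OF cont[of UNIV]] continuous_intros) auto
  have F_per: "periodic (\<lambda>x. \<phi> x * character z x)" if "M = Torus"
    unfolding periodic_def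
  proof (intro allI)
    fix x j
    have "z $ j \<in> \<int>" using z that by (simp add: dgrp_def lattice_def)
    then have "cis (- (2 * pi * z $ j)) = 1"
      using cis_multiple_2pi[of "- z $ j"] by simp
    moreover have "- ((x + axis j (2 * pi)) \<bullet> z) = - (x \<bullet> z) + - (2 * pi * z $ j)"
      by (simp add: inner_left_distrib inner_axis_eq)
    ultimately have "cis (- ((x + axis j (2 * pi)) \<bullet> z)) = character z x"
      by (simp only: cis_mult[symmetric]) simp
    moreover have "\<phi> (x + axis j (2 * pi)) = \<phi> x"
      using \<phi> that by (simp add: test_functions_def periodic_def)
    ultimately show "\<phi> (x + axis j (2 * pi)) * cis (- ((x + axis j (2 * pi)) \<bullet> z)) = \<phi> x * character z x" by simp
  qed
  have h: "0 < ?h n" "?h n \<le> 1" for n by auto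
  have shift_eq: "(LINT x|space_measure M. \<phi> (x + axis i (?h n)) * character z x) = cis (?h n * z $ i) * ?I" for n
  proof -
    have "(LINT x|space_measure M. \<phi> (x + axis i (?h n)) * character z x)
        = (LINT x|space_measure M. cis (?h n * z $ i) * (\<phi> (x + axis i (?h n)) * cis (- ((x + axis i (?h n)) \<bullet> z))))"
    proof (rule Bochner_Integration.integral_cong)
      fix x :: "real ^ 'd"
      have "cis (?h n * z $ i) * cis (- ((x + axis i (?h n)) \<bullet> z)) = character z x"
        unfolding cis_mult by (simp add: inner_left_distrib inner_axis_eq)
      then show "\<phi> (x + axis i (?h n)) * character z x = cis (?h n * z $ i) * (\<phi> (x + axis i (?h n)) * cis (- ((x + axis i (?h n)) \<bullet> z)))"
        by (metis mult.left_commute)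
    qed simp
    also have "... = cis (?h n * z $ i) * (LINT x|space_measure M. \<phi> (x + axis i (?h n)) * cis (- ((x + axis i (?h n)) \<bullet> z)))"
      by (rule integral_cmult)
    also have "(LINT x|space_measure M. \<phi> (x + axis i (?h n)) * cis (- ((x + axis i (?h n)) \<bullet> z))) = ?I"
      using order_trans[OF h(2)[of n], of "2 * pi"] pi_ge_two
      by (intro integral_space_measure_translate[where f="\<lambda>x. \<phi> x * character z x"] continuous_on_mult cont ccis F_per) simp_all
    finally show ?thesis .
  qed
  have cis_b: "norm (character z x) \<le> 1" for x :: "real ^ 'd" by simp
  have int0: "integrable (space_measure M) (\<lambda>x. \<phi> x * character z x)"
    using integrable_bounded_test[OF \<phi> borel_measurable_continuous_onI[OF ccis] cis_b] by (simp add: mult.commute)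
  \<comment> \<open>Shifts of length at most 1 change the weight by a bounded factor, which gives
    one majorant for all the difference quotients.\<close>
  have wt_shift: "test_weight M (x + axis i \<theta>) \<le> 4 ^ CARD('d) * test_weight M x" if "0 \<le> \<theta>" "\<theta> \<le> 1" for x :: "real ^ 'd" and \<theta>
  proof (cases M)
    case Euclidean
    have "wt CARD('d) x \<le> 2 ^ CARD('d) * (wt CARD('d) (x + axis i \<theta>) * wt CARD('d) (- axis i \<theta>))"
      using wt_add_mult_le[of "CARD('d)" "x + axis i \<theta>" "- axis i \<theta>"] by simp
    also have "wt CARD('d) (- axis i \<theta> :: real ^ 'd) \<le> 2 ^ CARD('d)"
      unfolding wt_def using that by (intro power_mono) (auto simp: norm_axis_real power_le_one)
    finally have "wt CARD('d) x \<le> (2 ^ CARD('d) * 2 ^ CARD('d)) * wt CARD('d) (x + axis i \<theta>)"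
      by (simp add: mult_ac mult_left_mono)
    moreover have "(2::real) ^ CARD('d) * 2 ^ CARD('d) = 4 ^ CARD('d)"
      by (simp add: power_mult_distrib[symmetric])
    ultimately show ?thesis by (simp add: test_weight_def Euclidean field_simps)
  next
    case Torus
    then show ?thesis by (simp add: test_weight_def)
  qed
  \<comment> \<open>The increment is the integral of the partial derivative along the segment, so
    the quotient inherits the majorant of the derivative.\<close>
  have quot_bound: "norm (\<phi> (x + axis i (?h n)) - \<phi> x) \<le> 4 ^ CARD('d) * C * test_weight M x * ?h n" for n x
  proof -
    have "((\<lambda>t. pderivs [i] \<phi> (x + axis i t)) has_integral (\<phi> (x + axis i (?h n)) - \<phi> (x + axis i 0))) (cbox 0 (?h n))"
      unfolding box_real
      by (intro fundamental_theorem_of_calculus smooth_directional_derivative sm) (use h[of n] in auto)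
    then have "norm (\<phi> (x + axis i (?h n)) - \<phi> (x + axis i 0)) \<le> (4 ^ CARD('d) * C * test_weight M x) * measure lborel (cbox 0 (?h n))"
    proof (rule has_integral_bound[rotated])
      show "0 \<le> 4 ^ CARD('d) * C * test_weight M x" using C0 test_weight_pos[of M x] by (intro mult_nonneg_nonneg) auto
      fix t assume "t \<in> cbox 0 (?h n)"
      then have t: "0 \<le> t" "t \<le> 1"
        using order_trans[OF _ h(2)[of n], of t] by (auto simp del: of_nat_Suc)
      have "norm (pderivs [i] \<phi> (x + axis i t)) \<le> C * test_weight M (x + axis i t)" by (rule C)
      also have "... \<le> C * (4 ^ CARD('d) * test_weight M x)" by (intro mult_left_mono wt_shift t C0)
      finally show "norm (pderivs [i] \<phi> (x + axis i t)) \<le> 4 ^ CARD('d) * C * test_weight M x" by (simp add: mult_ac)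
    qed
    then show ?thesis using h[of n] by (simp add: axis_0 del: of_nat_Suc)
  qed
  have "(\<lambda>n. LINT x|space_measure M. ?q n x) \<longlonglongrightarrow> (LINT x|space_measure M. pderivs [i] \<phi> x * character z x)"
  proof (rule integral_dominated_convergence)
    show "integrable (space_measure M) (\<lambda>x :: real ^ 'd. 4 ^ CARD('d) * C * test_weight M x)"
      by (intro integrable_mult_right integrable_test_weight)
    show "(\<lambda>x. pderivs [i] \<phi> x * character z x) \<in> borel_measurable (space_measure M)"
      by (intro continuous_measurable_space_measure continuous_on_mult ccis smooth_continuous smooth_pderivs sm)
    show "?q n \<in> borel_measurable (space_measure M)" for n
      by (intro continuous_measurable_space_measure continuous_intros cont cshift) (auto simp del: of_nat_Suc)
    show "AE x in space_measure M. norm (?q n x) \<le> 4 ^ CARD('d) * C * test_weight M x" for n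
    proof (rule AE_I2)
      fix x
      have "norm (?q n x) = norm (\<phi> (x + axis i (?h n)) - \<phi> x) / ?h n"
        by (simp only: norm_mult norm_divide norm_cis norm_of_real) (simp del: of_nat_Suc)
      also have "... \<le> 4 ^ CARD('d) * C * test_weight M x"
        by (rule pos_divide_le_eq[OF h(1), THEN iffD2, OF quot_bound])
      finally show "norm (?q n x) \<le> 4 ^ CARD('d) * C * test_weight M x" .
    qed
    show "AE x in space_measure M. (\<lambda>n. ?q n x) \<longlonglongrightarrow> pderivs [i] \<phi> x * character z x"
    proof (intro AE_I2 tendsto_mult tendsto_const)
      fix x
      have ax0: "axis i (0::real) = 0" by (simp add: vec_eq_iff axis_def)
      have "((\<lambda>h. (\<phi> (x + axis i h) - \<phi> (x + axis i 0)) / of_real h) \<longlongrightarrow> pderivs [i] \<phi> (x + axis i 0)) (at 0)"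
        by (rule has_vector_derivative_quotient[OF smooth_directional_derivative[OF sm]])
      moreover have "filterlim ?h (at 0) sequentially"
        unfolding filterlim_at using LIMSEQ_Suc[OF lim_1_over_n] by (auto simp del: of_nat_Suc)
      ultimately show "(\<lambda>n. (\<phi> (x + axis i (?h n)) - \<phi> x) / of_real (?h n)) \<longlonglongrightarrow> pderivs [i] \<phi> x"
        unfolding ax0 add_0_right by (rule filterlim_compose)
    qed
  qed
  moreover have "(LINT x|space_measure M. ?q n x) = (cis (?h n * z $ i) - cis (0 * z $ i)) / of_real (?h n) * ?I" for n
  proof -
    have i1: "integrable (space_measure M) (\<lambda>x. \<phi> (x + axis i (?h n)) * character z x)"
    proof -
      have "norm (\<phi> (x + axis i (?h n))) \<le> (D * 4 ^ CARD('d)) * test_weight M x" if D: "\<And>x. norm (\<phi> x) \<le> D * test_weight M x" for x D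
      proof -
        have D0: "0 \<le> D"
          using order_trans[OF norm_ge_zero D[of 0]] test_weight_pos[of M "0 :: real ^ 'd"] by (simp add: zero_le_mult_iff)
        have "norm (\<phi> (x + axis i (?h n))) \<le> D * test_weight M (x + axis i (?h n))" by (rule D)
        also have "... \<le> D * (4 ^ CARD('d) * test_weight M x)" using h[of n] by (intro mult_left_mono wt_shift D0) linarith+
        finally show ?thesis by (simp add: mult_ac)
      qed
      moreover obtain D where "norm (pderivs [] \<phi> x) \<le> D * test_weight M x" for x
        using test_functions_bound[OF \<phi>, of "[]"] by blast
      ultimately have "norm (\<phi> (x + axis i (?h n))) \<le> (D * 4 ^ CARD('d)) * test_weight M x" for x by simp
      from integrable_mult_test_weight[OF this cis_b borel_measurable_continuous_onI[OF ccis] borel_measurable_continuous_onI[OF cshift]]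
      show ?thesis by (simp add: mult.commute)
    qed
    have "(LINT x|space_measure M. ?q n x) = (LINT x|space_measure M. (\<phi> (x + axis i (?h n)) * character z x - \<phi> x * character z x) / of_real (?h n))"
      by (simp only: left_diff_distrib diff_divide_distrib times_divide_eq_left)
    also have "... = (cis (?h n * z $ i) * ?I - ?I) / of_real (?h n)"
      by (simp only: integral_divide_zero Bochner_Integration.integral_diff[OF i1 int0] shift_eq)
    finally show ?thesis by (simp add: left_diff_distrib)
  qed
  moreover have "(\<lambda>n. (cis (?h n * z $ i) - cis (0 * z $ i)) / of_real (?h n) * ?I) \<longlonglongrightarrow> (\<i> * of_real (z $ i)) * ?I"
  proof (intro tendsto_mult tendsto_const)
    have "((\<lambda>t. cis (t * z $ i)) has_vector_derivative \<i> * of_real (z $ i)) (at 0)"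
      unfolding cis_conv_exp
      by (rule has_vector_derivative_eq_rhs, rule field_vector_diff_chain_at[of "\<lambda>t. \<i> * complex_of_real (t * z $ i)" "\<i> * of_real (z $ i)" 0 exp "exp (\<i> * complex_of_real (0 * z $ i))", unfolded o_def])
         (auto intro!: derivative_eq_intros simp: has_vector_derivative_def scaleR_conv_of_real)
    from has_vector_derivative_quotient[OF this]
    have "((\<lambda>h. (cis (h * z $ i) - cis (0 * z $ i)) / of_real h) \<longlongrightarrow> \<i> * of_real (z $ i)) (at 0)" .
    moreover have "filterlim ?h (at 0) sequentially"
      unfolding filterlim_at using LIMSEQ_Suc[OF lim_1_over_n] by (auto simp del: of_nat_Suc)
    ultimately show "(\<lambda>n. (cis (?h n * z $ i) - cis (0 * z $ i)) / of_real (?h n)) \<longlonglongrightarrow> \<i> * of_real (z $ i)"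
      by (rule filterlim_compose)
  qed
  ultimately have "(LINT x|space_measure M. pderivs [i] \<phi> x * character z x) = (\<i> * of_real (z $ i)) * ?I"
    using LIMSEQ_unique by simp
  then show ?thesis unfolding fourier_fun_def by (simp add: mult_ac)
qed

lemma fourier_fun_pderivs:
  fixes \<phi> :: "'d::finite cfun"
  assumes "\<phi> \<in> test_functions M" "z \<in> dgrp M"
  shows "fourier_fun M (pderivs (replicate n i) \<phi>) z = (\<i> * of_real (z $ i)) ^ n * fourier_fun M \<phi> z"
proof (induction n)
  case (Suc n)
  have "fourier_fun M (pderivs (replicate (Suc n) i) \<phi>) z = fourier_fun M (pderivs [i] (pderivs (replicate n i) \<phi>)) z"
    by simp
  also have "... = \<i> * of_real (z $ i) * fourier_fun M (pderivs (replicate n i) \<phi>) z"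
    by (rule fourier_fun_pderiv[OF pderivs_test_functions[OF assms(1)] assms(2)])
  finally show ?case using Suc by simp
qed simp

lemma norm_fourier_fun_le:
  fixes \<phi> :: "'d::finite cfun"
  shows "norm (fourier_fun M \<phi> z) \<le> norm (fourier_const TYPE('d)) * (LINT x|space_measure M. norm (\<phi> x))"
proof -
  have "norm (LINT x|space_measure M. \<phi> x * character z x) \<le> (LINT x|space_measure M. norm (\<phi> x * character z x))"
    by (rule integral_norm_bound)
  then show ?thesis unfolding fourier_fun_def by (simp add: norm_mult mult_left_mono)
qed

text \<open>The number \<open>m\<close>, the largest squared coordinate or 1, controls the norm up
  to the dimension, and its power \<open>m ^ n\<close> is one of the terms on the right.\<close>

lemma wt_le_sum_coordinates:
  "wt n (z :: real ^ 'd::finite) \<le> (1 + real CARD('d)) ^ n * (1 + (\<Sum>i\<in>UNIV. \<bar>z $ i\<bar> ^ (2 * n)))"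
proof -
  define m where "m = Max (insert 1 (range (\<lambda>i. (z $ i)^2)))"
  have m1: "1 \<le> m" unfolding m_def by (rule Max_ge) auto
  have mi: "(z $ i)^2 \<le> m" for i unfolding m_def by (rule Max_ge) auto
  have "(norm z)^2 = (\<Sum>i\<in>UNIV. (z $ i)^2)" by (simp add: norm_vec_def L2_set_def sum_nonneg)
  also have "... \<le> (\<Sum>i\<in>(UNIV :: 'd set). m)" by (intro sum_mono mi)
  finally have "1 + (norm z)^2 \<le> (1 + real CARD('d)) * m" using m1 by (simp add: algebra_simps)
  then have "wt n z \<le> ((1 + real CARD('d)) * m) ^ n" unfolding wt_def by (intro power_mono) auto
  moreover have "m ^ n \<le> 1 + (\<Sum>i\<in>UNIV. \<bar>z $ i\<bar> ^ (2 * n))"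
  proof -
    have "m \<in> insert 1 (range (\<lambda>i. (z $ i)^2))" unfolding m_def by (intro Max_in) auto
    then show ?thesis
    proof
      assume "m = 1" then show ?thesis by (simp add: sum_nonneg)
    next
      assume "m \<in> range (\<lambda>i. (z $ i)^2)"
      then obtain i where "m = (z $ i)^2" by auto
      then have "m ^ n = \<bar>z $ i\<bar> ^ (2 * n)" by (simp add: power_mult)
      also have "... \<le> (\<Sum>i\<in>UNIV. \<bar>z $ i\<bar> ^ (2 * n))" by (intro member_le_sum) auto
      finally show ?thesis by simp
    qed
  qed
  ultimately show ?thesis
    unfolding power_mult_distrib
    by (elim order_trans) (rule mult_left_mono, auto)
qed

text \<open>The weight is controlled by pure powers of the coordinates, so derivatives of order
  \<open>2 * n\<close> in a single direction suffice. The bound is confined to the dual group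
  because the derivative formula holds there only.\<close>

lemma fourier_fun_decay:
  fixes \<phi> :: "'d::finite cfun"
  assumes \<phi>: "\<phi> \<in> test_functions M"
  shows "\<exists>K\<ge>0. \<forall>z\<in>dgrp M. norm (fourier_fun M \<phi> z) \<le> K / wt n z"
proof -
  define c where "c = norm (fourier_const TYPE('d))"
  define B where "B i = c * (LINT x|space_measure M. norm (pderivs (replicate (2 * n) i) \<phi> x))" for i
  define B0 where "B0 = c * (LINT x|space_measure M. norm (\<phi> x))"
  let ?K = "(1 + real CARD('d)) ^ n * (B0 + (\<Sum>i\<in>UNIV. B i))"
  have "norm (fourier_fun M \<phi> z) \<le> ?K / wt n z" if z: "z \<in> dgrp M" for z
  proof -
    let ?a = "norm (fourier_fun M \<phi> z)"
    have 1: "?a \<le> B0" unfolding B0_def c_def by (rule norm_fourier_fun_le)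
    have 2: "\<bar>z $ i\<bar> ^ (2 * n) * ?a \<le> B i" for i
      using norm_fourier_fun_le[of M "pderivs (replicate (2 * n) i) \<phi>" z]
      unfolding B_def c_def fourier_fun_pderivs[OF \<phi> z] by (simp add: norm_mult norm_power)
    have "wt n z * ?a \<le> ((1 + real CARD('d)) ^ n * (1 + (\<Sum>i\<in>UNIV. \<bar>z $ i\<bar> ^ (2 * n)))) * ?a"
      by (intro mult_right_mono wt_le_sum_coordinates) simp
    also have "... = (1 + real CARD('d)) ^ n * (?a + (\<Sum>i\<in>UNIV. \<bar>z $ i\<bar> ^ (2 * n) * ?a))"
      by (simp add: distrib_right mult.assoc sum_distrib_right)
    also have "... \<le> ?K" by (intro mult_left_mono add_mono 1 sum_mono 2) auto
    finally show ?thesis by (simp add: field_simps)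
  qed
  moreover have "0 \<le> ?K"
    unfolding B_def B0_def c_def by (intro mult_nonneg_nonneg add_nonneg_nonneg sum_nonneg) auto
  ultimately show ?thesis by blast
qed

lemma continuous_fourier_fun:
  fixes \<phi> :: "'d::finite cfun"
  assumes \<phi>: "\<phi> \<in> test_functions M"
  shows "continuous_on UNIV (fourier_fun M \<phi>)"
proof (rule continuous_on_sequentiallyI)
  fix u :: "nat => real ^ 'd" and a assume u: "u \<longlonglongrightarrow> a"
  have "(\<lambda>n. LINT x|space_measure M. \<phi> x * cis (- (x \<bullet> u n))) \<longlonglongrightarrow> (LINT x|space_measure M. \<phi> x * character a x)"
  proof (rule integral_dominated_convergence)
    show "integrable (space_measure M) (\<lambda>x. norm (\<phi> x))"
      by (intro integrable_norm integrable_test_function \<phi>)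
    have "(\<lambda>x. \<phi> x * character b x) \<in> borel_measurable (space_measure M)" for b
      by (intro continuous_measurable_space_measure continuous_intros smooth_continuous test_functions_smooth[OF \<phi>])
    then show "(\<lambda>x. \<phi> x * character a x) \<in> borel_measurable (space_measure M)"
      "(\<lambda>x. \<phi> x * cis (- (x \<bullet> u n))) \<in> borel_measurable (space_measure M)" for n by blast+
    show "AE x in space_measure M. (\<lambda>n. \<phi> x * cis (- (x \<bullet> u n))) \<longlonglongrightarrow> \<phi> x * character a x"
      unfolding cis_conv_exp by (intro AE_I2 tendsto_intros u)
  qed (simp add: norm_mult)
  then show "(\<lambda>n. fourier_fun M \<phi> (u n)) \<longlonglongrightarrow> fourier_fun M \<phi> a"
    unfolding fourier_fun_def by (intro tendsto_mult tendsto_const)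
qed

section \<open>Gaussians\<close>

text \<open>Fubini for a bounded kernel between two integrable functions: the form in which
  synthesis, inversion and uniqueness exchange their integrals.\<close>

lemma (in pair_sigma_finite) integral_kernel_swap:
  fixes f :: "'a => complex" and g :: "'b => complex" and k :: "'a => 'b => complex"
  assumes f: "integrable M1 f" and g: "integrable M2 g"
    and k [measurable]: "(\<lambda>p. k (fst p) (snd p)) \<in> borel_measurable (M1 \<Otimes>\<^sub>M M2)"
    and B: "\<And>x y. norm (k x y) \<le> B"
  shows "(LINT x|M1. f x * (LINT y|M2. g y * k x y)) = (LINT y|M2. g y * (LINT x|M1. f x * k x y))"
proof -
  have [measurable]: "f \<in> borel_measurable M1" "g \<in> borel_measurable M2"
    using f g by (auto simp: borel_measurable_integrable)
  have B0: "0 \<le> B" using norm_ge_zero order_trans B by blast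
  let ?F = "\<lambda>x y. f x * g y * k x y"
  have "integrable (M1 \<Otimes>\<^sub>M M2) (\<lambda>p. ?F (fst p) (snd p))"
  proof (rule integrableI_bounded)
    show "(\<lambda>p. ?F (fst p) (snd p)) \<in> borel_measurable (M1 \<Otimes>\<^sub>M M2)" by measurable
    have "(\<integral>\<^sup>+p. ennreal (norm (?F (fst p) (snd p))) \<partial>(M1 \<Otimes>\<^sub>M M2))
        \<le> (\<integral>\<^sup>+p. ennreal (norm (f (fst p))) * (ennreal B * ennreal (norm (g (snd p)))) \<partial>(M1 \<Otimes>\<^sub>M M2))"
    proof (rule nn_integral_mono)
      fix p
      have "norm (f (fst p)) * norm (g (snd p)) * norm (k (fst p) (snd p)) \<le> norm (f (fst p)) * norm (g (snd p)) * B"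
        by (intro mult_left_mono B) auto
      then show "ennreal (norm (?F (fst p) (snd p))) \<le> ennreal (norm (f (fst p))) * (ennreal B * ennreal (norm (g (snd p))))"
        using B0 by (simp add: norm_mult ennreal_leI mult_ac flip: ennreal_mult)
    qed
    also have "... = (\<integral>\<^sup>+x. (\<integral>\<^sup>+y. ennreal (norm (f x)) * (ennreal B * ennreal (norm (g y))) \<partial>M2) \<partial>M1)"
      by (subst M2.nn_integral_fst[symmetric]) auto
    also have "... = (\<integral>\<^sup>+x. ennreal (norm (f x)) \<partial>M1) * (ennreal B * (\<integral>\<^sup>+y. ennreal (norm (g y)) \<partial>M2))"
      by (simp add: nn_integral_cmult nn_integral_multc)
    also have "... < \<infinity>"
      using f g by (simp add: integrable_iff_bounded ennreal_mult_less_top)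
    finally show "(\<integral>\<^sup>+p. ennreal (norm (?F (fst p) (snd p))) \<partial>(M1 \<Otimes>\<^sub>M M2)) < \<infinity>" .
  qed
  then have "integrable (M1 \<Otimes>\<^sub>M M2) (case_prod ?F)" by (simp add: case_prod_unfold)
  from Fubini_integral[OF this]
  have "(LINT y|M2. LINT x|M1. g y * (f x * k x y)) = (LINT x|M1. LINT y|M2. f x * (g y * k x y))"
    by (simp add: mult_ac)
  then show ?thesis by simp
qed

lemma borel_measurable_cis [measurable]: "f \<in> borel_measurable N ==> (\<lambda>x. cis (f x)) \<in> borel_measurable N"
  unfolding cis_conv_exp by measurable

text \<open>Take \<open>Z \<le> exp Z\<close> at \<open>Z = s * (1 + y) / (2 * m)\<close> and raise
  it to the power \<open>m\<close>; the division by \<open>m\<close> is the reason for the separate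
  case \<open>m = 0\<close>.\<close>

lemma power_mult_exp_bounded:
  fixes s :: real
  assumes "0 < s"
  shows "\<exists>C. \<forall>y\<ge>0. (1 + y) ^ m * exp (- s * y / 2) \<le> C"
proof (cases "m = 0")
  case True
  then show ?thesis using assms by (intro exI[of _ 1]) (auto simp: mult_nonneg_nonneg)
next
  case False
  have "(1 + y) ^ m * exp (- s * y / 2) \<le> (2 * m / s) ^ m * exp (s / 2)" if "0 \<le> y" for y
  proof -
    let ?Z = "s * (1 + y) / (2 * m)"
    have "?Z \<le> exp ?Z" using exp_ge_add_one_self[of ?Z] by linarith
    then have "?Z ^ m \<le> exp ?Z ^ m" using that assms by (intro power_mono) auto
    also have "... = exp (s * (1 + y) / 2)" using False by (simp flip: exp_of_nat_mult)
    finally have "(2 * m / s) ^ m * ?Z ^ m \<le> (2 * m / s) ^ m * exp (s * (1 + y) / 2)"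
      using assms by (intro mult_left_mono) auto
    moreover have "(2 * m / s) ^ m * ?Z ^ m = (1 + y) ^ m"
      unfolding power_mult_distrib[symmetric] using False assms by simp
    ultimately have "(1 + y) ^ m \<le> (2 * m / s) ^ m * exp (s * (1 + y) / 2)" by simp
    then have "(1 + y) ^ m * exp (- s * y / 2) \<le> (2 * m / s) ^ m * exp (s * (1 + y) / 2) * exp (- s * y / 2)"
      by (rule mult_right_mono) simp
    also have "... = (2 * m / s) ^ m * exp (s / 2)"
      by (simp add: mult.assoc flip: exp_add) (simp add: field_simps)
    finally show ?thesis .
  qed
  then show ?thesis by blast
qed

text \<open>Functions of this family are products of a Gaussian, a polynomial and a function from a class
  that is closed under differentiation; such a family is itself closed under differentiation.\<close>

inductive_set gaussian_family ::
  "real => real ^ 'd::finite => 'd cfun set => 'd cfun set"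
  for s :: real and b :: "real ^ 'd" and H :: "'d cfun set"
where
  base: "h \<in> H ==> (\<lambda>x. of_real (exp (- s * (norm (x - b))^2 / 2)) * h x) \<in> gaussian_family s b H"
| coord: "f \<in> gaussian_family s b H ==> (\<lambda>x. of_real (x $ i) * f x) \<in> gaussian_family s b H"
| add: "f \<in> gaussian_family s b H ==> g \<in> gaussian_family s b H ==> (\<lambda>x. f x + g x) \<in> gaussian_family s b H"
| cmult: "f \<in> gaussian_family s b H ==> (\<lambda>x. c * f x) \<in> gaussian_family s b H"

lemma pderivs_eqI:
  assumes "\<And>x. (f has_derivative D x) (at x)"
  shows "pderivs [i] f = (\<lambda>x. D x (axis i 1))"
  by (rule ext) (simp add: frechet_derivative_at[OF assms, symmetric])

lemma gaussian_family_pderiv: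
  fixes H :: "'d::finite cfun set"
  assumes H: "\<And>h x. h \<in> H ==> h differentiable (at x)" "\<And>h i. h \<in> H ==> pderivs [i] h \<in> H"
    and f: "f \<in> gaussian_family s b H"
  shows "(\<forall>x. f differentiable (at x)) \<and> (\<forall>i. pderivs [i] f \<in> gaussian_family s b H)"
  using f
proof induction
  case (base h)
  let ?E = "\<lambda>x. complex_of_real (exp (- s * (norm (x - b))^2 / 2))"
  let ?D = "\<lambda>x. frechet_derivative h (at x)"
  have hD: "(h has_derivative ?D x) (at x)" for x using H(1)[OF base] by (simp add: frechet_derivative_works)
  have E: "(?E has_derivative (\<lambda>v. of_real (- s * ((x - b) \<bullet> v)) * ?E x)) (at x)" for x
    unfolding power2_norm_eq_inner
    by (rule has_derivative_eq_rhs, (rule derivative_intros)+) (auto simp: fun_eq_iff inner_commute algebra_simps diff_divide_distrib)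
  have D: "((\<lambda>x. ?E x * h x) has_derivative (\<lambda>v. ?E x * ?D x v + of_real (- s * ((x - b) \<bullet> v)) * ?E x * h x)) (at x)" for x
    by (rule has_derivative_mult[OF E hD])
  \<comment> \<open>The factor \<open>x $ i - b $ i\<close> from the exponent is split, so that
    every summand is built by the rules of the family.\<close>
  have "pderivs [i] (\<lambda>x. ?E x * h x) = (\<lambda>x. (?E x * pderivs [i] h x + of_real (- s) * (of_real (x $ i) * (?E x * h x))) + of_real (s * b $ i) * (?E x * h x))" for i
    unfolding pderivs_eqI[OF D]
    by (auto simp: fun_eq_iff inner_axis algebra_simps)
  moreover have "... i \<in> gaussian_family s b H" for i
    using base H(2)[OF base, of i] by (intro gaussian_family.intros)
  ultimately show ?case using D by (auto simp: differentiable_def)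
next
  case (coord f j)
  let ?D = "\<lambda>x. frechet_derivative f (at x)"
  have fD: "(f has_derivative ?D x) (at x)" for x using coord.IH by (simp add: frechet_derivative_works)
  have c: "((\<lambda>x :: real ^ 'd. complex_of_real (x $ j)) has_derivative (\<lambda>v. of_real (v $ j))) (at x)" for x
    by (rule has_derivative_of_real[OF bounded_linear_imp_has_derivative[OF bounded_linear_vec_nth]])
  have D: "((\<lambda>x. of_real (x $ j) * f x) has_derivative (\<lambda>v. of_real (x $ j) * ?D x v + of_real (v $ j) * f x)) (at x)" for x
    by (rule has_derivative_mult[OF c fD])
  have "pderivs [i] (\<lambda>x. of_real (x $ j) * f x) = (\<lambda>x. of_real (x $ j) * pderivs [i] f x + of_real (if i = j then 1 else 0) * f x)" for i
    unfolding pderivs_eqI[OF D] by (auto simp: fun_eq_iff axis_def)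
  moreover have "... i \<in> gaussian_family s b H" for i
    using coord by (intro gaussian_family.intros) auto
  ultimately show ?case using D by (auto simp: differentiable_def)
next
  case (add f g)
  have D: "((\<lambda>x. f x + g x) has_derivative (\<lambda>v. frechet_derivative f (at x) v + frechet_derivative g (at x) v)) (at x)" for x
    using add.IH by (intro has_derivative_add) (simp_all add: frechet_derivative_works)
  have "pderivs [i] (\<lambda>x. f x + g x) = (\<lambda>x. pderivs [i] f x + pderivs [i] g x)" for i
    unfolding pderivs_eqI[OF D] by simp
  then show ?case using D add.IH by (auto simp: differentiable_def intro!: gaussian_family.add)
next
  case (cmult f c)
  have D: "((\<lambda>x. c * f x) has_derivative (\<lambda>v. c * frechet_derivative f (at x) v)) (at x)" for x
    using cmult.IH by (intro has_derivative_mult_right) (simp add: frechet_derivative_works)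
  have "pderivs [i] (\<lambda>x. c * f x) = (\<lambda>x. c * pderivs [i] f x)" for i
    unfolding pderivs_eqI[OF D] by simp
  then show ?case using D cmult.IH by (auto simp: differentiable_def intro!: gaussian_family.cmult)
qed

lemma gaussian_family_bounded:
  fixes H :: "'d::finite cfun set"
  assumes s: "0 < s" and H: "\<And>h. h \<in> H ==> \<exists>C. \<forall>x. norm (h x) \<le> C"
    and f: "f \<in> gaussian_family s b H"
  shows "\<exists>C. \<forall>x. (1 + norm x) ^ m * norm (f x) \<le> C"
  using f
proof (induction arbitrary: m)
  case (base h)
  obtain C where C: "norm (h x) \<le> C" for x using H[OF base] by blast
  then have C0: "0 \<le> C" using norm_ge_zero order_trans by blast
  obtain D where D: "(1 + y) ^ m * exp (- s * y / 2) \<le> D" if "0 \<le> y" for y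
    using power_mult_exp_bounded[OF s, of m] by blast
  have "(1 + norm x) ^ m * norm (complex_of_real (exp (- s * (norm (x - b))^2 / 2)) * h x) \<le> (2 * (1 + norm b)) ^ m * D * C" for x
  proof -
    let ?r = "norm (x - b)"
    \<comment> \<open>This prepares \<open>1 + norm x \<le> 2 * (1 + norm b) * (1 + ?r^2)\<close>,
      by which polynomial growth about the origin is absorbed by the Gaussian centred at
      \<open>b\<close>.\<close>
    have "?r \<le> 1 + ?r^2"
    proof (cases "?r \<le> 1")
      case False
      then have "?r \<le> ?r^2" by (intro self_le_power) auto
      then show ?thesis by simp
    qed (simp add: add_increasing2)
    moreover have "norm x \<le> ?r + norm b" using norm_triangle_sub[of x b] by simp
    moreover have "0 \<le> norm b * ?r^2" "0 \<le> ?r^2" "0 \<le> norm b" by simp_all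
    moreover have "2 * (1 + norm b) * (1 + ?r^2) = 2 + 2 * norm b + 2 * ?r^2 + 2 * (norm b * ?r^2)"
      by (simp add: algebra_simps)
    ultimately have "1 + norm x \<le> 2 * (1 + norm b) * (1 + ?r^2)" by linarith
    then have "(1 + norm x) ^ m \<le> (2 * (1 + norm b) * (1 + ?r^2)) ^ m" by (intro power_mono) auto
    then have "(1 + norm x) ^ m * exp (- s * ?r^2 / 2) \<le> (2 * (1 + norm b) * (1 + ?r^2)) ^ m * exp (- s * ?r^2 / 2)"
      by (rule mult_right_mono) simp
    also have "... = (2 * (1 + norm b)) ^ m * ((1 + ?r^2) ^ m * exp (- s * ?r^2 / 2))"
      by (simp only: power_mult_distrib mult.assoc)
    also have "... \<le> (2 * (1 + norm b)) ^ m * D" by (intro mult_left_mono D) auto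
    finally have A: "(1 + norm x) ^ m * exp (- s * ?r^2 / 2) \<le> (2 * (1 + norm b)) ^ m * D" .
    have "0 \<le> D" using D[of 0] by simp
    then have "((1 + norm x) ^ m * exp (- s * ?r^2 / 2)) * norm (h x) \<le> (2 * (1 + norm b)) ^ m * D * C"
      by (intro mult_mono[OF A C]) auto
    then show ?thesis by (simp add: norm_mult mult_ac)
  qed
  then show ?case by blast
next
  case (coord f i)
  obtain C where C: "(1 + norm x) ^ Suc m * norm (f x) \<le> C" for x using coord.IH by blast
  have "(1 + norm x) ^ m * norm (complex_of_real (x $ i) * f x) \<le> C" for x
  proof -
    have "\<bar>x $ i\<bar> \<le> 1 + norm x" using component_le_norm_cart[of x i] by simp
    then have "(1 + norm x) ^ m * norm (complex_of_real (x $ i) * f x) \<le> (1 + norm x) ^ m * ((1 + norm x) * norm (f x))"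
      by (auto simp: norm_mult intro!: mult_left_mono mult_right_mono)
    then show ?thesis using C[of x] by (simp add: mult_ac)
  qed
  then show ?case by blast
next
  case (add f g)
  obtain C D where C: "(1 + norm x) ^ m * norm (f x) \<le> C" and D: "(1 + norm x) ^ m * norm (g x) \<le> D" for x
    using add.IH(1)[of m] add.IH(2)[of m] by blast
  have "(1 + norm x) ^ m * norm (f x + g x) \<le> C + D" for x
  proof -
    have "(1 + norm x) ^ m * norm (f x + g x) \<le> (1 + norm x) ^ m * (norm (f x) + norm (g x))"
      by (intro mult_left_mono norm_triangle_ineq) auto
    then show ?thesis using C[of x] D[of x] by (simp add: distrib_left)
  qed
  then show ?case by blast
next
  case (cmult f c)
  obtain C where C: "(1 + norm x) ^ m * norm (f x) \<le> C" for x using cmult.IH[of m] by blast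
  have "(1 + norm x) ^ m * norm (c * f x) \<le> norm c * C" for x
    using mult_left_mono[OF C, of "norm c" x] by (simp add: norm_mult mult_ac)
  then show ?case by blast
qed

lemma gaussian_family_test_functions:
  fixes H :: "'d::finite cfun set"
  assumes "0 < s" and H: "\<And>h x. h \<in> H ==> h differentiable (at x)" "\<And>h i. h \<in> H ==> pderivs [i] h \<in> H"
    "\<And>h. h \<in> H ==> \<exists>C. \<forall>x. norm (h x) \<le> C"
    and f: "f \<in> gaussian_family s b H"
  shows "f \<in> test_functions Euclidean"
proof -
  have "pderivs is f \<in> gaussian_family s b H" for "is"
    using gaussian_family_pderiv[OF H(1,2)] by (intro pderivs_closed_family[OF _ f]) blast
  then show ?thesis
    using gaussian_family_pderiv[OF H(1,2)] gaussian_family_bounded[OF assms(1) H(3)]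
    by (simp add: test_functions_def smooth_def) blast
qed

text \<open>The instance of the family in which the class \<open>H\<close> consists of the
  constants.\<close>

lemma gaussian_test_function:
  fixes b :: "real ^ 'd::finite"
  assumes "0 < s"
  shows "(\<lambda>x. c * of_real (exp (- s * (norm (x - b))^2 / 2))) \<in> test_functions Euclidean"
proof -
  let ?H = "range (\<lambda>c (x :: real ^ 'd). c :: complex)"
  have "pderivs [i] (\<lambda>x :: real ^ 'd. c) = (\<lambda>x. 0 :: complex)" for c i
    by (rule pderivs_eqI) (rule has_derivative_const)
  then have "(\<lambda>x. of_real (exp (- s * (norm (x - b))^2 / 2)) * c) \<in> test_functions Euclidean"
    by (intro gaussian_family_test_functions[where H="?H" and s=s and b=b, OF assms] gaussian_family.base) auto
  then show ?thesis by (simp add: mult.commute)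
qed

section \<open>The normalized Gaussian as an approximate identity\<close>

definition gauss :: "real ^ 'd::finite => real" where
  "gauss z = (\<Prod>b\<in>Basis. std_normal_density (z \<bullet> b))"

text \<open>The same number normalizes the Gaussian density and the unitary Fourier transform, so
  one real constant serves both purposes.\<close>

definition gauss_const :: "'d::finite itself => real" where
  "gauss_const _ = (2 * pi) powr (- real CARD('d) / 2)"

lemma gauss_const_pos [simp]: "0 < gauss_const TYPE('d::finite)"
  by (simp add: gauss_const_def)

lemma fourier_const_eq: "fourier_const TYPE('d::finite) = of_real (gauss_const TYPE('d))"
  by (simp add: fourier_const_def gauss_const_def)

lemma norm_square_Basis: "(norm (x :: 'a::euclidean_space))^2 = (\<Sum>b\<in>Basis. (x \<bullet> b)^2)"
  unfolding power2_norm_eq_inner by (subst euclidean_inner) (simp add: power2_eq_square)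

text \<open>The definition by one-dimensional normal densities gives access to their characteristic
  function; this closed form serves for estimates and for completing squares.\<close>

lemma gauss_eq: "gauss (z :: real ^ 'd::finite) = gauss_const TYPE('d) * exp (- (norm z)\<^sup>2 / 2)"
proof -
  have "gauss z = (1 / sqrt (2 * pi)) ^ CARD('d) * exp (\<Sum>b\<in>Basis. - (z \<bullet> b)\<^sup>2 / 2)"
    unfolding gauss_def std_normal_density_def prod.distrib exp_sum[OF finite_Basis] by simp
  also have "(\<Sum>b\<in>Basis. - (z \<bullet> b)\<^sup>2 / 2) = - (norm z)\<^sup>2 / 2"
    by (simp add: norm_square_Basis sum_negf flip: sum_divide_distrib)
  also have "(1 / sqrt (2 * pi)) ^ CARD('d) = gauss_const TYPE('d)"
  proof -
    have "1 / sqrt (2 * pi) = (2 * pi) powr (- 1 / 2)"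
      by (simp add: powr_minus_divide powr_half_sqrt)
    then show ?thesis by (simp add: gauss_const_def powr_power)
  qed
  finally show ?thesis .
qed

lemma gauss_pos: "0 < gauss z"
  by (simp add: gauss_eq)

lemma continuous_on_gauss [continuous_intros]: "continuous_on S f ==> continuous_on S (\<lambda>x. gauss (f x))"
  unfolding gauss_eq by (intro continuous_intros) auto

lemma gauss_borel [measurable]: "gauss \<in> borel_measurable borel"
  by (intro borel_measurable_continuous_onI continuous_intros)

lemma gauss_decay: "\<exists>K\<ge>0. \<forall>z :: real ^ 'd::finite. gauss z \<le> K / wt m z"
proof -
  obtain C :: real where C: "(1 + y) ^ m * exp (- 1 * y / 2) \<le> C" if "0 \<le> y" for y
    using power_mult_exp_bounded[of 1 m] by auto
  have C0: "0 \<le> C" using C[of 0] by simp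
  have "gauss z \<le> (gauss_const TYPE('d) * C) / wt m z" for z :: "real ^ 'd"
  proof -
    have "gauss_const TYPE('d) * (wt m z * exp (- (norm z)\<^sup>2 / 2)) \<le> gauss_const TYPE('d) * C"
      using C[of "(norm z)^2"] by (intro mult_left_mono) (simp_all add: wt_def less_imp_le)
    then show ?thesis by (simp add: gauss_eq field_simps)
  qed
  then show ?thesis using C0 by (intro exI[of _ "gauss_const TYPE('d) * C"]) (simp add: less_imp_le)
qed

lemma integrable_wt_gauss: "integrable lborel (\<lambda>z :: real ^ 'd::finite. wt m z * gauss z)"
proof -
  obtain K where K0: "0 \<le> K" and K: "gauss z \<le> K / wt (m + CARD('d)) z" for z :: "real ^ 'd"
    using gauss_decay by blast
  have "integrable (dm Euclidean) (\<lambda>z :: real ^ 'd. K * (1 / wt CARD('d) z))"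
    by (intro integrable_mult_right integrable_wt) simp
  then have "integrable (lborel :: (real ^ 'd) measure) (\<lambda>z. K * (1 / wt CARD('d) z))" by (simp add: dm_Euclidean)
  then show ?thesis
  proof (rule integrable_majorant)
    show "AE z :: real ^ 'd in lborel. norm (wt m z * gauss z) \<le> norm (K * (1 / wt CARD('d) z))"
    proof (rule AE_I2)
      fix z :: "real ^ 'd"
      have "wt m z * gauss z \<le> wt m z * (K / wt (m + CARD('d)) z)" by (intro mult_left_mono K) simp
      also have "... = K * (1 / wt CARD('d) z)" by (simp add: wt_plus)
      finally show "norm (wt m z * gauss z) \<le> norm (K * (1 / wt CARD('d) z))"
        using gauss_pos[of z] K0 by (simp add: abs_mult)
    qed
  qed simp
qed

lemma integrable_gauss: "integrable lborel (gauss :: real ^ 'd::finite => real)"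
  using integrable_wt_gauss[of 0] by (simp add: wt_def)

lemma lborel_integral_prod:
  fixes f :: "'a::euclidean_space => real => complex"
  assumes f: "\<And>b. b \<in> Basis ==> integrable lborel (f b)"
  shows "(LINT x|lborel. (\<Prod>b\<in>Basis. f b (x \<bullet> b))) = (\<Prod>b\<in>Basis. (LINT x|lborel. f b x))"
proof -
  interpret product_sigma_finite "\<lambda>_ :: 'a. lborel :: real measure" ..
  have [measurable]: "f b \<in> borel_measurable borel" if "b \<in> Basis" for b using f[OF that] by (simp add: integrable_iff_bounded)
  have "(LINT x|lborel. (\<Prod>b\<in>Basis. f b (x \<bullet> b)))
      = (LINT y|(\<Pi>\<^sub>M b\<in>Basis. lborel). (\<Prod>b\<in>Basis. f b ((\<Sum>b\<in>Basis. y b *\<^sub>R b) \<bullet> b)))"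
    by (subst lborel_eq, subst integral_distr) (auto intro!: borel_measurable_prod)
  also have "... = (LINT y|(\<Pi>\<^sub>M b\<in>(Basis :: 'a set). lborel). (\<Prod>b\<in>Basis. f b (y b)))"
    by (intro Bochner_Integration.integral_cong prod.cong) (auto simp: inner_sum_left_Basis)
  also have "... = (\<Prod>b\<in>Basis. (LINT x|lborel. f b x))"
    by (intro product_integral_prod f) auto
  finally show ?thesis .
qed

text \<open>The integral factorizes over the coordinates into characteristic functions of the
  standard normal distribution.\<close>

lemma fourier_gauss:
  "(LINT z|lborel. of_real (gauss z) * cis (x \<bullet> z)) = of_real (exp (- (norm (x :: real ^ 'd::finite))\<^sup>2 / 2))"
proof -
  let ?f = "\<lambda>b y. complex_of_real (std_normal_density y) * cis ((x \<bullet> b) * y)"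
  have one: "(LINT y|lborel. complex_of_real (std_normal_density y) * cis (t * y)) = of_real (exp (- t\<^sup>2 / 2))" for t
  proof -
    have "char std_normal_distribution t = (LINT y|lborel. std_normal_density y *\<^sub>R iexp (t * y))"
      unfolding char_def by (subst integral_density) auto
    then show ?thesis by (simp add: char_std_normal_distribution scaleR_conv_of_real cis_conv_exp)
  qed
  have "cis (x \<bullet> z) = (\<Prod>b\<in>Basis. cis ((x \<bullet> b) * (z \<bullet> b)))" for z
    by (subst euclidean_inner) (simp add: cis_conv_exp exp_sum sum_distrib_left)
  then have "(LINT z|lborel. of_real (gauss z) * cis (x \<bullet> z)) = (LINT z|lborel. (\<Prod>b\<in>Basis. ?f b (z \<bullet> b)))"
    by (simp add: gauss_def prod.distrib)
  also have "... = (\<Prod>b\<in>Basis. (LINT y|lborel. ?f b y))"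
  proof (rule lborel_integral_prod)
    fix b :: "real ^ 'd"
    have "integrable lborel (\<lambda>y. complex_of_real (std_normal_density y))" by simp
    then show "integrable lborel (?f b)"
      by (rule integrable_majorant) (auto simp: norm_mult)
  qed
  also have "... = (\<Prod>b\<in>(Basis :: (real ^ 'd) set). of_real (exp (- (x \<bullet> b)\<^sup>2 / 2)))" by (simp only: one)
  also have "... = of_real (exp (\<Sum>b\<in>(Basis :: (real ^ 'd) set). - (x \<bullet> b)\<^sup>2 / 2))" by (simp add: exp_sum)
  also have "(\<Sum>b\<in>(Basis :: (real ^ 'd) set). - (x \<bullet> b)\<^sup>2 / 2) = - (norm x)\<^sup>2 / 2"
    by (simp add: norm_square_Basis sum_negf flip: sum_divide_distrib)
  finally show ?thesis .
qed

lemma integral_gauss: "(LINT z|lborel. complex_of_real (gauss (z :: real ^ 'd::finite))) = 1"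
  using fourier_gauss[of "0 :: real ^ 'd"] by simp

lemma lborel_integral_scale:
  fixes f :: "'d::finite cfun"
  assumes c: "c \<noteq> 0" and [measurable]: "f \<in> borel_measurable borel"
  shows "(LINT y|lborel. f y) = of_real (\<bar>c\<bar> ^ CARD('d)) * (LINT \<eta>|lborel. f (a + c *\<^sub>R \<eta>))"
proof -
  have "(LINT y|lborel. f y) = (LINT y|distr lborel borel (\<lambda>x. a + c *\<^sub>R x). \<bar>c\<bar> ^ CARD('d) *\<^sub>R f y)"
    by (subst lborel_affine[OF c, of a], subst integral_density) auto
  also have "... = (LINT \<eta>|lborel. \<bar>c\<bar> ^ CARD('d) *\<^sub>R f (a + c *\<^sub>R \<eta>))"
    by (subst integral_distr) auto
  finally show ?thesis by (simp add: scaleR_conv_of_real)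
qed

text \<open>With the scale placed inside the argument of \<open>k\<close>, dominated convergence
  applies with the majorant \<open>B * gauss \<eta>\<close>, which does not depend on the
  scale.\<close>

lemma gauss_approximate_identity:
  fixes k :: "'d::finite cfun"
  assumes k: "continuous_on UNIV k" and B: "\<And>x. norm (k x) \<le> B" and \<sigma>: "\<sigma> \<longlonglongrightarrow> 0"
  shows "(\<lambda>n. LINT \<eta>|lborel. k (z - \<sigma> n *\<^sub>R \<eta>) * of_real (gauss \<eta>)) \<longlonglongrightarrow> k z"
proof -
  have "(\<lambda>n. LINT \<eta>|lborel. k (z - \<sigma> n *\<^sub>R \<eta>) * of_real (gauss \<eta>)) \<longlonglongrightarrow> (LINT (\<eta> :: real ^ 'd)|lborel. k z * of_real (gauss \<eta>))"
  proof (rule integral_dominated_convergence)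
    show "integrable lborel (\<lambda>\<eta> :: real ^ 'd. B * gauss \<eta>)" by (intro integrable_mult_right integrable_gauss)
    have [measurable]: "k \<in> borel_measurable borel" by (rule borel_measurable_continuous_onI[OF k])
    show "(\<lambda>\<eta> :: real ^ 'd. k z * complex_of_real (gauss \<eta>)) \<in> borel_measurable lborel" by measurable
    show "(\<lambda>\<eta>. k (z - \<sigma> n *\<^sub>R \<eta>) * complex_of_real (gauss \<eta>)) \<in> borel_measurable lborel" for n by measurable
    show "AE \<eta> in lborel. (\<lambda>n. k (z - \<sigma> n *\<^sub>R \<eta>) * complex_of_real (gauss \<eta>)) \<longlonglongrightarrow> k z * complex_of_real (gauss \<eta>)"
    proof (intro AE_I2 tendsto_mult tendsto_const)
      fix \<eta>
      have "(\<lambda>n. z - \<sigma> n *\<^sub>R \<eta>) \<longlonglongrightarrow> z - 0 *\<^sub>R \<eta>" by (intro tendsto_intros \<sigma>)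
      from continuous_on_tendsto_compose[OF k this] show "(\<lambda>n. k (z - \<sigma> n *\<^sub>R \<eta>)) \<longlonglongrightarrow> k z" by simp
    qed
    show "AE \<eta> in lborel. norm (k (z - \<sigma> n *\<^sub>R \<eta>) * complex_of_real (gauss \<eta>)) \<le> B * gauss \<eta>" for n
      by (intro AE_I2) (simp add: norm_mult abs_of_pos[OF gauss_pos] less_imp_le[OF gauss_pos] mult_right_mono B)
  qed
  then show ?thesis by (simp only: integral_cmult integral_gauss mult_1_right)
qed

section \<open>Fourier synthesis and inversion\<close>

lemma measurable_cis_inner [measurable]:
  fixes f g :: "'a => real ^ 'd::finite"
  assumes "f \<in> N \<rightarrow>\<^sub>M borel" "g \<in> N \<rightarrow>\<^sub>M borel"
  shows "(\<lambda>p. cis (f p \<bullet> g p)) \<in> borel_measurable N"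
  using assms by measurable

lemma measurable_fst_space_measure: "fst \<in> space_measure M \<Otimes>\<^sub>M N \<rightarrow>\<^sub>M borel"
  by (rule measurable_compose[OF measurable_fst]) (intro measurable_space_measure measurable_ident_sets refl)

lemma measurable_snd_dm: "snd \<in> N \<Otimes>\<^sub>M dm M \<rightarrow>\<^sub>M borel"
  by (rule measurable_compose[OF measurable_snd]) simp

lemma sigma_finite_space_measure: "sigma_finite_measure (space_measure M :: (real ^ 'd::finite) measure)"
proof (cases M)
  case Euclidean
  then show ?thesis by (simp add: space_measure_def sigma_finite_lborel)
next
  case Torus
  then show ?thesis
    by (simp add: space_measure_def sigma_finite_measure_restrict_space sigma_finite_lborel)
qed

interpretation space_dm: pair_sigma_finite "space_measure M :: (real ^ 'd::finite) measure" "dm M :: (real ^ 'd) measure" for M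
  by (intro pair_sigma_finite.intro sigma_finite_space_measure dm.sigma_finite_measure_axioms)

lemma cis_inner_periodic:
  assumes "z \<in> lattice"
  shows "cis ((x + axis i (2 * pi)) \<bullet> z) = cis (x \<bullet> z)"
proof -
  have "cis (2 * pi * z $ i) = 1" using assms by (simp add: lattice_def)
  then show ?thesis
    by (simp add: inner_left_distrib inner_axis_eq flip: cis_mult)
qed

lemma norm_cis_inner [simp]: "norm (cis (x \<bullet> z)) = 1"
  by simp

text \<open>The function with Fourier transform \<open>g\<close>.\<close>

definition synth :: "base_space => 'd::finite cfun => 'd cfun" where
  "synth M g x = fourier_const TYPE('d) * (LINT z|dm M. g z * cis (x \<bullet> z))"

lemma integrable_mult_cis:
  fixes g :: "'d::finite cfun"
  assumes "integrable (dm M) g"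
  shows "integrable (dm M) (\<lambda>z. g z * cis (x \<bullet> z))"
proof (rule integrable_majorant[OF assms])
  have [measurable]: "g \<in> borel_measurable borel" using borel_measurable_integrable[OF assms] by simp
  show "(\<lambda>z. g z * cis (x \<bullet> z)) \<in> borel_measurable (dm M)" by simp
qed (simp add: norm_mult)

text \<open>Compact support makes all polynomial moments integrable, so differentiation under the
  integral sign stays within this class.\<close>

definition compact_density :: "base_space => 'd::finite cfun => bool" where
  "compact_density M h \<longleftrightarrow> integrable (dm M) h \<and> (\<exists>R. \<forall>z. R < norm z \<longrightarrow> h z = 0)"

lemma compact_density_mult:
  fixes h k :: "'d::finite cfun"
  assumes h: "compact_density M h" and k: "continuous_on UNIV k"
  shows "compact_density M (\<lambda>z. k z * h z)"
proof -
  obtain R where R: "h z = 0" if "R < norm z" for z using h by (auto simp: compact_density_def)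
  have hi: "integrable (dm M) h" using h by (simp add: compact_density_def)
  then have [measurable]: "h \<in> borel_measurable borel" using borel_measurable_integrable by force
  have [measurable]: "k \<in> borel_measurable borel" by (rule borel_measurable_continuous_onI[OF k])
  have "bounded (k ` cball 0 R)"
    by (intro compact_imp_bounded compact_continuous_image continuous_on_subset[OF k]) auto
  then obtain B where B: "\<forall>y\<in>k ` cball 0 R. norm y \<le> B" unfolding bounded_iff by auto
  have "norm (k z * h z) \<le> norm (of_real B * h z)" for z
  proof (cases "R < norm z")
    case False
    then have "norm (k z) \<le> B" using B by auto
    then have "norm (k z) \<le> \<bar>B\<bar>" by linarith
    then show ?thesis by (simp add: norm_mult mult_right_mono)
  qed (simp add: R)
  moreover have "integrable (dm M) (\<lambda>z. of_real B * h z)" using hi by simp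
  ultimately have "integrable (dm M) (\<lambda>z. k z * h z)"
    by (intro integrable_majorant[where g="\<lambda>z. k z * h z" and f="\<lambda>z. of_real B * h z"] AE_I2) auto
  then show ?thesis using R by (auto simp: compact_density_def)
qed

text \<open>This is \<open>synth\<close> without its normalizing constant, which can be moved into
  the density.\<close>

definition osc :: "base_space => 'd::finite cfun => 'd cfun" where
  "osc M h x = (LINT z|dm M. h z * cis (x \<bullet> z))"

text \<open>The second-order Taylor bound for the exponential, integrated against the density,
  leaves a remainder of \<open>(norm v)^2\<close> times the second moment.\<close>

lemma osc_has_derivative:
  fixes h :: "'d::finite cfun"
  assumes h: "compact_density M h"
  shows "(osc M h has_derivative (\<lambda>v. LINT z|dm M. (\<i> * of_real (v \<bullet> z) * h z) * cis (x \<bullet> z))) (at x)"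
proof -
  let ?D = "\<lambda>v. LINT z|dm M. (\<i> * of_real (v \<bullet> z) * h z) * cis (x \<bullet> z)"
  have hi: "integrable (dm M) h" using h by (simp add: compact_density_def)
  have m: "integrable (dm M) (\<lambda>z. k z * h z)" if "continuous_on UNIV k" for k :: "'d cfun"
    using compact_density_mult[OF h that] by (simp add: compact_density_def)
  have D_int: "integrable (dm M) (\<lambda>z. (\<i> * of_real (v \<bullet> z) * h z) * cis (x \<bullet> z))" for v
    by (intro integrable_mult_cis m continuous_intros)
  have m2: "integrable (dm M) (\<lambda>z. norm (of_real ((norm z)^2) * h z))"
    by (intro integrable_norm m continuous_intros)
  have m1: "integrable (dm M) (\<lambda>z. norm (of_real (norm z) * h z))"
    by (intro integrable_norm m continuous_intros)
  let ?C1 = "LINT z|dm M. norm (of_real (norm z) * h z)" and ?C2 = "LINT z|dm M. norm (of_real ((norm z)^2) * h z)"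
  have lin: "bounded_linear ?D"
  proof (rule bounded_linear_intro)
    show "?D (v + w) = ?D v + ?D w" for v w
      by (subst Bochner_Integration.integral_add[symmetric, OF D_int D_int]) (simp add: inner_left_distrib algebra_simps)
    show "?D (r *\<^sub>R v) = r *\<^sub>R ?D v" for r v
      by (simp add: scaleR_conv_of_real[where 'a=complex] mult_ac flip: integral_cmult)
    show "norm (?D v) \<le> norm v * ?C1" for v
    proof -
      have "norm (?D v) \<le> (LINT z|dm M. norm v * norm (of_real (norm z) * h z))"
      proof (rule Bochner_Integration.integral_norm_bound_integral[OF D_int])
        show "norm ((\<i> * of_real (v \<bullet> z) * h z) * cis (x \<bullet> z)) \<le> norm v * norm (of_real (norm z) * h z)" for z
          using mult_right_mono[OF Cauchy_Schwarz_ineq2[of v z], of "norm (h z)"] by (simp add: norm_mult mult.assoc)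
      qed (intro integrable_mult_right m1)
      then show ?thesis by simp
    qed
  qed
  have est: "norm (osc M h (x + v) - osc M h x - ?D v) \<le> (norm v)^2 * ?C2" for v
  proof -
    have "osc M h (x + v) - osc M h x - ?D v = (LINT z|dm M. h z * cis ((x + v) \<bullet> z) - h z * cis (x \<bullet> z) - (\<i> * of_real (v \<bullet> z) * h z) * cis (x \<bullet> z))"
      unfolding osc_def
      by (simp only: Bochner_Integration.integral_diff integrable_mult_cis[OF hi] D_int Bochner_Integration.integrable_diff)
    also have "norm ... \<le> (LINT z|dm M. (norm v)^2 * norm (of_real ((norm z)^2) * h z))"
    proof (rule Bochner_Integration.integral_norm_bound_integral)
      show "integrable (dm M) (\<lambda>z. h z * cis ((x + v) \<bullet> z) - h z * cis (x \<bullet> z) - (\<i> * of_real (v \<bullet> z) * h z) * cis (x \<bullet> z))"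
        by (intro Bochner_Integration.integrable_diff integrable_mult_cis hi D_int)
      fix z
      have "h z * cis ((x + v) \<bullet> z) - h z * cis (x \<bullet> z) - (\<i> * of_real (v \<bullet> z) * h z) * cis (x \<bullet> z)
          = h z * cis (x \<bullet> z) * (iexp (v \<bullet> z) - (\<Sum>k\<le>1. (\<i> * complex_of_real (v \<bullet> z)) ^ k / fact k))"
        by (simp add: inner_left_distrib algebra_simps flip: cis_conv_exp cis_mult)
      also have "norm ... \<le> norm (h z) * (\<bar>v \<bullet> z\<bar> ^ Suc 1 / fact (Suc 1))"
        using mult_left_mono[OF iexp_approx1[of "v \<bullet> z" 1] norm_ge_zero[of "h z"]]
        by (simp only: norm_mult norm_cis mult_1_right)
      also have "... \<le> norm (h z) * (norm v * norm z)^2"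
      proof (intro mult_left_mono)
        have "\<bar>v \<bullet> z\<bar> ^ 2 \<le> (norm v * norm z) ^ 2" by (intro power_mono Cauchy_Schwarz_ineq2) simp
        then show "\<bar>v \<bullet> z\<bar> ^ Suc 1 / fact (Suc 1) \<le> (norm v * norm z)^2"
          by (simp add: power2_eq_square) (smt (verit) abs_mult_self_eq zero_le_square)
      qed simp
      finally show "norm (h z * cis ((x + v) \<bullet> z) - h z * cis (x \<bullet> z) - (\<i> * of_real (v \<bullet> z) * h z) * cis (x \<bullet> z))
          \<le> (norm v)^2 * norm (of_real ((norm z)^2) * h z)"
        by (simp add: norm_mult norm_power power_mult_distrib mult_ac)
    qed (intro integrable_mult_right m2)
    finally show ?thesis by simp
  qed
  have "((\<lambda>v. norm (osc M h (x + v) - osc M h x - ?D v) / norm v) \<longlongrightarrow> 0) (at 0)"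
  proof (rule tendsto_sandwich[of "\<lambda>_. 0" _ _ "\<lambda>v. norm v * ?C2"])
    show "\<forall>\<^sub>F v in at 0. norm (osc M h (x + v) - osc M h x - ?D v) / norm v \<le> norm v * ?C2"
      unfolding eventually_at_filter
    proof (intro always_eventually allI impI)
      fix v :: "real ^ 'd" assume "v \<noteq> 0"
      then show "norm (osc M h (x + v) - osc M h x - ?D v) / norm v \<le> norm v * ?C2"
        using est[of v] by (simp add: pos_divide_le_eq power2_eq_square mult_ac)
    qed
    have "((\<lambda>v :: real ^ 'd. norm v * ?C2) \<longlongrightarrow> norm (0 :: real ^ 'd) * ?C2) (at 0)"
      by (intro tendsto_mult tendsto_const) (rule tendsto_norm[OF tendsto_ident_at])
    then show "((\<lambda>v :: real ^ 'd. norm v * ?C2) \<longlongrightarrow> 0) (at 0)" by simp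
  qed auto
  then show ?thesis using lin by (simp add: has_derivative_at)
qed

lemma osc_pderivs:
  fixes h :: "'d::finite cfun"
  assumes "compact_density M h"
  shows "pderivs [i] (osc M h) = osc M (\<lambda>z. \<i> * of_real (z $ i) * h z)"
  unfolding pderivs_eqI[OF osc_has_derivative[OF assms]] by (simp add: osc_def fun_eq_iff inner_axis_eq)

text \<open>Differentiation multiplies the density by \<open>\<i> * z $ i\<close>. The three
  conclusions are exactly what \<open>gaussian_family_test_functions\<close> asks of its class
  \<open>H\<close>.\<close>

lemma osc_class:
  fixes f :: "'d::finite cfun"
  assumes "f \<in> osc M ` {h. compact_density M h}"
  shows "f differentiable (at x)" "pderivs [i] f \<in> osc M ` {h. compact_density M h}"
    "\<exists>C. \<forall>x. norm (f x) \<le> C"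
proof -
  obtain h where f: "f = osc M h" and h: "compact_density M h" using assms by auto
  show "f differentiable (at x)" using osc_has_derivative[OF h] by (auto simp: f differentiable_def)
  have "compact_density M (\<lambda>z. \<i> * of_real (z $ i) * h z)"
    by (intro compact_density_mult h continuous_intros)
  then show "pderivs [i] f \<in> osc M ` {h. compact_density M h}" unfolding f osc_pderivs[OF h] by blast
  have "norm (f x) \<le> (LINT z|dm M. norm (h z))" for x
    using integral_norm_bound[of "dm M" "\<lambda>z. h z * cis (x \<bullet> z)"] by (simp add: f osc_def norm_mult)
  then show "\<exists>C. \<forall>x. norm (f x) \<le> C" by blast
qed

lemma osc_smooth: "compact_density M h ==> smooth (osc M h)" for h :: "'d::finite cfun"
proof -
  assume h: "compact_density M h"
  have "pderivs is (osc M h) \<in> osc M ` {h. compact_density M h}" for "is"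
    by (rule pderivs_closed_family[OF osc_class(2)]) (use h in auto)
  then show ?thesis unfolding smooth_def using osc_class(1) by blast
qed

lemma norm_synth_le:
  fixes g :: "'d::finite cfun"
  shows "norm (synth M g x) \<le> norm (fourier_const TYPE('d)) * (LINT z|dm M. norm (g z))"
proof -
  have "norm (LINT z|dm M. g z * cis (x \<bullet> z)) \<le> (LINT z|dm M. norm (g z * cis (x \<bullet> z)))"
    by (rule integral_norm_bound)
  then show ?thesis by (simp add: synth_def norm_mult mult_left_mono)
qed

lemma continuous_on_synth:
  fixes g :: "'d::finite cfun"
  assumes g: "integrable (dm M) g"
  shows "continuous_on UNIV (synth M g)"
proof (rule continuous_on_sequentiallyI)
  fix u :: "nat => real ^ 'd" and a assume u: "u \<longlonglongrightarrow> a"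
  have "(\<lambda>n. LINT z|dm M. g z * cis (u n \<bullet> z)) \<longlonglongrightarrow> (LINT z|dm M. g z * cis (a \<bullet> z))"
  proof (rule integral_dominated_convergence)
    show "integrable (dm M) (\<lambda>z. norm (g z))" by (intro integrable_norm g)
    show "AE z in dm M. (\<lambda>n. g z * cis (u n \<bullet> z)) \<longlonglongrightarrow> g z * cis (a \<bullet> z)"
      unfolding cis_conv_exp by (intro AE_I2 tendsto_intros u)
  qed (use integrable_mult_cis[OF g] borel_measurable_integrable in \<open>blast, blast, simp add: norm_mult\<close>)
  then show "(\<lambda>n. synth M g (u n)) \<longlonglongrightarrow> synth M g a"
    unfolding synth_def by (intro tendsto_mult tendsto_const)
qed

lemma periodic_synth:
  fixes g :: "'d::finite cfun"
  assumes g: "integrable (dm Torus) g"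
  shows "periodic (synth Torus g)"
  unfolding periodic_def
proof (intro allI)
  fix x :: "real ^ 'd" and i
  have "(LINT z|dm Torus. g z * cis ((x + axis i (2 * pi)) \<bullet> z)) = (LINT z|dm Torus. g z * cis (x \<bullet> z))"
  proof (rule integral_cong_AE)
    show "AE z in dm Torus. g z * cis ((x + axis i (2 * pi)) \<bullet> z) = g z * cis (x \<bullet> z)"
      using AE_dm_dgrp[of Torus] by eventually_elim (simp add: dgrp_def cis_inner_periodic)
  qed (use integrable_mult_cis[OF g] borel_measurable_integrable in blast)+
  then show "synth Torus g (x + axis i (2 * pi)) = synth Torus g x" by (simp add: synth_def)
qed

lemma synth_test_function_Torus:
  fixes h :: "'d::finite cfun"
  assumes h: "compact_density Torus h"
  shows "synth Torus h \<in> test_functions Torus"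
proof -
  have h': "compact_density Torus (\<lambda>z. fourier_const TYPE('d) * h z)"
    by (intro compact_density_mult h continuous_intros)
  have "synth Torus h = osc Torus (\<lambda>z. fourier_const TYPE('d) * h z)"
    by (simp add: synth_def osc_def fun_eq_iff mult.assoc)
  then show ?thesis
    using osc_smooth[OF h'] periodic_synth[of h] h by (simp add: test_functions_def compact_density_def)
qed

lemma count_space_indicator:
  assumes "n \<in> A"
  shows "integrable (count_space A) (indicator {n} :: 'a => complex)"
    "(LINT x|count_space A. (indicator {n} x :: complex)) = 1"
proof -
  have eq: "(indicator {n} :: 'a => complex) = (\<lambda>x. complex_of_real (indicator {n} x))"
    by (auto simp: indicator_def)
  show "integrable (count_space A) (indicator {n} :: 'a => complex)"
    unfolding eq using assms by (intro integrable_of_real integrable_real_indicator) auto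
  show "(LINT x|count_space A. (indicator {n} x :: complex)) = 1"
    unfolding eq using assms by (simp add: measure_count_space)
qed

text \<open>The character is \<open>osc\<close> of the point mass at \<open>- n\<close>, so its
  smoothness is a case of \<open>osc_smooth\<close>.\<close>

lemma cis_test_function:
  fixes n :: "real ^ 'd::finite"
  assumes n: "n \<in> lattice"
  shows "(\<lambda>x. character n x) \<in> test_functions Torus"
proof -
  have n': "- n \<in> lattice" using dgrp_uminus[of n Torus] n by (simp add: dgrp_def)
  have int: "integrable (dm Torus) (indicator {- n} :: 'd cfun)"
    using n' by (subst integrable_dm) (auto simp: dual_measure_def count_space_indicator)
  then have d: "compact_density Torus (indicator {- n} :: 'd cfun)"
    by (auto simp: compact_density_def indicator_def intro!: exI[of _ "norm n"])
  have "osc Torus (indicator {- n}) x = character n x" for x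
  proof -
    have eq: "indicator {- n} z * cis (x \<bullet> z) = indicator {- n} z * cis (x \<bullet> - n)" for z
      by (cases "z = - n") simp_all
    have "osc Torus (indicator {- n}) x = (LINT z|dual_measure Torus. indicator {- n} z * cis (x \<bullet> - n))"
      unfolding osc_def eq by (rule integral_dm) simp
    also have "... = character n x"
      using n' by (simp add: dual_measure_def count_space_indicator)
    finally show ?thesis .
  qed
  then have "osc Torus (indicator {- n}) = (\<lambda>x. character n x)" by (rule ext)
  then have "smooth (\<lambda>x. character n x)" using osc_smooth[OF d] by simp
  moreover have "periodic (\<lambda>x. character n x)"
    using cis_inner_periodic[OF n'] by (simp add: periodic_def)
  ultimately show ?thesis by (simp add: test_functions_def)
qed

lemma admissible_bounded:
  fixes f :: "'d::finite cfun"
  assumes "f \<in> borel_measurable borel" "M = Torus ==> periodic f" "\<And>x. norm (f x) \<le> B"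
  shows "admissible M f"
  using assms integrable_bounded_test unfolding admissible_def by blast

lemma admissible_synth:
  fixes g :: "'d::finite cfun"
  assumes "integrable (dm M) g"
  shows "admissible M (synth M g)"
  using assms norm_synth_le[of M g] periodic_synth[of g]
  by (intro admissible_bounded borel_measurable_continuous_onI continuous_on_synth) auto

text \<open>The reflected argument arises because \<open>synth\<close> uses
  \<open>cis (x \<bullet> z)\<close> and \<open>fourier_fun\<close> its conjugate; it agrees with
  the convention of \<open>inv_fourier\<close>.\<close>

lemma fdist_synth:
  fixes g \<phi> :: "'d::finite cfun"
  assumes g: "integrable (dm M) g" and \<phi>: "integrable (space_measure M) \<phi>"
  shows "fdist M (synth M g) \<phi> = (LINT z|dm M. g z * fourier_fun M \<phi> (- z))"
proof -
  have "fdist M (synth M g) \<phi> = (LINT x|space_measure M. fourier_const TYPE('d) * (\<phi> x * (LINT z|dm M. g z * cis (x \<bullet> z))))"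
    by (simp add: fdist_def synth_def mult_ac)
  also have "... = fourier_const TYPE('d) * (LINT x|space_measure M. \<phi> x * (LINT z|dm M. g z * cis (x \<bullet> z)))"
    by (rule integral_cmult)
  also have "(LINT x|space_measure M. \<phi> x * (LINT z|dm M. g z * cis (x \<bullet> z)))
      = (LINT z|dm M. g z * (LINT x|space_measure M. \<phi> x * cis (x \<bullet> z)))"
    by (rule space_dm.integral_kernel_swap[OF \<phi> g, where B=1])
      (simp_all add: measurable_cis_inner measurable_fst_space_measure measurable_snd_dm)
  also have "fourier_const TYPE('d) * ... = (LINT z|dm M. g z * fourier_fun M \<phi> (- z))"
    by (simp add: fourier_fun_def mult_ac flip: integral_cmult)
  finally show ?thesis .
qed

lemma fourier_fun_uminus_borel:
  "\<phi> \<in> test_functions M ==> (\<lambda>z :: real ^ 'd::finite. fourier_fun M \<phi> (- z)) \<in> borel_measurable borel"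
  by (intro borel_measurable_continuous_onI continuous_on_compose2[OF continuous_fourier_fun] continuous_intros) auto

lemma fdist_bounded_distribution:
  fixes f :: "'d::finite cfun"
  assumes f: "f \<in> borel_measurable borel" "\<And>x. norm (f x) \<le> B"
  shows "fdist M f \<in> distributions M"
  unfolding distributions_def mem_Collect_eq
proof (intro conjI ballI allI)
  note int = integrable_bounded_test[OF _ f]
  fix \<phi> \<psi> :: "'d cfun" and c
  show "fdist M f (\<lambda>x. \<phi> x + \<psi> x) = fdist M f \<phi> + fdist M f \<psi>" if "\<phi> \<in> test_functions M" "\<psi> \<in> test_functions M"
    using int that by (simp add: fdist_def distrib_left)
  show "fdist M f (\<lambda>x. c * \<phi> x) = c * fdist M f \<phi>"
    by (simp add: fdist_def mult.left_commute)
next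
  obtain N where N: "norm (\<phi> x) \<le> test_seminorm M N \<phi> * test_weight M x"
    if "\<phi> \<in> test_functions M" for \<phi> and x :: "real ^ 'd"
    using test_seminorm_dominates[of M] by blast
  let ?I = "LINT x|space_measure M. test_weight M (x :: real ^ 'd)"
  have B: "0 \<le> B" using norm_ge_zero order_trans f(2) by blast
  show "\<exists>N C. \<forall>\<phi>\<in>test_functions M. norm (fdist M f \<phi>) \<le> C * test_seminorm M N \<phi>"
  proof (intro exI ballI)
    fix \<phi> :: "'d cfun" assume \<phi>: "\<phi> \<in> test_functions M"
    have "norm (fdist M f \<phi>) \<le> (LINT (x :: real ^ 'd)|space_measure M. B * (test_seminorm M N \<phi> * test_weight M x))"
      unfolding fdist_def
    proof (rule Bochner_Integration.integral_norm_bound_integral)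
      show "integrable (space_measure M) (\<lambda>x. f x * \<phi> x)" by (rule integrable_bounded_test[OF \<phi> f])
      show "integrable (space_measure M) (\<lambda>x :: real ^ 'd. B * (test_seminorm M N \<phi> * test_weight M x))"
        by (intro integrable_mult_right integrable_test_weight)
      show "norm (f x * \<phi> x) \<le> B * (test_seminorm M N \<phi> * test_weight M x)" for x
        unfolding norm_mult by (intro mult_mono f N \<phi> B) auto
    qed
    also have "... = (B * ?I) * test_seminorm M N \<phi>" by simp
    finally show "norm (fdist M f \<phi>) \<le> (B * ?I) * test_seminorm M N \<phi>" .
  qed
qed

lemma fdist_synth_distribution:
  fixes g :: "'d::finite cfun"
  assumes "integrable (dm M) g"
  shows "fdist M (synth M g) \<in> distributions M"
  using assms norm_synth_le[of M g]
  by (intro fdist_bounded_distribution borel_measurable_continuous_onI continuous_on_synth)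

text \<open>If \<open>l $ i \<noteq> 0\<close>, a shift of coordinate \<open>i\<close> by
  \<open>pi / \<bar>l $ i\<bar>\<close> changes the sign of the character but not its integral. As
  \<open>l $ i\<close> is an integer, the shift is at most \<open>pi\<close>, within the range of
  the translation lemma.\<close>

lemma torus_orthogonality:
  fixes l :: "real ^ 'd::finite"
  assumes l: "l \<in> lattice"
  shows "(LINT x|space_measure Torus. cis (x \<bullet> l)) = (if l = 0 then of_real ((2 * pi) ^ CARD('d)) else 0)"
proof (cases "l = 0")
  case True
  have "measure lborel (cbox 0 (\<chi> i. 2 * pi) :: (real ^ 'd) set) = (2 * pi) ^ CARD('d)"
  proof -
    have "((\<chi> i. 2 * pi) - 0 :: real ^ 'd) \<bullet> b = 2 * pi" if "b \<in> Basis" for b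
      using that by (auto simp: Basis_vec_def inner_axis)
    then show ?thesis by (auto simp: measure_lborel_cbox_eq)
  qed
  then show ?thesis
    using True by (simp add: space_measure_def measure_restrict_space space_restrict_space scaleR_conv_of_real)
next
  case False
  then obtain i where i: "l $ i \<noteq> 0" by (auto simp: vec_eq_iff)
  let ?h = "pi / \<bar>l $ i\<bar>"
  have "l $ i \<in> \<int>" using l by (simp add: lattice_def)
  then have "1 \<le> \<bar>l $ i\<bar>" using i by (metis Ints_nonzero_abs_ge1)
  then have h: "0 \<le> ?h" "?h \<le> 2 * pi"
    using pi_gt_zero by (simp_all add: divide_le_eq)
  have per: "periodic (\<lambda>x :: real ^ 'd. cis (x \<bullet> l))"
    using cis_inner_periodic[OF l] by (simp add: periodic_def)
  have "cis ((x + axis i ?h) \<bullet> l) = - cis (x \<bullet> l)" for x :: "real ^ 'd"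
  proof -
    have "?h * l $ i = pi \<or> ?h * l $ i = - pi" using i by (auto simp: abs_if field_simps)
    then have "cis (?h * l $ i) = - 1" by (auto simp: cis_cnj[symmetric])
    then show ?thesis by (simp add: inner_left_distrib inner_axis_eq flip: cis_mult)
  qed
  moreover have "(LINT x|space_measure Torus. cis ((x + axis i ?h) \<bullet> l)) = (LINT x|space_measure Torus. cis (x \<bullet> l))"
    by (intro integral_space_measure_translate[where f="\<lambda>x. cis (x \<bullet> l)"] per h continuous_intros)
  ultimately have "- (LINT x|space_measure Torus. cis (x \<bullet> l)) = (LINT x|space_measure Torus. cis (x \<bullet> l))" by simp
  moreover have "Z = 0" if "- Z = Z" for Z :: complex using that by (auto simp: complex_eq_iff)
  ultimately show ?thesis using False by simp
qed

lemma decay_fourier_fun: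
  fixes \<psi> :: "'d::finite cfun"
  assumes "\<psi> \<in> test_functions Euclidean"
  shows "\<exists>K. decay n K (fourier_fun Euclidean \<psi>)"
  using fourier_fun_decay[OF assms, of n] continuous_fourier_fun[OF assms]
  by (auto simp: decay_def dgrp_def)

lemma integrable_fourier_fun:
  "\<psi> \<in> test_functions Euclidean ==> integrable lborel (fourier_fun Euclidean (\<psi> :: 'd::finite cfun))"
  using decay_fourier_fun[of \<psi> "CARD('d)"] integrable_decay[where M=Euclidean] by (auto simp: dm_Euclidean)

text \<open>One constant comes from the transform and one from its inversion; together they turn the
  transformed Gaussian into a density of mass 1 at scale \<sigma>.\<close>

lemma gauss_multiplier_integral:
  fixes Z :: "real ^ 'd::finite"
  assumes \<sigma>: "0 < \<sigma>"
  shows "of_real ((gauss_const TYPE('d))^2) * (LINT x|lborel. of_real (exp (- (norm (\<sigma> *\<^sub>R x))\<^sup>2 / 2)) * cis (x \<bullet> Z))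
    = of_real ((1 / \<sigma>) ^ CARD('d) * gauss ((1 / \<sigma>) *\<^sub>R Z))"
proof -
  let ?c = "gauss_const TYPE('d)"
  have c: "?c \<noteq> 0" using gauss_const_pos[where 'd='d] by linarith
  have [measurable]: "(\<lambda>x :: real ^ 'd. complex_of_real (exp (- (norm (\<sigma> *\<^sub>R x))\<^sup>2 / 2)) * cis (x \<bullet> Z)) \<in> borel_measurable borel"
    by measurable
  have "(LINT x|lborel. of_real (exp (- (norm (\<sigma> *\<^sub>R x))\<^sup>2 / 2)) * cis (x \<bullet> Z))
      = of_real (\<bar>1 / \<sigma>\<bar> ^ CARD('d)) * (LINT \<eta>|lborel. of_real (exp (- (norm (\<sigma> *\<^sub>R (0 + (1 / \<sigma>) *\<^sub>R \<eta>)))\<^sup>2 / 2)) * cis ((0 + (1 / \<sigma>) *\<^sub>R \<eta>) \<bullet> Z))"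
    using \<sigma> by (intro lborel_integral_scale) auto
  also have "(LINT \<eta>|lborel. of_real (exp (- (norm (\<sigma> *\<^sub>R (0 + (1 / \<sigma>) *\<^sub>R \<eta>)))\<^sup>2 / 2)) * cis ((0 + (1 / \<sigma>) *\<^sub>R \<eta>) \<bullet> Z))
      = (LINT (\<eta> :: real ^ 'd)|lborel. of_real (1 / ?c) * (of_real (gauss \<eta>) * cis (((1 / \<sigma>) *\<^sub>R Z) \<bullet> \<eta>)))"
    using \<sigma> c by (intro Bochner_Integration.integral_cong) (auto simp: gauss_eq inner_commute)
  also have "... = of_real (1 / ?c) * of_real (exp (- (norm ((1 / \<sigma>) *\<^sub>R Z))\<^sup>2 / 2))"
    by (simp only: integral_cmult fourier_gauss)
  finally show ?thesis using c \<sigma> by (simp add: gauss_eq power2_eq_square)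
qed

text \<open>A Gaussian factor makes the double integral absolutely convergent. After the exchange it
  has become the mollification of \<psi> at scale \<sigma>, and both sides converge as \<sigma>
  tends to 0.\<close>

lemma fourier_inversion:
  fixes \<psi> :: "'d::finite cfun"
  assumes \<psi>: "\<psi> \<in> test_functions Euclidean"
  shows "fourier_const TYPE('d) * (LINT x|lborel. fourier_fun Euclidean \<psi> x * cis (x \<bullet> z)) = \<psi> z"
proof -
  let ?c = "complex_of_real (gauss_const TYPE('d))"
  let ?E = "\<lambda>\<sigma> x. complex_of_real (exp (- (norm (\<sigma> *\<^sub>R x))\<^sup>2 / 2))"
  have psi_int: "integrable lborel \<psi>" using integrable_test_function[OF \<psi>] by (simp add: space_measure_def)
  have psi_cont: "continuous_on UNIV \<psi>" by (rule smooth_continuous[OF test_functions_smooth[OF \<psi>]])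
  note [measurable] = borel_measurable_continuous_onI[OF psi_cont]
  have [measurable]: "fourier_fun Euclidean \<psi> \<in> borel_measurable borel"
    by (intro borel_measurable_continuous_onI continuous_fourier_fun \<psi>)
  obtain C where C: "norm (pderivs [] \<psi> x) \<le> C * test_weight Euclidean x" for x
    using test_functions_bound[OF \<psi>, of "[]"] by blast
  have psi_b: "norm (\<psi> x) \<le> \<bar>C\<bar>" for x
  proof -
    have "C * test_weight Euclidean x \<le> \<bar>C\<bar> * 1"
      using wt_ge_1[of "CARD('d)" x] by (intro mult_mono) (auto simp: test_weight_def)
    then show ?thesis using C[of x] by simp
  qed
  have E_int: "integrable lborel (\<lambda>x :: real ^ 'd. ?E \<sigma> x)" if "0 < \<sigma>" for \<sigma>
  proof -
    have "(\<lambda>x :: real ^ 'd. 1 * complex_of_real (exp (- \<sigma>\<^sup>2 * (norm (x - 0))^2 / 2))) \<in> test_functions Euclidean"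
      using that by (intro gaussian_test_function) auto
    from integrable_test_function[OF this] show ?thesis by (simp add: space_measure_def power_mult_distrib)
  qed
  have key: "?c * (LINT x|lborel. fourier_fun Euclidean \<psi> x * (?E \<sigma> x * cis (x \<bullet> z))) = (LINT \<eta>|lborel. \<psi> (z - \<sigma> *\<^sub>R \<eta>) * of_real (gauss \<eta>))"
    if \<sigma>: "0 < \<sigma>" for \<sigma>
  proof -
    have Ex: "integrable lborel (\<lambda>x. ?E \<sigma> x * cis (x \<bullet> z))"
      using integrable_mult_cis[of Euclidean "?E \<sigma>" z] E_int[OF \<sigma>] by (simp add: dm_Euclidean inner_commute)
    have "(LINT x|lborel. fourier_fun Euclidean \<psi> x * (?E \<sigma> x * cis (x \<bullet> z)))
        = (LINT x|lborel. ?c * ((?E \<sigma> x * cis (x \<bullet> z)) * (LINT y|lborel. \<psi> y * character y x)))"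
      by (simp add: fourier_fun_def fourier_const_eq space_measure_def inner_commute mult_ac)
    also have "... = ?c * (LINT x|lborel. (?E \<sigma> x * cis (x \<bullet> z)) * (LINT y|lborel. \<psi> y * character y x))"
      by (rule integral_cmult)
    also have "(LINT x|lborel. (?E \<sigma> x * cis (x \<bullet> z)) * (LINT y|lborel. \<psi> y * character y x))
        = (LINT y|lborel. \<psi> y * (LINT x|lborel. (?E \<sigma> x * cis (x \<bullet> z)) * character y x))"
      using Ex psi_int dm2.integral_kernel_swap[of Euclidean "\<lambda>x. ?E \<sigma> x * cis (x \<bullet> z)" \<psi> "\<lambda>x y. character y x" 1]
      by (simp add: dm_Euclidean)
    also have "... = (LINT y|lborel. \<psi> y * (LINT x|lborel. ?E \<sigma> x * cis (x \<bullet> (z - y))))"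
      by (simp add: mult.assoc cis_mult inner_diff_right)
    finally have "?c * (LINT x|lborel. fourier_fun Euclidean \<psi> x * (?E \<sigma> x * cis (x \<bullet> z)))
        = (LINT y|lborel. \<psi> y * (of_real ((gauss_const TYPE('d))^2) * (LINT x|lborel. ?E \<sigma> x * cis (x \<bullet> (z - y)))))"
      by (simp add: power2_eq_square mult_ac flip: integral_cmult)
    also have "... = (LINT y|lborel. \<psi> y * of_real ((1 / \<sigma>) ^ CARD('d) * gauss ((1 / \<sigma>) *\<^sub>R (z - y))))"
      by (simp only: gauss_multiplier_integral[OF \<sigma>])
    also have "... = of_real (\<bar>- \<sigma>\<bar> ^ CARD('d)) * (LINT \<eta>|lborel. \<psi> (z + (- \<sigma>) *\<^sub>R \<eta>) *
        of_real ((1 / \<sigma>) ^ CARD('d) * gauss ((1 / \<sigma>) *\<^sub>R (z - (z + (- \<sigma>) *\<^sub>R \<eta>)))))"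
      using \<sigma> by (intro lborel_integral_scale) auto
    also have "... = (LINT \<eta>|lborel. \<psi> (z - \<sigma> *\<^sub>R \<eta>) * of_real (gauss \<eta>))"
      using \<sigma> by (simp add: power_one_over field_simps flip: integral_cmult)
    finally show ?thesis .
  qed
  let ?s = "\<lambda>n. 1 / real (Suc n)"
  have s0: "?s \<longlonglongrightarrow> 0" using LIMSEQ_Suc[OF lim_1_over_n] .
  have "(\<lambda>n. LINT \<eta>|lborel. \<psi> (z - ?s n *\<^sub>R \<eta>) * of_real (gauss \<eta>)) \<longlonglongrightarrow> \<psi> z"
    by (rule gauss_approximate_identity[OF psi_cont psi_b s0])
  \<comment> \<open>\<open>?E 0\<close> is the constant 1, so the limit is the integral without the
    regularizing factor.\<close>
  moreover have "(\<lambda>n. LINT x|lborel. fourier_fun Euclidean \<psi> x * (?E (?s n) x * cis (x \<bullet> z)))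
      \<longlonglongrightarrow> (LINT x|lborel. fourier_fun Euclidean \<psi> x * (?E 0 x * cis (x \<bullet> z)))"
  proof (rule integral_dominated_convergence)
    show "integrable lborel (\<lambda>x. norm (fourier_fun Euclidean \<psi> x))"
      by (intro integrable_norm integrable_fourier_fun \<psi>)
    show "(\<lambda>x. fourier_fun Euclidean \<psi> x * (?E 0 x * cis (x \<bullet> z))) \<in> borel_measurable lborel"
      "(\<lambda>x. fourier_fun Euclidean \<psi> x * (?E (?s n) x * cis (x \<bullet> z))) \<in> borel_measurable lborel" for n by measurable
    show "AE x in lborel. (\<lambda>n. fourier_fun Euclidean \<psi> x * (?E (?s n) x * cis (x \<bullet> z))) \<longlonglongrightarrow> fourier_fun Euclidean \<psi> x * (?E 0 x * cis (x \<bullet> z))"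
      by (intro AE_I2 tendsto_intros s0) simp
    show "AE x in lborel. norm (fourier_fun Euclidean \<psi> x * (?E (?s n) x * cis (x \<bullet> z))) \<le> norm (fourier_fun Euclidean \<psi> x)" for n
      by (intro AE_I2) (simp add: norm_mult mult_left_le)
  qed
  then have "(\<lambda>n. ?c * (LINT x|lborel. fourier_fun Euclidean \<psi> x * (?E (?s n) x * cis (x \<bullet> z))))
      \<longlonglongrightarrow> ?c * (LINT x|lborel. fourier_fun Euclidean \<psi> x * (?E 0 x * cis (x \<bullet> z)))"
    by (intro tendsto_mult tendsto_const)
  then have "(\<lambda>n. LINT \<eta>|lborel. \<psi> (z - ?s n *\<^sub>R \<eta>) * of_real (gauss \<eta>))
      \<longlonglongrightarrow> ?c * (LINT x|lborel. fourier_fun Euclidean \<psi> x * cis (x \<bullet> z))"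
    by (subst (asm) key) auto
  ultimately show ?thesis unfolding fourier_const_eq by (rule LIMSEQ_unique[rotated])
qed

text \<open>On Euclidean space this is Fourier inversion for the test function. On the torus
  orthogonality selects one lattice point, and the volume \<open>(2 * pi) ^ CARD('d)\<close> cancels
  against the square of the normalizing constant.\<close>

lemma is_fourier_synth:
  fixes g :: "'d::finite cfun"
  assumes g: "integrable (dm M) g"
  shows "is_fourier M (fdist M (synth M g)) g"
proof -
  have gb [measurable]: "g \<in> borel_measurable borel" using borel_measurable_integrable[OF g] by simp
  show ?thesis
  proof (cases M)
    case Euclidean
    have "integrable lborel (\<lambda>z. g z * \<psi> z) \<and> fdist M (synth M g) (fourier_fun Euclidean \<psi>) = (LINT z|lborel. g z * \<psi> z)"
      if \<psi>: "\<psi> \<in> test_functions Euclidean" for \<psi>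
    proof
      have [measurable]: "\<psi> \<in> borel_measurable borel" by (rule test_functions_borel[OF \<psi>])
      obtain C where C: "norm (pderivs [] \<psi> x) \<le> C * test_weight Euclidean x" for x
        using test_functions_bound[OF \<psi>, of "[]"] by blast
      have psi_b: "norm (\<psi> x) \<le> \<bar>C\<bar>" for x
      proof -
        have "C * test_weight Euclidean x \<le> \<bar>C\<bar> * 1"
          using wt_ge_1[of "CARD('d)" x] by (intro mult_mono) (auto simp: test_weight_def)
        then show ?thesis using C[of x] by simp
      qed
      show "integrable lborel (\<lambda>z. g z * \<psi> z)"
      proof (rule integrable_majorant)
        show "integrable lborel (\<lambda>z. of_real \<bar>C\<bar> * g z)" using g by (simp add: Euclidean dm_Euclidean)
        show "AE z in lborel. norm (g z * \<psi> z) \<le> norm (of_real \<bar>C\<bar> * g z)"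
          using psi_b by (intro AE_I2) (simp add: norm_mult mult.commute mult_right_mono)
      qed measurable
      have "fdist M (synth M g) (fourier_fun Euclidean \<psi>) = (LINT z|dm M. g z * fourier_fun M (fourier_fun Euclidean \<psi>) (- z))"
        using integrable_fourier_fun[OF \<psi>] by (intro fdist_synth g) (simp add: Euclidean space_measure_def)
      also have "... = (LINT z|lborel. g z * \<psi> z)"
        using fourier_inversion[OF \<psi>] by (simp add: Euclidean dm_Euclidean fourier_fun_def[of Euclidean "fourier_fun Euclidean \<psi>"] space_measure_def)
      finally show "fdist M (synth M g) (fourier_fun Euclidean \<psi>) = (LINT z|lborel. g z * \<psi> z)" .
    qed
    then show ?thesis using gb by (simp add: is_fourier_def Euclidean)
  next
    case Torus
    have "g n = fourier_const TYPE('d) * fdist M (synth M g) (\<lambda>x. character n x)" if n: "n \<in> lattice" for n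
    proof -
      let ?v = "complex_of_real ((2 * pi) ^ CARD('d))"
      have "integrable (space_measure Torus) (\<lambda>x :: real ^ 'd. 1 * character n x)"
        using continuous_on_compose2
        by (intro integrable_mult_test_weight[where B=1 and C=1]) (auto simp: test_weight_def intro!: borel_measurable_continuous_onI continuous_intros)
      then have "fdist M (synth M g) (\<lambda>x. character n x) = (LINT z|dm Torus. g z * fourier_fun Torus (\<lambda>x. character n x) (- z))"
        using g unfolding Torus by (intro fdist_synth) simp_all
      also have "... = (LINT z|dm Torus. (fourier_const TYPE('d) * ?v * g n) * indicator {n} z)"
      proof (rule integral_cong_AE)
        have "fourier_fun Torus (\<lambda>x. character n x) (- z) = fourier_const TYPE('d) * (LINT x|space_measure Torus. cis (x \<bullet> (z - n)))" for z
          by (simp add: fourier_fun_def cis_mult inner_diff_right)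
        moreover have "z - n \<in> lattice" if "z \<in> lattice" for z
          using dgrp_diff[of z Torus n] that n by (simp add: dgrp_def)
        ultimately have eq: "g z * fourier_fun Torus (\<lambda>x. character n x) (- z) = (fourier_const TYPE('d) * ?v * g n) * indicator {n} z"
          if "z \<in> lattice" for z
          using that by (simp add: torus_orthogonality indicator_def)
        show "AE z in dm Torus. g z * fourier_fun Torus (\<lambda>x. character n x) (- z) = (fourier_const TYPE('d) * ?v * g n) * indicator {n} z"
          using AE_dm_dgrp[of Torus] by eventually_elim (simp add: dgrp_def eq)
        show "(\<lambda>z. fourier_const TYPE('d) * ?v * g n * indicator {n} z) \<in> borel_measurable (dm Torus)" by simp
        have "(\<lambda>x :: real ^ 'd. character n x) \<in> test_functions Torus"
          by (rule cis_test_function[OF n])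
        from fourier_fun_uminus_borel[OF this]
        show "(\<lambda>z. g z * fourier_fun Torus (\<lambda>x. character n x) (- z)) \<in> borel_measurable (dm Torus)" by simp
      qed
      also have "... = (LINT z|dual_measure Torus. (fourier_const TYPE('d) * ?v * g n) * indicator {n} z)"
        by (intro integral_dm) simp
      also have "... = fourier_const TYPE('d) * ?v * g n"
        using n by (simp add: dual_measure_def count_space_indicator)
      finally have F: "fdist M (synth M g) (\<lambda>x. character n x) = fourier_const TYPE('d) * ?v * g n" .
      have v: "fourier_const TYPE('d) * fourier_const TYPE('d) * ?v = 1"
      proof -
        have "gauss_const TYPE('d) * gauss_const TYPE('d) * (2 * pi) ^ CARD('d) = (2 * pi) powr (- real CARD('d) / 2 + - real CARD('d) / 2 + real CARD('d))"
          unfolding gauss_const_def powr_add by (simp add: powr_realpow)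
        then show ?thesis by (simp add: fourier_const_eq flip: of_real_mult)
      qed
      have "fourier_const TYPE('d) * fdist M (synth M g) (\<lambda>x. character n x) = (fourier_const TYPE('d) * fourier_const TYPE('d) * ?v) * g n"
        unfolding F by (simp only: mult.assoc)
      then show ?thesis unfolding v by simp
    qed
    then show ?thesis by (simp add: is_fourier_def Torus)
  qed
qed

section \<open>Uniqueness of the Fourier transform\<close>

text \<open>The positive and the negative part of \<open>f\<close>, taken as densities, define
  finite measures that agree on boxes, an intersection-stable generator. Hence the two parts agree
  almost everywhere, which forces both to vanish.\<close>

lemma integral_box_zero_imp_AE_zero:
  fixes f :: "'a::euclidean_space => real"
  assumes f: "integrable lborel f" and Z: "\<And>a b. (LINT x|lborel. indicator (box a b) x * f x) = 0"
  shows "AE x in lborel. f x = 0"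
proof -
  have [measurable]: "f \<in> borel_measurable borel" using borel_measurable_integrable[OF f] by simp
  let ?P = "density lborel (\<lambda>x. ennreal (f x))" and ?N = "density lborel (\<lambda>x. ennreal (- f x))"
  have fin: "(\<integral>\<^sup>+x. ennreal (g x) \<partial>lborel) < \<infinity>" if "integrable lborel g" for g :: "'a => real"
  proof -
    have "(\<integral>\<^sup>+x. ennreal (g x) \<partial>lborel) \<le> (\<integral>\<^sup>+x. ennreal (norm (g x)) \<partial>lborel)"
      by (intro nn_integral_mono ennreal_leI) simp
    also have "... < \<infinity>" using that by (simp add: integrable_iff_bounded)
    finally show ?thesis .
  qed
  have eq: "emeasure ?P (box a b) = emeasure ?N (box a b)" for a b
  proof -
    let ?g = "\<lambda>x. indicator (box a b) x * f x"
    have gi: "integrable lborel ?g" using integrable_real_mult_indicator[of "box a b" lborel f] f by (simp add: mult.commute)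
    have "0 = enn2real (\<integral>\<^sup>+x. ennreal (?g x) \<partial>lborel) - enn2real (\<integral>\<^sup>+x. ennreal (- ?g x) \<partial>lborel)"
      using real_lebesgue_integral_def[OF gi] Z[of a b] by simp
    moreover have "(\<integral>\<^sup>+x. ennreal (?g x) \<partial>lborel) < \<infinity>" by (rule fin[OF gi])
    moreover have "(\<integral>\<^sup>+x. ennreal (- ?g x) \<partial>lborel) < \<infinity>" using gi by (intro fin) simp
    ultimately have "(\<integral>\<^sup>+x. ennreal (?g x) \<partial>lborel) = (\<integral>\<^sup>+x. ennreal (- ?g x) \<partial>lborel)"
      by (metis ennreal_enn2real eq_iff_diff_eq_0 infinity_ennreal_def)
    moreover have "emeasure ?P (box a b) = (\<integral>\<^sup>+x. ennreal (?g x) \<partial>lborel)"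
      by (subst emeasure_density) (auto intro!: nn_integral_cong simp: indicator_def)
    moreover have "emeasure ?N (box a b) = (\<integral>\<^sup>+x. ennreal (- ?g x) \<partial>lborel)"
      by (subst emeasure_density) (auto intro!: nn_integral_cong simp: indicator_def)
    ultimately show ?thesis by simp
  qed
  have finP: "emeasure ?P X < \<infinity>" if "X \<in> sets borel" for X
  proof -
    have "emeasure ?P X \<le> (\<integral>\<^sup>+x. ennreal (f x) \<partial>lborel)"
      using that by (subst emeasure_density) (auto intro!: nn_integral_mono simp: indicator_def)
    then show ?thesis using fin[OF f] by (rule le_less_trans)
  qed
  have "?P = ?N"
  proof (rule measure_eqI_generator_eq)
    let ?E = "range (\<lambda>(a, b). box a b::'a set)"
    show "Int_stable ?E" by (auto simp: Int_stable_def box_Int_box)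
    show "?E \<subseteq> Pow UNIV" "sets ?P = sigma_sets UNIV ?E" "sets ?N = sigma_sets UNIV ?E"
      by (simp_all add: borel_eq_box)
    let ?A = "\<lambda>n::nat. box (- (real n *\<^sub>R One)) (real n *\<^sub>R One) :: 'a set"
    show "range ?A \<subseteq> ?E" "(\<Union>i. ?A i) = UNIV" unfolding UN_box_eq_UNIV by auto
    show "emeasure ?P (?A i) \<noteq> \<infinity>" for i using finP[of "?A i"] by simp
    show "emeasure ?P X = emeasure ?N X" if "X \<in> ?E" for X using that eq by auto
  qed
  then have "AE x in lborel. ennreal (f x) = ennreal (- f x)"
    by (intro sigma_finite_measure.density_unique[OF sigma_finite_lborel]) auto
  then show ?thesis
  proof eventually_elim
    fix x assume "ennreal (f x) = ennreal (- f x)"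
    then show "f x = 0" by (cases "0 \<le> f x") (auto simp: ennreal_neg ennreal_eq_0_iff)
  qed
qed

lemma integral_continuous_zero_imp_AE_zero:
  fixes f :: "'d::finite cfun"
  assumes f: "integrable lborel f"
    and Z: "\<And>k. continuous_on UNIV k ==> (\<And>x. norm (k x) \<le> 1) ==> integrable lborel k ==> (LINT x|lborel. f x * k x) = 0"
  shows "AE x in lborel. f x = 0"
proof -
  have [measurable]: "f \<in> borel_measurable borel" using borel_measurable_integrable[OF f] by simp
  have box: "(LINT x|lborel. f x * indicator (box a b) x) = 0" for a b :: "real ^ 'd"
  proof -
    let ?C = "- box a b"
    have ne: "?C \<noteq> {}" 
    proof -
      have "box a b \<noteq> UNIV" using bounded_box[of a b] not_bounded_UNIV[where 'a="real ^ 'd"] by metis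
      then show ?thesis by blast
    qed
    \<comment> \<open>Continuous functions that converge to the indicator of the open box, since the
      distance to the complement is positive exactly inside.\<close>
    let ?k = "\<lambda>n x. complex_of_real (min 1 (real n * infdist x ?C))"
    have kc: "continuous_on UNIV (?k n)" for n by (intro continuous_intros)
    have kb: "norm (?k n x) \<le> 1" for n x using infdist_nonneg[of x ?C] by simp
    have k0: "?k n x = 0" if "x \<notin> box a b" for n x using that by simp
    have ki: "integrable lborel (?k n)" for n
    proof (rule integrableI_bounded_set[where A="box a b" and B=1])
      show "?k n \<in> borel_measurable lborel" using borel_measurable_continuous_onI[OF kc[of n]] by simp
      show "emeasure lborel (box a b) < \<infinity>" by (rule emeasure_lborel_box_finite)
      show "AE x in lborel. x \<in> box a b \<longrightarrow> norm (?k n x) \<le> 1" using kb by simp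
      show "AE x in lborel. x \<notin> box a b \<longrightarrow> ?k n x = 0" using k0 by blast
    qed simp
    have "(\<lambda>n. LINT x|lborel. f x * ?k n x) \<longlonglongrightarrow> (LINT x|lborel. f x * indicator (box a b) x)"
    proof (rule integral_dominated_convergence)
      show "integrable lborel (\<lambda>x. norm (f x))" using f by simp
      show "AE x in lborel. norm (f x * ?k n x) \<le> norm (f x)" for n
        using kb by (intro AE_I2) (simp add: norm_mult mult_left_le)
      show "(\<lambda>x. f x * ?k n x) \<in> borel_measurable lborel" for n
        using borel_measurable_continuous_onI[OF kc[of n]] by simp
      show "AE x in lborel. (\<lambda>n. f x * ?k n x) \<longlonglongrightarrow> f x * indicator (box a b) x"
      proof (intro AE_I2 tendsto_mult tendsto_const)
        fix x :: "real ^ 'd"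
        show "(\<lambda>n. ?k n x) \<longlonglongrightarrow> indicator (box a b) x"
        proof (cases "x \<in> box a b")
          case True
          have "closed ?C" by (simp add: open_box closed_Compl)
          then have "0 < infdist x ?C"
            using True ne infdist_nonneg[of x ?C] in_closed_iff_infdist_zero[of ?C x] by force
          then obtain n0 where n0: "1 < real n0 * infdist x ?C" using ex_less_of_nat_mult by blast
          have "?k n x = 1" if "n0 \<le> n" for n
          proof -
            have "real n0 * infdist x ?C \<le> real n * infdist x ?C" using that by (intro mult_right_mono infdist_nonneg) simp
            then show ?thesis using n0 by simp
          qed
          then have "\<forall>\<^sub>F n in sequentially. ?k n x = 1" using eventually_sequentially by blast
          then show ?thesis using True by (simp add: tendsto_eventually)
        qed (simp add: k0)
      qed
    qed simp
    moreover have "(LINT x|lborel. f x * ?k n x) = 0" for n by (rule Z[OF kc kb ki])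
    ultimately show ?thesis by (simp add: LIMSEQ_const_iff)
  qed
  have i: "integrable lborel (\<lambda>x. f x * indicator (box a b) x)" for a b :: "real ^ 'd"
  proof (rule integrable_majorant[OF f])
    show "AE x in lborel. norm (f x * indicator (box a b) x) \<le> norm (f x)"
      by (intro AE_I2) (simp add: norm_mult indicator_def)
  qed simp
  have "AE x in lborel. Re (f x) = 0"
  proof (rule integral_box_zero_imp_AE_zero)
    show "integrable lborel (\<lambda>x. Re (f x))" using f by simp
    fix a b :: "real ^ 'd"
    have "(LINT x|lborel. Re (f x * indicator (box a b) x)) = 0" unfolding integral_Re[OF i[of a b]] box[of a b] by simp
    moreover have eq: "Re (f x * indicator (box a b) x) = indicator (box a b) x * Re (f x)" for x by (simp add: indicator_def)
    ultimately show "(LINT x|lborel. indicator (box a b) x * Re (f x)) = 0" by (simp only: eq)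
  qed
  moreover have "AE x in lborel. Im (f x) = 0"
  proof (rule integral_box_zero_imp_AE_zero)
    show "integrable lborel (\<lambda>x. Im (f x))" using f by simp
    fix a b :: "real ^ 'd"
    have "(LINT x|lborel. Im (f x * indicator (box a b) x)) = 0" unfolding integral_Im[OF i[of a b]] box[of a b] by simp
    moreover have eq: "Im (f x * indicator (box a b) x) = indicator (box a b) x * Im (f x)" for x by (simp add: indicator_def)
    ultimately show "(LINT x|lborel. indicator (box a b) x * Im (f x)) = 0" by (simp only: eq)
  qed
  ultimately show ?thesis by eventually_elim (simp add: complex_eq_iff)
qed

text \<open>Up to a constant, the product of the standard Gaussian and a translated and scaled one is again
  a translated and scaled Gaussian, hence an admissible test function.\<close>

lemma gauss_product_test_function:
  fixes a :: "real ^ 'd::finite"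
  assumes \<sigma>: "0 < \<sigma>"
  shows "(\<lambda>z. of_real (gauss z) * of_real (gauss ((1 / \<sigma>) *\<^sub>R (z - a)))) \<in> test_functions Euclidean"
proof -
  define s where "s = 1 + 1 / \<sigma>^2"
  define b where "b = (1 / (\<sigma>^2 + 1)) *\<^sub>R a"
  have s: "0 < s" unfolding s_def by (simp add: add_pos_nonneg)
  have sb: "s *\<^sub>R b = (1 / \<sigma>^2) *\<^sub>R a"
  proof -
    have "s * (1 / (\<sigma>^2 + 1)) = 1 / \<sigma>^2"
      using \<sigma> by (simp add: s_def field_simps add_pos_nonneg add_nonneg_eq_0_iff)
    then show ?thesis by (simp add: b_def)
  qed
  define C where "C = exp ((s * (norm b)^2 - (norm a)\<^sup>2 / \<sigma>^2) / 2)"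
  have "(norm z)^2 + (norm ((1 / \<sigma>) *\<^sub>R (z - a)))^2 = s * (norm (z - b))^2 - (s * (norm b)^2 - (norm a)\<^sup>2 / \<sigma>^2)" for z
  proof -
    have 1: "(norm (z - c))^2 = (norm z)^2 - 2 * (z \<bullet> c) + (norm c)^2" for c
      by (simp add: power2_norm_eq_inner inner_diff inner_commute algebra_simps)
    have "s * (z \<bullet> b) = (z \<bullet> a) / \<sigma>^2" using arg_cong[OF sb, of "\<lambda>v. z \<bullet> v"] by simp
    moreover have "(norm ((1 / \<sigma>) *\<^sub>R (z - a)))^2 = (norm (z - a))^2 / \<sigma>^2" by (simp add: power_divide)
    moreover have "(norm (z - a))^2 / \<sigma>^2 = (norm z)^2 / \<sigma>^2 - 2 * ((z \<bullet> a) / \<sigma>^2) + (norm a)^2 / \<sigma>^2"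
      unfolding 1[of a] by (simp add: add_divide_distrib diff_divide_distrib)
    moreover have "s * (norm (z - b))^2 = s * (norm z)^2 - 2 * (s * (z \<bullet> b)) + s * (norm b)^2"
      unfolding 1[of b] by (simp add: algebra_simps)
    moreover have "s * (norm z)^2 = (norm z)^2 + (norm z)^2 / \<sigma>^2" by (simp add: s_def algebra_simps)
    ultimately show ?thesis by linarith
  qed
  then have "exp (- (norm z)\<^sup>2 / 2) * exp (- (norm ((1 / \<sigma>) *\<^sub>R (z - a)))\<^sup>2 / 2) = C * exp (- s * (norm (z - b))^2 / 2)" for z
    unfolding C_def exp_add[symmetric] by (simp add: algebra_simps add_divide_distrib[symmetric] diff_divide_distrib[symmetric])
  then have "complex_of_real (gauss z) * of_real (gauss ((1 / \<sigma>) *\<^sub>R (z - a)))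
      = of_real ((gauss_const TYPE('d))^2 * C) * of_real (exp (- s * (norm (z - b))^2 / 2))" for z
    unfolding gauss_eq of_real_mult[symmetric] by (simp add: power2_eq_square mult_ac)
  then show ?thesis using gaussian_test_function[OF s] by simp
qed

text \<open>Multiplication by a Gaussian makes \<open>f\<close> integrable. Smoothing a continuous
  \<open>k\<close> writes it as a superposition of translated Gaussians, whose products with the
  first Gaussian are test functions. So \<open>f\<close> times the Gaussian annihilates every
  bounded, integrable, continuous function and vanishes almost everywhere.\<close>

lemma fourier_unique_Euclidean:
  fixes f :: "'d::finite cfun"
  assumes fb [measurable]: "f \<in> borel_measurable borel"
    and f: "\<And>\<psi>. \<psi> \<in> test_functions Euclidean ==> integrable lborel (\<lambda>z. f z * \<psi> z)"
    and Z: "\<And>\<psi>. \<psi> \<in> test_functions Euclidean ==> (LINT z|lborel. f z * \<psi> z) = 0"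
  shows "AE z in lborel. f z = 0"
proof -
  let ?H = "\<lambda>z. f z * of_real (gauss z)"
  have gt: "(\<lambda>z :: real ^ 'd. complex_of_real (gauss z)) \<in> test_functions Euclidean"
    using gaussian_test_function[of 1 "of_real (gauss_const TYPE('d))" "0 :: real ^ 'd"] by (simp add: gauss_eq)
  have H: "integrable lborel ?H" by (rule f[OF gt])
  have "AE z in lborel. ?H z = 0"
  proof (rule integral_continuous_zero_imp_AE_zero[OF H])
    fix k :: "'d cfun"
    assume kc: "continuous_on UNIV k" and kb: "\<And>x. norm (k x) \<le> 1" and ki: "integrable lborel k"
    note [measurable] = borel_measurable_continuous_onI[OF kc]
    have zero: "(LINT z|lborel. ?H z * (LINT \<eta>|lborel. k (z - \<sigma> *\<^sub>R \<eta>) * of_real (gauss \<eta>))) = 0" if \<sigma>: "0 < \<sigma>" for \<sigma>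
    proof -
      let ?g = "\<lambda>z y. complex_of_real ((1 / \<sigma>) ^ CARD('d) * gauss ((1 / \<sigma>) *\<^sub>R (z - y)))"
      obtain B where B: "gauss z \<le> B / wt 0 z" for z :: "real ^ 'd" using gauss_decay by blast
      have gB: "norm (?g z y) \<le> (1 / \<sigma>) ^ CARD('d) * B" for z y :: "real ^ 'd"
        using B[of "(1 / \<sigma>) *\<^sub>R (z - y)"] \<sigma> by (simp add: abs_of_pos[OF gauss_pos] wt_def norm_mult norm_power norm_divide mult_left_mono divide_right_mono)
      have "(LINT \<eta>|lborel. k (z - \<sigma> *\<^sub>R \<eta>) * of_real (gauss \<eta>)) = (LINT y|lborel. k y * ?g z y)" for z
      proof -
        have "(LINT y|lborel. k y * ?g z y) = of_real (\<bar>- \<sigma>\<bar> ^ CARD('d)) * (LINT \<eta>|lborel. k (z + (- \<sigma>) *\<^sub>R \<eta>) * ?g z (z + (- \<sigma>) *\<^sub>R \<eta>))"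
          using \<sigma> by (intro lborel_integral_scale) auto
        also have "... = (LINT \<eta>|lborel. k (z - \<sigma> *\<^sub>R \<eta>) * of_real (gauss \<eta>))"
          using \<sigma> by (simp add: power_one_over field_simps flip: integral_cmult)
        finally show ?thesis ..
      qed
      then have "(LINT z|lborel. ?H z * (LINT \<eta>|lborel. k (z - \<sigma> *\<^sub>R \<eta>) * of_real (gauss \<eta>))) = (LINT z|lborel. ?H z * (LINT y|lborel. k y * ?g z y))"
        by simp
      also have "... = (LINT y|lborel. k y * (LINT z|lborel. ?H z * ?g z y))"
        using H ki gB dm2.integral_kernel_swap[of Euclidean ?H k ?g "(1 / \<sigma>) ^ CARD('d) * B"] by (simp add: dm_Euclidean)
      also have "... = (LINT y|lborel. k y * 0)"
      proof (intro Bochner_Integration.integral_cong arg_cong2[where f="(*)"] refl)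
        fix y :: "real ^ 'd"
        have "(LINT z|lborel. ?H z * ?g z y) = of_real ((1 / \<sigma>) ^ CARD('d)) * (LINT z|lborel. f z * (of_real (gauss z) * of_real (gauss ((1 / \<sigma>) *\<^sub>R (z - y)))))"
          by (simp add: mult_ac flip: integral_cmult)
        also have "... = 0" using Z[OF gauss_product_test_function[OF \<sigma>, of y]] by simp
        finally show "(LINT z|lborel. ?H z * ?g z y) = 0" .
      qed
      finally show ?thesis by simp
    qed
    let ?s = "\<lambda>n. 1 / real (Suc n)"
    have s0: "?s \<longlonglongrightarrow> 0" using LIMSEQ_Suc[OF lim_1_over_n] .
    have "(\<lambda>n. LINT z|lborel. ?H z * (LINT \<eta>|lborel. k (z - ?s n *\<^sub>R \<eta>) * of_real (gauss \<eta>))) \<longlonglongrightarrow> (LINT z|lborel. ?H z * k z)"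
    proof (rule integral_dominated_convergence)
      show "integrable lborel (\<lambda>z. norm (?H z))" using H by simp
      show "AE z in lborel. (\<lambda>n. ?H z * (LINT \<eta>|lborel. k (z - ?s n *\<^sub>R \<eta>) * of_real (gauss \<eta>))) \<longlonglongrightarrow> ?H z * k z"
        by (intro AE_I2 tendsto_mult tendsto_const gauss_approximate_identity[OF kc kb s0])
      have inner: "norm (LINT \<eta>|lborel. k (z - ?s n *\<^sub>R \<eta>) * of_real (gauss \<eta>)) \<le> 1" for z n
      proof -
        have "norm (LINT \<eta>|lborel. k (z - ?s n *\<^sub>R \<eta>) * of_real (gauss \<eta>)) \<le> (LINT \<eta>|lborel. norm (k (z - ?s n *\<^sub>R \<eta>) * of_real (gauss \<eta>)))"
          by (rule integral_norm_bound)
        also have "... \<le> (LINT (\<eta> :: real ^ 'd)|lborel. gauss \<eta>)"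
          using kb by (intro integral_mono' integrable_gauss)
            (auto simp: norm_mult abs_of_pos[OF gauss_pos] less_imp_le[OF gauss_pos] intro!: mult_left_le_one_le)
        also have "... = 1" using integral_gauss[where 'd='d] by (simp only: integral_complex_of_real of_real_eq_1_iff)
        finally show ?thesis .
      qed
      show "AE z in lborel. norm (?H z * (LINT \<eta>|lborel. k (z - ?s n *\<^sub>R \<eta>) * of_real (gauss \<eta>))) \<le> norm (?H z)" for n
        using inner[where n=n] unfolding norm_mult[of "?H _"] by (intro AE_I2 mult_left_le) auto
      have "(\<lambda>z. LINT \<eta>|lborel. k (z - ?s n *\<^sub>R \<eta>) * of_real (gauss \<eta>)) \<in> borel_measurable borel" for n
        by (rule lborel.borel_measurable_lebesgue_integral) (simp add: case_prod_unfold)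
      then show "(\<lambda>z. ?H z * (LINT \<eta>|lborel. k (z - ?s n *\<^sub>R \<eta>) * of_real (gauss \<eta>))) \<in> borel_measurable lborel" for n by simp
    qed simp
    moreover have "(LINT z|lborel. ?H z * (LINT \<eta>|lborel. k (z - ?s n *\<^sub>R \<eta>) * of_real (gauss \<eta>))) = 0" for n
      by (rule zero) simp
    ultimately show "(LINT z|lborel. ?H z * k z) = 0" by (simp only: LIMSEQ_const_iff)
  qed
  then show ?thesis
  proof eventually_elim
    fix z assume "?H z = 0"
    then show "f z = 0" using gauss_pos[of z] by simp
  qed
qed

lemma is_fourier_unique:
  fixes g h :: "'d::finite cfun"
  assumes "is_fourier M T g" "is_fourier M T h"
  shows "AE z in dual_measure M. g z = h z"
proof (cases M)
  case Euclidean
  have [measurable]: "g \<in> borel_measurable borel" "h \<in> borel_measurable borel"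
    using assms by (auto simp: is_fourier_def Euclidean)
  have A: "AE z in lborel. g z - h z = 0"
  proof (rule fourier_unique_Euclidean)
    fix \<psi> :: "'d cfun" assume "\<psi> \<in> test_functions Euclidean"
    then have "integrable lborel (\<lambda>z. g z * \<psi> z)" "integrable lborel (\<lambda>z. h z * \<psi> z)"
      "(LINT z|lborel. g z * \<psi> z) = (LINT z|lborel. h z * \<psi> z)"
      using assms by (auto simp: is_fourier_def Euclidean)
    then show "integrable lborel (\<lambda>z. (g z - h z) * \<psi> z)" "(LINT z|lborel. (g z - h z) * \<psi> z) = 0"
      by (simp_all add: left_diff_distrib)
  qed simp
  have *: "dual_measure Euclidean = (lborel :: (real ^ 'd) measure)" by (simp add: dual_measure_def)
  show ?thesis unfolding Euclidean * using A by simp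
next
  case Torus
  have *: "dual_measure Torus = count_space (lattice :: (real ^ 'd) set)" by (simp add: dual_measure_def)
  show ?thesis using assms unfolding Torus * by (simp add: is_fourier_def AE_count_space)
qed

lemma is_fourier_fourier: "is_fourier M T g ==> is_fourier M T (fourier M T)"
  unfolding fourier_def by (rule someI[where P="is_fourier M T"])

lemma fourier_AE: "is_fourier M T g ==> AE z in dual_measure M. fourier M T z = g z"
  by (rule is_fourier_unique[OF is_fourier_fourier])

lemma is_fourier_diff:
  fixes S T :: "'d::finite distr"
  assumes "is_fourier M S g" "is_fourier M T h"
  shows "is_fourier M (S - T) (\<lambda>z. g z - h z)"
  using assms by (cases M) (auto simp: is_fourier_def left_diff_distrib right_diff_distrib)

lemma is_fourier_fdist_test:
  fixes \<phi> :: "'d::finite cfun"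
  assumes \<phi>: "\<phi> \<in> test_functions M"
  shows "is_fourier M (fdist M \<phi>) (fourier_fun M \<phi>)"
proof (cases M)
  case Euclidean
  have \<phi>i: "integrable lborel \<phi>" using integrable_test_function[OF \<phi>] by (simp add: Euclidean space_measure_def)
  have "integrable lborel (\<lambda>z. fourier_fun Euclidean \<phi> z * \<psi> z) \<and>
      fdist M \<phi> (fourier_fun Euclidean \<psi>) = (LINT z|lborel. fourier_fun Euclidean \<phi> z * \<psi> z)"
    if \<psi>: "\<psi> \<in> test_functions Euclidean" for \<psi>
  proof
    have \<psi>i: "integrable lborel \<psi>" using integrable_test_function[OF \<psi>] by (simp add: space_measure_def)
    have fb: "norm (fourier_fun Euclidean \<phi> z) \<le> norm (fourier_const TYPE('d)) * (LINT x|space_measure Euclidean. norm (\<phi> x))" for z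
      by (rule norm_fourier_fun_le)
    show "integrable lborel (\<lambda>z. fourier_fun Euclidean \<phi> z * \<psi> z)"
      using integrable_bounded_test[OF \<psi> _ fb] continuous_fourier_fun[of \<phi> Euclidean] \<phi>
      by (simp add: Euclidean space_measure_def borel_measurable_continuous_onI)
    have "fdist M \<phi> (fourier_fun Euclidean \<psi>) = fourier_const TYPE('d) * (LINT x|lborel. \<phi> x * (LINT y|lborel. \<psi> y * character y x))"
      by (simp add: fdist_def Euclidean space_measure_def fourier_fun_def inner_commute mult_ac flip: integral_cmult)
    also have "(LINT x|lborel. \<phi> x * (LINT y|lborel. \<psi> y * character y x)) = (LINT y|lborel. \<psi> y * (LINT x|lborel. \<phi> x * character y x))"
      using \<phi>i \<psi>i dm2.integral_kernel_swap[of Euclidean \<phi> \<psi> "\<lambda>x y. character y x" 1] by (simp add: dm_Euclidean)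
    also have "fourier_const TYPE('d) * ... = (LINT z|lborel. fourier_fun Euclidean \<phi> z * \<psi> z)"
      by (simp add: fourier_fun_def space_measure_def mult_ac flip: integral_cmult)
    finally show "fdist M \<phi> (fourier_fun Euclidean \<psi>) = (LINT z|lborel. fourier_fun Euclidean \<phi> z * \<psi> z)" .
  qed
  moreover have "fourier_fun Euclidean \<phi> \<in> borel_measurable borel"
    using continuous_fourier_fun[of \<phi> Euclidean] \<phi> by (simp add: Euclidean borel_measurable_continuous_onI)
  ultimately show ?thesis by (simp add: is_fourier_def Euclidean)
next
  case Torus
  then show ?thesis by (simp add: is_fourier_def fourier_fun_def fdist_def)
qed

section \<open>Norms on the Fourier side\<close>

lemma ennpow_mono: "a \<le> b ==> 0 \<le> r ==> ennpow a r \<le> ennpow b r"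
  by (auto simp: ennpow_def top_unique intro!: ennreal_leI powr_mono2 enn2real_mono simp: less_top)

lemma ennpow_ennreal: "0 \<le> x ==> ennpow (ennreal x) r = ennreal (x powr r)"
  by (simp add: ennpow_def)

lemma ennpow_top [simp]: "ennpow top r = top"
  by (simp add: ennpow_def)

lemma ennpow_0 [simp]: "ennpow 0 r = 0"
  by (simp add: ennpow_def)

lemma ennpow_1 [simp]: "ennpow a 1 = a"
  by (cases a) (simp_all add: ennpow_ennreal)

lemma ennpow_cmult: "0 < c ==> ennpow (ennreal c * a) r = ennreal (c powr r) * ennpow a r"
  by (cases a) (simp_all add: ennpow_ennreal powr_mult ennreal_mult_top flip: ennreal_mult)

lemma ennpow_inverse: "0 < r ==> ennpow (ennpow a r) (1 / r) = a"
  by (cases a) (simp_all add: ennpow_ennreal powr_powr)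

lemma ennpow_add_le: "0 \<le> r ==> ennpow (a + b) r \<le> ennreal (2 powr r) * (ennpow a r + ennpow b r)"
proof -
  assume r: "0 \<le> r"
  have "ennpow (a + b) r \<le> ennpow (ennreal 2 * max a b) r"
    using r by (intro ennpow_mono) (auto simp: max_def mult_2 intro: add_mono)
  also have "... = ennreal (2 powr r) * ennpow (max a b) r" by (rule ennpow_cmult) simp
  also have "... \<le> ennreal (2 powr r) * (ennpow a r + ennpow b r)"
    by (intro mult_left_mono) (auto simp: max_def add_increasing add_increasing2)
  finally show ?thesis .
qed

lemma ennpow_borel [measurable]:
  assumes [measurable]: "f \<in> borel_measurable N"
  shows "(\<lambda>x. ennpow (f x) r) \<in> borel_measurable N"
  unfolding ennpow_def by measurable

lemma enn2real_ge_1: "1 \<le> p ==> p \<noteq> \<infinity> ==> 1 \<le> enn2real p"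
  by (cases p) (auto simp flip: ennreal_1)

lemma Lp_norm_mono:
  assumes le: "AE x in N. f x \<le> g x" and f: "f \<in> borel_measurable N" and p: "1 \<le> p"
  shows "Lp_norm p N f \<le> Lp_norm p N g"
proof (cases "p = \<infinity>")
  case True
  then show ?thesis using le f by (simp add: Lp_norm_def esssup_AE_mono)
next
  case False
  then have p1: "1 \<le> enn2real p" using p by (rule enn2real_ge_1[rotated])
  have "(\<integral>\<^sup>+x. ennpow (f x) (enn2real p) \<partial>N) \<le> (\<integral>\<^sup>+x. ennpow (g x) (enn2real p) \<partial>N)"
    using le p1 by (intro nn_integral_mono_AE) (auto elim!: eventually_mono intro!: ennpow_mono)
  then show ?thesis using False by (simp add: Lp_norm_def ennpow_mono)
qed

lemma Lp_norm_cong_AE: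
  assumes "AE x in N. f x = g x" "f \<in> borel_measurable N" "g \<in> borel_measurable N" "1 \<le> p"
  shows "Lp_norm p N f = Lp_norm p N g"
  using assms by (intro antisym Lp_norm_mono) (auto elim!: eventually_mono)

lemma Lp_norm_1: "Lp_norm 1 N f = (\<integral>\<^sup>+x. f x \<partial>N)"
  by (simp add: Lp_norm_def)

text \<open>A quasi-triangle inequality suffices, since the norms only have to be made small.\<close>

lemma Lp_norm_quasi_triangle:
  assumes h: "h \<in> borel_measurable N" and f: "f \<in> borel_measurable N" and g: "g \<in> borel_measurable N"
    and le: "\<And>x. h x \<le> ennreal c * (f x + g x)" and c: "0 < c" and p: "1 \<le> p"
  shows "Lp_norm p N h \<le> ennreal (4 * c) * (Lp_norm p N f + Lp_norm p N g)"
proof (cases "p = \<infinity>")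
  case True
  have "AE x in N. h x \<le> ennreal c * (esssup N f + esssup N g)"
    using esssup_AE[of f N] esssup_AE[of g N]
  proof eventually_elim
    fix x assume "f x \<le> esssup N f" "g x \<le> esssup N g"
    then have "ennreal c * (f x + g x) \<le> ennreal c * (esssup N f + esssup N g)"
      by (intro mult_left_mono add_mono) auto
    then show "h x \<le> ennreal c * (esssup N f + esssup N g)" using le[of x] by (rule order_trans[rotated])
  qed
  then have "esssup N h \<le> ennreal c * (esssup N f + esssup N g)" by (intro esssup_I h)
  also have "... \<le> ennreal (4 * c) * (esssup N f + esssup N g)"
    using c by (intro mult_right_mono ennreal_leI) auto
  finally show ?thesis using True by (simp add: Lp_norm_def)
next
  case False
  define r where "r = enn2real p"
  have r: "1 \<le> r" unfolding r_def using False p by (rule enn2real_ge_1[rotated])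
  let ?F = "\<integral>\<^sup>+x. ennpow (f x) r \<partial>N" and ?G = "\<integral>\<^sup>+x. ennpow (g x) r \<partial>N"
  have "(\<integral>\<^sup>+x. ennpow (h x) r \<partial>N) \<le> (\<integral>\<^sup>+x. ennreal ((2 * c) powr r) * (ennpow (f x) r + ennpow (g x) r) \<partial>N)"
  proof (rule nn_integral_mono)
    fix x
    have "ennpow (h x) r \<le> ennpow (ennreal c * (f x + g x)) r" using r le by (intro ennpow_mono) auto
    also have "... = ennreal (c powr r) * ennpow (f x + g x) r" by (rule ennpow_cmult[OF c])
    also have "... \<le> ennreal (c powr r) * (ennreal (2 powr r) * (ennpow (f x) r + ennpow (g x) r))"
      using r by (intro mult_left_mono ennpow_add_le) auto
    also have "... = ennreal ((2 * c) powr r) * (ennpow (f x) r + ennpow (g x) r)"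
      using c by (simp add: powr_mult ennreal_mult mult_ac)
    finally show "ennpow (h x) r \<le> ennreal ((2 * c) powr r) * (ennpow (f x) r + ennpow (g x) r)" .
  qed
  also have "... = ennreal ((2 * c) powr r) * (?F + ?G)"
    using f g by (simp add: nn_integral_cmult nn_integral_add)
  finally have "ennpow (\<integral>\<^sup>+x. ennpow (h x) r \<partial>N) (1 / r) \<le> ennpow (ennreal ((2 * c) powr r) * (?F + ?G)) (1 / r)"
    using r by (intro ennpow_mono) auto
  also have "... = ennreal (2 * c) * ennpow (?F + ?G) (1 / r)"
    using r c by (subst ennpow_cmult) (auto simp: powr_powr)
  also have "... \<le> ennreal (2 * c) * (ennreal (2 powr (1 / r)) * (ennpow ?F (1 / r) + ennpow ?G (1 / r)))"
    using r by (intro mult_left_mono ennpow_add_le) auto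
  also have "... \<le> ennreal (2 * c) * (ennreal 2 * (ennpow ?F (1 / r) + ennpow ?G (1 / r)))"
  proof -
    have "2 powr (1 / r) \<le> 2 powr (1 :: real)" using r by (intro powr_mono) auto
    then show ?thesis by (intro mult_left_mono mult_right_mono ennreal_leI) auto
  qed
  also have "... = ennreal (4 * c) * (ennpow ?F (1 / r) + ennpow ?G (1 / r))"
  proof -
    have "ennreal (4 * c) = ennreal (2 * c) * ennreal 2" using c by (subst ennreal_mult[symmetric]) auto
    then show ?thesis by (simp only: mult.assoc)
  qed
  finally show ?thesis using False by (simp add: Lp_norm_def r_def)
qed

text \<open>The inclusion of l^1 in l^q: no term exceeds the sum \<open>S\<close>, so each
  \<open>r\<close>-th power is at most \<open>S powr (r - 1)\<close> times the term itself.\<close>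

lemma Lp_norm_count_space_le:
  assumes q: "1 \<le> q"
  shows "Lp_norm q (count_space A) h \<le> (\<integral>\<^sup>+x. h x \<partial>count_space A)"
proof -
  let ?S = "\<integral>\<^sup>+x. h x \<partial>count_space A"
  have hS: "h x \<le> ?S" if "x \<in> A" for x using that by (rule nn_integral_ge_point)
  show ?thesis
  proof (cases "q = \<infinity> \<or> ?S = \<infinity>")
    case True
    then show ?thesis using hS by (auto simp: Lp_norm_def AE_count_space intro!: esssup_I)
  next
    case False
    define r where "r = enn2real q"
    have r: "1 \<le> r" unfolding r_def using False q by (intro enn2real_ge_1) auto
    obtain S where S: "?S = ennreal S" "0 \<le> S" using False by (cases ?S) auto
    have "(\<integral>\<^sup>+x. ennpow (h x) r \<partial>count_space A) \<le> (\<integral>\<^sup>+x. ennreal (S powr (r - 1)) * h x \<partial>count_space A)"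
    proof (rule nn_integral_mono)
      fix x assume "x \<in> space (count_space A)"
      then have "h x \<le> ennreal S" using hS[of x] S by simp
      then obtain y where y: "h x = ennreal y" "0 \<le> y" "y \<le> S"
        using S(2) by (cases "h x") (auto simp: top_unique)
      have "y powr r = y powr (r - 1) * y"
        using y(2) r by (cases "y = 0") (simp_all add: powr_diff)
      also have "... \<le> S powr (r - 1) * y" using y r by (intro mult_right_mono powr_mono2) auto
      finally show "ennpow (h x) r \<le> ennreal (S powr (r - 1)) * h x"
        using y by (simp add: ennpow_ennreal ennreal_leI flip: ennreal_mult)
    qed
    also have "... = ennreal (S powr (r - 1)) * ?S" by (intro nn_integral_cmult) simp
    also have "... = ennpow ?S r"
    proof -
      have "S powr r = S powr (r - 1) * S"
        using S(2) r by (cases "S = 0") (simp_all add: powr_diff)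
      then show ?thesis using S by (simp add: ennpow_ennreal flip: ennreal_mult)
    qed
    finally have "ennpow (\<integral>\<^sup>+x. ennpow (h x) r \<partial>count_space A) (1 / r) \<le> ennpow (ennpow ?S r) (1 / r)"
      using r by (intro ennpow_mono) auto
    then show ?thesis using r False ennpow_inverse[of r ?S] by (simp add: Lp_norm_def r_def)
  qed
qed

lemma Lp_norm_count_space_ge:
  assumes q: "1 \<le> q" and x: "x \<in> A"
  shows "h x \<le> Lp_norm q (count_space A) h"
proof (cases "q = \<infinity>")
  case True
  have "AE x in count_space A. h x \<le> esssup (count_space A) h" by (rule esssup_AE)
  then show ?thesis using True x by (simp add: Lp_norm_def AE_count_space)
next
  case False
  then have r: "1 \<le> enn2real q" using q by (intro enn2real_ge_1)
  have "ennpow (h x) (enn2real q) \<le> (\<integral>\<^sup>+x. ennpow (h x) (enn2real q) \<partial>count_space A)"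
    by (rule nn_integral_ge_point[OF x])
  then have "ennpow (ennpow (h x) (enn2real q)) (1 / enn2real q) \<le> Lp_norm q (count_space A) h"
    using r False by (simp add: Lp_norm_def ennpow_mono)
  then show ?thesis using r ennpow_inverse[of "enn2real q" "h x"] by simp
qed

lemma Lp_norm_cell_le:
  fixes h :: "real ^ 'd::finite => ennreal"
  assumes p: "1 \<le> p" and h: "h \<in> borel_measurable borel" and b: "\<And>z. h z \<le> ennreal B * indicator (unit_cell n) z" and B: "0 \<le> B"
  shows "Lp_norm p lborel h \<le> ennreal B"
proof (cases "p = \<infinity>")
  case True
  have "h z \<le> ennreal B" for z using order_trans[OF b, of z "ennreal B"] by (simp add: indicator_def)
  then show ?thesis using True h by (auto simp: Lp_norm_def intro!: esssup_I)
next
  case False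
  define r where "r = enn2real p"
  have r: "1 \<le> r" unfolding r_def using False p by (intro enn2real_ge_1)
  have "(\<integral>\<^sup>+z. ennpow (h z) r \<partial>lborel) \<le> (\<integral>\<^sup>+z. ennpow (ennreal B) r * indicator (unit_cell n) z \<partial>lborel)"
  proof (rule nn_integral_mono)
    fix z
    have "ennpow (h z) r \<le> ennpow (ennreal B * indicator (unit_cell n) z) r" using r b by (intro ennpow_mono) auto
    then show "ennpow (h z) r \<le> ennpow (ennreal B) r * indicator (unit_cell n) z"
      by (cases "z \<in> unit_cell n") simp_all
  qed
  also have "... = ennpow (ennreal B) r" by (subst nn_integral_cmult_indicator) (simp_all add: emeasure_unit_cell)
  finally have "ennpow (\<integral>\<^sup>+z. ennpow (h z) r \<partial>lborel) (1 / r) \<le> ennpow (ennpow (ennreal B) r) (1 / r)"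
    using r by (intro ennpow_mono) auto
  then show ?thesis using r False ennpow_inverse[of r "ennreal B"] by (simp add: Lp_norm_def r_def)
qed

text \<open>Hoelder's inequality on a set of measure 1, up to a factor 2. It comes from the
  pointwise split \<open>y \<le> \<theta> + \<theta> powr (1 - r) * y powr r\<close>, where each of
  the two terms integrates to at most \<theta>.\<close>

lemma nn_integral_le_Lp_norm_cell:
  fixes h :: "real ^ 'd::finite => ennreal"
  assumes p: "1 \<le> p" and h [measurable]: "h \<in> borel_measurable borel" and Z: "\<And>z. z \<notin> unit_cell n ==> h z = 0"
  shows "(\<integral>\<^sup>+z. h z \<partial>lborel) \<le> 2 * Lp_norm p lborel h"
proof (cases "p = \<infinity>")
  case True
  have "AE z in lborel. h z \<le> esssup lborel h * indicator (unit_cell n) z"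
    using esssup_AE[of h lborel] by eventually_elim (use Z in \<open>auto simp: indicator_def\<close>)
  then have "(\<integral>\<^sup>+z. h z \<partial>lborel) \<le> (\<integral>\<^sup>+z. esssup lborel h * indicator (unit_cell n) z \<partial>lborel)"
    by (rule nn_integral_mono_AE)
  also have "... = esssup lborel h" by (subst nn_integral_cmult_indicator) (simp_all add: emeasure_unit_cell)
  also have "... \<le> 2 * esssup lborel h" by (simp add: mult_2 add_increasing2)
  finally show ?thesis using True by (simp add: Lp_norm_def)
next
  case False
  define r where "r = enn2real p"
  have r: "1 \<le> r" unfolding r_def using False p by (intro enn2real_ge_1)
  define I where "I = (\<integral>\<^sup>+z. ennpow (h z) r \<partial>lborel)"
  have L: "Lp_norm p lborel h = ennpow I (1 / r)" using False by (simp add: Lp_norm_def I_def r_def)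
  show ?thesis
  proof (cases "I = top")
    case True
    then show ?thesis by (simp add: L)
  next
    case fin: False
    then obtain J where J: "I = ennreal J" "0 \<le> J" by (cases I) auto
    let ?N = "J powr (1 / r)"
    \<comment> \<open>The level \<theta> has to be positive, while the norm \<open>?N\<close> may be
      0; it is therefore taken slightly above \<open>?N\<close>, and the excess is removed at the
      end.\<close>
    have bound: "(\<integral>\<^sup>+z. h z \<partial>lborel) \<le> ennreal (2 * \<theta>)" if l: "?N \<le> \<theta>" "0 < \<theta>" for \<theta>
    proof -
      have "(\<integral>\<^sup>+z. h z \<partial>lborel) \<le> (\<integral>\<^sup>+z. ennreal \<theta> * indicator (unit_cell n) z + ennreal (\<theta> powr (1 - r)) * ennpow (h z) r \<partial>lborel)"
      proof (rule nn_integral_mono)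
        fix z
        show "h z \<le> ennreal \<theta> * indicator (unit_cell n) z + ennreal (\<theta> powr (1 - r)) * ennpow (h z) r"
        proof (cases "z \<in> unit_cell n")
          case True
          show ?thesis
          proof (cases "h z")
            case (real y)
            have "y \<le> \<theta> + \<theta> powr (1 - r) * y powr r"
            proof (cases "y \<le> \<theta>")
              case True
              then show ?thesis by (simp add: add_increasing2)
            next
              case F: False
              then have y: "0 < y" using l by linarith
              have "y = y powr (1 - r) * y powr r" using y by (simp flip: powr_add)
              also have "... \<le> \<theta> powr (1 - r) * y powr r"
                using F l r by (intro mult_right_mono powr_mono2') auto
              finally show ?thesis using l by linarith
            qed
            then show ?thesis using True real l by (simp add: ennpow_ennreal ennreal_leI flip: ennreal_mult ennreal_plus)
          next
            case top
            then show ?thesis using l by (simp add: ennreal_mult_top)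
          qed
        qed (simp add: Z)
      qed
      also have "... = ennreal \<theta> + ennreal (\<theta> powr (1 - r)) * I"
        unfolding I_def by (subst nn_integral_add) (simp_all add: nn_integral_cmult nn_integral_cmult_indicator emeasure_unit_cell)
      also have "... \<le> ennreal (2 * \<theta>)"
      proof -
        have "J = ?N powr r" using J r by (simp add: powr_powr)
        also have "... \<le> \<theta> powr r" using l r by (intro powr_mono2) auto
        finally have "\<theta> powr (1 - r) * J \<le> \<theta> powr (1 - r) * \<theta> powr r" by (intro mult_left_mono) auto
        also have "... = \<theta>" using l by (simp flip: powr_add)
        finally show ?thesis using J l by (simp add: ennreal_leI flip: ennreal_mult ennreal_plus)
      qed
      finally show ?thesis .
    qed
    show ?thesis
    proof (rule ennreal_le_epsilon)
      fix e :: real assume e: "0 < e"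
      have "(\<integral>\<^sup>+z. h z \<partial>lborel) \<le> ennreal (2 * (?N + e / 2))" using e by (intro bound) (auto intro: add_nonneg_pos)
      also have "... = 2 * Lp_norm p lborel h + ennreal e"
      proof -
        have "2 * Lp_norm p lborel h = ennreal (2 * ?N)"
          unfolding L J(1) ennpow_ennreal[OF J(2)] by (simp add: ennreal_mult')
        moreover have "ennreal (2 * ?N) + ennreal e = ennreal (2 * (?N + e / 2))"
          using e by (subst ennreal_plus[symmetric]) auto
        ultimately show ?thesis by simp
      qed
      finally show "(\<integral>\<^sup>+z. h z \<partial>lborel) \<le> 2 * Lp_norm p lborel h + ennreal e" .
    qed
  qed
qed

lemma bracket_ge_1: "1 \<le> bracket n"
  by (simp add: bracket_def)

lemma bracket_0 [simp]: "bracket 0 = 1"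
  by (simp add: bracket_def)

lemma bracket_powr_mono: "s \<le> r ==> bracket n powr s \<le> bracket n powr r"
  by (intro powr_mono bracket_ge_1)

lemma bracket_borel [measurable]: "bracket \<in> borel_measurable borel"
  unfolding bracket_def by measurable

text \<open>The exponents cover a regularity in \<open>[-1, 0]\<close>, lowered by 1 for the
  velocity. One unit of weight is spent here, which is why decay of order
  \<open>Suc CARD('d)\<close> appears in the norm bounds.\<close>

lemma bracket_peetre:
  fixes n a :: "real ^ 'd::finite"
  assumes r: "- 2 \<le> r" "r \<le> 0"
  shows "bracket n powr r \<le> 2 * bracket a powr r * wt 1 (n - a)"
proof -
  have b2: "(bracket x)^2 = wt 1 x" for x :: "real ^ 'd" by (simp add: bracket_def wt_def)
  have pos: "0 < bracket x" for x :: "real ^ 'd" using bracket_ge_1[of x] by linarith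
  have "(bracket a)^2 \<le> 2 * ((bracket n)^2 * (bracket (n - a))^2)"
    using wt_add_mult_le[of 1 n "a - n"] by (simp add: b2 wt_minus_commute)
  also have "... = (sqrt 2 * bracket n * bracket (n - a))^2" by (simp add: power_mult_distrib)
  finally have "bracket a \<le> sqrt 2 * bracket n * bracket (n - a)"
    using pos by (intro power2_le_imp_le[of "bracket a"]) (auto simp: less_imp_le)
  then have "bracket a powr (- r) \<le> (sqrt 2 * bracket n * bracket (n - a)) powr (- r)"
    using r less_imp_le[OF pos] by (intro powr_mono2) auto
  also have "... = sqrt 2 powr (- r) * (bracket n powr (- r) * bracket (n - a) powr (- r))"
    using less_imp_le[OF pos] by (simp add: powr_mult)
  also have "... \<le> sqrt 2 powr 2 * (bracket n powr (- r) * bracket (n - a) powr 2)"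
    using r bracket_ge_1[of "n - a"] bracket_ge_1[of n] by (intro mult_mono powr_mono) auto
  also have "... = 2 * wt 1 (n - a) * bracket n powr (- r)"
    using pos[of "n - a"] by (simp add: powr_numeral b2)
  finally have *: "bracket a powr (- r) \<le> 2 * wt 1 (n - a) * bracket n powr (- r)" .
  have inv: "bracket x powr r * bracket x powr (- r) = 1" for x :: "real ^ 'd"
    using pos[of x] by (simp flip: powr_add)
  have "bracket n powr r = bracket n powr r * (bracket a powr r * bracket a powr (- r))" by (simp add: inv)
  also have "... \<le> bracket n powr r * (bracket a powr r * (2 * wt 1 (n - a) * bracket n powr (- r)))"
    by (intro mult_left_mono *) auto
  also have "... = 2 * bracket a powr r * wt 1 (n - a) * (bracket n powr r * bracket n powr (- r))" by (simp add: mult_ac)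
  finally show ?thesis by (simp add: inv)
qed

text \<open>The norm is read off a given representative of the transform, so that computations avoid
  the choice inside \<open>fourier\<close>.\<close>

definition XF_norm :: "base_space => ennreal => ennreal => real => 'd::finite cfun => ennreal" where
  "XF_norm M p q s g = (case M of
     Euclidean => Lp_norm q (count_space lattice) (\<lambda>n. ennreal (bracket n powr s) *
       Lp_norm p lborel (\<lambda>z. ennreal (indicator (unit_cell n) z * norm (g z))))
   | Torus => Lp_norm q (count_space lattice) (\<lambda>z. ennreal (bracket z powr s * norm (g z))))"

lemma X_norm_fourier: "X_norm M p q s T = XF_norm M p q s (fourier M T)"
  by (cases M) (simp_all add: X_norm_def XF_norm_def amalgam_norm_def FL_norm_def dual_measure_def)

lemma is_fourier_borel: "is_fourier Euclidean T g ==> g \<in> borel_measurable borel"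
  by (simp add: is_fourier_def)

text \<open>Borel measurability is demanded in the Euclidean case only: on the torus
  \<open>fourier\<close> may be any function off the lattice, and for the counting measure every
  function is measurable.\<close>

lemma XF_norm_cong_AE:
  fixes g h :: "'d::finite cfun"
  assumes eq: "AE z in dual_measure M. g z = h z" and p: "1 \<le> p"
    and b: "M = Euclidean ==> g \<in> borel_measurable borel" "M = Euclidean ==> h \<in> borel_measurable borel"
  shows "XF_norm M p q s g = XF_norm M p q s h"
proof (cases M)
  case Euclidean
  have [measurable]: "g \<in> borel_measurable borel" "h \<in> borel_measurable borel" using b Euclidean by auto
  have *: "dual_measure Euclidean = (lborel :: (real ^ 'd) measure)" by (simp add: dual_measure_def)
  have "Lp_norm p lborel (\<lambda>z. ennreal (indicator (unit_cell n) z * norm (g z))) = Lp_norm p lborel (\<lambda>z. ennreal (indicator (unit_cell n) z * norm (h z)))"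
    for n :: "real ^ 'd"
    using eq[unfolded Euclidean *] by (intro Lp_norm_cong_AE p) (auto elim!: eventually_mono)
  then show ?thesis by (simp add: XF_norm_def Euclidean)
next
  case Torus
  have *: "dual_measure Torus = count_space (lattice :: (real ^ 'd) set)" by (simp add: dual_measure_def)
  have "\<forall>z\<in>lattice. g z = h z" using eq[unfolded Torus *] by (simp add: AE_count_space)
  then have "(\<integral>\<^sup>+z. ennpow (ennreal (bracket z powr s * norm (g z))) r \<partial>count_space lattice) = (\<integral>\<^sup>+z. ennpow (ennreal (bracket z powr s * norm (h z))) r \<partial>count_space lattice)" for r
    by (intro nn_integral_cong) simp
  moreover have "esssup (count_space lattice) (\<lambda>z. ennreal (bracket z powr s * norm (g z))) = esssup (count_space lattice) (\<lambda>z. ennreal (bracket z powr s * norm (h z)))"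
    using \<open>\<forall>z\<in>lattice. g z = h z\<close> by (intro esssup_AE_cong) (auto simp: AE_count_space)
  ultimately show ?thesis by (simp add: XF_norm_def Torus Lp_norm_def)
qed

lemma X_norm_eq:
  fixes g :: "'d::finite cfun"
  assumes "is_fourier M T g" "1 \<le> p"
  shows "X_norm M p q s T = XF_norm M p q s g"
  unfolding X_norm_fourier using assms is_fourier_fourier[OF assms(1)]
  by (intro XF_norm_cong_AE fourier_AE) (auto dest: is_fourier_borel)

text \<open>Brackets are at least 1. This lets an arbitrarily negative regularity be raised into the
  range of \<open>bracket_peetre\<close>.\<close>

lemma XF_norm_mono_exponent:
  assumes "s \<le> r" "1 \<le> q"
  shows "XF_norm M p q s g \<le> XF_norm M p q r g"
  unfolding XF_norm_def using assms
  by (auto split: base_space.split intro!: Lp_norm_mono AE_I2 mult_right_mono ennreal_leI bracket_powr_mono)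

text \<open>The constant is \<open>4 * 4\<close>, one factor for the norm on a cell and one for the
  norm over the cells.\<close>

lemma XF_norm_quasi_triangle:
  fixes f g h :: "'d::finite cfun"
  assumes le: "\<And>z. norm (h z) \<le> norm (f z) + norm (g z)" and p: "1 \<le> p" and q: "1 \<le> q"
    and b: "M = Euclidean ==> f \<in> borel_measurable borel" "M = Euclidean ==> g \<in> borel_measurable borel" "M = Euclidean ==> h \<in> borel_measurable borel"
  shows "XF_norm M p q s h \<le> 16 * (XF_norm M p q s f + XF_norm M p q s g)"
proof (cases M)
  case Euclidean
  have [measurable]: "f \<in> borel_measurable borel" "g \<in> borel_measurable borel" "h \<in> borel_measurable borel" using b Euclidean by auto
  let ?L = "\<lambda>n f. Lp_norm p lborel (\<lambda>z. ennreal (indicator (unit_cell n) z * norm (f z)))"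
  have in_le: "?L n h \<le> ennreal (4 * 1) * (?L n f + ?L n g)" for n :: "real ^ 'd"
    using le by (intro Lp_norm_quasi_triangle p) (auto simp: indicator_def ennreal_leI simp flip: ennreal_plus)
  have "Lp_norm q (count_space lattice) (\<lambda>n. ennreal (bracket n powr s) * ?L n h)
      \<le> ennreal (4 * 4) * (Lp_norm q (count_space lattice) (\<lambda>n. ennreal (bracket n powr s) * ?L n f) + Lp_norm q (count_space lattice) (\<lambda>n. ennreal (bracket n powr s) * ?L n g))"
  proof (intro Lp_norm_quasi_triangle q)
    fix n :: "real ^ 'd"
    have "ennreal (bracket n powr s) * ?L n h \<le> ennreal (bracket n powr s) * (ennreal (4 * 1) * (?L n f + ?L n g))"
      by (intro mult_left_mono in_le) simp
    then show "ennreal (bracket n powr s) * ?L n h \<le> ennreal 4 * (ennreal (bracket n powr s) * ?L n f + ennreal (bracket n powr s) * ?L n g)"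
      by (simp add: distrib_left mult_ac)
  qed simp_all
  then show ?thesis by (simp add: XF_norm_def Euclidean)
next
  case Torus
  have "Lp_norm q (count_space lattice) (\<lambda>z. ennreal (bracket z powr s * norm (h z)))
      \<le> ennreal (4 * 1) * (Lp_norm q (count_space lattice) (\<lambda>z. ennreal (bracket z powr s * norm (f z))) + Lp_norm q (count_space lattice) (\<lambda>z. ennreal (bracket z powr s * norm (g z))))"
    using le mult_left_mono[OF le] by (intro Lp_norm_quasi_triangle q) (auto simp: ennreal_leI simp flip: ennreal_plus distrib_left)
  also have "... \<le> 16 * (Lp_norm q (count_space lattice) (\<lambda>z. ennreal (bracket z powr s * norm (f z))) + Lp_norm q (count_space lattice) (\<lambda>z. ennreal (bracket z powr s * norm (g z))))"
    by (intro mult_right_mono) auto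
  finally show ?thesis by (simp add: XF_norm_def Torus)
qed

text \<open>The product of the factor 2 in \<open>bracket_peetre\<close>, the comparison constant of
  a unit cell and the bound for the lattice sum.\<close>

definition XF_const :: "'d::finite itself => real" where
  "XF_const _ = 2 * (2 * (1 + real CARD('d))) ^ Suc CARD('d) * dmK Torus TYPE('d)"

lemma XF_const_nonneg [simp]: "0 \<le> XF_const TYPE('d::finite)"
  by (simp add: XF_const_def)

text \<open>The l^1 sum over cells dominates the norm, and Peetre's inequality moves the weight from
  \<open>n\<close> to the centre \<open>a\<close>. For \<open>r < 0\<close> the factor
  \<open>bracket a powr r\<close> is what makes a pulse small at high frequency.\<close>

lemma XF_norm_le:
  fixes g :: "'d::finite cfun"
  assumes g: "\<And>z. z \<in> dgrp M ==> norm (g z) \<le> K / wt (Suc CARD('d)) (z - a)" and K: "0 \<le> K"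
    and r: "- 2 \<le> r" "r \<le> 0" and p: "1 \<le> p" and q: "1 \<le> q" and b: "M = Euclidean ==> g \<in> borel_measurable borel"
  shows "XF_norm M p q r g \<le> ennreal (XF_const TYPE('d) * K * bracket a powr r)"
proof -
  define c where "c = (2 * (1 + real CARD('d))) ^ Suc CARD('d)"
  have c1: "1 \<le> c" unfolding c_def by (intro one_le_power) simp
  let ?B = "2 * c * K * bracket a powr r"
  have B: "0 \<le> ?B" using K c1 by (intro mult_nonneg_nonneg) auto
  have ptw: "bracket n powr r * (c * K / wt (Suc CARD('d)) (n - a)) \<le> ?B * (1 / wt CARD('d) (a - n))" for n :: "real ^ 'd"
  proof -
    have "bracket n powr r * (c * K / wt (Suc CARD('d)) (n - a)) \<le> (2 * bracket a powr r * wt 1 (n - a)) * (c * K / wt (Suc CARD('d)) (n - a))"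
      using K c1 by (intro mult_right_mono bracket_peetre r) auto
    also have "... = ?B * (1 / wt CARD('d) (a - n))"
      using wt_plus[of 1 "CARD('d)" "n - a"] by (simp add: wt_minus_commute[of _ a n] field_simps)
    finally show ?thesis .
  qed
  have sum: "(\<integral>\<^sup>+n. ennreal (?B * (1 / wt CARD('d) (a - n))) \<partial>count_space lattice) \<le> ennreal (XF_const TYPE('d) * K * bracket a powr r)"
  proof -
    have "(\<integral>\<^sup>+n. ennreal (1 / wt CARD('d) (a - n)) \<partial>count_space lattice) \<le> ennreal (dmK Torus TYPE('d))"
      using dmK(2)[where M=Torus and z=a] by (subst (asm) nn_integral_dm) (auto simp: dual_measure_def)
    then have "ennreal ?B * (\<integral>\<^sup>+n. ennreal (1 / wt CARD('d) (a - n)) \<partial>count_space lattice) \<le> ennreal ?B * ennreal (dmK Torus TYPE('d))"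
      by (rule mult_left_mono) simp
    moreover have "(\<integral>\<^sup>+n. ennreal (?B * (1 / wt CARD('d) (a - n))) \<partial>count_space lattice) = ennreal ?B * (\<integral>\<^sup>+n. ennreal (1 / wt CARD('d) (a - n)) \<partial>count_space lattice)"
    proof -
      have "(\<integral>\<^sup>+n. ennreal (?B * (1 / wt CARD('d) (a - n))) \<partial>count_space lattice) = (\<integral>\<^sup>+n. ennreal ?B * ennreal (1 / wt CARD('d) (a - n)) \<partial>count_space lattice)"
        by (simp only: ennreal_mult'[OF B])
      also have "... = ennreal ?B * (\<integral>\<^sup>+n. ennreal (1 / wt CARD('d) (a - n)) \<partial>count_space lattice)"
        by (rule nn_integral_cmult) simp
      finally show ?thesis .
    qed
    moreover have "ennreal ?B * ennreal (dmK Torus TYPE('d)) = ennreal (XF_const TYPE('d) * K * bracket a powr r)"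
    proof -
      have "XF_const TYPE('d) = 2 * c * dmK Torus TYPE('d)" unfolding XF_const_def c_def ..
      then show ?thesis by (simp only: ennreal_mult'[OF B, symmetric]) (simp add: mult_ac)
    qed
    ultimately show ?thesis by simp
  qed
  show ?thesis
  proof (cases M)
    case Euclidean
    have [measurable]: "g \<in> borel_measurable borel" using b Euclidean by simp
    have cell: "Lp_norm p lborel (\<lambda>z. ennreal (indicator (unit_cell n) z * norm (g z))) \<le> ennreal (c * K / wt (Suc CARD('d)) (n - a))" for n :: "real ^ 'd"
    proof (rule Lp_norm_cell_le[OF p])
      fix z :: "real ^ 'd"
      show "ennreal (indicator (unit_cell n) z * norm (g z)) \<le> ennreal (c * K / wt (Suc CARD('d)) (n - a)) * indicator (unit_cell n) z"
      proof (cases "z \<in> unit_cell n")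
        case True
        have "wt (Suc CARD('d)) (n - a) \<le> c * wt (Suc CARD('d)) (z - a)"
          using wt_unit_cell_le(2)[OF True, of "Suc CARD('d)" a] by (simp add: c_def wt_minus_commute[of _ a])
        then have "K / wt (Suc CARD('d)) (z - a) \<le> c * K / wt (Suc CARD('d)) (n - a)"
          using mult_left_mono[of "wt (Suc CARD('d)) (n - a)" "c * wt (Suc CARD('d)) (z - a)" K] K by (simp add: field_simps)
        then show ?thesis using g[of z] True by (simp add: Euclidean dgrp_def ennreal_leI)
      qed simp
    qed (use K c1 in auto)
    have "XF_norm M p q r g \<le> (\<integral>\<^sup>+n. ennreal (bracket n powr r) * Lp_norm p lborel (\<lambda>z. ennreal (indicator (unit_cell n) z * norm (g z))) \<partial>count_space lattice)"
      unfolding XF_norm_def Euclidean by (simp add: Lp_norm_count_space_le q)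
    also have "... \<le> (\<integral>\<^sup>+n. ennreal (?B * (1 / wt CARD('d) (a - n))) \<partial>count_space lattice)"
    proof (rule nn_integral_mono)
      fix n :: "real ^ 'd"
      have "ennreal (bracket n powr r) * Lp_norm p lborel (\<lambda>z. ennreal (indicator (unit_cell n) z * norm (g z))) \<le> ennreal (bracket n powr r) * ennreal (c * K / wt (Suc CARD('d)) (n - a))"
        by (intro mult_left_mono cell) simp
      also have "... = ennreal (bracket n powr r * (c * K / wt (Suc CARD('d)) (n - a)))" by (rule ennreal_mult'[symmetric]) simp
      also have "... \<le> ennreal (?B * (1 / wt CARD('d) (a - n)))" by (rule ennreal_leI[OF ptw])
      finally show "ennreal (bracket n powr r) * Lp_norm p lborel (\<lambda>z. ennreal (indicator (unit_cell n) z * norm (g z))) \<le> ennreal (?B * (1 / wt CARD('d) (a - n)))" .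
    qed
    finally show ?thesis using sum by (rule order_trans)
  next
    case Torus
    have "XF_norm M p q r g \<le> (\<integral>\<^sup>+n. ennreal (bracket n powr r * norm (g n)) \<partial>count_space lattice)"
      unfolding XF_norm_def Torus by (simp add: Lp_norm_count_space_le q)
    also have "... \<le> (\<integral>\<^sup>+n. ennreal (?B * (1 / wt CARD('d) (a - n))) \<partial>count_space lattice)"
    proof (intro nn_integral_mono ennreal_leI)
      fix n :: "real ^ 'd" assume n: "n \<in> space (count_space lattice)"
      have "norm (g n) \<le> K / wt (Suc CARD('d)) (n - a)" using n by (intro g) (simp add: Torus dgrp_def)
      also have "... \<le> c * K / wt (Suc CARD('d)) (n - a)" using K mult_right_mono[OF c1 K] by (intro divide_right_mono) auto
      finally have "bracket n powr r * norm (g n) \<le> bracket n powr r * (c * K / wt (Suc CARD('d)) (n - a))" by (rule mult_left_mono) simp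
      then show "bracket n powr r * norm (g n) \<le> ?B * (1 / wt CARD('d) (a - n))" using ptw[of n] by (rule order_trans)
    qed
    finally show ?thesis using sum by (rule order_trans)
  qed
qed

text \<open>Only the contribution at the origin is kept, where the weight is 1. The bound is
  therefore independent of \<open>s\<close>, and growth at frequency 0 becomes growth of the
  norm.\<close>

lemma XF_norm_lower:
  fixes g :: "'d::finite cfun"
  assumes g [measurable]: "g \<in> borel_measurable borel" and p: "1 \<le> p" and q: "1 \<le> q"
  shows "ennreal (norm (LINT z|dm M. indicator (unit_cell 0) z * g z)) \<le> 2 * XF_norm M p q s g"
proof -
  have 0: "0 \<in> (lattice :: (real ^ 'd) set)" by (simp add: lattice_def)
  have le: "ennreal (norm (LINT z|dm M. indicator (unit_cell 0) z * g z)) \<le> (\<integral>\<^sup>+z. ennreal (indicator (unit_cell 0) z * norm (g z)) \<partial>dm M)"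
  proof -
    have "norm (indicator (unit_cell 0) z * g z) = indicator (unit_cell 0) z * norm (g z)" for z by (simp add: indicator_def)
    then show ?thesis using norm_lebesgue_integral_le_nn[of "dm M" "\<lambda>z. indicator (unit_cell 0) z * g z"] by simp
  qed
  show ?thesis
  proof (cases M)
    case Euclidean
    let ?h = "\<lambda>z. ennreal (indicator (unit_cell 0) z * norm (g z))"
    have "(\<integral>\<^sup>+z. ?h z \<partial>lborel) \<le> 2 * Lp_norm p lborel ?h"
      by (rule nn_integral_le_Lp_norm_cell[OF p, of _ 0]) auto
    moreover have "Lp_norm p lborel ?h \<le> XF_norm M p q s g"
      using Lp_norm_count_space_ge[OF q 0, of "\<lambda>n. ennreal (bracket n powr s) * Lp_norm p lborel (\<lambda>z. ennreal (indicator (unit_cell n) z * norm (g z)))"]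
      by (simp add: XF_norm_def Euclidean)
    ultimately have "(\<integral>\<^sup>+z. ?h z \<partial>lborel) \<le> 2 * XF_norm M p q s g"
      using mult_left_mono[of "Lp_norm p lborel ?h" _ 2] order_trans by fastforce
    then show ?thesis using le by (simp add: Euclidean dm_Euclidean)
  next
    case Torus
    have "(\<integral>\<^sup>+z. ennreal (indicator (unit_cell 0) z * norm (g z)) \<partial>dm M) = (\<integral>\<^sup>+z. ennreal (indicator (unit_cell 0) z * norm (g z)) \<partial>count_space lattice)"
      by (subst nn_integral_dm) (simp_all add: dual_measure_def Torus)
    also have "... = (\<integral>\<^sup>+z. ennreal (norm (g 0)) * indicator {0} z \<partial>count_space (lattice :: (real ^ 'd) set))"
    proof (rule nn_integral_cong)
      fix z :: "real ^ 'd" assume "z \<in> space (count_space lattice)"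
      then have z: "z \<in> lattice" by simp
      have c: "m \<in> unit_cell m" for m :: "real ^ 'd" by (simp add: unit_cell_def)
      have "z \<in> unit_cell 0 \<longleftrightarrow> z = 0" using unit_cell_disjoint[OF z 0 c, of] c[of 0] by blast
      then show "ennreal (indicator (unit_cell 0) z * norm (g z)) = ennreal (norm (g 0)) * indicator {0} z" by (simp add: indicator_def)
    qed
    also have "... = ennreal (norm (g 0))" using 0 by (subst nn_integral_cmult_indicator) auto
    also have "... \<le> XF_norm M p q s g"
      using Lp_norm_count_space_ge[OF q 0, of "\<lambda>z. ennreal (bracket z powr s * norm (g z))"] by (simp add: XF_norm_def Torus)
    also have "... \<le> 2 * XF_norm M p q s g" by (simp add: mult_2 add_increasing2)
    finally show ?thesis using le by (rule order_trans[rotated])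
  qed
qed

lemma FL_norm_eq:
  fixes g :: "'d::finite cfun"
  assumes "is_fourier M T g"
  shows "FL_norm M s 1 T = (\<integral>\<^sup>+z. ennreal (bracket z powr s * norm (g z)) \<partial>dual_measure M)"
  unfolding FL_norm_def Lp_norm_1
  using fourier_AE[OF assms] by (intro nn_integral_cong_AE) (auto elim!: eventually_mono)

lemma FL_norm_le:
  fixes g :: "'d::finite cfun"
  assumes T: "is_fourier M T g" and g: "\<And>z. z \<in> dgrp M ==> norm (g z) \<le> K / wt (Suc CARD('d)) z" and K: "0 \<le> K" and s: "s \<le> 0"
  shows "FL_norm M s 1 T \<le> ennreal (K * dmK M TYPE('d))"
proof -
  have "FL_norm M s 1 T \<le> (\<integral>\<^sup>+(z :: real ^ 'd). ennreal (K * (1 / wt CARD('d) (0 - z))) \<partial>dual_measure M)"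
    unfolding FL_norm_eq[OF T]
  proof (intro nn_integral_mono ennreal_leI)
    fix z :: "real ^ 'd" assume "z \<in> space (dual_measure M)"
    then have z: "z \<in> dgrp M" by (cases M) (simp_all add: dual_measure_def dgrp_def)
    have "bracket z powr s \<le> 1" using bracket_powr_mono[OF s, of z] bracket_ge_1[of z] by simp
    then have "bracket z powr s * norm (g z) \<le> 1 * norm (g z)" by (rule mult_right_mono) simp
    also have "... \<le> K / wt (Suc CARD('d)) z" using g[OF z] by simp
    also have "... \<le> K / wt CARD('d) z" using K by (intro divide_left_mono wt_mono) auto
    finally show "bracket z powr s * norm (g z) \<le> K * (1 / wt CARD('d) (0 - z))" by simp
  qed
  also have "... = (\<integral>\<^sup>+(z :: real ^ 'd). ennreal K * ennreal (1 / wt CARD('d) (0 - z)) \<partial>dm M)"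
    unfolding ennreal_mult'[OF K] by (rule nn_integral_dm[symmetric]) simp
  also have "... = ennreal K * (\<integral>\<^sup>+(z :: real ^ 'd). ennreal (1 / wt CARD('d) (0 - z)) \<partial>dm M)" by (intro nn_integral_cmult) simp
  also have "... \<le> ennreal K * ennreal (dmK M TYPE('d))" by (intro mult_left_mono dmK) simp
  finally show ?thesis using K by (simp add: ennreal_mult)
qed

section \<open>Approximation by test functions\<close>

text \<open>The convolution theorem. Absolute integrability over pairs rests on translation
  invariance, which is available because almost every \<eta> lies in the dual group.\<close>

lemma integral_conv_cis:
  fixes f g :: "'d::finite cfun"
  assumes f: "decay n K f" and g: "decay n L g" and n: "CARD('d) \<le> n"
  shows "(LINT z|dm M. conv M f g z * cis (x \<bullet> z)) = (LINT z|dm M. f z * cis (x \<bullet> z)) * (LINT z|dm M. g z * cis (x \<bullet> z))"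
proof -
  have fi: "integrable (dm M) f" and gi: "integrable (dm M) g" by (rule integrable_decay[OF f n] integrable_decay[OF g n])+
  have [measurable]: "f \<in> borel_measurable borel" "g \<in> borel_measurable borel" by (rule decay_borel[OF f] decay_borel[OF g])+
  let ?F = "\<lambda>z \<eta>. f (z - \<eta>) * g \<eta> * cis (x \<bullet> z)"
  have fin: "(\<integral>\<^sup>+z. ennreal (norm (h z)) \<partial>dm M) < \<infinity>" if "integrable (dm M) h" for h :: "'d cfun"
    using that by (simp add: integrable_iff_bounded)
  have "integrable (dm M \<Otimes>\<^sub>M dm M) (\<lambda>p. ?F (fst p) (snd p))"
  proof (rule integrableI_bounded)
    show meas: "(\<lambda>p. ?F (fst p) (snd p)) \<in> borel_measurable (dm M \<Otimes>\<^sub>M dm M)" by measurable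
    have "(\<integral>\<^sup>+p. ennreal (norm (?F (fst p) (snd p))) \<partial>(dm M \<Otimes>\<^sub>M dm M)) = (\<integral>\<^sup>+\<eta>. (\<integral>\<^sup>+z. ennreal (norm (?F z \<eta>)) \<partial>dm M) \<partial>dm M)"
      using dm2.nn_integral_snd[of "\<lambda>p. ennreal (norm (?F (fst p) (snd p)))" M] meas by simp
    also have "... = (\<integral>\<^sup>+\<eta>. (\<integral>\<^sup>+z. ennreal (norm (f z)) \<partial>dm M) * ennreal (norm (g \<eta>)) \<partial>dm M)"
    proof (rule nn_integral_cong_AE)
      show "AE \<eta> in dm M. (\<integral>\<^sup>+z. ennreal (norm (?F z \<eta>)) \<partial>dm M) = (\<integral>\<^sup>+z. ennreal (norm (f z)) \<partial>dm M) * ennreal (norm (g \<eta>))"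
        using AE_dm_dgrp[of M]
      proof eventually_elim
        fix \<eta> :: "real ^ 'd" assume \<eta>: "\<eta> \<in> dgrp M"
        have "(\<integral>\<^sup>+z. ennreal (norm (?F z \<eta>)) \<partial>dm M) = (\<integral>\<^sup>+z. ennreal (norm (f (z + - \<eta>))) * ennreal (norm (g \<eta>)) \<partial>dm M)"
          by (simp add: norm_mult ennreal_mult)
        also have "... = (\<integral>\<^sup>+z. ennreal (norm (f (z + - \<eta>))) \<partial>dm M) * ennreal (norm (g \<eta>))"
          by (intro nn_integral_multc) simp
        also have "(\<integral>\<^sup>+z. ennreal (norm (f (z + - \<eta>))) \<partial>dm M) = (\<integral>\<^sup>+z. ennreal (norm (f z)) \<partial>dm M)"
          by (rule nn_integral_dm_translate[where f="\<lambda>z. ennreal (norm (f z))", OF dgrp_uminus[OF \<eta>]]) simp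
        finally show "(\<integral>\<^sup>+z. ennreal (norm (?F z \<eta>)) \<partial>dm M) = (\<integral>\<^sup>+z. ennreal (norm (f z)) \<partial>dm M) * ennreal (norm (g \<eta>))" .
      qed
    qed
    also have "... = (\<integral>\<^sup>+z. ennreal (norm (f z)) \<partial>dm M) * (\<integral>\<^sup>+\<eta>. ennreal (norm (g \<eta>)) \<partial>dm M)"
      by (intro nn_integral_cmult) simp
    also have "... < \<infinity>" using fin[OF fi] fin[OF gi] by (simp add: ennreal_mult_less_top)
    finally show "(\<integral>\<^sup>+p. ennreal (norm (?F (fst p) (snd p))) \<partial>(dm M \<Otimes>\<^sub>M dm M)) < \<infinity>" .
  qed
  then have "integrable (dm M \<Otimes>\<^sub>M dm M) (case_prod ?F)" by (simp add: case_prod_unfold)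
  from dm2.Fubini_integral[OF this]
  have "(LINT z|dm M. conv M f g z * cis (x \<bullet> z)) = (LINT \<eta>|dm M. LINT z|dm M. ?F z \<eta>)"
    by (simp add: conv_def)
  also have "... = (LINT \<eta>|dm M. (LINT z|dm M. f z * cis (x \<bullet> z)) * (g \<eta> * cis (x \<bullet> \<eta>)))"
  proof (rule integral_cong_AE)
    show "AE \<eta> in dm M. (LINT z|dm M. ?F z \<eta>) = (LINT z|dm M. f z * cis (x \<bullet> z)) * (g \<eta> * cis (x \<bullet> \<eta>))"
      using AE_dm_dgrp[of M]
    proof eventually_elim
      fix \<eta> :: "real ^ 'd" assume \<eta>: "\<eta> \<in> dgrp M"
      have "(LINT z|dm M. ?F z \<eta>) = (LINT z|dm M. ?F (z + \<eta>) \<eta>)"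
        by (rule integral_dm_translate[where f="\<lambda>z. ?F z \<eta>", OF \<eta>, symmetric]) measurable
      also have "... = (LINT z|dm M. (f z * cis (x \<bullet> z)) * (g \<eta> * cis (x \<bullet> \<eta>)))"
        by (simp add: inner_right_distrib mult_ac flip: cis_mult)
      finally show "(LINT z|dm M. ?F z \<eta>) = (LINT z|dm M. f z * cis (x \<bullet> z)) * (g \<eta> * cis (x \<bullet> \<eta>))" by simp
    qed
    show "(\<lambda>\<eta>. LINT z|dm M. ?F z \<eta>) \<in> borel_measurable (dm M)"
      by (rule dm.borel_measurable_lebesgue_integral) measurable
  qed simp
  finally show ?thesis by simp
qed

lemma gauss_scaled_integral:
  assumes \<sigma>: "0 < \<sigma>"
  shows "(LINT z|lborel. of_real ((1 / \<sigma>) ^ CARD('d) * gauss ((1 / \<sigma>) *\<^sub>R z)) * cis (x \<bullet> z)) = of_real (exp (- \<sigma>\<^sup>2 * (norm (x :: real ^ 'd::finite))^2 / 2))"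
proof -
  have "(LINT z|lborel. of_real ((1 / \<sigma>) ^ CARD('d) * gauss ((1 / \<sigma>) *\<^sub>R z)) * cis (x \<bullet> z))
      = of_real (\<bar>\<sigma>\<bar> ^ CARD('d)) * (LINT \<eta>|lborel. of_real ((1 / \<sigma>) ^ CARD('d) * gauss ((1 / \<sigma>) *\<^sub>R (0 + \<sigma> *\<^sub>R \<eta>))) * cis (x \<bullet> (0 + \<sigma> *\<^sub>R \<eta>)))"
    using \<sigma> by (intro lborel_integral_scale) auto
  also have "... = (LINT \<eta>|lborel. of_real (gauss \<eta>) * cis ((\<sigma> *\<^sub>R x) \<bullet> \<eta>))"
    using \<sigma> by (simp add: power_one_over field_simps flip: integral_cmult)
  also have "... = of_real (exp (- \<sigma>\<^sup>2 * (norm x)^2 / 2))"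
    unfolding fourier_gauss using \<sigma> by (simp add: power_mult_distrib)
  finally show ?thesis .
qed

lemma compact_support_modulus:
  fixes g :: "'d::finite cfun"
  assumes g: "continuous_on UNIV g" and R: "\<And>z. R < norm z ==> g z = 0" and e: "0 < e"
  shows "\<exists>r>0. r \<le> 1 \<and> (\<forall>z \<zeta>. norm \<zeta> \<le> r \<longrightarrow> norm (g z - g (z - \<zeta>)) \<le> e)"
proof -
  have "uniformly_continuous_on (cball 0 (R + 2)) g"
    by (intro compact_uniformly_continuous continuous_on_subset[OF g]) auto
  then obtain r where r: "0 < r" "\<And>x y. norm x \<le> R + 2 ==> norm y \<le> R + 2 ==> dist y x < r ==> dist (g y) (g x) < e"
    using e unfolding uniformly_continuous_on_def by (metis mem_cball_0)
  let ?r = "min 1 (r / 2)"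
  have "norm (g z - g (z - \<zeta>)) \<le> e" if \<zeta>: "norm \<zeta> \<le> ?r" for z \<zeta>
  proof (cases "norm z \<le> R + 1")
    case True
    have "norm (z - \<zeta>) \<le> norm z + norm \<zeta>" by (rule norm_triangle_ineq4)
    then have "norm (z - \<zeta>) \<le> R + 2" using True \<zeta> by simp
    moreover have "dist z (z - \<zeta>) < r" using \<zeta> r(1) by (simp add: dist_norm)
    ultimately show ?thesis using r(2)[of "z - \<zeta>" z] True by (simp add: dist_norm less_imp_le)
  next
    case False
    have "norm z \<le> norm (z - \<zeta>) + norm \<zeta>" using norm_triangle_ineq[of "z - \<zeta>" \<zeta>] by simp
    then have "R < norm z" "R < norm (z - \<zeta>)" using False \<zeta> by auto
    then show ?thesis using R e by simp
  qed
  then show ?thesis using r(1) by (intro exI[of _ ?r]) auto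
qed

text \<open>Shifts shorter than \<open>r\<close> are handled by uniform continuity, the weight being
  bounded near the support. Longer shifts are handled by Peetre's inequality at the price of
  \<open>(norm \<zeta> / r)^2\<close>, which at scale \<sigma> contributes \<open>\<sigma>^2\<close>
  times a Gaussian moment.\<close>

lemma gauss_mollification:
  fixes g :: "'d::finite cfun"
  assumes g: "continuous_on UNIV g" and R: "\<And>z. R < norm z ==> g z = 0" "0 \<le> R" and B: "\<And>z. norm (g z) \<le> B" and \<delta>: "0 < \<delta>"
  shows "\<exists>\<sigma>>0. \<forall>z. norm (g z - (LINT \<eta>|lborel. g (z - \<sigma> *\<^sub>R \<eta>) * of_real (gauss \<eta>))) \<le> \<delta> / wt n z"
proof -
  have [measurable]: "g \<in> borel_measurable borel" by (rule borel_measurable_continuous_onI[OF g])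
  have B0: "0 \<le> B" using order_trans[OF norm_ge_zero B] .
  define W where "W = (1 + (R + 1)^2) ^ n"
  define V where "V = (1 + R^2) ^ n"
  have W: "0 < W" "0 < V" unfolding W_def V_def by (intro zero_less_power add_pos_nonneg; simp)+
  obtain r where r: "0 < r" "r \<le> 1" and mod: "\<And>z \<zeta>. norm \<zeta> \<le> r ==> norm (g z - g (z - \<zeta>)) \<le> \<delta> / (2 * W)"
  proof -
    have "0 < \<delta> / (2 * W)" using \<delta> W by simp
    from compact_support_modulus[OF g R(1) this] show ?thesis using that by blast
  qed
  \<comment> \<open>The terms \<open>g z\<close> and \<open>g (z - \<zeta>)\<close> cost
    \<open>B * V\<close> times 1 and times \<open>2 ^ n\<close>; dividing by \<open>r^2\<close>
    allows a factor \<open>(norm \<zeta>)^2 \<ge> r^2\<close> to be inserted.\<close>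
  define D where "D = B * V * (1 + 2 ^ n) / r^2"
  have D: "0 \<le> D" unfolding D_def using B0 W by simp
  have wg: "wt n z * norm (g z) \<le> V * B" for z
  proof (cases "R < norm z")
    case False
    then have "wt n z \<le> V" unfolding wt_def V_def by (intro power_mono add_left_mono) auto
    then show ?thesis using B W by (intro mult_mono) auto
  qed (use R B0 W in simp)
  have key: "wt n z * norm (g z - g (z - \<zeta>)) \<le> \<delta> / 2 + D * ((norm \<zeta>)^2 * wt n \<zeta>)" for z \<zeta>
  proof (cases "norm \<zeta> \<le> r")
    case True
    have "wt n z * norm (g z - g (z - \<zeta>)) \<le> W * (\<delta> / (2 * W))"
    proof (cases "norm z \<le> R + 1")
      case T: True
      then have "wt n z \<le> W" unfolding wt_def W_def by (intro power_mono add_left_mono) auto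
      then show ?thesis using mod[OF True, of z] W by (intro mult_mono) auto
    next
      case False
      have "norm z \<le> norm (z - \<zeta>) + norm \<zeta>" using norm_triangle_ineq[of "z - \<zeta>" \<zeta>] by simp
      then have "R < norm z" "R < norm (z - \<zeta>)" using False True r by auto
      then show ?thesis using R W \<delta> by simp
    qed
    also have "... = \<delta> / 2" using W by simp
    finally show ?thesis using D by (simp add: add_increasing2)
  next
    case False
    have "wt n z * norm (g (z - \<zeta>)) \<le> (2 ^ n * (wt n (z - \<zeta>) * wt n \<zeta>)) * norm (g (z - \<zeta>))"
      using wt_add_mult_le[of n "z - \<zeta>" \<zeta>] by (intro mult_right_mono) auto
    also have "... = 2 ^ n * wt n \<zeta> * (wt n (z - \<zeta>) * norm (g (z - \<zeta>)))" by simp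
    also have "... \<le> 2 ^ n * wt n \<zeta> * (V * B)" by (intro mult_left_mono wg) auto
    finally have 2: "wt n z * norm (g (z - \<zeta>)) \<le> 2 ^ n * wt n \<zeta> * (V * B)" .
    have 1: "wt n z * norm (g z) \<le> wt n \<zeta> * (V * B)"
    proof -
      have "1 * (V * B) \<le> wt n \<zeta> * (V * B)" using W B0 by (intro mult_right_mono wt_ge_1) auto
      then show ?thesis using wg[of z] by linarith
    qed
    have "wt n z * norm (g z - g (z - \<zeta>)) \<le> wt n z * (norm (g z) + norm (g (z - \<zeta>)))"
      by (intro mult_left_mono norm_triangle_ineq4) simp
    also have "... \<le> wt n \<zeta> * (V * B) + 2 ^ n * wt n \<zeta> * (V * B)" unfolding distrib_left by (intro add_mono 1 2)
    also have "... = (B * V * (1 + 2 ^ n)) * wt n \<zeta>" by (simp add: algebra_simps)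
    also have "B * V * (1 + 2 ^ n) = D * r^2" using r by (simp add: D_def)
    also have "D * r^2 * wt n \<zeta> \<le> (D * (norm \<zeta>)^2) * wt n \<zeta>"
      using False r D by (intro mult_right_mono mult_left_mono power_mono) auto
    finally show ?thesis using \<delta> by (simp add: mult.assoc)
  qed
  define m where "m = (LINT \<eta>|lborel. wt (Suc n) (\<eta> :: real ^ 'd) * gauss \<eta>)"
  have m: "0 \<le> m" unfolding m_def by (intro integral_nonneg_AE AE_I2 mult_nonneg_nonneg less_imp_le[OF gauss_pos]) simp
  \<comment> \<open>With \<open>\<sigma> \<le> 1\<close> one has
    \<open>\<sigma>^2 \<le> \<sigma>\<close>, and the second bound then gives
    \<open>\<sigma>^2 * (D * m) \<le> \<delta> / 2\<close>; the added 1 keeps the denominator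
    positive.\<close>
  define \<sigma> where "\<sigma> = min 1 (\<delta> / (2 * (D * m + 1)))"
  have Dm: "0 \<le> D * m" using D m by simp
  have \<sigma>: "0 < \<sigma>" "\<sigma> \<le> 1" unfolding \<sigma>_def using \<delta> Dm by auto
  have \<sigma>D: "\<sigma>^2 * (D * m) \<le> \<delta> / 2"
  proof -
    have "\<sigma>^2 * (D * m) \<le> \<sigma> * (D * m + 1)"
      using \<sigma> Dm by (intro mult_mono) (auto simp: power2_eq_square mult_left_le)
    also have "... \<le> (\<delta> / (2 * (D * m + 1))) * (D * m + 1)" using Dm by (intro mult_right_mono) (auto simp: \<sigma>_def)
    also have "... = \<delta> / 2" using Dm by (simp add: field_simps)
    finally show ?thesis .
  qed
  have "norm (g z - (LINT \<eta>|lborel. g (z - \<sigma> *\<^sub>R \<eta>) * of_real (gauss \<eta>))) \<le> \<delta> / wt n z" for z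
  proof -
    have gi: "integrable lborel (\<lambda>\<eta> :: real ^ 'd. complex_of_real (gauss \<eta>))" by (rule integrable_of_real[OF integrable_gauss])
    have i1: "integrable lborel (\<lambda>\<eta>. g (z - \<sigma> *\<^sub>R \<eta>) * of_real (gauss \<eta>))"
    proof (rule integrable_majorant)
      show "integrable lborel (\<lambda>\<eta> :: real ^ 'd. of_real B * complex_of_real (gauss \<eta>))" using gi by (rule integrable_mult_right)
      show "AE \<eta> in lborel. norm (g (z - \<sigma> *\<^sub>R \<eta>) * complex_of_real (gauss \<eta>)) \<le> norm (of_real B * complex_of_real (gauss \<eta>))"
        using B0 B by (intro AE_I2) (simp add: norm_mult mult_right_mono)
    qed simp
    have i2: "integrable lborel (\<lambda>\<eta> :: real ^ 'd. g z * of_real (gauss \<eta>))" using gi by (rule integrable_mult_right)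
    have "g z - (LINT \<eta>|lborel. g (z - \<sigma> *\<^sub>R \<eta>) * of_real (gauss \<eta>)) = (LINT (\<eta> :: real ^ 'd)|lborel. g z * of_real (gauss \<eta>)) - (LINT \<eta>|lborel. g (z - \<sigma> *\<^sub>R \<eta>) * of_real (gauss \<eta>))"
      by (simp only: integral_cmult integral_gauss mult_1_right)
    also have "... = (LINT \<eta>|lborel. (g z - g (z - \<sigma> *\<^sub>R \<eta>)) * of_real (gauss \<eta>))"
      using i1 i2 by (simp add: left_diff_distrib)
    finally have "wt n z * norm (g z - (LINT \<eta>|lborel. g (z - \<sigma> *\<^sub>R \<eta>) * of_real (gauss \<eta>))) = norm (LINT \<eta>|lborel. of_real (wt n z) * ((g z - g (z - \<sigma> *\<^sub>R \<eta>)) * of_real (gauss \<eta>)))"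
      by (simp add: norm_mult)
    also have "... \<le> (LINT (\<eta> :: real ^ 'd)|lborel. \<delta> / 2 * gauss \<eta> + (\<sigma>^2 * D) * (wt (Suc n) \<eta> * gauss \<eta>))"
    proof (rule Bochner_Integration.integral_norm_bound_integral)
      show "integrable lborel (\<lambda>\<eta>. complex_of_real (wt n z) * ((g z - g (z - \<sigma> *\<^sub>R \<eta>)) * of_real (gauss \<eta>)))"
        using i1 i2 by (simp add: left_diff_distrib)
      show "integrable lborel (\<lambda>\<eta> :: real ^ 'd. \<delta> / 2 * gauss \<eta> + (\<sigma>^2 * D) * (wt (Suc n) \<eta> * gauss \<eta>))"
        by (intro Bochner_Integration.integrable_add integrable_mult_right integrable_gauss integrable_wt_gauss)
      fix \<eta> :: "real ^ 'd"
      have "D * ((norm (\<sigma> *\<^sub>R \<eta>))^2 * wt n (\<sigma> *\<^sub>R \<eta>)) \<le> D * ((\<sigma>^2 * (1 + (norm \<eta>)^2)) * wt n \<eta>)"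
      proof (intro mult_left_mono mult_mono D)
        show "(norm (\<sigma> *\<^sub>R \<eta>))^2 \<le> \<sigma>^2 * (1 + (norm \<eta>)^2)" by (simp add: power_mult_distrib mult_left_mono)
        show "wt n (\<sigma> *\<^sub>R \<eta>) \<le> wt n \<eta>" using \<sigma> by (intro wt_mono_norm) (simp add: mult_left_le_one_le)
      qed auto
      also have "... = (\<sigma>^2 * D) * wt (Suc n) \<eta>" by (simp add: wt_Suc)
      finally have "wt n z * norm (g z - g (z - \<sigma> *\<^sub>R \<eta>)) \<le> \<delta> / 2 + (\<sigma>^2 * D) * wt (Suc n) \<eta>" using key[of z "\<sigma> *\<^sub>R \<eta>"] by linarith
      then have "(wt n z * norm (g z - g (z - \<sigma> *\<^sub>R \<eta>))) * gauss \<eta> \<le> (\<delta> / 2 + (\<sigma>^2 * D) * wt (Suc n) \<eta>) * gauss \<eta>"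
        by (rule mult_right_mono) (rule less_imp_le[OF gauss_pos])
      then show "norm (complex_of_real (wt n z) * ((g z - g (z - \<sigma> *\<^sub>R \<eta>)) * of_real (gauss \<eta>))) \<le> \<delta> / 2 * gauss \<eta> + (\<sigma>^2 * D) * (wt (Suc n) \<eta> * gauss \<eta>)"
        by (simp add: norm_mult abs_of_pos[OF gauss_pos] distrib_right mult.assoc)
    qed
    also have "... = \<delta> / 2 * (LINT (\<eta> :: real ^ 'd)|lborel. gauss \<eta>) + (\<sigma>^2 * D) * m"
      unfolding m_def by (subst Bochner_Integration.integral_add) (auto intro!: integrable_mult_right integrable_gauss integrable_wt_gauss)
    also have "(LINT (\<eta> :: real ^ 'd)|lborel. gauss \<eta>) = 1"
      using integral_gauss[where 'd='d] by (simp only: integral_complex_of_real of_real_eq_1_iff)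
    also have "\<delta> / 2 * 1 + (\<sigma>^2 * D) * m \<le> \<delta>" using \<sigma>D by (simp add: mult.assoc)
    finally show ?thesis by (simp add: field_simps)
  qed
  then show ?thesis using \<sigma> by blast
qed

text \<open>One order of decay is given up to make the tail small in the weighted sup norm. On the
  torus truncation to a ball suffices. On Euclidean space a continuous cutoff is followed by
  convolution with a Gaussian; in physical space this multiplies a smooth function of compact
  spectrum by a Gaussian, which yields a Schwartz function.\<close>

lemma test_approximation:
  fixes g :: "'d::finite cfun"
  assumes g: "decay (Suc n) K g" and n: "CARD('d) \<le> n" and \<delta>: "0 < \<delta>"
  shows "\<exists>\<phi> h. \<phi> \<in> test_functions M \<and> is_fourier M (fdist M \<phi>) h \<and> h \<in> borel_measurable borel \<and>
    (\<forall>z. norm (g z - h z) \<le> \<delta> / wt n z)"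
proof -
  have K: "0 \<le> K" by (rule decay_nonneg[OF g])
  have gn: "decay n K g" by (rule decay_mono[OF g]) auto
  \<comment> \<open>Large enough that \<open>K / (1 + R^2) \<le> \<delta> / 2\<close>, because
    \<open>R \<ge> 1\<close> gives \<open>R \<le> R^2\<close>.\<close>
  define R where "R = 1 + 2 * K / \<delta>"
  have R1: "1 \<le> R" using K \<delta> by (simp add: R_def)
  have "2 * K / \<delta> \<le> 1 + R^2" using R1 self_le_power[of R 2] by (simp add: R_def)
  then have KR: "K / (1 + R^2) \<le> \<delta> / 2" using \<delta> by (simp add: field_simps add_pos_nonneg)
  have tail: "norm (g z) \<le> (\<delta> / 2) / wt n z" if "R \<le> norm z" for z
  proof -
    have "norm (g z) \<le> K / (1 + (norm z)^2) / wt n z" using decayD[OF g, of z] by (simp add: wt_Suc)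
    also have "... \<le> K / (1 + R^2) / wt n z"
      using that R1 K by (intro divide_right_mono divide_left_mono add_left_mono power_mono mult_pos_pos add_pos_nonneg) auto
    also have "... \<le> (\<delta> / 2) / wt n z" by (intro divide_right_mono KR) simp
    finally show ?thesis .
  qed
  show ?thesis
  proof (cases M)
    case Torus
    let ?h = "\<lambda>z. indicator (cball 0 R) z * g z"
    have hb: "?h \<in> borel_measurable borel" 
      using decay_borel[OF g] by (intro borel_measurable_times borel_measurable_indicator) auto
    have hi: "integrable (dm Torus) ?h"
      by (rule integrable_majorant[OF integrable_decay[OF gn n]])
        (use hb in \<open>auto simp: norm_mult indicator_def\<close>)
    then have "compact_density Torus ?h"
      by (auto simp: compact_density_def indicator_def intro!: exI[of _ R])
    then have "synth Torus ?h \<in> test_functions Torus" by (rule synth_test_function_Torus)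
    moreover have "norm (g z - ?h z) \<le> \<delta> / wt n z" for z
    proof (cases "norm z \<le> R")
      case True
      then show ?thesis using \<delta> by simp
    next
      case False
      then have "norm (g z) \<le> (\<delta> / 2) / wt n z" by (intro tail) simp
      also have "... \<le> \<delta> / wt n z" using \<delta> by (intro divide_right_mono) auto
      finally show ?thesis using False by simp
    qed
    ultimately show ?thesis using is_fourier_synth[OF hi] hb Torus by blast
  next
    case Euclidean
    let ?\<chi> = "\<lambda>z :: real ^ 'd. max 0 (min 1 (2 - norm z / R))"
    let ?g = "\<lambda>z. complex_of_real (?\<chi> z) * g z"
    have \<chi>01: "0 \<le> ?\<chi> z" "?\<chi> z \<le> 1" for z by auto
    have gle: "norm (?g z) \<le> norm (g z)" for z
      using mult_right_mono[OF \<chi>01(2), of "norm (g z)" z] \<chi>01(1)[of z] by (simp add: norm_mult)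
    have gc: "continuous_on UNIV ?g"
      using R1 by (intro continuous_intros decay_continuous[OF g]) auto
    have gd: "decay n K ?g" using gc order_trans[OF gle decayD[OF gn]] by (simp add: decay_def)
    have supp: "?g z = 0" if "2 * R < norm z" for z
    proof -
      have "2 - norm z / R \<le> 0" using that R1 by (simp add: field_simps)
      then show ?thesis by simp
    qed
    have near: "norm (g z - ?g z) \<le> (\<delta> / 2) / wt n z" for z
    proof (cases "norm z \<le> R")
      case True
      then have "1 \<le> 2 - norm z / R" using R1 by (simp add: field_simps)
      then have "?\<chi> z = 1" by (simp add: min_absorb1)
      then have g_eq: "?g z = g z" by (simp only: of_real_1 mult_1)
      show ?thesis unfolding g_eq using \<delta> by simp
    next
      case False
      have "norm (g z - ?g z) = (1 - ?\<chi> z) * norm (g z)"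
      proof -
        have "g z - ?g z = complex_of_real (1 - ?\<chi> z) * g z" by (simp add: left_diff_distrib)
        then show ?thesis using \<chi>01[of z] by (simp only: norm_mult norm_of_real abs_of_nonneg diff_ge_0_iff_ge)
      qed
      also have "... \<le> 1 * norm (g z)" using \<chi>01[of z] by (intro mult_right_mono) auto
      also have "... \<le> (\<delta> / 2) / wt n z" using tail[of z] False by simp
      finally show ?thesis .
    qed
    obtain \<sigma> where \<sigma>: "0 < \<sigma>" and mol: "\<And>z. norm (?g z - (LINT \<eta>|lborel. ?g (z - \<sigma> *\<^sub>R \<eta>) * of_real (gauss \<eta>))) \<le> (\<delta> / 2) / wt n z"
    proof -
      have "0 \<le> 2 * R" "0 < \<delta> / 2" using R1 \<delta> by auto
      from gauss_mollification[OF gc supp this(1) decay_bounded[OF gd] this(2), of n] show ?thesis using that by blast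
    qed
    let ?G = "\<lambda>z :: real ^ 'd. complex_of_real ((1 / \<sigma>) ^ CARD('d) * gauss ((1 / \<sigma>) *\<^sub>R z))"
    obtain L where L: "decay n L ?G"
    proof -
      obtain L where L: "0 \<le> L" "gauss z \<le> L / wt n z" for z :: "real ^ 'd" using gauss_decay by blast
      have "norm (?G z) \<le> ((1 / \<sigma>) ^ CARD('d) * L * (1 + \<sigma>^2) ^ n) / wt n z" for z
      proof -
        have "wt n z \<le> (1 + \<sigma>^2) ^ n * wt n ((1 / \<sigma>) *\<^sub>R z)"
        proof -
          have "(norm z)^2 = \<sigma>^2 * (norm ((1 / \<sigma>) *\<^sub>R z))^2" using \<sigma> by (simp add: power_divide)
          then have "1 + (norm z)^2 \<le> (1 + \<sigma>^2) * (1 + (norm ((1 / \<sigma>) *\<^sub>R z))^2)" by (simp add: algebra_simps)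
          then show ?thesis unfolding wt_def power_mult_distrib[symmetric] by (intro power_mono) auto
        qed
        then have "L / wt n ((1 / \<sigma>) *\<^sub>R z) \<le> L * (1 + \<sigma>^2) ^ n / wt n z"
          using mult_left_mono[of "wt n z" "(1 + \<sigma>^2) ^ n * wt n ((1 / \<sigma>) *\<^sub>R z)" L] L(1) by (simp add: field_simps)
        then have "gauss ((1 / \<sigma>) *\<^sub>R z) \<le> L * (1 + \<sigma>^2) ^ n / wt n z" using L(2) order_trans by blast
        then have "(1 / \<sigma>) ^ CARD('d) * gauss ((1 / \<sigma>) *\<^sub>R z) \<le> (1 / \<sigma>) ^ CARD('d) * (L * (1 + \<sigma>^2) ^ n / wt n z)"
          using \<sigma> by (intro mult_left_mono) auto
        moreover have "norm (?G z) = (1 / \<sigma>) ^ CARD('d) * gauss ((1 / \<sigma>) *\<^sub>R z)"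
          unfolding norm_of_real using \<sigma> gauss_pos[of "(1 / \<sigma>) *\<^sub>R z"] by (simp add: abs_mult)
        ultimately show ?thesis by simp
      qed
      moreover have "continuous_on UNIV ?G" by (intro continuous_intros)
      ultimately show ?thesis using that by (simp only: decay_def) blast
    qed
    define h where "h = conv Euclidean ?G ?g"
    have hmol: "h z = (LINT \<eta>|lborel. ?g (z - \<sigma> *\<^sub>R \<eta>) * of_real (gauss \<eta>))" for z
    proof -
      have [measurable]: "g \<in> borel_measurable borel" by (rule decay_borel[OF g])
      have "h z = (LINT \<zeta>|lborel. ?G (z - \<zeta>) * ?g \<zeta>)" by (simp add: h_def conv_def dm_Euclidean)
      also have "... = of_real (\<bar>- \<sigma>\<bar> ^ CARD('d)) * (LINT \<eta>|lborel. ?G (z - (z + (- \<sigma>) *\<^sub>R \<eta>)) * ?g (z + (- \<sigma>) *\<^sub>R \<eta>))"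
        using \<sigma> by (intro lborel_integral_scale) auto
      also have "... = (LINT \<eta>|lborel. ?g (z - \<sigma> *\<^sub>R \<eta>) * of_real (gauss \<eta>))"
        unfolding integral_cmult[symmetric]
      proof (rule Bochner_Integration.integral_cong[OF refl])
        fix \<eta> :: "real ^ 'd"
        have "complex_of_real (\<bar>- \<sigma>\<bar> ^ CARD('d)) * complex_of_real ((1 / \<sigma>) ^ CARD('d)) = 1"
          using \<sigma> by (simp add: power_one_over flip: of_real_mult)
        moreover have "?G (z - (z + (- \<sigma>) *\<^sub>R \<eta>)) = complex_of_real ((1 / \<sigma>) ^ CARD('d)) * of_real (gauss \<eta>)" using \<sigma> by simp
        ultimately have "of_real (\<bar>- \<sigma>\<bar> ^ CARD('d)) * ?G (z - (z + (- \<sigma>) *\<^sub>R \<eta>)) = of_real (gauss \<eta>)"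
          by (metis mult.assoc mult_1)
        then show "of_real (\<bar>- \<sigma>\<bar> ^ CARD('d)) * (?G (z - (z + (- \<sigma>) *\<^sub>R \<eta>)) * ?g (z + (- \<sigma>) *\<^sub>R \<eta>)) = ?g (z - \<sigma> *\<^sub>R \<eta>) * of_real (gauss \<eta>)"
          by (simp only: mult.assoc[symmetric] scaleR_minus_left diff_conv_add_uminus[symmetric]) (simp only: mult_ac)
      qed
      finally show ?thesis .
    qed
    have hc: "continuous_on UNIV h" unfolding h_def by (rule continuous_on_conv[OF L gd n])
    have hd: "norm (g z - h z) \<le> \<delta> / wt n z" for z
    proof -
      have "norm (g z - h z) \<le> norm (g z - ?g z) + norm (?g z - h z)" using norm_triangle_ineq[of "g z - ?g z" "?g z - h z"] by simp
      also have "... \<le> (\<delta> / 2) / wt n z + (\<delta> / 2) / wt n z" unfolding hmol by (intro add_mono near mol)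
      finally show ?thesis by (simp add: field_simps)
    qed
    have "decay n (K + \<delta>) h"
    proof -
      have "norm (h z) \<le> (K + \<delta>) / wt n z" for z
      proof -
        have "norm (h z) \<le> norm (g z) + norm (g z - h z)" using norm_triangle_ineq4[of "g z" "g z - h z"] by simp
        then show ?thesis using decayD[OF gn, of z] hd[of z] by (simp add: add_divide_distrib)
      qed
      then show ?thesis using hc by (simp add: decay_def)
    qed
    then have hi: "integrable (dm Euclidean) h" using n by (rule integrable_decay)
    \<comment> \<open>By the convolution theorem the synthesis is a Gaussian times an oscillatory
      integral of compact density, hence a member of \<open>gaussian_family\<close>.\<close>
    have synth_h: "synth Euclidean h = (\<lambda>x. of_real (exp (- \<sigma>\<^sup>2 * (norm (x - 0))^2 / 2)) * osc Euclidean (\<lambda>z. fourier_const TYPE('d) * ?g z) x)"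
    proof
      fix x :: "real ^ 'd"
      show "synth Euclidean h x = of_real (exp (- \<sigma>\<^sup>2 * (norm (x - 0))^2 / 2)) * osc Euclidean (\<lambda>z. fourier_const TYPE('d) * ?g z) x"
        unfolding synth_def h_def integral_conv_cis[OF L gd n]
        using gauss_scaled_integral[OF \<sigma>, of x] by (simp add: osc_def dm_Euclidean mult.assoc)
    qed
    have "compact_density Euclidean ?g"
      using integrable_decay[OF gd n] supp unfolding compact_density_def by blast
    then have "compact_density Euclidean (\<lambda>z. fourier_const TYPE('d) * ?g z)" by (rule compact_density_mult) (intro continuous_intros)
    then have "synth Euclidean h \<in> gaussian_family (\<sigma>^2) 0 (osc Euclidean ` {h. compact_density Euclidean h})"
      unfolding synth_h by (intro gaussian_family.base) blast
    then have "synth Euclidean h \<in> test_functions Euclidean"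
      by (rule gaussian_family_test_functions[rotated 4]) (assumption | rule osc_class zero_less_power \<sigma>)+
    then show ?thesis using is_fourier_synth[OF hi] borel_measurable_continuous_onI[OF hc] hd Euclidean by blast
  qed
qed

section \<open>Membership in the function spaces\<close>

lemma smooth_diff_pderivs:
  assumes "smooth f" "smooth g"
  shows "pderivs is (\<lambda>x. f x - g x) = (\<lambda>x. pderivs is f x - pderivs is g x)"
proof (induction "is")
  case (Cons i "is")
  have "((\<lambda>x. pderivs is f x - pderivs is g x) has_derivative
      (\<lambda>v. frechet_derivative (pderivs is f) (at x) v - frechet_derivative (pderivs is g) (at x) v)) (at x)" for x
    using assms unfolding smooth_def by (intro has_derivative_diff) (simp_all add: frechet_derivative_works)
  from pderivs_eqI[OF this, of i] show ?case by (simp add: Cons.IH)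
qed simp

lemma smooth_diff: "smooth f ==> smooth g ==> smooth (\<lambda>x. f x - g x)"
  unfolding smooth_def[of "\<lambda>x. f x - g x"] by (auto simp: smooth_diff_pderivs smooth_def)

lemma test_functions_diff:
  fixes \<phi> \<psi> :: "'d::finite cfun"
  assumes "\<phi> \<in> test_functions M" "\<psi> \<in> test_functions M"
  shows "(\<lambda>x. \<phi> x - \<psi> x) \<in> test_functions M"
proof (cases M)
  case Euclidean
  have s: "smooth \<phi>" "smooth \<psi>" using assms by (auto intro: test_functions_smooth)
  have "\<exists>C. \<forall>x. (1 + norm x) ^ m * norm (pderivs is (\<lambda>x. \<phi> x - \<psi> x) x) \<le> C" for m "is"
  proof -
    obtain C D where CD: "(1 + norm x) ^ m * norm (pderivs is \<phi> x) \<le> C" "(1 + norm x) ^ m * norm (pderivs is \<psi> x) \<le> D" for x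
      using assms by (simp add: test_functions_def Euclidean) metis
    have "(1 + norm x) ^ m * norm (pderivs is (\<lambda>x. \<phi> x - \<psi> x) x) \<le> C + D" for x
    proof -
      have "(1 + norm x) ^ m * norm (pderivs is (\<lambda>x. \<phi> x - \<psi> x) x) \<le> (1 + norm x) ^ m * (norm (pderivs is \<phi> x) + norm (pderivs is \<psi> x))"
        unfolding smooth_diff_pderivs[OF s] by (intro mult_left_mono norm_triangle_ineq4) simp
      then show ?thesis using CD[of x] by (simp add: distrib_left)
    qed
    then show ?thesis by blast
  qed
  then show ?thesis using smooth_diff[OF s] by (simp add: test_functions_def Euclidean)
next
  case Torus
  then show ?thesis using assms by (auto simp: test_functions_def smooth_diff periodic_def)
qed

lemma fourier_fun_diff:
  fixes \<phi> \<psi> :: "'d::finite cfun"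
  assumes "\<phi> \<in> test_functions M" "\<psi> \<in> test_functions M"
  shows "fourier_fun M (\<lambda>x. \<phi> x - \<psi> x) z = fourier_fun M \<phi> z - fourier_fun M \<psi> z"
proof -
  have "integrable (space_measure M) (\<lambda>x. character z x * \<phi> x)" if "\<phi> \<in> test_functions M" for \<phi> :: "'d cfun"
    by (rule integrable_bounded_test[OF that, of _ 1]) auto
  from this[OF assms(1)] this[OF assms(2)] show ?thesis
    by (simp add: fourier_fun_def left_diff_distrib right_diff_distrib mult.commute[of "cis _"])
qed

lemma test_seminorm_mono:
  fixes \<phi> :: "'d::finite cfun"
  assumes \<phi>: "\<phi> \<in> test_functions M" and N: "N \<le> N'"
  shows "test_seminorm M N \<phi> \<le> test_seminorm M N' \<phi>"
  unfolding test_seminorm_def[of M N]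
proof (rule cSUP_least)
  show "{is :: 'd list. length is \<le> N} \<times> (UNIV :: (real ^ 'd) set) \<noteq> {}" by (auto intro: exI[of _ "[]"])
  fix p :: "'d list \<times> (real ^ 'd)" assume "p \<in> {is. length is \<le> N} \<times> UNIV"
  then obtain js x where p: "p = (js, x)" and js: "length js \<le> N" by auto
  have "(case M of Euclidean => (1 + norm x) ^ N | Torus => 1) * norm (pderivs js \<phi> x) \<le> (case M of Euclidean => (1 + norm x) ^ N' | Torus => 1) * norm (pderivs js \<phi> x)"
    using N by (cases M) (auto intro!: mult_right_mono power_increasing)
  also have "... \<le> test_seminorm M N' \<phi>" using js N by (intro test_seminorm_upper \<phi>) simp
  finally show "(case p of (is, x) => (case M of Euclidean => (1 + norm x) ^ N | Torus => 1) * norm (pderivs is \<phi> x)) \<le> test_seminorm M N' \<phi>"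
    by (simp add: p)
qed

lemma test_seminorm_nonneg:
  fixes \<phi> :: "'d::finite cfun"
  assumes "\<phi> \<in> test_functions M"
  shows "0 \<le> test_seminorm M N \<phi>"
  using order_trans[OF _ test_seminorm_upper[OF assms, of "[]" N 0]] by (auto split: base_space.splits)

lemma distributions_diff:
  fixes S T :: "'d::finite distr"
  assumes "S \<in> distributions M" "T \<in> distributions M"
  shows "S - T \<in> distributions M"
proof -
  obtain N C where S: "norm (S \<phi>) \<le> C * test_seminorm M N \<phi>" if "\<phi> \<in> test_functions M" for \<phi>
    using assms(1) unfolding distributions_def by blast
  obtain N' C' where T: "norm (T \<phi>) \<le> C' * test_seminorm M N' \<phi>" if "\<phi> \<in> test_functions M" for \<phi>
    using assms(2) unfolding distributions_def by blast
  have "norm ((S - T) \<phi>) \<le> (\<bar>C\<bar> + \<bar>C'\<bar>) * test_seminorm M (max N N') \<phi>" if \<phi>: "\<phi> \<in> test_functions M" for \<phi>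
  proof -
    have "C * test_seminorm M N \<phi> \<le> \<bar>C\<bar> * test_seminorm M (max N N') \<phi>"
      using test_seminorm_nonneg[OF \<phi>] by (intro mult_mono test_seminorm_mono \<phi>) auto
    moreover have "C' * test_seminorm M N' \<phi> \<le> \<bar>C'\<bar> * test_seminorm M (max N N') \<phi>"
      using test_seminorm_nonneg[OF \<phi>] by (intro mult_mono test_seminorm_mono \<phi>) auto
    moreover have "norm ((S - T) \<phi>) \<le> norm (S \<phi>) + norm (T \<phi>)" by (simp add: norm_triangle_ineq4)
    ultimately show ?thesis using S[OF \<phi>] T[OF \<phi>] by (simp add: distrib_right)
  qed
  then show ?thesis using assms unfolding distributions_def
    by (auto simp: right_diff_distrib)
qed

lemma X_space_eq: "X_space M p q s = test_closure M (X_norm M p q s)"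
  by (cases M) (simp_all add: X_space_def X_norm_def[abs_def] amalgam_def FL_def)

lemma X_norm_diff_test:
  fixes T :: "'d::finite distr"
  assumes T: "is_fourier M T g" and \<phi>: "\<phi> \<in> test_functions M" and p: "1 \<le> p"
  shows "X_norm M p q s (T - fdist M \<phi>) = XF_norm M p q s (\<lambda>z. g z - fourier_fun M \<phi> z)"
  by (rule X_norm_eq[OF is_fourier_diff[OF T is_fourier_fdist_test[OF \<phi>]] p])

lemma fourier_fun_borel: "\<phi> \<in> test_functions M ==> fourier_fun M \<phi> \<in> borel_measurable borel"
  for \<phi> :: "'d::finite cfun"
  by (intro borel_measurable_continuous_onI continuous_fourier_fun)

text \<open>The closure is stable under differences although only a quasi-triangle inequality is
  available: with both errors below \<open>\<delta> / 32\<close> the constant 16 gives exactly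
  \<delta>.\<close>

lemma X_space_diff:
  fixes S T :: "'d::finite distr"
  assumes S: "S \<in> X_space M p q s" and T: "T \<in> X_space M p q s" and p: "1 \<le> p" and q: "1 \<le> q"
  shows "S - T \<in> X_space M p q s"
proof -
  obtain g h where g: "is_fourier M S g" and h: "is_fourier M T h"
    using S T by (auto simp: X_space_eq test_closure_def)
  have "\<exists>\<phi>\<in>test_functions M. X_norm M p q s (S - T - fdist M \<phi>) < ennreal \<delta>" if \<delta>: "0 < \<delta>" for \<delta>
  proof -
    have d32: "0 < \<delta> / 32" using \<delta> by simp
    obtain \<phi> where \<phi>: "\<phi> \<in> test_functions M" and \<phi>S: "X_norm M p q s (S - fdist M \<phi>) < ennreal (\<delta> / 32)"
      using S d32 unfolding X_space_eq test_closure_def by blast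
    obtain \<psi> where \<psi>: "\<psi> \<in> test_functions M" and \<psi>T: "X_norm M p q s (T - fdist M \<psi>) < ennreal (\<delta> / 32)"
      using T d32 unfolding X_space_eq test_closure_def by blast
    let ?\<chi> = "\<lambda>x. \<phi> x - \<psi> x"
    have \<chi>: "?\<chi> \<in> test_functions M" by (rule test_functions_diff[OF \<phi> \<psi>])
    have "X_norm M p q s (S - T - fdist M ?\<chi>) = XF_norm M p q s (\<lambda>z. g z - h z - fourier_fun M ?\<chi> z)"
      by (rule X_norm_diff_test[OF is_fourier_diff[OF g h] \<chi> p])
    also have "... \<le> 16 * (XF_norm M p q s (\<lambda>z. g z - fourier_fun M \<phi> z) + XF_norm M p q s (\<lambda>z. h z - fourier_fun M \<psi> z))"
    proof (rule XF_norm_quasi_triangle[OF _ p q])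
      fix z
      have "g z - h z - fourier_fun M ?\<chi> z = (g z - fourier_fun M \<phi> z) - (h z - fourier_fun M \<psi> z)"
        by (simp add: fourier_fun_diff[OF \<phi> \<psi>])
      then show "norm (g z - h z - fourier_fun M ?\<chi> z) \<le> norm (g z - fourier_fun M \<phi> z) + norm (h z - fourier_fun M \<psi> z)"
        by (simp only: norm_triangle_ineq4)
    qed (use is_fourier_borel g h fourier_fun_borel[OF \<phi>] fourier_fun_borel[OF \<psi>] fourier_fun_borel[OF \<chi>] in \<open>auto intro!: borel_measurable_diff\<close>)
    also have "... < 16 * (ennreal (\<delta> / 32) + ennreal (\<delta> / 32))"
      using \<phi>S \<psi>T unfolding X_norm_diff_test[OF g \<phi> p] X_norm_diff_test[OF h \<psi> p]
      by (intro ennreal_mult_strict_left_mono add_strict_mono) auto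
    also have "... = ennreal \<delta>" using \<delta> by (simp flip: ennreal_plus ennreal_numeral add: ennreal_mult[symmetric])
    finally show ?thesis using \<chi> by blast
  qed
  then show ?thesis
    using S T distributions_diff is_fourier_diff[OF g h] by (auto simp: X_space_eq test_closure_def)
qed

lemma mult_divide_Suc_less:
  fixes c \<delta> :: real
  assumes "0 \<le> c" "0 < \<delta>"
  shows "c * (\<delta> / (c + 1)) < \<delta>"
proof -
  have "\<delta> * (c / (c + 1)) < \<delta> * 1" using assms by (intro mult_strict_left_mono) auto
  then show ?thesis by (simp add: mult.commute)
qed

text \<open>For \<open>s \<le> 0\<close> the norm is dominated by the one with exponent 0, where
  weighted sup approximation suffices. The decay order is \<open>Suc CARD('d)\<close> for the norm
  bound plus one for the approximation.\<close>

lemma synth_X_space: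
  fixes g :: "'d::finite cfun"
  assumes g: "decay (CARD('d) + 2) K g" and s: "s \<le> 0" and p: "1 \<le> p" and q: "1 \<le> q"
  shows "fdist M (synth M g) \<in> X_space M p q s"
proof -
  have gi: "integrable (dm M) g" by (rule integrable_decay[OF g]) simp
  have "\<exists>\<phi>\<in>test_functions M. X_norm M p q s (fdist M (synth M g) - fdist M \<phi>) < ennreal \<delta>" if \<delta>: "0 < \<delta>" for \<delta>
  proof -
    let ?c = "XF_const TYPE('d)"
    let ?d = "\<delta> / (?c + 1)"
    have d: "0 < ?d" using \<delta> by (simp add: add_nonneg_pos)
    obtain \<phi> h where \<phi>: "\<phi> \<in> test_functions M" and h: "is_fourier M (fdist M \<phi>) h" and hb: "h \<in> borel_measurable borel"
      and le: "\<And>z. norm (g z - h z) \<le> ?d / wt (Suc CARD('d)) z"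
      using test_approximation[of "Suc CARD('d)" K g ?d M] g d by auto
    have "X_norm M p q s (fdist M (synth M g) - fdist M \<phi>) = XF_norm M p q s (\<lambda>z. g z - h z)"
      by (rule X_norm_eq[OF is_fourier_diff[OF is_fourier_synth[OF gi] h] p])
    also have "... \<le> XF_norm M p q 0 (\<lambda>z. g z - h z)" by (rule XF_norm_mono_exponent[OF s q])
    also have "... \<le> ennreal (?c * ?d * bracket (0 :: real ^ 'd) powr 0)"
      using le d hb decay_borel[OF g] by (intro XF_norm_le p q) auto
    also have "... < ennreal \<delta>" using mult_divide_Suc_less[OF XF_const_nonneg[where 'd='d] \<delta>] \<delta> by (intro ennreal_lessI) auto
    finally show ?thesis using \<phi> by blast
  qed
  then show ?thesis using fdist_synth_distribution[OF gi] is_fourier_synth[OF gi] by (auto simp: X_space_eq test_closure_def)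
qed

lemma synth_FL:
  fixes g :: "'d::finite cfun"
  assumes g: "decay (CARD('d) + 2) K g" and s: "s \<le> 0"
  shows "fdist M (synth M g) \<in> FL M s 1"
proof -
  have gi: "integrable (dm M) g" by (rule integrable_decay[OF g]) simp
  have "\<exists>\<phi>\<in>test_functions M. FL_norm M s 1 (fdist M (synth M g) - fdist M \<phi>) < ennreal \<delta>" if \<delta>: "0 < \<delta>" for \<delta>
  proof -
    let ?c = "dmK M TYPE('d)"
    let ?d = "\<delta> / (?c + 1)"
    have d: "0 < ?d" using \<delta> by (simp add: add_nonneg_pos)
    obtain \<phi> h where \<phi>: "\<phi> \<in> test_functions M" and h: "is_fourier M (fdist M \<phi>) h"
      and le: "\<And>z. norm (g z - h z) \<le> ?d / wt (Suc CARD('d)) z"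
      using test_approximation[of "Suc CARD('d)" K g ?d M] g d by auto
    have "FL_norm M s 1 (fdist M (synth M g) - fdist M \<phi>) \<le> ennreal (?d * ?c)"
      using d by (intro FL_norm_le[OF is_fourier_diff[OF is_fourier_synth[OF gi] h] le _ s]) auto
    also have "... < ennreal \<delta>" using \<delta> mult_divide_Suc_less[OF dmK_nonneg[where 'd='d and M=M] \<delta>] by (intro ennreal_lessI) (auto simp: mult.commute)
    finally show ?thesis using \<phi> by blast
  qed
  then show ?thesis using fdist_synth_distribution[OF gi] is_fourier_synth[OF gi] by (auto simp: FL_def test_closure_def)
qed

section \<open>Tents, and approximation of the data by rapidly decaying transforms\<close>

definition tent :: "real ^ 'd::finite => real" where
  "tent z = max 0 (1 - norm z)"

lemma tent_bounds: "0 \<le> tent z" "tent z \<le> 1"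
  by (auto simp: tent_def)

lemma tent_eq_0: "1 \<le> norm z ==> tent z = 0"
  by (simp add: tent_def)

lemma continuous_on_tent [continuous_intros]: "continuous_on S f ==> continuous_on S (\<lambda>x. tent (f x))"
  unfolding tent_def by (intro continuous_intros)

text \<open>On the unit ball about \<open>a\<close> the weight is at most \<open>2 ^ n\<close>. The
  constant is the same for all centres, which keeps the pulse bounds uniform in the
  frequency.\<close>

lemma tent_le: "tent (z - a) \<le> 2 ^ n / wt n (z - a)"
proof (cases "norm (z - a) < 1")
  case True
  then have "(norm (z - a))^2 \<le> 1" by (simp add: power_le_one)
  then have "wt n (z - a) \<le> 2 ^ n" unfolding wt_def by (intro power_mono) auto
  then have "1 \<le> 2 ^ n / wt n (z - a)" by simp
  then show ?thesis using tent_bounds(2)[of "z - a"] by linarith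
qed (simp add: tent_eq_0)

lemma decay_tent: "\<exists>K. decay n K (\<lambda>z. c * of_real (tent (z - a)))"
proof -
  have "norm (c * of_real (tent (z - a))) \<le> (norm c * 2 ^ n * (2 ^ n * wt n a)) / wt n z" for z
  proof -
    have "wt n z \<le> 2 ^ n * (wt n (z - a) * wt n a)" using wt_add_mult_le[of n "z - a" a] by simp
    then have "2 ^ n / wt n (z - a) \<le> 2 ^ n * (2 ^ n * wt n a) / wt n z" by (simp add: field_simps)
    then have "tent (z - a) \<le> 2 ^ n * (2 ^ n * wt n a) / wt n z" using tent_le[of z a n] by linarith
    then have "norm c * tent (z - a) \<le> norm c * (2 ^ n * (2 ^ n * wt n a) / wt n z)" by (rule mult_left_mono) simp
    then show ?thesis using tent_bounds(1)[of "z - a"] by (simp add: norm_mult mult.assoc)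
  qed
  then show ?thesis unfolding decay_def by (intro exI conjI allI) (auto intro!: continuous_intros)
qed

text \<open>Consequently a tent at one lattice point vanishes at all others, and sums of tents
  interpolate prescribed lattice values.\<close>

lemma lattice_dist: assumes "m \<in> lattice" "n \<in> lattice" "m \<noteq> n" shows "1 \<le> norm (m - n)"
proof -
  obtain i where i: "m $ i \<noteq> n $ i" using assms(3) by (auto simp: vec_eq_iff)
  have "m $ i - n $ i \<in> \<int>" using assms by (auto simp: lattice_def)
  then have "1 \<le> \<bar>m $ i - n $ i\<bar>" using i by (intro Ints_nonzero_abs_ge1) auto
  also have "... \<le> norm (m - n)" using component_le_norm_cart[of "m - n" i] by simp
  finally show ?thesis .
qed

lemma finite_lattice_ball: "finite (lattice \<inter> {n :: real ^ 'd::finite. norm n \<le> R})"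
proof -
  let ?F = "{- \<lceil>R\<rceil>..\<lceil>R\<rceil>}"
  have "lattice \<inter> {n :: real ^ 'd. norm n \<le> R} \<subseteq> (\<lambda>f. \<chi> i. real_of_int (f i)) ` (UNIV \<rightarrow>\<^sub>E ?F)"
  proof
    fix n :: "real ^ 'd" assume n: "n \<in> lattice \<inter> {n. norm n \<le> R}"
    have "\<exists>Z. n $ i = real_of_int Z" for i using n by (auto simp: lattice_def elim: Ints_cases)
    then obtain Z where Z: "n $ i = real_of_int (Z i)" for i by metis
    have "Z i \<in> ?F" for i
    proof -
      have "\<bar>real_of_int (Z i)\<bar> \<le> R" using component_le_norm_cart[of n i] n Z[of i] by simp
      then show ?thesis by (simp add: abs_le_iff) linarith
    qed
    moreover have "n = (\<chi> i. real_of_int (Z i))" using Z by (simp add: vec_eq_iff)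
    ultimately show "n \<in> (\<lambda>f. \<chi> i. real_of_int (f i)) ` (UNIV \<rightarrow>\<^sub>E ?F)" by (auto simp: PiE_def)
  qed
  moreover have "finite ((UNIV :: 'd set) \<rightarrow>\<^sub>E ?F)" by (intro finite_PiE) auto
  ultimately show ?thesis using finite_surj by blast
qed

text \<open>On Euclidean space the transform of a nearby test function serves. On the torus the
  decay of that transform is known on the lattice only, so finitely many of its values are
  interpolated by tents to obtain a profile that decays at every real point.\<close>

lemma X_space_decay_approximation:
  fixes T :: "'d::finite distr"
  assumes T: "T \<in> X_space M p q s" and s: "s \<le> 0" and p: "1 \<le> p" and q: "1 \<le> q" and \<delta>: "0 < \<delta>"
  shows "\<exists>g K. decay n K g \<and> XF_norm M p q s (\<lambda>z. g z - fourier M T z) < ennreal \<delta>"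
proof -
  obtain f where f: "is_fourier M T f" using T by (auto simp: X_space_eq test_closure_def)
  have fT: "is_fourier M T (fourier M T)" by (rule is_fourier_fourier[OF f])
  have d32: "0 < \<delta> / 32" using \<delta> by simp
  obtain \<phi> where \<phi>: "\<phi> \<in> test_functions M" and \<phi>T: "X_norm M p q s (T - fdist M \<phi>) < ennreal (\<delta> / 32)"
    using T d32 unfolding X_space_eq test_closure_def by blast
  let ?F = "fourier_fun M \<phi>"
  have near: "XF_norm M p q s (\<lambda>z. fourier M T z - ?F z) < ennreal (\<delta> / 32)"
    using \<phi>T X_norm_diff_test[OF fT \<phi> p, of q s] by simp
  have sym: "XF_norm M p q s (\<lambda>z. ?F z - fourier M T z) = XF_norm M p q s (\<lambda>z. fourier M T z - ?F z)"
    by (cases M) (simp_all add: XF_norm_def norm_minus_commute)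
  show ?thesis
  proof (cases M)
    case Euclidean
    obtain K where "decay n K ?F" using decay_fourier_fun[of \<phi> n] \<phi> Euclidean by auto
    moreover have "ennreal (\<delta> / 32) \<le> ennreal \<delta>" using \<delta> by (intro ennreal_leI) simp
    ultimately show ?thesis using near sym by (metis order_less_le_trans)
  next
    case Torus
    obtain K where K: "0 \<le> K" "\<And>z. z \<in> dgrp M ==> norm (?F z) \<le> K / wt (Suc (Suc CARD('d))) z"
      using fourier_fun_decay[OF \<phi>] by blast
    let ?c = "XF_const TYPE('d)"
    \<comment> \<open>After multiplication by \<open>XF_const\<close> the truncation error stays
      below \<open>\<delta> / 32\<close>; together with the error of the test function and the
      constant 16 the total is below \<delta>.\<close>
    define d where "d = \<delta> / 32 / (?c + 1)"
    have d: "0 < d" using \<delta> by (simp add: d_def add_nonneg_pos)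
    define R where "R = 1 + K / d"
    have R1: "1 \<le> R" using K d by (simp add: R_def)
    have "K / d \<le> 1 + R^2" using R1 self_le_power[of R 2] by (simp add: R_def)
    then have KR: "K / (1 + R^2) \<le> d" using d by (simp add: field_simps add_pos_nonneg)
    let ?S = "lattice \<inter> {m :: real ^ 'd. norm m \<le> R}"
    define g where "g z = (\<Sum>m\<in>?S. ?F m * of_real (tent (z - m)))" for z
    have "\<exists>L. decay n L (\<lambda>z. \<Sum>m\<in>A. ?F m * of_real (tent (z - m)))" if "finite A" for A
      using that
    proof induction
      case empty
      show ?case by (intro exI[of _ 0]) (simp add: decay_def)
    next
      case (insert m A)
      then obtain L where "decay n L (\<lambda>z. \<Sum>m\<in>A. ?F m * of_real (tent (z - m)))" by blast
      moreover obtain L' where "decay n L' (\<lambda>z. ?F m * of_real (tent (z - m)))" using decay_tent by blast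
      ultimately show ?case using decay_add insert by (simp add: decay_add) blast
    qed
    then obtain L where L: "decay n L g" using finite_lattice_ball[of R] by (auto simp: g_def[abs_def])
    have gval: "g z = (if norm z \<le> R then ?F z else 0)" if z: "z \<in> lattice" for z
    proof -
      have "g z = (\<Sum>m\<in>?S. if m = z then ?F z else 0)"
        unfolding g_def
      proof (rule sum.cong[OF refl])
        fix m assume "m \<in> ?S"
        then show "?F m * of_real (tent (z - m)) = (if m = z then ?F z else 0)"
          using lattice_dist[of z m] z by (auto simp: tent_eq_0) (simp add: tent_def)
      qed
      also have "... = (if norm z \<le> R then ?F z else 0)" using z by (subst sum.delta[OF finite_lattice_ball]) auto
      finally show ?thesis .
    qed
    have "XF_norm M p q s (\<lambda>z. g z - ?F z) \<le> XF_norm M p q 0 (\<lambda>z. g z - ?F z)" by (rule XF_norm_mono_exponent[OF s q])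
    also have "... \<le> ennreal (?c * d * bracket (0 :: real ^ 'd) powr 0)"
    proof (rule XF_norm_le)
      fix z :: "real ^ 'd" assume z: "z \<in> dgrp M"
      then have zl: "z \<in> lattice" by (simp add: Torus dgrp_def)
      show "norm (g z - ?F z) \<le> d / wt (Suc CARD('d)) (z - 0)"
      proof (cases "norm z \<le> R")
        case True
        then show ?thesis using d by (simp add: gval[OF zl])
      next
        case False
        have "norm (?F z) \<le> K / (1 + (norm z)^2) / wt (Suc CARD('d)) z" using K(2)[OF z] by (simp add: wt_Suc)
        also have "... \<le> K / (1 + R^2) / wt (Suc CARD('d)) z"
          using False R1 K by (intro divide_right_mono divide_left_mono add_left_mono power_mono mult_pos_pos add_pos_nonneg) auto
        also have "... \<le> d / wt (Suc CARD('d)) z" by (intro divide_right_mono KR) simp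
        finally show ?thesis using False by (simp add: gval[OF zl])
      qed
    qed (use d p q Torus in auto)
    also have "... < ennreal (\<delta> / 32)"
      using mult_divide_Suc_less[OF XF_const_nonneg[where 'd='d] d32] \<delta> by (intro ennreal_lessI) (auto simp: d_def)
    finally have g_near: "XF_norm M p q s (\<lambda>z. g z - ?F z) < ennreal (\<delta> / 32)" .
    have "XF_norm M p q s (\<lambda>z. g z - fourier M T z) \<le> 16 * (XF_norm M p q s (\<lambda>z. g z - ?F z) + XF_norm M p q s (\<lambda>z. ?F z - fourier M T z))"
    proof (rule XF_norm_quasi_triangle[OF _ p q])
      show "norm (g z - fourier M T z) \<le> norm (g z - ?F z) + norm (?F z - fourier M T z)" for z
        using norm_triangle_ineq[of "g z - ?F z" "?F z - fourier M T z"] by simp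
    qed (simp_all add: Torus)
    also have "... < 16 * (ennreal (\<delta> / 32) + ennreal (\<delta> / 32))"
      using g_near near unfolding sym by (intro ennreal_mult_strict_left_mono add_strict_mono) auto
    also have "... = ennreal \<delta>" using \<delta> by (simp flip: ennreal_plus ennreal_numeral add: ennreal_mult[symmetric])
    finally show ?thesis using L by blast
  qed
qed

section \<open>Solutions from the Fourier side\<close>

text \<open>Each product in physical space is a convolution of transforms times one normalizing
  constant, and \<open>Suc m\<close> factors make \<open>m\<close> products.\<close>

lemma synth_power:
  fixes g :: "'d::finite cfun"
  assumes g: "decay n K g" and n: "CARD('d) \<le> n"
  shows "synth M g x ^ Suc m = synth M (\<lambda>z. of_real (gauss_const TYPE('d) ^ m) * cpow M g m z) x"
proof (induction m)
  case 0
  show ?case by simp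
next
  case (Suc m)
  let ?c = "complex_of_real (gauss_const TYPE('d))"
  have synth_eq: "synth M (\<lambda>z. of_real (gauss_const TYPE('d) ^ j) * h z) x = ?c ^ Suc j * (LINT z|dm M. h z * cis (x \<bullet> z))" for j h
    by (simp add: synth_def fourier_const_eq mult.assoc)
  have "synth M g x ^ Suc (Suc m) = synth M g x * synth M (\<lambda>z. of_real (gauss_const TYPE('d) ^ m) * cpow M g m z) x"
    unfolding power_Suc[of _ "Suc m"] Suc.IH ..
  also have "... = ?c ^ Suc (Suc m) * (LINT z|dm M. conv M g (cpow M g m) z * cis (x \<bullet> z))"
    unfolding synth_eq integral_conv_cis[OF g cpow_bounds'[OF g n] n] by (simp add: synth_def fourier_const_eq mult_ac)
  finally show ?case unfolding synth_eq by simp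
qed

text \<open>A known representative of the transform replaces the one chosen by
  \<open>fourier\<close>, and \<open>dm\<close> replaces the dual measure.\<close>

lemma multiplier_eq:
  fixes f \<phi> :: "'d::finite cfun"
  assumes T: "is_fourier M T f" and f [measurable]: "f \<in> borel_measurable borel" and \<phi>: "\<phi> \<in> test_functions M"
    and m [measurable]: "m \<in> borel_measurable borel"
  shows "multiplier M m T \<phi> = (LINT z|dm M. of_real (m (norm z)) * f z * fourier_fun M \<phi> (- z))"
proof -
  note [measurable] = fourier_fun_uminus_borel[OF \<phi>]
  have "multiplier M m T \<phi> = (LINT z|dual_measure M. of_real (m (norm z)) * f z * fourier_fun M \<phi> (- z))"
    unfolding multiplier_def inv_fourier_def
  proof (rule integral_cong_AE)
    show "AE z in dual_measure M. of_real (m (norm z)) * fourier M T z * fourier_fun M \<phi> (- z) = of_real (m (norm z)) * f z * fourier_fun M \<phi> (- z)"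
      using fourier_AE[OF T] by eventually_elim simp
    have dual_borel: "h \<in> borel_measurable (dual_measure M)" if "M = Euclidean ==> h \<in> borel_measurable borel" for h :: "'d cfun"
      using that by (cases M) (simp_all add: dual_measure_def)
    show "(\<lambda>z. of_real (m (norm z)) * fourier M T z * fourier_fun M \<phi> (- z)) \<in> borel_measurable (dual_measure M)"
    proof (rule dual_borel)
      assume "M = Euclidean"
      then have [measurable]: "fourier M T \<in> borel_measurable borel"
        using is_fourier_borel is_fourier_fourier[OF T] by blast
      show "(\<lambda>z. of_real (m (norm z)) * fourier M T z * fourier_fun M \<phi> (- z)) \<in> borel_measurable borel" by measurable
    qed
    show "(\<lambda>z. of_real (m (norm z)) * f z * fourier_fun M \<phi> (- z)) \<in> borel_measurable (dual_measure M)"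
      by (rule dual_borel) measurable
  qed
  also have "... = (LINT z|dm M. of_real (m (norm z)) * f z * fourier_fun M \<phi> (- z))"
    by (rule integral_dm[symmetric]) measurable
  finally show ?thesis .
qed

text \<open>Fubini on \<open>[0, t]\<close> times the dual group, with integrability from the decay
  in \<open>z\<close>. The gauge integral in time agrees with the Lebesgue integral on both
  sides.\<close>

lemma integral_duhamel:
  fixes G :: "real => 'd::finite cfun"
  assumes G: "jointly_continuous G" and Gb: "\<And>t z. norm (G t z) \<le> B / wt n z" and n: "CARD('d) \<le> n"
    and h [measurable]: "h \<in> borel_measurable borel" and hb: "\<And>z. norm (h z) \<le> H" and t: "0 \<le> t"
  shows "(LINT z|dm M. duhamel G t z * h z)
    = integral {0..t} (\<lambda>s. LINT z|dm M. of_real (sinc_symbol (t - s) (norm z)) * G s z * h z)"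
proof -
  let ?F = "\<lambda>s z. of_real (sinc_symbol (t - s) (norm z)) * G s z * h z"
  let ?I = "\<lambda>s z. indicator {0..t} s *\<^sub>R ?F s z"
  have H: "0 \<le> H" by (rule order_trans[OF norm_ge_zero hb])
  have B: "0 \<le> B" using order_trans[OF norm_ge_zero Gb[of 0 0]] by (simp add: wt_def)
  have "continuous_on UNIV (\<lambda>p :: real \<times> (real ^ 'd). of_real (sinc_symbol (t - fst p) (norm (snd p))) * G (fst p) (snd p))"
    by (intro continuous_intros continuous_on_joint[OF G])
  from borel_measurable_continuous_onI[OF this]
  have [measurable]: "(\<lambda>p. complex_of_real (sinc_symbol (t - fst p) (norm (snd p))) * G (fst p) (snd p)) \<in> borel_measurable (lborel \<Otimes>\<^sub>M dm M)"
    by (subst measurable_cong_sets[OF sets_pair_measure_cong[OF sets_lborel sets_dm] refl]) (simp add: borel_prod)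
  have meas: "(\<lambda>p. ?I (fst p) (snd p)) \<in> borel_measurable (lborel \<Otimes>\<^sub>M dm M)" by measurable
  have bound: "norm (?I s z) \<le> indicator {0..t} s * (t * (B / wt n z) * H)" for s z
  proof (cases "s \<in> {0..t}")
    case True
    have "\<bar>sinc_symbol (t - s) (norm z)\<bar> \<le> t" using abs_sinc_symbol_le[of "t - s" "norm z"] True by auto
    then have "\<bar>sinc_symbol (t - s) (norm z)\<bar> * norm (G s z) * norm (h z) \<le> t * (B / wt n z) * H"
      using t B H by (intro mult_mono Gb hb) auto
    then show ?thesis using True by (simp add: norm_mult)
  qed simp
  have "integrable (lborel \<Otimes>\<^sub>M dm M) (\<lambda>p. ?I (fst p) (snd p))"
  proof (rule integrableI_bounded[OF meas])
    have "(\<integral>\<^sup>+p. ennreal (norm (?I (fst p) (snd p))) \<partial>(lborel \<Otimes>\<^sub>M dm M)) = (\<integral>\<^sup>+s. (\<integral>\<^sup>+z. ennreal (norm (?I s z)) \<partial>dm M) \<partial>lborel)"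
      using dm.nn_integral_fst[of "\<lambda>p. ennreal (norm (?I (fst p) (snd p)))" lborel M] meas by simp
    also have "... \<le> (\<integral>\<^sup>+s. (\<integral>\<^sup>+(z :: real ^ 'd). ennreal (indicator {0..t} s * (t * (B / wt n z) * H)) \<partial>dm M) \<partial>lborel)"
      by (intro nn_integral_mono ennreal_leI bound)
    also have "... = (\<integral>\<^sup>+s. ennreal (indicator {0..t} s) * (\<integral>\<^sup>+(z :: real ^ 'd). ennreal (t * (B / wt n z) * H) \<partial>dm M) \<partial>lborel)"
      unfolding ennreal_mult'[OF indicator_pos_le] by (intro nn_integral_cong nn_integral_cmult) simp
    also have "... = (\<integral>\<^sup>+s. ennreal (indicator {0..t} s) \<partial>lborel) * (\<integral>\<^sup>+(z :: real ^ 'd). ennreal (t * (B / wt n z) * H) \<partial>dm M)"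
      by (intro nn_integral_multc) simp
    also have "(\<integral>\<^sup>+s. ennreal (indicator {0..t} s) \<partial>lborel) = ennreal t"
      using t by (simp add: ennreal_indicator)
    also have "ennreal t * (\<integral>\<^sup>+(z :: real ^ 'd). ennreal (t * (B / wt n z) * H) \<partial>dm M) < \<infinity>"
    proof -
      have "integrable (dm M) (\<lambda>z :: real ^ 'd. (t * B * H) * (1 / wt n z))" by (intro integrable_mult_right integrable_wt n)
      then have "(\<integral>\<^sup>+(z :: real ^ 'd). ennreal (norm ((t * B * H) * (1 / wt n z))) \<partial>dm M) < \<infinity>" by (simp only: integrable_iff_bounded)
      moreover have "norm ((t * B * H) * (1 / wt n z)) = t * (B / wt n z) * H" for z :: "real ^ 'd" using t B H by (simp add: abs_mult)
      ultimately show ?thesis by (simp add: ennreal_mult_less_top)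
    qed
    finally show "(\<integral>\<^sup>+p. ennreal (norm (?I (fst p) (snd p))) \<partial>(lborel \<Otimes>\<^sub>M dm M)) < \<infinity>" .
  qed
  then have int: "integrable (lborel \<Otimes>\<^sub>M dm M) (case_prod ?I)" by (simp add: case_prod_unfold)
  have inner: "(LINT s|lborel. ?I s z) = duhamel G t z * h z" for z
  proof -
    have "continuous_on {0..t} (\<lambda>s. ?F s z)" by (intro continuous_intros continuous_on_section[OF G])
    from set_borel_integral_eq_integral(2)[OF borel_integrable_atLeastAtMost'[OF this]]
    have "(LINT s|lborel. ?I s z) = integral {0..t} (\<lambda>s. ?F s z)" unfolding set_lebesgue_integral_def .
    also have "... = duhamel G t z * h z" by (simp add: duhamel_def)
    finally show ?thesis .
  qed
  have out: "(LINT z|dm M. ?I s z) = indicator {0..t} s *\<^sub>R (LINT z|dm M. ?F s z)" for s by simp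
  have "set_integrable lborel {0..t} (\<lambda>s. LINT z|dm M. ?F s z)"
    using lborel_dm.integrable_fst'[OF int[unfolded case_prod_unfold]] by (simp add: set_integrable_def)
  from set_borel_integral_eq_integral(2)[OF this]
  have "integral {0..t} (\<lambda>s. LINT z|dm M. ?F s z) = (LINT s|lborel. LINT z|dm M. ?I s z)"
    unfolding out set_lebesgue_integral_def by simp
  also have "... = (LINT z|dm M. LINT s|lborel. ?I s z)" using lborel_dm.Fubini_integral[OF int] by simp
  finally show ?thesis by (simp only: inner)
qed

lemma abs_cos_minus_one_le: "\<bar>cos x - 1\<bar> \<le> x^2" for x :: real
proof -
  have "cos x = 1 - 2 * (sin (x / 2))^2" using cos_double_sin[of "x / 2"] by simp
  moreover have "(sin (x / 2))^2 \<le> (x / 2)^2" using abs_sin_x_le_abs_x[of "x / 2"] by (simp only: abs_le_square_iff)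
  moreover have "(x / 2)^2 = x^2 / 4" by (simp add: power_divide)
  moreover have "0 \<le> (sin (x / 2))^2" by simp
  ultimately show ?thesis by linarith
qed

text \<open>The Taylor error \<open>(t * r)^2 / 2\<close>, divided by \<open>r\<close>, is linear in
  \<open>r\<close> and is absorbed by \<open>1 + r^2\<close>, so that this symbol costs the same
  weight as the cosine.\<close>

lemma abs_sinc_symbol_minus_le:
  assumes "0 \<le> r"
  shows "\<bar>sinc_symbol t r - t\<bar> \<le> t^2 * (1 + r^2)"
proof (cases "r = 0")
  case False
  have "\<bar>sin (t * r) - t * r\<bar> \<le> (t * r)^2 / 2"
    using Maclaurin_sin_bound[of "t * r" 2] by (simp add: sin_coeff_def numeral_2_eq_2)
  moreover have "sinc_symbol t r - t = (sin (t * r) - t * r) / r" using False by (simp add: sinc_symbol_def field_simps)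
  ultimately have "\<bar>sinc_symbol t r - t\<bar> \<le> (t * r)^2 / 2 / r"
    using assms by (simp only: abs_divide abs_of_nonneg divide_right_mono)
  also have "... = t^2 * (r / 2)" using False by (simp add: power2_eq_square)
  also have "... \<le> t^2 * (1 + r^2)"
  proof (rule mult_left_mono)
    have "0 \<le> (r - 1)^2" by simp
    then have "2 * r \<le> r^2 + 1" by (simp add: power2_diff)
    then show "r / 2 \<le> 1 + r^2" using assms by linarith
  qed simp
  finally show ?thesis .
qed (simp add: sinc_symbol_def)

lemma has_vector_derivative_quadratic:
  fixes f :: "real => complex"
  assumes le: "\<And>t. 0 \<le> t ==> t \<le> T ==> norm (f t - f 0 - of_real t * v) \<le> C * t^2"
  shows "(f has_vector_derivative v) (at 0 within {0..T})"
  unfolding has_vector_derivative_def has_derivative_within_alt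
proof (intro conjI allI impI bounded_linear_scaleR_left)
  fix e :: real assume e: "0 < e"
  show "\<exists>d>0. \<forall>y\<in>{0..T}. norm (y - 0) < d \<longrightarrow> norm (f y - f 0 - (y - 0) *\<^sub>R v) \<le> e * norm (y - 0)"
  proof (intro exI conjI ballI impI)
    show "0 < e / (\<bar>C\<bar> + 1)" using e by (simp add: add_nonneg_pos)
    fix y assume y: "y \<in> {0..T}" "norm (y - 0) < e / (\<bar>C\<bar> + 1)"
    then have "y * (\<bar>C\<bar> + 1) \<le> e" by (simp add: field_simps add_nonneg_pos)
    have "C * y^2 \<le> (\<bar>C\<bar> + 1) * y^2" by (intro mult_right_mono) auto
    also have "... = (y * (\<bar>C\<bar> + 1)) * y" by (simp add: power2_eq_square)
    also have "... \<le> e * y" using \<open>y * (\<bar>C\<bar> + 1) \<le> e\<close> y by (intro mult_right_mono) auto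
    finally show "norm (f y - f 0 - (y - 0) *\<^sub>R v) \<le> e * norm (y - 0)"
      using le[of y] y by (simp add: scaleR_conv_of_real)
  qed
qed

section \<open>The free evolution, and the passage from Fourier profiles to solutions\<close>

definition free_wave :: "'d::finite cfun => 'd cfun => real => 'd cfun" where
  "free_wave g0 g1 t z = of_real (cos (t * norm z)) * g0 z + of_real (sinc_symbol t (norm z)) * g1 z"

lemma norm_free_wave_le: "norm (free_wave g0 g1 t z) \<le> norm (g0 z) + \<bar>t\<bar> * norm (g1 z)"
proof -
  have "norm (of_real (cos (t * norm z)) * g0 z) \<le> 1 * norm (g0 z)"
    unfolding norm_mult by (intro mult_right_mono) auto
  moreover have "norm (of_real (sinc_symbol t (norm z)) * g1 z) \<le> \<bar>t\<bar> * norm (g1 z)"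
    unfolding norm_mult by (intro mult_right_mono) (auto simp: abs_sinc_symbol_le)
  ultimately show ?thesis unfolding free_wave_def by (intro order_trans[OF norm_triangle_ineq add_mono]) auto
qed

lemma continuous_on_free_wave:
  assumes "continuous_on UNIV g0" "continuous_on UNIV g1"
  shows "continuous_on UNIV (\<lambda>(t, z). free_wave g0 g1 t z)"
  unfolding free_wave_def case_prod_unfold
  by (intro continuous_intros continuous_on_compose2[OF assms(1)] continuous_on_compose2[OF assms(2)]) auto

text \<open>The factor \<open>1 + (norm z)^2\<close> from the two symbols is exactly one order of
  the weight; hence \<open>Suc n\<close> for the data and \<open>n\<close> for the error.\<close>

lemma free_wave_small_time:
  fixes g0 g1 :: "'d::finite cfun"
  assumes g0: "decay (Suc n) K0 g0" and g1: "decay (Suc n) K1 g1"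
  shows "norm (free_wave g0 g1 t z - g0 z - of_real t * g1 z) \<le> t^2 * ((K0 + K1) / wt n z)"
proof -
  let ?r = "norm z"
  have w: "(1 + ?r^2) * (K / wt (Suc n) z) = K / wt n z" for K
    using wt_neq_0[of 1 z] by (simp add: wt_Suc wt_def)
  have "free_wave g0 g1 t z - g0 z - of_real t * g1 z = of_real (cos (t * ?r) - 1) * g0 z + of_real (sinc_symbol t ?r - t) * g1 z"
    by (simp add: free_wave_def algebra_simps)
  also have "norm ... \<le> \<bar>cos (t * ?r) - 1\<bar> * norm (g0 z) + \<bar>sinc_symbol t ?r - t\<bar> * norm (g1 z)"
    by (rule order_trans[OF norm_triangle_ineq]) (simp only: norm_mult norm_of_real order_refl)
  also have "... \<le> (t^2 * (1 + ?r^2)) * (K0 / wt (Suc n) z) + (t^2 * (1 + ?r^2)) * (K1 / wt (Suc n) z)"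
  proof (intro add_mono mult_mono decayD[OF g0] decayD[OF g1] abs_sinc_symbol_minus_le)
    have "\<bar>cos (t * ?r) - 1\<bar> \<le> t^2 * ?r^2" using abs_cos_minus_one_le[of "t * ?r"] by (simp add: power_mult_distrib)
    then show "\<bar>cos (t * ?r) - 1\<bar> \<le> t^2 * (1 + ?r^2)" by (rule order_trans) (intro mult_left_mono; simp)
  qed auto
  also have "... = t^2 * ((K0 + K1) / wt n z)"
    unfolding mult.assoc w by (simp add: add_divide_distrib distrib_left)
  finally show ?thesis .
qed

text \<open>Every clause of the solution concept becomes a statement about integrals of profiles.
  Continuity in time is dominated convergence, the initial velocity comes from a quadratic expansion
  at time 0, and the factor \<open>gauss_const TYPE('d) ^ m\<close> in the profile equation
  compensates the one in \<open>synth_power\<close>.\<close>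

theorem wave_solution_synth:
  fixes U :: "real => 'd::finite cfun"
  assumes n: "CARD('d) + 2 \<le> n" and g0: "decay (Suc n) K0 g0" and g1: "decay (Suc n) K1 g1"
    and U: "jointly_continuous U" and Ub: "\<And>t z. norm (U t z) \<le> K / wt n z"
    and eq: "\<And>t z. t \<in> {0..T} ==> U t z = free_wave g0 g1 t z + of_real (sg * gauss_const TYPE('d) ^ m) * duhamel (\<lambda>s. cpow M (U s) m) t z"
    and T: "0 < T"
  shows "wave_solution M sg (Suc m) T (\<lambda>t. synth M (U t)) (fdist M (synth M g0)) (fdist M (synth M g1))"
proof -
  let ?\<kappa> = "sg * gauss_const TYPE('d) ^ m"
  let ?G = "\<lambda>s. cpow M (U s) m"
  have n': "CARD('d) \<le> n" using n by simp
  have g0': "decay n K0 g0" and g1': "decay n K1 g1" by (rule decay_mono[OF g0] decay_mono[OF g1]; simp)+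
  have Ud: "decay n K (U t)" for t using Ub continuous_on_section(2)[OF U] by (simp add: decay_def)
  have int: "integrable (dm M) g0" "integrable (dm M) g1" "integrable (dm M) (U t)" for t
    using integrable_decay[OF g0' n'] integrable_decay[OF g1' n'] integrable_decay[OF Ud n'] by auto
  have FL: "fdist M (synth M h) \<in> FL M s 1" if "decay n L h" "s \<le> 0" for h :: "'d cfun" and L s
    by (rule synth_FL[OF decay_mono[OF that(1) order_refl n] that(2)])
  define B where "B = cpow_const n m * (K * dmK M TYPE('d)) ^ m * K"
  have G: "jointly_continuous ?G" by (rule continuous_on_cpow_param[OF U Ub n'])
  have Gd: "decay n B (?G t)" for t unfolding B_def by (rule cpow_bounds'[OF Ud n'])
  have Gb: "norm (?G t z) \<le> B / wt n z" for t z by (rule decayD[OF Gd])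
  have fd: "fdist M (synth M h) \<phi> = (LINT z|dm M. h z * fourier_fun M \<phi> (- z))" if "decay n L h" "\<phi> \<in> test_functions M" for h \<phi> :: "'d cfun" and L
    by (rule fdist_synth[OF integrable_decay[OF that(1) n'] integrable_test_function[OF that(2)]])
  have hat_bound: "\<exists>H. \<forall>z. norm (fourier_fun M \<phi> z) \<le> H" for \<phi> :: "'d cfun"
    using norm_fourier_fun_le[of M \<phi>] by blast
  have prod_int: "integrable (dm M) (\<lambda>z. h z * fourier_fun M \<phi> (- z))" if h: "h \<in> borel_measurable borel" "\<And>z. norm (h z) \<le> L / wt j z" "CARD('d) \<le> j" and \<phi>: "\<phi> \<in> test_functions M" for h \<phi> :: "'d cfun" and L j
  proof -
    obtain H where H: "norm (fourier_fun M \<phi> z) \<le> H" for z using hat_bound by blast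
    note [measurable] = fourier_fun_uminus_borel[OF \<phi>] h(1)
    show ?thesis
    proof (rule integrable_majorant)
      show "integrable (dm M) (\<lambda>z :: real ^ 'd. (L * H) * (1 / wt j z))" by (intro integrable_mult_right integrable_wt h(3))
      have "norm (h z * fourier_fun M \<phi> (- z)) \<le> (L / wt j z) * H" for z
        unfolding norm_mult using order_trans[OF norm_ge_zero h(2)] by (intro mult_mono h(2) H) auto
      then have "norm (h z * fourier_fun M \<phi> (- z)) \<le> norm ((L * H) * (1 / wt j z))" for z
        by (rule order_trans) (simp only: real_norm_def times_divide_eq_left times_divide_eq_right mult_1_right abs_ge_self)
      then show "AE z in dm M. norm (h z * fourier_fun M \<phi> (- z)) \<le> norm ((L * H) * (1 / wt j z))"
        by (rule AE_I2)
    qed measurable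
  qed
  have U0: "U 0 = g0" using eq[of 0] T by (auto simp: free_wave_def duhamel_def fun_eq_iff)
  \<comment> \<open>The free wave deviates from its linear expansion at time 0 by a multiple of
    \<open>t^2\<close>, and the Duhamel term is itself of that order; this yields the initial
    velocity.\<close>
  have sq: "norm (U t z - g0 z - of_real t * g1 z) \<le> t^2 * ((K0 + K1 + \<bar>?\<kappa>\<bar> * B) / wt n z)" if t: "t \<in> {0..T}" for t z
  proof -
    have "norm (duhamel ?G t z) \<le> t^2 * (B / wt n z)" using t by (intro norm_duhamel_le G Gb) auto
    then have "\<bar>?\<kappa>\<bar> * norm (duhamel ?G t z) \<le> \<bar>?\<kappa>\<bar> * (t^2 * (B / wt n z))" by (intro mult_left_mono) auto
    moreover have "norm (U t z - g0 z - of_real t * g1 z) \<le> norm (free_wave g0 g1 t z - g0 z - of_real t * g1 z) + norm (of_real ?\<kappa> * duhamel ?G t z)"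
      using norm_triangle_ineq[of "free_wave g0 g1 t z - g0 z - of_real t * g1 z" "of_real ?\<kappa> * duhamel ?G t z"]
      unfolding eq[OF t] by (simp add: algebra_simps)
    moreover have "norm (of_real ?\<kappa> * duhamel ?G t z) = \<bar>?\<kappa>\<bar> * norm (duhamel ?G t z)" by (simp only: norm_mult norm_of_real)
    moreover have "t^2 * ((K0 + K1 + \<bar>?\<kappa>\<bar> * B) / wt n z) = t^2 * ((K0 + K1) / wt n z) + \<bar>?\<kappa>\<bar> * (t^2 * (B / wt n z))"
      by (simp add: add_divide_distrib distrib_left)
    ultimately show ?thesis using free_wave_small_time[OF g0 g1, of t z] by linarith
  qed
  have cont: "((\<lambda>t'. FL_norm M 0 1 (fdist M (synth M (U t')) - fdist M (synth M (U t)))) \<longlongrightarrow> 0) (at t within {0..T})" for t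
    unfolding tendsto_at_iff_sequentially
  proof (intro allI impI)
    fix X assume X: "X \<longlonglongrightarrow> t"
    have b0: "bracket z powr 0 = 1" for z :: "real ^ 'd" using bracket_ge_1[of z] by (auto simp: powr_def)
    have FLX: "FL_norm M 0 1 (fdist M (synth M (U t')) - fdist M (synth M (U t))) = ennreal (LINT z|dm M. norm (U t' z - U t z))" for t'
    proof -
      have [measurable]: "U t' \<in> borel_measurable borel" "U t \<in> borel_measurable borel" by (rule decay_borel[OF Ud])+
      have "FL_norm M 0 1 (fdist M (synth M (U t')) - fdist M (synth M (U t))) = (\<integral>\<^sup>+z. ennreal (norm (U t' z - U t z)) \<partial>dual_measure M)"
        unfolding FL_norm_eq[OF is_fourier_diff[OF is_fourier_synth[OF int(3)] is_fourier_synth[OF int(3)]]]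
        by (simp only: b0 mult_1)
      also have "... = (\<integral>\<^sup>+z. ennreal (norm (U t' z - U t z)) \<partial>dm M)" by (rule nn_integral_dm[symmetric]) measurable
      also have "... = ennreal (LINT z|dm M. norm (U t' z - U t z))"
        by (intro nn_integral_eq_integral integrable_norm Bochner_Integration.integrable_diff int) auto
      finally show ?thesis .
    qed
    have "(\<lambda>i. LINT z|dm M. norm (U (X i) z - U t z)) \<longlonglongrightarrow> (LINT (z :: real ^ 'd)|dm M. 0)"
    proof (rule integral_dominated_convergence)
      show "integrable (dm M) (\<lambda>z :: real ^ 'd. (2 * K) * (1 / wt n z))" by (intro integrable_mult_right integrable_wt n')
      show "(\<lambda>z. norm (U (X i) z - U t z)) \<in> borel_measurable (dm M)" for i
        using decay_borel[OF Ud] by simp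
      show "AE z in dm M. (\<lambda>i. norm (U (X i) z - U t z)) \<longlonglongrightarrow> 0"
      proof (rule AE_I2)
        fix z :: "real ^ 'd"
        have "(\<lambda>i. U (X i) z) \<longlonglongrightarrow> U t z"
          using continuous_on_tendsto_compose[OF continuous_on_section(1)[OF U, of UNIV z] X] by simp
        then have "(\<lambda>i. norm (U (X i) z - U t z)) \<longlonglongrightarrow> norm (U t z - U t z)" by (intro tendsto_intros)
        then show "(\<lambda>i. norm (U (X i) z - U t z)) \<longlonglongrightarrow> 0" by simp
      qed
      show "AE z in dm M. norm (norm (U (X i) z - U t z)) \<le> (2 * K) * (1 / wt n z)" for i
      proof (rule AE_I2)
        fix z :: "real ^ 'd"
        have "norm (U (X i) z - U t z) \<le> K / wt n z + K / wt n z"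
          by (rule order_trans[OF norm_triangle_ineq4 add_mono[OF Ub Ub]])
        then show "norm (norm (U (X i) z - U t z)) \<le> (2 * K) * (1 / wt n z)" by simp
      qed
    qed simp
    then show "((\<lambda>t'. FL_norm M 0 1 (fdist M (synth M (U t')) - fdist M (synth M (U t)))) \<circ> X) \<longlonglongrightarrow> 0"
      unfolding FLX o_def using tendsto_ennrealI by fastforce
  qed
  have deriv: "((\<lambda>t. fdist M (synth M (U t)) \<phi>) has_vector_derivative fdist M (synth M g1) \<phi>) (at 0 within {0..T})" if \<phi>: "\<phi> \<in> test_functions M" for \<phi> :: "'d cfun"
  proof -
    obtain H where H: "norm (fourier_fun M \<phi> z) \<le> H" for z using hat_bound by blast
    have H0: "0 \<le> H" by (rule order_trans[OF norm_ge_zero H])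
    let ?C = "(K0 + K1 + \<bar>?\<kappa>\<bar> * B) * H * (LINT (z :: real ^ 'd)|dm M. 1 / wt n z)"
    show ?thesis
    proof (rule has_vector_derivative_quadratic[where C="?C"])
      fix t assume t: "0 \<le> t" "t \<le> T"
      have i: "integrable (dm M) (\<lambda>z. U t z * fourier_fun M \<phi> (- z))" "integrable (dm M) (\<lambda>z. g0 z * fourier_fun M \<phi> (- z))"
        "integrable (dm M) (\<lambda>z. g1 z * fourier_fun M \<phi> (- z))"
        by (rule prod_int[OF decay_borel[OF Ud] Ub n' \<phi>] prod_int[OF decay_borel[OF g0'] decayD[OF g0'] n' \<phi>] prod_int[OF decay_borel[OF g1'] decayD[OF g1'] n' \<phi>])+
      have "fdist M (synth M (U t)) \<phi> - fdist M (synth M (U 0)) \<phi> - of_real t * fdist M (synth M g1) \<phi> = (LINT z|dm M. (U t z - g0 z - of_real t * g1 z) * fourier_fun M \<phi> (- z))"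
        unfolding U0 fd[OF Ud \<phi>] fd[OF g0' \<phi>] fd[OF g1' \<phi>] using i by (simp add: left_diff_distrib mult.assoc)
      also have "norm ... \<le> (LINT (z :: real ^ 'd)|dm M. (t^2 * (K0 + K1 + \<bar>?\<kappa>\<bar> * B) * H) * (1 / wt n z))"
      proof (rule Bochner_Integration.integral_norm_bound_integral)
        show "integrable (dm M) (\<lambda>z. (U t z - g0 z - of_real t * g1 z) * fourier_fun M \<phi> (- z))"
          using i by (simp add: left_diff_distrib mult.assoc)
        show "integrable (dm M) (\<lambda>z :: real ^ 'd. (t^2 * (K0 + K1 + \<bar>?\<kappa>\<bar> * B) * H) * (1 / wt n z))"
          by (intro integrable_mult_right integrable_wt n')
        fix z :: "real ^ 'd"
        have s: "norm (U t z - g0 z - of_real t * g1 z) \<le> t^2 * ((K0 + K1 + \<bar>?\<kappa>\<bar> * B) / wt n z)" using t by (intro sq) auto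
        have "norm ((U t z - g0 z - of_real t * g1 z) * fourier_fun M \<phi> (- z)) \<le> (t^2 * ((K0 + K1 + \<bar>?\<kappa>\<bar> * B) / wt n z)) * H"
          unfolding norm_mult by (intro mult_mono s H order_trans[OF norm_ge_zero s]) simp
        then show "norm ((U t z - g0 z - of_real t * g1 z) * fourier_fun M \<phi> (- z)) \<le> (t^2 * (K0 + K1 + \<bar>?\<kappa>\<bar> * B) * H) * (1 / wt n z)"
          by simp
      qed
      also have "... = ?C * t^2"
        unfolding integral_cmult by (simp only: mult_ac)
      finally show "norm (fdist M (synth M (U t)) \<phi> - fdist M (synth M (U 0)) \<phi> - of_real t * fdist M (synth M g1) \<phi>) \<le> ?C * t^2" .
    qed
  qed
  have sinc_borel: "sinc_symbol t \<in> borel_measurable borel" for t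
    by (intro borel_measurable_continuous_onI continuous_intros)
  have duh: "fdist M (synth M (U t)) \<phi> = multiplier M (\<lambda>r. cos (t * r)) (fdist M (synth M g0)) \<phi> + multiplier M (sinc_symbol t) (fdist M (synth M g1)) \<phi>
      + of_real sg * integral {0..t} (\<lambda>t'. multiplier M (sinc_symbol (t - t')) (fdist M (\<lambda>x. synth M (U t') x ^ Suc m)) \<phi>)"
    if t: "t \<in> {0..T}" and \<phi>: "\<phi> \<in> test_functions M" for t and \<phi> :: "'d cfun"
  proof -
    obtain H where H: "norm (fourier_fun M \<phi> z) \<le> H" for z using hat_bound by blast
    let ?h = "\<lambda>z. fourier_fun M \<phi> (- z)"
    let ?c = "complex_of_real (gauss_const TYPE('d) ^ m)"
    have m0: "multiplier M (\<lambda>r. cos (t * r)) (fdist M (synth M g0)) \<phi> = (LINT z|dm M. of_real (cos (t * norm z)) * g0 z * ?h z)"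
      by (rule multiplier_eq[OF is_fourier_synth[OF int(1)] decay_borel[OF g0'] \<phi>]) measurable
    have m1: "multiplier M (sinc_symbol t) (fdist M (synth M g1)) \<phi> = (LINT z|dm M. of_real (sinc_symbol t (norm z)) * g1 z * ?h z)"
      by (rule multiplier_eq[OF is_fourier_synth[OF int(2)] decay_borel[OF g1'] \<phi> sinc_borel])
    have m2: "multiplier M (sinc_symbol (t - t')) (fdist M (\<lambda>x. synth M (U t') x ^ Suc m)) \<phi> = ?c * (LINT z|dm M. of_real (sinc_symbol (t - t') (norm z)) * ?G t' z * ?h z)" for t'
    proof -
      have d: "decay n (norm ?c * B) (\<lambda>z. ?c * ?G t' z)" by (rule decay_cmult[OF Gd])
      have "multiplier M (sinc_symbol (t - t')) (fdist M (\<lambda>x. synth M (U t') x ^ Suc m)) \<phi> = (LINT z|dm M. of_real (sinc_symbol (t - t') (norm z)) * (?c * ?G t' z) * ?h z)"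
        unfolding synth_power[OF Ud n']
        by (rule multiplier_eq[OF is_fourier_synth[OF integrable_decay[OF d n']] decay_borel[OF d] \<phi> sinc_borel])
      also have "... = (LINT z|dm M. ?c * (of_real (sinc_symbol (t - t') (norm z)) * ?G t' z * ?h z))"
        by (intro Bochner_Integration.integral_cong refl) (simp only: mult_ac)
      finally show ?thesis by simp
    qed
    have [measurable]: "g0 \<in> borel_measurable borel" "g1 \<in> borel_measurable borel" "sinc_symbol t \<in> borel_measurable borel"
      using decay_borel[OF g0'] decay_borel[OF g1'] sinc_borel by auto
    have i0: "integrable (dm M) (\<lambda>z. of_real (cos (t * norm z)) * g0 z * ?h z)"
    proof (rule prod_int[OF _ _ n' \<phi>])
      fix z
      have "norm (complex_of_real (cos (t * norm z)) * g0 z) \<le> 1 * norm (g0 z)" unfolding norm_mult by (intro mult_right_mono) auto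
      then show "norm (complex_of_real (cos (t * norm z)) * g0 z) \<le> K0 / wt n z" using decayD[OF g0', of z] by simp
    qed measurable
    have i1: "integrable (dm M) (\<lambda>z. of_real (sinc_symbol t (norm z)) * g1 z * ?h z)"
    proof (rule prod_int[OF _ _ n' \<phi>])
      fix z
      have "norm (complex_of_real (sinc_symbol t (norm z)) * g1 z) \<le> \<bar>t\<bar> * (K1 / wt n z)"
        unfolding norm_mult by (intro mult_mono decayD[OF g1']) (auto simp: abs_sinc_symbol_le)
      then show "norm (complex_of_real (sinc_symbol t (norm z)) * g1 z) \<le> (\<bar>t\<bar> * K1) / wt n z" by simp
    qed measurable
    have dc: "duhamel ?G t \<in> borel_measurable borel"
    proof -
      have "continuous_on UNIV (\<lambda>z. duhamel ?G (max 0 (min T t)) z)"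
        using T by (intro continuous_on_section(2)[OF continuous_on_duhamel[OF G]]) simp
      then show ?thesis using t by (intro borel_measurable_continuous_onI) simp
    qed
    have i2: "integrable (dm M) (\<lambda>z. duhamel ?G t z * ?h z)"
    proof (rule prod_int[OF dc _ n' \<phi>])
      fix z
      have "norm (duhamel ?G t z) \<le> t^2 * (B / wt n z)" using t by (intro norm_duhamel_le G Gb) auto
      then show "norm (duhamel ?G t z) \<le> (t^2 * B) / wt n z" by simp
    qed
    have "fdist M (synth M (U t)) \<phi> = (LINT z|dm M. of_real (cos (t * norm z)) * g0 z * ?h z + of_real (sinc_symbol t (norm z)) * g1 z * ?h z + of_real ?\<kappa> * (duhamel ?G t z * ?h z))"
      unfolding fd[OF Ud \<phi>] by (simp add: eq[OF t] free_wave_def distrib_right mult.assoc)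
    also have "... = (LINT z|dm M. of_real (cos (t * norm z)) * g0 z * ?h z) + (LINT z|dm M. of_real (sinc_symbol t (norm z)) * g1 z * ?h z) + of_real ?\<kappa> * (LINT z|dm M. duhamel ?G t z * ?h z)"
      using i0 i1 i2 by simp
    also have "of_real ?\<kappa> * (LINT z|dm M. duhamel ?G t z * ?h z) = of_real sg * integral {0..t} (\<lambda>t'. ?c * (LINT z|dm M. of_real (sinc_symbol (t - t') (norm z)) * ?G t' z * ?h z))"
      using t by (subst integral_duhamel[OF G Gb n' fourier_fun_uminus_borel[OF \<phi>] H]) auto
    finally show ?thesis unfolding m0 m1 m2 .
  qed
  show ?thesis
    unfolding wave_solution_def
    using FL[OF g0'] FL[OF g1'] FL[OF Ud] admissible_synth[OF int(3)] cont deriv duh by (auto simp: U0)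
qed

section \<open>Convolution powers of two distant pulses\<close>

text \<open>The vector \<open>b\<close> shifts the variable of integration and so has to lie in the
  dual group, while \<open>a\<close> only shifts the point of evaluation.\<close>

lemma conv_translate:
  fixes f g :: "'d::finite cfun"
  assumes b: "b \<in> dgrp M" and [measurable]: "f \<in> borel_measurable borel" "g \<in> borel_measurable borel"
  shows "conv M (\<lambda>z. f (z - a)) (\<lambda>z. g (z - b)) z = conv M f g (z - (a + b))"
proof -
  have "(LINT \<eta>|dm M. f (z - \<eta> - a) * g (\<eta> - b)) = (LINT \<eta>|dm M. f (z - (\<eta> + b) - a) * g (\<eta> + b - b))"
    by (rule integral_dm_translate[where f="\<lambda>\<eta>. f (z - \<eta> - a) * g (\<eta> - b)", OF b, symmetric]) measurable
  also have "... = (LINT \<eta>|dm M. f (z - (a + b) - \<eta>) * g \<eta>)" by (simp add: algebra_simps)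
  finally show ?thesis by (simp add: conv_def)
qed

text \<open>Pascal's rule in summed form: the inductive step of the binomial theorem for convolution
  powers.\<close>

lemma pascal_sum:
  fixes h :: "nat => nat => complex"
  shows "(\<Sum>i\<le>p. of_nat (p choose i) * (h (Suc i) (p - i) + h i (Suc (p - i)))) = (\<Sum>i\<le>Suc p. of_nat (Suc p choose i) * h i (Suc p - i))"
proof -
  have "(\<Sum>i\<le>p. of_nat (p choose i) * h i (Suc (p - i))) = (\<Sum>i\<le>p. of_nat (p choose i) * h i (Suc p - i))"
    by (intro sum.cong) (auto simp: Suc_diff_le)
  also have "... = (\<Sum>i\<le>Suc p. of_nat (p choose i) * h i (Suc p - i))" by simp
  also have "... = h 0 (Suc p) + (\<Sum>i\<le>p. of_nat (p choose Suc i) * h (Suc i) (p - i))"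
    by (subst sum.atMost_Suc_shift) simp
  finally have "(\<Sum>i\<le>p. of_nat (p choose i) * h i (Suc (p - i))) = h 0 (Suc p) + (\<Sum>i\<le>p. of_nat (p choose Suc i) * h (Suc i) (p - i))" .
  moreover have "(\<Sum>i\<le>Suc p. of_nat (Suc p choose i) * h i (Suc p - i)) = h 0 (Suc p) + (\<Sum>i\<le>p. of_nat (Suc p choose Suc i) * h (Suc i) (p - i))"
    by (subst sum.atMost_Suc_shift) simp
  ultimately show ?thesis by (simp add: distrib_left distrib_right sum.distrib)
qed

lemma conv_sum_right:
  fixes f :: "'d::finite cfun"
  assumes "\<And>i. i \<in> A ==> integrable (dm M) (\<lambda>\<eta>. f (z - \<eta>) * g i \<eta>)"
  shows "conv M f (\<lambda>\<eta>. \<Sum>i\<in>A. c i * g i \<eta>) z = (\<Sum>i\<in>A. c i * conv M f (g i) z)"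
proof -
  have "conv M f (\<lambda>\<eta>. \<Sum>i\<in>A. c i * g i \<eta>) z = (LINT \<eta>|dm M. (\<Sum>i\<in>A. c i * (f (z - \<eta>) * g i \<eta>)))"
    by (simp add: conv_def sum_distrib_left mult_ac)
  also have "... = (\<Sum>i\<in>A. LINT \<eta>|dm M. c i * (f (z - \<eta>) * g i \<eta>))"
    using assms by (intro Bochner_Integration.integral_sum) simp
  finally show ?thesis by (simp add: conv_def)
qed

lemma conv_two_left:
  fixes f g h :: "'d::finite cfun"
  assumes "integrable (dm M) (\<lambda>\<eta>. f (z - \<eta>) * h \<eta>)" "integrable (dm M) (\<lambda>\<eta>. g (z - \<eta>) * h \<eta>)"
  shows "conv M (\<lambda>z. \<alpha> * f z + \<beta> * g z) h z = \<alpha> * conv M f h z + \<beta> * conv M g h z"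
proof -
  have "conv M (\<lambda>z. \<alpha> * f z + \<beta> * g z) h z = (LINT \<eta>|dm M. \<alpha> * (f (z - \<eta>) * h \<eta>) + \<beta> * (g (z - \<eta>) * h \<eta>))"
    by (simp add: conv_def distrib_right mult.assoc)
  then show ?thesis using assms by (simp add: conv_def)
qed

lemma dgrp_scaleR_of_nat: "a \<in> dgrp M ==> of_nat i *\<^sub>R a \<in> dgrp M"
  by (induction i) (simp_all add: dgrp_0 scaleR_left_distrib dgrp_add)

lemma decay_translate:
  fixes f :: "'d::finite cfun"
  assumes f: "decay n K f"
  shows "decay n (K * (2 ^ n * wt n a)) (\<lambda>z. f (z - a))"
proof -
  have "norm (f (z - a)) \<le> K * (2 ^ n * wt n a) / wt n z" for z
  proof -
    have "wt n z \<le> 2 ^ n * (wt n (z - a) * wt n a)" using wt_add_mult_le[of n "z - a" a] by simp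
    then have "K * wt n z \<le> K * (2 ^ n * (wt n (z - a) * wt n a))" using decay_nonneg[OF f] by (rule mult_left_mono)
    then have "K / wt n (z - a) \<le> K * (2 ^ n * wt n a) / wt n z" by (simp add: field_simps)
    then show ?thesis using decayD[OF f, of "z - a"] by (rule order_trans[rotated])
  qed
  then show ?thesis unfolding decay_def by (auto intro!: decay_continuous[OF f] continuous_intros)
qed

text \<open>The binomial theorem for convolution: the positions of the chosen copies add up, and
  what remains is one translate of the power of \<open>f\<close>.\<close>

lemma cpow_two_translates:
  fixes f :: "'d::finite cfun"
  assumes f: "decay n K f" and n: "CARD('d) \<le> n" and a: "a \<in> dgrp M" and b: "b \<in> dgrp M"
  shows "cpow M (\<lambda>z. \<alpha> * f (z - a) + \<beta> * f (z - b)) j z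
    = (\<Sum>i\<le>Suc j. of_nat (Suc j choose i) * (\<alpha> ^ i * \<beta> ^ (Suc j - i) * cpow M f j (z - (of_nat i *\<^sub>R a + of_nat (Suc j - i) *\<^sub>R b))))"
proof (induction j arbitrary: z)
  case 0
  show ?case by simp
next
  case (Suc j)
  let ?P = "\<lambda>z. \<alpha> * f (z - a) + \<beta> * f (z - b)"
  let ?x = "\<lambda>i l. of_nat i *\<^sub>R a + of_nat l *\<^sub>R b"
  let ?c = "\<lambda>i. of_nat (Suc j choose i) * (\<alpha> ^ i * \<beta> ^ (Suc j - i))"
  define h where "h i l = \<alpha> ^ i * \<beta> ^ l * cpow M f (Suc j) (z - ?x i l)" for i l
  have fb: "f \<in> borel_measurable borel" by (rule decay_borel[OF f])
  note cp = cpow_bounds'[OF f n, where M=M and m=j]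
  have cb: "cpow M f j \<in> borel_measurable borel" by (rule decay_borel[OF cp])
  have x: "?x i l \<in> dgrp M" for i l by (intro dgrp_add dgrp_scaleR_of_nat a b)
  have i1: "integrable (dm M) (\<lambda>\<eta>. f (z - \<eta> - y) * cpow M f j (\<eta> - Z))" for y Z
    by (rule integrable_conv[OF decay_translate[OF f, of y] decay_translate[OF cp, of Z] n])
  have "cpow M ?P (Suc j) z = conv M ?P (\<lambda>z. \<Sum>i\<le>Suc j. ?c i * cpow M f j (z - ?x i (Suc j - i))) z"
    unfolding cpow.simps(2) by (rule arg_cong[where f="\<lambda>g. conv M ?P g z"]) (rule ext, simp only: Suc.IH mult.assoc)
  also have "... = (\<Sum>i\<le>Suc j. ?c i * conv M ?P (\<lambda>z. cpow M f j (z - ?x i (Suc j - i))) z)"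
    by (rule conv_sum_right) (use i1 in \<open>simp add: distrib_right mult.assoc\<close>)
  also have "... = (\<Sum>i\<le>Suc j. of_nat (Suc j choose i) * (h (Suc i) (Suc j - i) + h i (Suc (Suc j - i))))"
  proof (rule sum.cong[OF refl])
    fix i
    have "conv M ?P (\<lambda>z. cpow M f j (z - ?x i (Suc j - i))) z = \<alpha> * conv M f (cpow M f j) (z - (a + ?x i (Suc j - i))) + \<beta> * conv M f (cpow M f j) (z - (b + ?x i (Suc j - i)))"
      by (subst conv_two_left[OF i1 i1]) (simp only: conv_translate[OF x fb cb])
    also have "... = \<alpha> * cpow M f (Suc j) (z - ?x (Suc i) (Suc j - i)) + \<beta> * cpow M f (Suc j) (z - ?x i (Suc (Suc j - i)))"
      by (simp add: scaleR_left_distrib add_ac)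
    finally show "?c i * conv M ?P (\<lambda>z. cpow M f j (z - ?x i (Suc j - i))) z = of_nat (Suc j choose i) * (h (Suc i) (Suc j - i) + h i (Suc (Suc j - i)))"
      by (simp only: h_def power_Suc distrib_left mult_ac)
  qed
  also have "... = (\<Sum>i\<le>Suc (Suc j). of_nat (Suc (Suc j) choose i) * h i (Suc (Suc j) - i))" by (rule pascal_sum)
  finally show ?case unfolding h_def .
qed

text \<open>Supports add under convolution; the radius is \<open>Suc j\<close> because
  \<open>cpow M f j\<close> has \<open>j + 1\<close> factors.\<close>

lemma cpow_eq_0:
  fixes f :: "'d::finite cfun"
  assumes f: "\<And>z. 1 \<le> norm z ==> f z = 0"
  shows "real (Suc j) \<le> norm z ==> cpow M f j z = 0"
proof (induction j arbitrary: z)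
  case 0
  then show ?case using f by simp
next
  case (Suc j)
  have "f (z - \<eta>) * cpow M f j \<eta> = 0" for \<eta>
  proof (cases "real (Suc j) \<le> norm \<eta>")
    case False
    have "norm z \<le> norm (z - \<eta>) + norm \<eta>" using norm_triangle_ineq[of "z - \<eta>" \<eta>] by simp
    then have "1 \<le> norm (z - \<eta>)" using False Suc.prems by simp
    then show ?thesis using f by simp
  qed (simp add: Suc.IH)
  then have "(\<lambda>\<eta>. f (z - \<eta>) * cpow M f j \<eta>) = (\<lambda>\<eta>. 0)" by (rule ext)
  then show ?case by (simp only: cpow.simps conv_def) simp
qed

text \<open>A neighbourhood of 0 has positive measure in both cases: open sets are not negligible
  for Lebesgue measure, and 0 is an atom of the lattice measure.\<close>

lemma integral_dm_pos:
  fixes f :: "real ^ 'd::finite => real"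
  assumes f: "integrable (dm M) f" and nonneg: "\<And>z. 0 \<le> f z" and V: "open V" "0 \<in> V" and pos: "\<And>z. z \<in> V ==> 0 < f z"
  shows "0 < (LINT z|dm M. f z)"
proof (rule ccontr)
  assume "\<not> 0 < (LINT z|dm M. f z)"
  then have "(LINT z|dm M. f z) = 0" 
    by (intro antisym integral_nonneg_AE AE_I2 nonneg) simp
  then have "AE z in dm M. f z = 0" using f nonneg by (simp add: integral_nonneg_eq_0_iff_AE)
  then have AE: "AE z in dm M. z \<notin> V" by eventually_elim (use pos in force)
  have [measurable]: "V \<in> sets borel" using V by simp
  show False
  proof (cases M)
    case Euclidean
    have "V \<in> null_sets lborel" using AE by (simp add: Euclidean dm_Euclidean AE_iff_null)
    then have "negligible V" by (simp add: negligible_iff_null_sets null_sets_completionI)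
    then show False using open_not_negligible[OF V(1)] V(2) by blast
  next
    case Torus
    have *: "dual_measure Torus = count_space (lattice :: (real ^ 'd) set)" by (simp add: dual_measure_def)
    have 0: "(\<integral>\<^sup>+z. indicator V z \<partial>dm Torus) = 0" using AE unfolding Torus by (simp add: nn_integral_0_iff_AE indicator_def)
    have "(\<integral>\<^sup>+z. indicator V z \<partial>dm Torus) = (\<integral>\<^sup>+z. indicator V z \<partial>count_space (lattice :: (real ^ 'd) set))"
      unfolding *[symmetric] by (rule nn_integral_dm) measurable
    then have "(\<integral>\<^sup>+z. indicator V z \<partial>count_space (lattice :: (real ^ 'd) set)) = 0" unfolding 0 by (rule sym)
    then have "AE z in count_space (lattice :: (real ^ 'd) set). indicator V z = (0 :: ennreal)" by (simp add: nn_integral_0_iff_AE)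
    then have "indicator V 0 = (0 :: ennreal)" by (simp add: AE_count_space lattice_def)
    then show False using V by simp
  qed
qed

lemma integrable_indicator_mult:
  fixes f :: "'d::finite cfun"
  assumes "integrable (dm M) f"
  shows "integrable (dm M) (\<lambda>z. indicator (unit_cell 0) z * f z)"
proof (rule integrable_majorant[OF assms])
  have [measurable]: "f \<in> borel_measurable borel" using borel_measurable_integrable[OF assms] by simp
  show "(\<lambda>z. indicator (unit_cell 0) z * f z) \<in> borel_measurable (dm M)"
    by (simp add: borel_measurable_indicator)
qed (simp add: norm_mult indicator_def)

text \<open>Positivity survives each convolution because, for \<open>norm z < 1\<close>, the unit
  balls about 0 and \<open>z\<close> are both neighbourhoods of 0.\<close>

lemma cpow_tent:
  "\<exists>r :: real ^ 'd::finite => real. (\<forall>z. cpow M (\<lambda>z. of_real (tent z)) j z = of_real (r z)) \<and> (\<forall>z. 0 \<le> r z) \<and> (\<forall>z. norm z < 1 \<longrightarrow> 0 < r z)"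
proof (induction j)
  case 0
  show ?case by (intro exI[of _ tent]) (simp add: tent_bounds, simp add: tent_def)
next
  case (Suc j)
  let ?f = "\<lambda>z :: real ^ 'd. complex_of_real (tent z)"
  obtain r where r: "cpow M ?f j z = of_real (r z)" "0 \<le> r z" "norm z < 1 ==> 0 < r z" for z using Suc by blast
  obtain K where K: "decay CARD('d) K ?f" using decay_tent[of "CARD('d)" 1 0] by auto
  let ?r = "\<lambda>z. LINT \<eta>|dm M. tent (z - \<eta>) * r \<eta>"
  have eq: "cpow M ?f (Suc j) z = of_real (?r z)" for z
    by (simp add: conv_def r(1) flip: of_real_mult integral_complex_of_real)
  have int: "integrable (dm M) (\<lambda>\<eta>. tent (z - \<eta>) * r \<eta>)" for z
  proof -
    have "integrable (dm M) (\<lambda>\<eta>. ?f (z - \<eta>) * cpow M ?f j \<eta>)"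
      by (rule integrable_conv[OF K cpow_bounds'[OF K order_refl] order_refl])
    then have "integrable (dm M) (\<lambda>\<eta>. complex_of_real (tent (z - \<eta>) * r \<eta>))" by (simp add: r(1))
    then show ?thesis by (simp only: complex_of_real_integrable_eq)
  qed
  have nonneg: "0 \<le> tent (z - \<eta>) * r \<eta>" for z \<eta> by (intro mult_nonneg_nonneg tent_bounds(1) r(2))
  show ?case
  proof (intro exI conjI allI impI)
    fix z :: "real ^ 'd"
    show "cpow M ?f (Suc j) z = of_real (?r z)" by (rule eq)
    show "0 \<le> ?r z" using nonneg by (intro integral_nonneg_AE AE_I2)
    assume z: "norm z < 1"
    show "0 < ?r z"
    proof (rule integral_dm_pos[OF int nonneg])
      show "open (ball 0 1 \<inter> ball z 1)" "0 \<in> ball 0 1 \<inter> ball z 1" using z by (auto simp: dist_norm)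
      fix \<eta> assume "\<eta> \<in> ball 0 1 \<inter> ball z 1"
      then show "0 < tent (z - \<eta>) * r \<eta>" using r(3)[of \<eta>] by (simp add: tent_def dist_norm)
    qed
  qed
qed

text \<open>The ball of radius 1/2 lies in the unit cell, so the mass is positive. This number is
  the constant against which the error terms are measured in the end.\<close>

lemma cpow_tent_mass:
  obtains r :: "real ^ 'd::finite => real" where "\<And>z. cpow M (\<lambda>z. of_real (tent z)) j z = of_real (r z)" "\<And>z. 0 \<le> r z"
    "integrable (dm M) (\<lambda>z. indicator (unit_cell 0) z * r z)" "0 < (LINT z|dm M. indicator (unit_cell 0) z * r z)"
proof -
  let ?f = "\<lambda>z :: real ^ 'd. complex_of_real (tent z)"
  obtain r where r: "cpow M ?f j z = of_real (r z)" "0 \<le> r z" "norm z < 1 ==> 0 < r z" for z using cpow_tent by blast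
  obtain K where K: "decay CARD('d) K ?f" using decay_tent[of "CARD('d)" 1 0] by auto
  have "integrable (dm M) (\<lambda>z. indicator (unit_cell 0) z * cpow M ?f j z)"
    by (rule integrable_indicator_mult[OF integrable_decay[OF cpow_bounds'[OF K order_refl] order_refl]])
  moreover have "indicator (unit_cell 0) z * cpow M ?f j z = complex_of_real (indicator (unit_cell 0) z * r z)" for z
    by (simp add: r(1) indicator_def)
  ultimately have int: "integrable (dm M) (\<lambda>z. indicator (unit_cell 0) z * r z)"
    by (simp only: complex_of_real_integrable_eq)
  have "0 < (LINT z|dm M. indicator (unit_cell 0) z * r z)"
  proof (rule integral_dm_pos[OF int])
    show "open (ball (0 :: real ^ 'd) (1 / 2))" "(0 :: real ^ 'd) \<in> ball 0 (1 / 2)" by auto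
    fix z :: "real ^ 'd" assume "z \<in> ball 0 (1 / 2)"
    then have z: "norm z < 1 / 2" by simp
    have "- (1 / 2) \<le> z $ i" "z $ i < 1 / 2" for i using component_le_norm_cart[of z i] z by linarith+
    then have "z \<in> unit_cell 0" by (simp add: unit_cell_def)
    then show "0 < indicator (unit_cell 0) z * r z" using r(3)[of z] z by simp
  qed (use r(2) in simp)
  then show ?thesis using that r(1,2) int by blast
qed

lemma cpow_cmult: "cpow M (\<lambda>z. c * f z) j z = c ^ Suc j * cpow M f j z"
proof (induction j arbitrary: z)
  case (Suc j)
  have "cpow M (\<lambda>z. c * f z) (Suc j) z = (LINT \<eta>|dm M. c ^ Suc (Suc j) * (f (z - \<eta>) * cpow M f j \<eta>))"
    by (simp add: conv_def Suc.IH mult_ac)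
  then show ?case by (simp add: conv_def)
qed simp

section \<open>Free evolution of the pulses\<close>

text \<open>Here \<open>m\<close> stands for \<open>k - 1\<close>. The phases are those of half
  waves at frequencies of length \<open>N\<close> and \<open>m * N\<close>, with opposite
  signs.\<close>

definition pulses :: "nat => real => real ^ 'd::finite => real => 'd cfun" where
  "pulses m N a t z = cis (- (N * t)) * of_real (tent (z - a)) + cis (real m * N * t) * of_real (tent (z - (- (real m *\<^sub>R a))))"

lemma abs_cos_diff_le: "\<bar>cos x - cos y\<bar> \<le> \<bar>x - y\<bar>" for x y :: real
proof -
  have "\<bar>cos x - cos y\<bar> = 2 * (\<bar>sin ((x + y) / 2)\<bar> * \<bar>sin ((y - x) / 2)\<bar>)" by (simp add: cos_diff_cos abs_mult)
  also have "... \<le> 2 * (1 * \<bar>(y - x) / 2\<bar>)" by (intro mult_left_mono mult_mono abs_sin_x_le_abs_x) auto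
  finally show ?thesis by simp
qed

lemma abs_sin_diff_le: "\<bar>sin x - sin y\<bar> \<le> \<bar>x - y\<bar>" for x y :: real
proof -
  have "\<bar>sin x - sin y\<bar> = 2 * (\<bar>sin ((x - y) / 2)\<bar> * \<bar>cos ((x + y) / 2)\<bar>)" by (simp add: sin_diff_sin abs_mult)
  also have "... \<le> 2 * (\<bar>(x - y) / 2\<bar> * 1)" by (intro mult_left_mono mult_mono abs_sin_x_le_abs_x) auto
  finally show ?thesis by simp
qed

text \<open>With datum 1 and velocity \<open>\<i> * b\<close>, a frequency of length
  \<open>\<bar>b\<bar>\<close> evolves exactly as \<open>cis (b * t)\<close>. At other lengths
  \<open>r\<close> the error follows from Lipschitz bounds: one unit for the cosine and two for the
  sine term.\<close>

lemma half_wave_symbol: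
  assumes "0 \<le> r"
  shows "norm (of_real (cos (t * r)) + \<i> * of_real (b * sinc_symbol t r) - cis (b * t)) \<le> 3 * (\<bar>t\<bar> * \<bar>r - \<bar>b\<bar>\<bar>)"
proof -
  have r_sinc: "r * sinc_symbol t r = sin (t * r)" by (simp add: sinc_symbol_def)
  have lip: "\<bar>t * r - t * \<bar>b\<bar>\<bar> = \<bar>t\<bar> * \<bar>r - \<bar>b\<bar>\<bar>" by (simp add: abs_mult flip: right_diff_distrib)
  have "\<bar>cos (t * r) - cos (t * \<bar>b\<bar>)\<bar> \<le> \<bar>t * r - t * \<bar>b\<bar>\<bar>" by (rule abs_cos_diff_le)
  moreover have "cos (t * \<bar>b\<bar>) = cos (b * t)" by (cases "0 \<le> b") (simp_all add: mult.commute)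
  ultimately have re: "\<bar>cos (t * r) - cos (b * t)\<bar> \<le> \<bar>t\<bar> * \<bar>r - \<bar>b\<bar>\<bar>" by (simp only: lip)
  have s: "\<bar>\<bar>b\<bar> * sinc_symbol t r - sin (t * \<bar>b\<bar>)\<bar> \<le> 2 * (\<bar>t\<bar> * \<bar>r - \<bar>b\<bar>\<bar>)"
  proof -
    have "\<bar>(\<bar>b\<bar> - r) * sinc_symbol t r\<bar> \<le> \<bar>r - \<bar>b\<bar>\<bar> * \<bar>t\<bar>"
      unfolding abs_mult by (intro mult_mono abs_sinc_symbol_le) auto
    moreover have "\<bar>sin (t * r) - sin (t * \<bar>b\<bar>)\<bar> \<le> \<bar>t\<bar> * \<bar>r - \<bar>b\<bar>\<bar>" unfolding lip[symmetric] by (rule abs_sin_diff_le)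
    moreover have "\<bar>b\<bar> * sinc_symbol t r - sin (t * \<bar>b\<bar>) = (\<bar>b\<bar> - r) * sinc_symbol t r + (sin (t * r) - sin (t * \<bar>b\<bar>))"
      by (simp add: left_diff_distrib r_sinc)
    moreover note abs_triangle_ineq[of "(\<bar>b\<bar> - r) * sinc_symbol t r" "sin (t * r) - sin (t * \<bar>b\<bar>)"]
    ultimately show ?thesis unfolding mult.commute[of "\<bar>r - \<bar>b\<bar>\<bar>" "\<bar>t\<bar>"] by linarith
  qed
  have im: "\<bar>b * sinc_symbol t r - sin (b * t)\<bar> \<le> 2 * (\<bar>t\<bar> * \<bar>r - \<bar>b\<bar>\<bar>)"
  proof (cases "0 \<le> b")
    case False
    then have "\<bar>b * sinc_symbol t r - sin (b * t)\<bar> = \<bar>\<bar>b\<bar> * sinc_symbol t r - sin (t * \<bar>b\<bar>)\<bar>"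
      by (simp add: mult.commute[of t b])
    then show ?thesis using s by simp
  qed (use s in \<open>simp add: mult.commute\<close>)
  have "norm (of_real (cos (t * r)) + \<i> * of_real (b * sinc_symbol t r) - cis (b * t)) \<le> \<bar>cos (t * r) - cos (b * t)\<bar> + \<bar>b * sinc_symbol t r - sin (b * t)\<bar>"
    by (rule order_trans[OF cmod_le]) simp
  then show ?thesis using re im by simp
qed

text \<open>On the support of the tent the length \<open>norm z\<close> differs from
  \<open>\<bar>b\<bar>\<close> by at most 1, so the error has size \<open>\<bar>t\<bar>\<close>
  whatever the frequency.\<close>

lemma pulse_symbol_error:
  assumes a: "norm a = \<bar>b\<bar>"
  shows "norm ((of_real (cos (t * norm z)) + \<i> * of_real (b * sinc_symbol t (norm z)) - cis (b * t)) * of_real (tent (z - a))) \<le> 3 * \<bar>t\<bar> * tent (z - a)"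
proof (cases "norm (z - a) < 1")
  case True
  have "\<bar>norm z - \<bar>b\<bar>\<bar> \<le> 1" using norm_triangle_ineq3[of z a] True a by simp
  then have "\<bar>t\<bar> * \<bar>norm z - \<bar>b\<bar>\<bar> \<le> \<bar>t\<bar> * 1" by (rule mult_left_mono) simp
  then have "norm (of_real (cos (t * norm z)) + \<i> * of_real (b * sinc_symbol t (norm z)) - cis (b * t)) \<le> 3 * \<bar>t\<bar>"
    using half_wave_symbol[of "norm z" t b] by simp
  then show ?thesis unfolding norm_mult norm_of_real abs_of_nonneg[OF tent_bounds(1)] by (rule mult_right_mono) (rule tent_bounds)
qed (simp add: tent_eq_0)

definition pulse_data0 :: "nat => real ^ 'd::finite => real => 'd cfun => 'd cfun" where
  "pulse_data0 m a A \<phi> z = \<phi> z + (of_real A * of_real (tent (z - a)) + of_real A * of_real (tent (z - (- (real m *\<^sub>R a)))))"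

text \<open>With this choice of velocities, each pulse evolves into a single half wave, up to an error
  of size \<open>t\<close>.\<close>

definition pulse_data1 :: "nat => real => real ^ 'd::finite => real => 'd cfun => 'd cfun" where
  "pulse_data1 m N a A \<phi> z = \<phi> z + (of_real A * (\<i> * of_real (- N)) * of_real (tent (z - a))
    + of_real A * (\<i> * of_real (real m * N)) * of_real (tent (z - (- (real m *\<^sub>R a)))))"

lemma free_wave_pulse_data:
  fixes a :: "real ^ 'd::finite"
  assumes a: "norm a = N" and A: "0 \<le> A"
  shows "norm (free_wave (pulse_data0 m a A \<phi>) (pulse_data1 m N a A \<psi>) t z - of_real A * pulses m N a t z)
    \<le> norm (free_wave \<phi> \<psi> t z) + (3 * \<bar>t\<bar> * A * tent (z - a) + 3 * \<bar>t\<bar> * A * tent (z - (- (real m *\<^sub>R a))))"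
proof -
  let ?S = "\<lambda>b. of_real (cos (t * norm z)) + \<i> * of_real (b * sinc_symbol t (norm z)) - cis (b * t)"
  let ?b = "- (real m *\<^sub>R a)"
  have N: "0 \<le> N" using a norm_ge_zero by blast
  have "free_wave (pulse_data0 m a A \<phi>) (pulse_data1 m N a A \<psi>) t z - of_real A * pulses m N a t z
      = free_wave \<phi> \<psi> t z + (of_real A * (?S (- N) * of_real (tent (z - a))) + of_real A * (?S (real m * N) * of_real (tent (z - ?b))))"
    unfolding free_wave_def pulse_data0_def pulse_data1_def pulses_def by (simp add: algebra_simps)
  also have "norm ... \<le> norm (free_wave \<phi> \<psi> t z) + (A * norm (?S (- N) * of_real (tent (z - a))) + A * norm (?S (real m * N) * of_real (tent (z - ?b))))"
  proof (rule order_trans[OF norm_triangle_ineq add_left_mono], rule order_trans[OF norm_triangle_ineq])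
    show "norm (of_real A * (?S (- N) * of_real (tent (z - a)))) + norm (of_real A * (?S (real m * N) * of_real (tent (z - ?b)))) \<le> A * norm (?S (- N) * of_real (tent (z - a))) + A * norm (?S (real m * N) * of_real (tent (z - ?b)))"
      unfolding norm_mult[of "of_real A"] norm_of_real abs_of_nonneg[OF A] by (rule order_refl)
  qed
  also have "... \<le> norm (free_wave \<phi> \<psi> t z) + (A * (3 * \<bar>t\<bar> * tent (z - a)) + A * (3 * \<bar>t\<bar> * tent (z - ?b)))"
    using a N by (intro add_left_mono add_mono mult_left_mono A pulse_symbol_error) (auto simp: abs_mult)
  finally show ?thesis by (simp add: mult_ac)
qed

lemma distant_pulse_vanishes:
  fixes a :: "real ^ 'd::finite"
  assumes "norm z + 1 \<le> norm a"
  shows "tent (z - a) = 0"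
  using norm_triangle_ineq2[of a z] assms by (intro tent_eq_0) (simp add: norm_minus_commute)

text \<open>In the binomial expansion the term with \<open>i\<close> copies at \<open>a\<close> is
  centred at \<open>(i - (m + 1 - i) * m) *\<^sub>R a\<close>. The coefficient is 0 for
  \<open>i = m\<close> and a nonzero integer otherwise, so for large \<open>N\<close> only that term
  reaches \<open>z\<close>, with phase \<open>- m * N * t + m * N * t = 0\<close>.\<close>

lemma cpow_pulses:
  fixes a :: "real ^ 'd::finite"
  assumes a: "a \<in> dgrp M" "norm a = N" and N: "norm z + real (Suc m) \<le> N" and m: "1 \<le> m"
  shows "cpow M (pulses m N a t) m z = of_nat (Suc m) * cpow M (\<lambda>z. of_real (tent z)) m z"
proof -
  let ?f = "\<lambda>z :: real ^ 'd. complex_of_real (tent z)"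
  let ?b = "- (real m *\<^sub>R a)"
  let ?x = "\<lambda>i. of_nat i *\<^sub>R a + of_nat (Suc m - i) *\<^sub>R ?b"
  obtain K where K: "decay CARD('d) K ?f" using decay_tent[of "CARD('d)" 1 0] by auto
  have b: "?b \<in> dgrp M" by (intro dgrp_uminus dgrp_scaleR_of_nat a)
  have x: "?x i = (real i - real (Suc m - i) * real m) *\<^sub>R a" for i by (simp add: scaleR_left_diff_distrib)
  have "cpow M (pulses m N a t) m z = (\<Sum>i\<le>Suc m. of_nat (Suc m choose i) * (cis (- (N * t)) ^ i * cis (real m * N * t) ^ (Suc m - i) * cpow M ?f m (z - ?x i)))"
    unfolding pulses_def[abs_def] by (rule cpow_two_translates[OF K order_refl a(1) b])
  also have "... = (\<Sum>i\<in>{m}. of_nat (Suc m choose i) * (cis (- (N * t)) ^ i * cis (real m * N * t) ^ (Suc m - i) * cpow M ?f m (z - ?x i)))"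
  proof (rule sum.mono_neutral_right)
    show "\<forall>i\<in>{..Suc m} - {m}. of_nat (Suc m choose i) * (cis (- (N * t)) ^ i * cis (real m * N * t) ^ (Suc m - i) * cpow M ?f m (z - ?x i)) = 0"
    proof
      fix i assume i: "i \<in> {..Suc m} - {m}"
      \<comment> \<open>For \<open>i = m + 1\<close> the number is \<open>m + 1\<close>. For
        \<open>i < m\<close> at least two copies sit at \<open>- m *\<^sub>R a\<close>, so it is
        below \<open>- m\<close>.\<close>
      have "1 \<le> \<bar>real i - real (Suc m - i) * real m\<bar>"
      proof (cases "i = Suc m")
        case False
        then have "i < m" using i by auto
        then have "2 * real m \<le> real (Suc m - i) * real m" by (intro mult_right_mono) auto
        moreover have "real i < real m" using \<open>i < m\<close> by simp
        ultimately show ?thesis using m by linarith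
      qed simp
      then have "1 * N \<le> norm (?x i)" unfolding x norm_scaleR a(2) using norm_ge_zero[of a, unfolded a(2)] by (intro mult_right_mono) auto
      then have "real (Suc m) \<le> norm (z - ?x i)" using norm_triangle_ineq2[of "?x i" z] N by (simp add: norm_minus_commute)
      then have "cpow M ?f m (z - ?x i) = 0" by (intro cpow_eq_0) (auto simp: tent_eq_0)
      then show "of_nat (Suc m choose i) * (cis (- (N * t)) ^ i * cis (real m * N * t) ^ (Suc m - i) * cpow M ?f m (z - ?x i)) = 0" by simp
    qed
  qed auto
  also have "... = of_nat (Suc m) * cpow M ?f m z"
  proof -
    have "cis (- (N * t)) ^ m * cis (real m * N * t) = cis (real m * (- (N * t)) + real m * N * t)" by (simp only: Complex.DeMoivre cis_mult)
    also have "... = 1" by simp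
    finally have "cis (- (N * t)) ^ m * cis (real m * N * t) = 1" .
    then show ?thesis by (simp add: x mult.assoc[symmetric])
  qed
  finally show ?thesis .
qed

section \<open>The inflation mechanism\<close>

text \<open>For \<open>x = t * r\<close> in \<open>[0, 1]\<close> one has
  \<open>sin x \<ge> x - x^2 / 2 \<ge> x / 2\<close>.\<close>

lemma sinc_symbol_ge:
  assumes "0 \<le> t" "0 \<le> r" "t * r \<le> 1"
  shows "t / 2 \<le> sinc_symbol t r"
proof (cases "r = 0")
  case False
  have "\<bar>sin (t * r) - t * r\<bar> \<le> (t * r)^2 / 2"
    using Maclaurin_sin_bound[of "t * r" 2] by (simp add: sin_coeff_def numeral_2_eq_2)
  moreover have "(t * r)^2 \<le> t * r" using mult_left_mono[OF assms(3), of "t * r"] assms by (simp add: power2_eq_square)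
  ultimately have "(t * r) / 2 \<le> sin (t * r)" by linarith
  then have "(t * r) / 2 / r \<le> sin (t * r) / r" using assms by (intro divide_right_mono) auto
  then show ?thesis using False by (simp add: sinc_symbol_def)
qed (use assms in \<open>simp add: sinc_symbol_def\<close>)

lemma integral_sinc_symbol_ge:
  assumes T: "0 \<le> T" and r: "0 \<le> r" "T * r \<le> 1"
  shows "T^2 / 4 \<le> integral {0..T} (\<lambda>s. sinc_symbol (T - s) r)"
proof -
  have I: "((\<lambda>s. (T - s) / 2) has_integral (- ((T - T)^2 / 4) - - ((T - 0)^2 / 4))) {0..T}"
    using T by (intro fundamental_theorem_of_calculus)
      (auto intro!: derivative_eq_intros simp: has_real_derivative_iff_has_vector_derivative[symmetric] field_simps)
  have "T^2 / 4 = integral {0..T} (\<lambda>s. (T - s) / 2)" using integral_unique[OF I] by simp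
  also have "... \<le> integral {0..T} (\<lambda>s. sinc_symbol (T - s) r)"
  proof (rule integral_le)
    show "(\<lambda>s. (T - s) / 2) integrable_on {0..T}" using I by (rule has_integral_integrable)
    show "(\<lambda>s. sinc_symbol (T - s) r) integrable_on {0..T}"
      by (intro integrable_continuous_interval continuous_intros)
    fix s assume s: "s \<in> {0..T}"
    then have "(T - s) * r \<le> T * r" using r by (intro mult_right_mono) auto
    then show "(T - s) / 2 \<le> sinc_symbol (T - s) r" using s r by (intro sinc_symbol_ge) auto
  qed
  finally show ?thesis .
qed

lemma norm_integral_unit_cell_le:
  fixes f :: "'d::finite cfun"
  assumes f: "unif_int M R f" "f \<in> borel_measurable borel" and R: "0 \<le> R"
  shows "norm (LINT z|dm M. indicator (unit_cell 0) z * f z) \<le> R"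
proof -
  have "ennreal (norm (LINT z|dm M. indicator (unit_cell 0) z * f z)) \<le> (\<integral>\<^sup>+z. ennreal (norm (indicator (unit_cell 0) z * f z)) \<partial>dm M)"
    by (rule norm_lebesgue_integral_le_nn)
  also have "... \<le> (\<integral>\<^sup>+z. ennreal (norm (f z)) \<partial>dm M)"
    by (intro nn_integral_mono ennreal_leI) (simp add: norm_mult indicator_def)
  also have "... \<le> ennreal R" by (rule unif_int_nn_integral[OF f])
  finally show ?thesis using R by simp
qed

text \<open>On the unit cell the source does not depend on time, and the kernel is bounded below
  because \<open>T * norm z \<le> 1\<close>. The integrand has one sign, so no cancellation
  occurs.\<close>

lemma integral_unit_cell_duhamel_pos:
  fixes G :: "real => 'd::finite cfun"
  assumes G: "jointly_continuous G" and int: "integrable (dm M) (duhamel G T)" and T: "0 \<le> T"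
    and b: "\<And>s z. s \<in> {0..T} ==> z \<in> unit_cell 0 ==> G s z = of_real (b z)" "\<And>z. 0 \<le> b z"
    and bi: "integrable (dm M) (\<lambda>z. indicator (unit_cell 0) z * b z)"
    and small: "\<And>z :: real ^ 'd. z \<in> unit_cell 0 ==> T * norm z \<le> 1"
  shows "T^2 / 4 * (LINT z|dm M. indicator (unit_cell 0) z * b z) \<le> norm (LINT z|dm M. indicator (unit_cell 0) z * duhamel G T z)"
proof -
  define w where "w z = integral {0..T} (\<lambda>s. sinc_symbol (T - s) (norm z))" for z :: "real ^ 'd"
  have eq: "indicator (unit_cell 0) z * duhamel G T z = complex_of_real (w z * (indicator (unit_cell 0) z * b z))" for z
  proof (cases "z \<in> unit_cell 0")
    case True
    have "((\<lambda>s. sinc_symbol (T - s) (norm z)) has_integral w z) {0..T}"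
      unfolding w_def by (intro integrable_integral integrable_continuous_interval continuous_intros)
    then have "((\<lambda>s. of_real (sinc_symbol (T - s) (norm z)) * complex_of_real (b z)) has_integral (of_real (w z) * complex_of_real (b z))) {0..T}"
      by (intro has_integral_mult_left has_integral_of_real)
    then have "((\<lambda>s. of_real (sinc_symbol (T - s) (norm z)) * G s z) has_integral (of_real (w z) * complex_of_real (b z))) {0..T}"
      by (rule has_integral_cong[THEN iffD1, rotated]) (use True b(1) in auto)
    then have "duhamel G T z = of_real (w z) * complex_of_real (b z)" unfolding duhamel_def by (rule integral_unique)
    then show ?thesis using True by simp
  qed simp
  have wi: "integrable (dm M) (\<lambda>z. w z * (indicator (unit_cell 0) z * b z))"
    using integrable_indicator_mult[OF int] by (simp only: eq complex_of_real_integrable_eq)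
  have "T^2 / 4 * (LINT z|dm M. indicator (unit_cell 0) z * b z) = (LINT z|dm M. T^2 / 4 * (indicator (unit_cell 0) z * b z))"
    by (rule integral_cmult[symmetric])
  also have "... \<le> (LINT z|dm M. w z * (indicator (unit_cell 0) z * b z))"
  proof (rule integral_mono[OF integrable_mult_right[OF bi] wi])
    fix z :: "real ^ 'd"
    show "T^2 / 4 * (indicator (unit_cell 0) z * b z) \<le> w z * (indicator (unit_cell 0) z * b z)"
    proof (cases "z \<in> unit_cell 0")
      case True
      from mult_right_mono[OF integral_sinc_symbol_ge[OF T norm_ge_zero small[OF True]] b(2)[of z]] show ?thesis
        using True by (simp add: w_def)
    qed simp
  qed
  also have "... \<le> norm (LINT z|dm M. indicator (unit_cell 0) z * duhamel G T z)"
    unfolding eq integral_complex_of_real norm_of_real by (rule abs_ge_self)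
  finally show ?thesis .
qed

text \<open>The Duhamel term of \<open>U\<close> is compared with that of the model profile \<open>P\<close>, whose
  convolution power is an explicit positive density on the unit cell.\<close>

lemma inflation_lower_bound:
  fixes U P lin :: "real => 'd::finite cfun"
  assumes n: "CARD('d) \<le> n"
    and U: "jointly_continuous U" "\<And>t z. norm (U t z) \<le> K / wt n z" "\<And>t. unif_int M R (U t)"
    and P: "jointly_continuous P" "\<And>t z. norm (P t z) \<le> L / wt n z" "\<And>t. unif_int M R (P t)"
    and lin: "jointly_continuous lin" "\<And>t. t \<in> {0..T} ==> unif_int M e (\<lambda>z. lin t z - P t z)"
    and linQ: "integrable (dm M) (lin T)" "norm (LINT z|dm M. indicator (unit_cell 0) z * lin T z) \<le> D"
    and eq: "\<And>t z. t \<in> {0..T} ==> U t z = lin t z + of_real \<kappa> * duhamel (\<lambda>s. cpow M (U s) m) t z"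
    and pos: "0 \<le> R" "0 \<le> e" "0 \<le> T"
    and b: "\<And>s z. s \<in> {0..T} ==> z \<in> unit_cell 0 ==> cpow M (P s) m z = of_real (b z)" "\<And>z. 0 \<le> b z"
    and bi: "integrable (dm M) (\<lambda>z. indicator (unit_cell 0) z * b z)"
    and small: "\<And>z :: real ^ 'd. z \<in> unit_cell 0 ==> T * norm z \<le> 1"
  shows "\<bar>\<kappa>\<bar> * (T^2 / 4 * (LINT z|dm M. indicator (unit_cell 0) z * b z)) - D
      - \<bar>\<kappa>\<bar> * (T^2 * (real (Suc m) * R ^ m * (e + \<bar>\<kappa>\<bar> * (T^2 * R ^ Suc m))))
    \<le> norm (LINT z|dm M. indicator (unit_cell 0) z * U T z)"
proof -
  let ?G = "\<lambda>s. cpow M (U s) m" and ?H = "\<lambda>s. cpow M (P s) m"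
  have Ud: "decay n K (U t)" and Pd: "decay n L (P t)" for t
    using U(2) P(2) continuous_on_section(2)[OF U(1)] continuous_on_section(2)[OF P(1)] by (simp_all add: decay_def)
  have linb: "lin t \<in> borel_measurable borel" for t
    by (rule borel_measurable_continuous_onI[OF continuous_on_section(2)[OF lin(1)]])
  have G: "jointly_continuous ?G" by (rule continuous_on_cpow_param[OF U(1,2) n])
  have H: "jointly_continuous ?H" by (rule continuous_on_cpow_param[OF P(1,2) n])
  have GH: "continuous_on UNIV (\<lambda>(t, z). ?G t z - ?H t z)"
    using continuous_on_diff[OF G H] by (simp add: case_prod_unfold)
  have db: "duhamel F t \<in> borel_measurable borel" if "jointly_continuous F" "0 \<le> t" for F :: "real => 'd cfun" and t
    using borel_measurable_continuous_onI[OF continuous_on_section(2)[OF continuous_on_duhamel[OF that], of UNIV t]] that(2) by simp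
  have Gu: "unif_int M (R ^ Suc m) (?G t)" for t using cpow_bounds[OF Ud U(3) pos(1) n] by blast
  have Hu: "unif_int M (R ^ Suc m) (?H t)" for t using cpow_bounds[OF Pd P(3) pos(1) n] by blast
  \<comment> \<open>The distance of \<open>U\<close> from the model \<open>P\<close>: the error of
    the linear part plus a bound for the entire Duhamel term of \<open>U\<close>.\<close>
  define e' where "e' = e + \<bar>\<kappa>\<bar> * (T^2 * R ^ Suc m)"
  have e': "0 \<le> e'" unfolding e'_def using pos by (intro add_nonneg_nonneg mult_nonneg_nonneg) auto
  have UP: "unif_int M e' (\<lambda>z. U t z - P t z)" if t: "t \<in> {0..T}" for t
  proof -
    have "unif_int M (t^2 * R ^ Suc m) (duhamel ?G t)" using t pos by (intro nn_integral_duhamel_le G Gu) auto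
    then have "unif_int M (T^2 * R ^ Suc m) (duhamel ?G t)"
      by (rule unif_int_mono) (use t pos in \<open>auto intro!: mult_right_mono power_mono\<close>)
    then have "unif_int M (norm (complex_of_real \<kappa>) * (T^2 * R ^ Suc m)) (\<lambda>z. of_real \<kappa> * duhamel ?G t z)"
      by (rule unif_int_cmult) (use t db[OF G] in auto)
    moreover have "(\<lambda>z. of_real \<kappa> * duhamel ?G t z) \<in> borel_measurable borel" "(\<lambda>z. lin t z - P t z) \<in> borel_measurable borel"
      using t db[OF G] linb decay_borel[OF Pd] by auto
    ultimately have "unif_int M e' (\<lambda>z. (lin t z - P t z) + of_real \<kappa> * duhamel ?G t z)"
      unfolding e'_def using pos by (intro unif_int_add lin(2)[OF t]) auto
    then show ?thesis unfolding eq[OF t] by (simp add: algebra_simps)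
  qed
  define E where "E = real (Suc m) * R ^ m * e'"
  have E0: "0 \<le> E" unfolding E_def using e' pos by simp
  have diff: "unif_int M E (\<lambda>z. ?G t z - ?H t z)" if "t \<in> {0..T}" for t
    unfolding E_def by (rule unif_int_cpow_diff[OF Ud U(3) Pd P(3) UP[OF that] e' pos(1) n])
  have "unif_int M (T^2 * E) (duhamel (\<lambda>s z. ?G s z - ?H s z) T)"
    using pos E0 by (intro nn_integral_duhamel_le GH diff) auto
  then have err: "norm (LINT z|dm M. indicator (unit_cell 0) z * duhamel (\<lambda>s z. ?G s z - ?H s z) T z) \<le> T^2 * E"
    by (rule norm_integral_unit_cell_le[OF _ db[OF GH pos(3)]]) (use E0 in simp)
  have dint: "integrable (dm M) (duhamel F T)" if F: "jointly_continuous F" "\<And>t. unif_int M (R ^ Suc m) (F t)" for F :: "real => 'd cfun"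
  proof -
    have "unif_int M (T^2 * R ^ Suc m) (duhamel F T)" using pos by (intro nn_integral_duhamel_le F) auto
    then show ?thesis by (rule unif_int_integrable[OF _ db[OF F(1) pos(3)]])
  qed
  have main: "T^2 / 4 * (LINT z|dm M. indicator (unit_cell 0) z * b z) \<le> norm (LINT z|dm M. indicator (unit_cell 0) z * duhamel ?H T z)"
    by (rule integral_unit_cell_duhamel_pos[OF H dint[OF H Hu] pos(3) b bi small])
  let ?J = "\<lambda>f :: 'd cfun. LINT z|dm M. indicator (unit_cell 0) z * f z"
  have i: "integrable (dm M) (\<lambda>z. indicator (unit_cell 0) z * lin T z)" "integrable (dm M) (\<lambda>z. indicator (unit_cell 0) z * duhamel ?G T z)" "integrable (dm M) (\<lambda>z. indicator (unit_cell 0) z * duhamel ?H T z)"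
    by (intro integrable_indicator_mult linQ(1) dint G H Gu Hu)+
  have "?J (U T) = (LINT z|dm M. indicator (unit_cell 0) z * lin T z + of_real \<kappa> * (indicator (unit_cell 0) z * duhamel ?G T z))"
    using pos(3) by (simp add: eq algebra_simps)
  also have "... = ?J (lin T) + of_real \<kappa> * ?J (duhamel ?G T)" using i by simp
  also have "?J (duhamel ?G T) = ?J (duhamel ?H T) + ?J (duhamel (\<lambda>s z. ?G s z - ?H s z) T)"
    unfolding duhamel_diff[OF G H, symmetric] using i by (simp add: right_diff_distrib)
  finally have J: "?J (U T) = of_real \<kappa> * ?J (duhamel ?H T) - (- ?J (lin T) - of_real \<kappa> * ?J (duhamel (\<lambda>s z. ?G s z - ?H s z) T))"
    by (simp add: algebra_simps)
  have "norm (of_real \<kappa> * ?J (duhamel ?H T)) - norm (- ?J (lin T) - of_real \<kappa> * ?J (duhamel (\<lambda>s z. ?G s z - ?H s z) T)) \<le> norm (?J (U T))"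
    unfolding J by (rule norm_triangle_ineq2)
  moreover have "norm (- ?J (lin T) - of_real \<kappa> * ?J (duhamel (\<lambda>s z. ?G s z - ?H s z) T)) \<le> D + \<bar>\<kappa>\<bar> * (T^2 * E)"
    by (rule order_trans[OF norm_triangle_ineq4 add_mono]) (use linQ(2) err in \<open>auto simp only: norm_minus_cancel norm_mult norm_of_real intro!: mult_left_mono\<close>)
  moreover have "\<bar>\<kappa>\<bar> * (T^2 / 4 * (LINT z|dm M. indicator (unit_cell 0) z * b z)) \<le> norm (of_real \<kappa> * ?J (duhamel ?H T))"
    unfolding norm_mult norm_of_real by (rule mult_left_mono[OF main]) simp
  ultimately show ?thesis unfolding E_def e'_def by linarith
qed

section \<open>Frequency-independent bounds for the pulses, and the solution they generate\<close>

lemma unif_int_tent: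
  fixes a :: "real ^ 'd::finite"
  assumes n: "CARD('d) \<le> n" and \<tau>: "2 ^ n * dmK M TYPE('d) \<le> \<tau>"
  shows "unif_int M (norm Z * \<tau>) (\<lambda>z. Z * of_real (tent (z - a)))"
proof -
  have "norm (Z * of_real (tent (z - a))) \<le> (norm Z * 2 ^ n) / wt n (z - a)" for z
    using mult_left_mono[OF tent_le[of z a n], of "norm Z"] tent_bounds(1)[of "z - a"] by (simp add: norm_mult)
  then have "unif_int M ((norm Z * 2 ^ n) * dmK M TYPE('d)) (\<lambda>z. Z * of_real (tent (z - a)))"
    by (intro unif_int_shifted_decay[where n=n and a=a] n) auto
  then show ?thesis
    by (rule unif_int_mono) (use mult_left_mono[OF \<tau>, of "norm Z"] in \<open>auto simp: mult.assoc\<close>)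
qed

lemma tent_borel [measurable]: "tent \<in> borel_measurable borel"
  unfolding tent_def by measurable

lemma unif_int_pulses:
  fixes a :: "real ^ 'd::finite"
  assumes n: "CARD('d) \<le> n" and \<tau>: "2 ^ n * dmK M TYPE('d) \<le> \<tau>" and \<tau>0: "0 \<le> \<tau>"
  shows "unif_int M (2 * \<tau>) (pulses m N a t)"
proof -
  have "unif_int M (1 * \<tau> + 1 * \<tau>) (\<lambda>z. cis (- (N * t)) * of_real (tent (z - a)) + cis (real m * N * t) * of_real (tent (z - (- (real m *\<^sub>R a)))))"
    using unif_int_tent[OF n \<tau>, of "cis (- (N * t))" a] unif_int_tent[OF n \<tau>, of "cis (real m * N * t)" "- (real m *\<^sub>R a)"] \<tau>0
    by (intro unif_int_add) auto
  then show ?thesis by (simp add: pulses_def[abs_def])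
qed

lemma decay_pulses:
  "\<exists>L. \<forall>t z :: real ^ 'd::finite. norm (pulses m N a t z) \<le> L / wt n z"
proof -
  obtain L L' where L: "decay n L (\<lambda>z. 1 * complex_of_real (tent (z - a)))" "decay n L' (\<lambda>z. 1 * complex_of_real (tent (z - (- (real m *\<^sub>R a)))))"
    using decay_tent by blast
  have "norm (pulses m N a t z) \<le> (L + L') / wt n z" for t z
    unfolding pulses_def add_divide_distrib using decayD[OF L(1), of z] decayD[OF L(2), of z]
    by (intro order_trans[OF norm_triangle_ineq] add_mono) (auto simp: norm_mult)
  then show ?thesis by blast
qed

lemma continuous_on_pulses: "continuous_on UNIV (\<lambda>(t, z). pulses m N a t z)"
  unfolding pulses_def case_prod_unfold cis_conv_exp by (intro continuous_intros)

lemma decay_pulse_data: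
  assumes "decay n K \<phi>"
  shows "\<exists>K'. decay n K' (pulse_data0 m a A \<phi>)" "\<exists>K'. decay n K' (pulse_data1 m N a A \<phi>)"
proof -
  have "\<exists>K'. decay n K' (\<lambda>z. \<phi> z + (Z * of_real (tent (z - a)) + w * of_real (tent (z - b))))" for Z w a b
  proof -
    obtain L L' where "decay n L (\<lambda>z. Z * of_real (tent (z - a)))" "decay n L' (\<lambda>z. w * of_real (tent (z - b)))"
      using decay_tent by blast
    from decay_add[OF assms decay_add[OF this]] show ?thesis by blast
  qed
  then show "\<exists>K'. decay n K' (pulse_data0 m a A \<phi>)" "\<exists>K'. decay n K' (pulse_data1 m N a A \<phi>)"
    unfolding pulse_data0_def[abs_def] pulse_data1_def[abs_def] by blast+
qed

text \<open>The factor 6 adds the half-wave errors of the two pulses, each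
  \<open>3 * \<bar>t\<bar> * A\<close> times a tent.\<close>

lemma unif_int_pulse_error:
  fixes a :: "real ^ 'd::finite"
  assumes n: "CARD('d) \<le> n" and \<tau>: "2 ^ n * dmK M TYPE('d) \<le> \<tau>" "0 \<le> \<tau>" and a: "norm a = N" and A: "0 \<le> A"
    and fw: "unif_int M D (free_wave \<phi> \<psi> t)" "free_wave \<phi> \<psi> t \<in> borel_measurable borel" "0 \<le> D"
  shows "unif_int M (D + 6 * \<tau> * \<bar>t\<bar> * A) (\<lambda>z. free_wave (pulse_data0 m a A \<phi>) (pulse_data1 m N a A \<psi>) t z - of_real A * pulses m N a t z)"
proof -
  let ?Z = "complex_of_real (3 * \<bar>t\<bar> * A)"
  let ?h = "\<lambda>z. of_real (norm (free_wave \<phi> \<psi> t z)) + (?Z * of_real (tent (z - a)) + ?Z * of_real (tent (z - (- (real m *\<^sub>R a)))))"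
  have Z: "norm ?Z = 3 * \<bar>t\<bar> * A" unfolding norm_of_real using A by simp
  have fn: "unif_int M D (\<lambda>z. complex_of_real (norm (free_wave \<phi> \<psi> t z)))" by (rule unif_int_mono[OF fw(1)]) auto
  have "unif_int M (D + (norm ?Z * \<tau> + norm ?Z * \<tau>)) ?h"
    using \<tau>(2) fw(2,3) by (intro unif_int_add fn unif_int_tent[OF n \<tau>(1)]) auto
  then show ?thesis
  proof (rule unif_int_mono)
    fix z :: "real ^ 'd"
    have "?h z = of_real (norm (free_wave \<phi> \<psi> t z) + (3 * \<bar>t\<bar> * A * tent (z - a) + 3 * \<bar>t\<bar> * A * tent (z - (- (real m *\<^sub>R a)))))"
      by simp
    moreover have "0 \<le> norm (free_wave \<phi> \<psi> t z) + (3 * \<bar>t\<bar> * A * tent (z - a) + 3 * \<bar>t\<bar> * A * tent (z - (- (real m *\<^sub>R a))))"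
      using A tent_bounds by (intro add_nonneg_nonneg mult_nonneg_nonneg) auto
    ultimately have "norm (?h z) = norm (free_wave \<phi> \<psi> t z) + (3 * \<bar>t\<bar> * A * tent (z - a) + 3 * \<bar>t\<bar> * A * tent (z - (- (real m *\<^sub>R a))))"
      by (simp only: norm_of_real abs_of_nonneg)
    then show "norm (free_wave (pulse_data0 m a A \<phi>) (pulse_data1 m N a A \<psi>) t z - of_real A * pulses m N a t z) \<le> norm (?h z)"
      using free_wave_pulse_data[OF a A] by metis
  qed (simp only: Z, simp add: algebra_simps)
qed

text \<open>The smallness conditions and the lower bound contain no \<open>N\<close>. The decay
  constants of the complete data, which do depend on \<open>N\<close>, stay inside the proof as
  \<open>L0\<close> and \<open>L1\<close> and only serve the existence of the solution.\<close>

lemma pulse_solution: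
  fixes a :: "real ^ 'd::finite" and \<phi>0 \<phi>1 :: "'d cfun" and b0 :: "real ^ 'd => real" and m :: nat and M :: base_space
  defines "c \<equiv> gauss_const TYPE('d) ^ m" and "D \<equiv> dmK M TYPE('d)"
  assumes n: "CARD('d) + 2 \<le> n" and \<phi>: "decay (Suc n) K0 \<phi>0" "decay (Suc n) K1 \<phi>1" and m: "1 \<le> m" and sg: "sg = 1 \<or> sg = - 1"
    and a: "a \<in> dgrp M" "norm a = N" and N: "sqrt (real CARD('d)) + real (Suc m) \<le> N"
    and \<tau>: "2 ^ n * D \<le> \<tau>" "1 \<le> \<tau>" and A: "1 \<le> A" "(K0 + K1) * D \<le> A"
    and T: "0 < T" "T \<le> 1" "T * sqrt (real CARD('d)) \<le> 1"
    and small: "c * (T^2 * (18 * \<tau> * A) ^ Suc m) \<le> 9 * \<tau> * A" "c * (T^2 * (cpow_const n m * (18 * \<tau> * A) ^ m)) \<le> 1 / 2"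
    and b0: "\<And>z. cpow M (\<lambda>z. of_real (tent z)) m z = of_real (b0 z)" "\<And>z. 0 \<le> b0 z" "integrable (dm M) (\<lambda>z. indicator (unit_cell 0) z * b0 z)"
  shows "\<exists>U K. wave_solution M sg (Suc m) T (\<lambda>t. synth M (U t)) (fdist M (synth M (pulse_data0 m a A \<phi>0))) (fdist M (synth M (pulse_data1 m N a A \<phi>1)))
    \<and> (\<forall>t. decay n K (U t))
    \<and> c * (T^2 / 4 * (A ^ Suc m * real (Suc m) * (LINT z|dm M. indicator (unit_cell 0) z * b0 z))) - (K0 + K1) * D
      - c * (T^2 * (real (Suc m) * (18 * \<tau> * A) ^ m * ((K0 + K1) * D + 6 * \<tau> * T * A + c * (T^2 * (18 * \<tau> * A) ^ Suc m))))
    \<le> norm (LINT z|dm M. indicator (unit_cell 0) z * U T z)"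
proof -
  let ?g0 = "pulse_data0 m a A \<phi>0" and ?g1 = "pulse_data1 m N a A \<phi>1"
  let ?P = "\<lambda>t z. of_real A * pulses m N a t z"
  let ?\<kappa> = "sg * c"
  define D' where "D' = (K0 + K1) * D"
  \<comment> \<open>The sum of \<open>\<tau> * A\<close> for the smooth part,
    \<open>6 * \<tau> * A\<close> for the half-wave error and \<open>2 * \<tau> * A\<close> for the
    pulses. The solution is bounded by twice this, the \<open>18 * \<tau> * A\<close> of the
    statement.\<close>
  define R where "R = 9 * \<tau> * A"
  have n': "CARD('d) \<le> n" using n by simp
  have K01: "0 \<le> K0" "0 \<le> K1" using \<phi> by (auto dest: decay_nonneg)
  have D'0: "0 \<le> D'" unfolding D'_def D_def using K01 by simp
  have c0: "0 < c" by (simp add: c_def)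
  have \<kappa>: "\<bar>?\<kappa>\<bar> = c" using sg c0 by auto
  have R: "0 \<le> R" "2 * R = 18 * \<tau> * A" using \<tau> A by (auto simp: R_def)
  have \<tau>D: "2 ^ n * dmK M TYPE('d) \<le> \<tau>" "0 \<le> \<tau>" using \<tau> by (auto simp: D_def)
  obtain L0 L1 where g: "decay (Suc n) L0 ?g0" "decay (Suc n) L1 ?g1" using decay_pulse_data \<phi> by meson
  have g': "decay n L0 ?g0" "decay n L1 ?g1" by (rule decay_mono[OF g(1)] decay_mono[OF g(2)]; simp)+
  have \<phi>': "decay n K0 \<phi>0" "decay n K1 \<phi>1" by (rule decay_mono[OF \<phi>(1)] decay_mono[OF \<phi>(2)]; simp)+
  have fw_le: "norm (free_wave f h t z) \<le> (K + K') / wt n z" if "decay n K f" "decay n K' h" "\<bar>t\<bar> \<le> 1" for f h :: "'d cfun" and K K' t z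
  proof -
    have "norm (free_wave f h t z) \<le> norm (f z) + \<bar>t\<bar> * norm (h z)" by (rule norm_free_wave_le)
    also have "... \<le> norm (f z) + 1 * norm (h z)" using that(3) by (intro add_left_mono mult_right_mono) auto
    also have "... \<le> (K + K') / wt n z" using decayD[OF that(1), of z] decayD[OF that(2), of z] by (simp add: add_divide_distrib)
    finally show ?thesis .
  qed
  have fwc: "continuous_on UNIV (\<lambda>(t, z). free_wave f h t z)" if "decay n K f" "decay n K' h" for f h :: "'d cfun" and K K'
    using that by (intro continuous_on_free_wave decay_continuous[where g="\<lambda>x. x"]) auto
  have fwb: "free_wave f h t \<in> borel_measurable borel" if "decay n K f" "decay n K' h" for f h :: "'d cfun" and K K' t
    by (rule borel_measurable_continuous_onI[OF continuous_on_section(2)[OF fwc[OF that]]])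
  have fwu: "unif_int M D' (free_wave \<phi>0 \<phi>1 t)" if "\<bar>t\<bar> \<le> 1" for t
    unfolding D'_def D_def using fw_le[OF \<phi>' that] K01 by (intro unif_int_shifted_decay[where n=n and a=0] n') auto
  have pb: "pulses m N a t \<in> borel_measurable borel" for t
    by (rule borel_measurable_continuous_onI[OF continuous_on_section(2)[OF continuous_on_pulses]])
  have Pu: "unif_int M (A * (2 * \<tau>)) (?P t)" for t
    using unif_int_cmult[OF unif_int_pulses[OF n' \<tau>D, of m N a t] pb, of "complex_of_real A"] A by simp
  have err: "unif_int M (D' + 6 * \<tau> * T * A) (\<lambda>z. free_wave ?g0 ?g1 t z - ?P t z)" if t: "t \<in> {0..T}" for t
  proof -
    have t1: "\<bar>t\<bar> \<le> 1" using t T by auto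
    have "unif_int M (D' + 6 * \<tau> * \<bar>t\<bar> * A) (\<lambda>z. free_wave ?g0 ?g1 t z - ?P t z)"
      using A by (intro unif_int_pulse_error[OF n' \<tau>D a(2) _ fwu[OF t1] fwb[OF \<phi>'] D'0]) simp
    then show ?thesis
      by (rule unif_int_mono) (use t A \<tau>D in \<open>auto intro!: mult_right_mono mult_left_mono\<close>)
  qed
  have e0: "0 \<le> D' + 6 * \<tau> * T * A" using D'0 \<tau>D T A by simp
  have linu: "unif_int M R (free_wave ?g0 ?g1 t)" if t: "t \<in> {0..T}" for t
  proof -
    have "unif_int M ((D' + 6 * \<tau> * T * A) + A * (2 * \<tau>)) (\<lambda>z. (free_wave ?g0 ?g1 t z - ?P t z) + ?P t z)"
      using fwb[OF g'] pb A \<tau>D by (intro unif_int_add err[OF t] Pu e0) auto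
    moreover have "(D' + 6 * \<tau> * T * A) + A * (2 * \<tau>) \<le> R"
    proof -
      have "D' \<le> \<tau> * A" using A(2) mult_right_mono[OF \<tau>(2), of A] A(1) unfolding D'_def by linarith
      moreover have "6 * \<tau> * T * A \<le> 6 * \<tau> * 1 * A" using T \<tau>D A by (intro mult_right_mono mult_left_mono) auto
      ultimately show ?thesis unfolding R_def by (simp add: mult.commute)
    qed
    ultimately show ?thesis by (auto elim!: unif_int_mono)
  qed
  have "\<exists>U. jointly_continuous U \<and> (\<forall>t z. norm (U t z) \<le> 2 * (L0 + L1) / wt n z) \<and> (\<forall>t. unif_int M (2 * R) (U t)) \<and>
      (\<forall>t\<in>{0..T}. \<forall>z. U t z = free_wave ?g0 ?g1 t z + of_real ?\<kappa> * duhamel (\<lambda>s. cpow M (U s) m) t z)"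
  proof (rule duhamel_equation_solvable[OF n' T(1) R(1) fwc[OF g']])
    show "norm (free_wave ?g0 ?g1 t z) \<le> (L0 + L1) / wt n z" if "0 \<le> t" "t \<le> T" for t z
      using that T by (intro fw_le g') auto
    show "unif_int M R (free_wave ?g0 ?g1 t)" if "0 \<le> t" "t \<le> T" for t using that by (intro linu) auto
    show "\<bar>?\<kappa>\<bar> * T^2 * (2 * R) ^ Suc m \<le> R" using small(1) unfolding \<kappa> R(2) by (simp add: R_def mult.assoc)
    show "\<bar>?\<kappa>\<bar> * T^2 * (cpow_const n m * (2 * R) ^ m) \<le> 1 / 2" using small(2) unfolding \<kappa> R(2) by (simp add: mult.assoc)
  qed
  then obtain U where U: "jointly_continuous U" "\<And>t z. norm (U t z) \<le> 2 * (L0 + L1) / wt n z" "\<And>t. unif_int M (2 * R) (U t)"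
    and eq: "\<And>t z. t \<in> {0..T} ==> U t z = free_wave ?g0 ?g1 t z + of_real ?\<kappa> * duhamel (\<lambda>s. cpow M (U s) m) t z" by blast
  have sol: "wave_solution M sg (Suc m) T (\<lambda>t. synth M (U t)) (fdist M (synth M ?g0)) (fdist M (synth M ?g1))"
    by (rule wave_solution_synth[OF n g U(1,2) eq[unfolded c_def] T(1)])
  have Q: "norm z \<le> sqrt (real CARD('d))" if "z \<in> unit_cell 0" for z :: "real ^ 'd"
    using norm_unit_cell[OF that] by (intro real_le_rsqrt) simp
  obtain L where L: "\<And>t z. norm (pulses m N a t z) \<le> L / wt n z" using decay_pulses by blast
  have Pb: "norm (?P t z) \<le> (A * L) / wt n z" for t z
    using mult_left_mono[OF L, of A t z] A by (simp add: norm_mult)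
  have Pc: "continuous_on UNIV (\<lambda>(t, z). ?P t z)"
    using continuous_on_mult_left[OF continuous_on_pulses] by (simp add: case_prod_unfold)
  have P2R: "unif_int M (2 * R) (?P t)" for t
    by (rule unif_int_mono[OF Pu]) (use A \<tau>D in \<open>auto simp: R_def\<close>)
  have cpP: "cpow M (?P s) m z = of_real (A ^ Suc m * real (Suc m) * b0 z)" if "z \<in> unit_cell 0" for s z
  proof -
    have "norm z + real (Suc m) \<le> N" using Q[OF that] N by linarith
    from cpow_pulses[OF a this m, of s] show ?thesis by (simp add: cpow_cmult b0(1))
  qed
  have T0: "0 \<le> T" "T \<in> {0..T}" using T by auto
  \<comment> \<open>Both pulses vanish on the unit cell at the origin, so the linear part there
    comes from \<phi>0 and \<phi>1 alone.\<close>
  have linQ: "norm (LINT z|dm M. indicator (unit_cell 0) z * free_wave ?g0 ?g1 T z) \<le> D'"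
  proof -
    have Qeq: "indicator (unit_cell 0) z * free_wave ?g0 ?g1 T z = indicator (unit_cell 0) z * free_wave \<phi>0 \<phi>1 T z" for z
    proof (cases "z \<in> unit_cell 0")
      case True
      have le: "norm z + 1 \<le> N" using Q[OF True] N by simp
      moreover have "1 * N \<le> real m * N" using m le norm_ge_zero[of z] by (intro mult_right_mono) linarith+
      then have "1 * N \<le> norm (- (real m *\<^sub>R a))" by (simp add: a(2))
      ultimately have "tent (z - a) = 0" "tent (z - (- (real m *\<^sub>R a))) = 0"
        by (intro distant_pulse_vanishes; simp add: a(2))+
      then show ?thesis by (simp only: free_wave_def pulse_data0_def pulse_data1_def) simp
    qed simp
    have "\<bar>T\<bar> \<le> 1" using T by simp
    then show ?thesis unfolding Qeq by (rule norm_integral_unit_cell_le[OF fwu fwb[OF \<phi>'] D'0])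
  qed
  have "\<bar>?\<kappa>\<bar> * (T^2 / 4 * (LINT z|dm M. indicator (unit_cell 0) z * (A ^ Suc m * real (Suc m) * b0 z))) - D'
      - \<bar>?\<kappa>\<bar> * (T^2 * (real (Suc m) * (2 * R) ^ m * (D' + 6 * \<tau> * T * A + \<bar>?\<kappa>\<bar> * (T^2 * (2 * R) ^ Suc m))))
    \<le> norm (LINT z|dm M. indicator (unit_cell 0) z * U T z)"
  proof (rule inflation_lower_bound[OF n' U Pc Pb P2R fwc[OF g'] err _ linQ eq _ e0 T0(1)])
    show "integrable (dm M) (free_wave ?g0 ?g1 T)"
      by (rule unif_int_integrable[OF linu[OF T0(2)] fwb[OF g']])
    show "0 \<le> 2 * R" using R by simp
    show "0 \<le> A ^ Suc m * real (Suc m) * b0 z" for z using A b0(2) by simp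
    show "integrable (dm M) (\<lambda>z. indicator (unit_cell 0) z * (A ^ Suc m * real (Suc m) * b0 z))"
      using integrable_mult_right[OF b0(3), of "A ^ Suc m * real (Suc m)"] by (simp add: mult_ac)
    show "T * norm z \<le> 1" if "z \<in> unit_cell 0" for z :: "real ^ 'd"
      using mult_left_mono[OF Q[OF that] T0(1)] T(3) by linarith
  qed (use cpP in auto)
  moreover have "(LINT z|dm M. indicator (unit_cell 0) z * (A ^ Suc m * real (Suc m) * b0 z)) = A ^ Suc m * real (Suc m) * (LINT z|dm M. indicator (unit_cell 0) z * b0 z)"
    unfolding integral_cmult[symmetric] by (intro Bochner_Integration.integral_cong) (auto simp: mult_ac)
  ultimately have bound: "c * (T^2 / 4 * (A ^ Suc m * real (Suc m) * (LINT z|dm M. indicator (unit_cell 0) z * b0 z))) - (K0 + K1) * D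
      - c * (T^2 * (real (Suc m) * (18 * \<tau> * A) ^ m * ((K0 + K1) * D + 6 * \<tau> * T * A + c * (T^2 * (18 * \<tau> * A) ^ Suc m))))
    \<le> norm (LINT z|dm M. indicator (unit_cell 0) z * U T z)"
    unfolding \<kappa> R(2) D'_def by (simp only:)
  have "decay n (2 * (L0 + L1)) (U t)" for t using U(2) continuous_on_section(2)[OF U(1)] by (simp add: decay_def)
  then show ?thesis using sol bound by blast
qed

text \<open>The exponent \<open>l\<close> is 0 for positions and 1 for velocities, whose height
  grows with the frequency. Against a weight of order \<open>r - l\<close> this growth cancels and
  \<open>N powr r\<close> remains.\<close>

lemma XF_norm_pulse_le:
  fixes a :: "real ^ 'd::finite"
  assumes s: "s \<le> r - l" and r: "- 1 \<le> r" "r \<le> 0" and l: "0 \<le> l" "l \<le> 1" and Z: "norm Z \<le> A * bracket a powr l" and A: "0 \<le> A"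
    and N: "1 \<le> N" "N \<le> norm a" and p: "1 \<le> p" and q: "1 \<le> q"
  shows "XF_norm M p q s (\<lambda>z. Z * of_real (tent (z - a))) \<le> ennreal (XF_const TYPE('d) * 2 ^ Suc CARD('d) * A * N powr r)"
proof -
  have "XF_norm M p q s (\<lambda>z. Z * of_real (tent (z - a))) \<le> XF_norm M p q (r - l) (\<lambda>z. Z * of_real (tent (z - a)))"
    by (rule XF_norm_mono_exponent[OF s q])
  also have "... \<le> ennreal (XF_const TYPE('d) * (norm Z * 2 ^ Suc CARD('d)) * bracket a powr (r - l))"
  proof (rule XF_norm_le)
    fix z :: "real ^ 'd"
    have "norm Z * tent (z - a) \<le> norm Z * (2 ^ Suc CARD('d) / wt (Suc CARD('d)) (z - a))" by (intro mult_left_mono tent_le) simp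
    then show "norm (Z * complex_of_real (tent (z - a))) \<le> norm Z * 2 ^ Suc CARD('d) / wt (Suc CARD('d)) (z - a)"
      using tent_bounds(1)[of "z - a"] by (simp only: norm_mult norm_of_real abs_of_nonneg times_divide_eq_right)
  qed (use r l p q in auto)
  also have "... \<le> ennreal (XF_const TYPE('d) * 2 ^ Suc CARD('d) * A * N powr r)"
  proof (rule ennreal_leI)
    have b: "0 < bracket a" using bracket_ge_1[of a] by linarith
    have Nb: "N \<le> bracket a" using N(2) by (rule order_trans) (simp add: bracket_def real_le_rsqrt)
    have "norm Z * bracket a powr (r - l) \<le> (A * bracket a powr l) * bracket a powr (r - l)" by (intro mult_right_mono Z) simp
    also have "... = A * bracket a powr r" using b by (simp add: mult.assoc flip: powr_add)
    also have "... \<le> A * N powr r" using N Nb r A by (intro mult_left_mono powr_mono2') auto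
    finally have "norm Z * bracket a powr (r - l) \<le> A * N powr r" .
    then have "(XF_const TYPE('d) * 2 ^ Suc CARD('d)) * (norm Z * bracket a powr (r - l)) \<le> (XF_const TYPE('d) * 2 ^ Suc CARD('d)) * (A * N powr r)"
      using XF_const_nonneg[where 'd='d] by (intro mult_left_mono) auto
    then show "XF_const TYPE('d) * (norm Z * 2 ^ Suc CARD('d)) * bracket a powr (r - l) \<le> XF_const TYPE('d) * 2 ^ Suc CARD('d) * A * N powr r"
      by (simp only: mult_ac)
  qed
  finally show ?thesis .
qed

text \<open>Two uses of the quasi-triangle inequality: \<open>16 * (2 / 2048) = 1 / 64\<close>,
  below \<open>1 / 32\<close>, for the two pulses, and then
  \<open>16 * (2 / 32) = 1\<close>.\<close>

lemma XF_norm_pulse_perturbation: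
  fixes a b :: "real ^ 'd::finite"
  assumes s: "s \<le> r - l" and r: "- 1 \<le> r" "r \<le> 0" and l: "0 \<le> l" "l \<le> 1"
    and zw: "norm Z \<le> A * bracket a powr l" "norm w \<le> A * bracket b powr l" and A: "0 \<le> A"
    and N: "1 \<le> N" "N \<le> norm a" "N \<le> norm b" and p: "1 \<le> p" and q: "1 \<le> q"
    and near: "XF_norm M p q s (\<lambda>z. \<phi> z - f z) < ennreal (\<delta> / 32)"
    and small: "XF_const TYPE('d) * 2 ^ Suc CARD('d) * A * N powr r \<le> \<delta> / 2048" and \<delta>: "0 < \<delta>"
    and borel: "\<phi> \<in> borel_measurable borel" "M = Euclidean ==> f \<in> borel_measurable borel"
  shows "XF_norm M p q s (\<lambda>z. \<phi> z + (Z * of_real (tent (z - a)) + w * of_real (tent (z - b))) - f z) < ennreal \<delta>"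
proof -
  let ?u = "\<lambda>z. Z * complex_of_real (tent (z - a))" and ?v = "\<lambda>z. w * complex_of_real (tent (z - b))"
  have uv: "XF_norm M p q s ?u \<le> ennreal (\<delta> / 2048)" "XF_norm M p q s ?v \<le> ennreal (\<delta> / 2048)"
    using XF_norm_pulse_le[OF s r l zw(1) A N(1,2) p q] XF_norm_pulse_le[OF s r l zw(2) A N(1,3) p q] ennreal_leI[OF small]
    by (blast intro: order_trans)+
  have uvb: "(\<lambda>z. ?u z + ?v z) \<in> borel_measurable borel" by measurable
  have pulses: "XF_norm M p q s (\<lambda>z. ?u z + ?v z) < ennreal (\<delta> / 32)"
  proof -
    have "XF_norm M p q s (\<lambda>z. ?u z + ?v z) \<le> 16 * (XF_norm M p q s ?u + XF_norm M p q s ?v)"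
      by (rule XF_norm_quasi_triangle[OF norm_triangle_ineq p q]) measurable
    also have "... \<le> 16 * (ennreal (\<delta> / 2048) + ennreal (\<delta> / 2048))" by (intro mult_left_mono add_mono uv) auto
    also have "... = ennreal (\<delta> / 64)" using \<delta> by (simp flip: ennreal_plus ennreal_numeral add: ennreal_mult[symmetric])
    also have "... < ennreal (\<delta> / 32)" using \<delta> by (intro ennreal_lessI) auto
    finally show ?thesis .
  qed
  have "XF_norm M p q s (\<lambda>z. \<phi> z + (?u z + ?v z) - f z) \<le> 16 * (XF_norm M p q s (\<lambda>z. \<phi> z - f z) + XF_norm M p q s (\<lambda>z. ?u z + ?v z))"
  proof (rule XF_norm_quasi_triangle[OF _ p q])
    show "norm (\<phi> z + (?u z + ?v z) - f z) \<le> norm (\<phi> z - f z) + norm (?u z + ?v z)" for z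
      using norm_triangle_ineq[of "\<phi> z - f z" "?u z + ?v z"] by (simp add: algebra_simps)
    show "(\<lambda>z. ?u z + ?v z) \<in> borel_measurable borel" by (rule uvb)
    show "(\<lambda>z. \<phi> z - f z) \<in> borel_measurable borel" if "M = Euclidean"
      using borel(1) borel(2)[OF that] by (rule borel_measurable_diff)
    show "(\<lambda>z. \<phi> z + (?u z + ?v z) - f z) \<in> borel_measurable borel" if "M = Euclidean"
      by (rule borel_measurable_diff[OF borel_measurable_add[OF borel(1) uvb] borel(2)[OF that]])
  qed
  also have "... < 16 * (ennreal (\<delta> / 32) + ennreal (\<delta> / 32))"
    using near pulses by (intro ennreal_mult_strict_left_mono add_strict_mono) auto
  also have "... = ennreal \<delta>" using \<delta> by (simp flip: ennreal_plus ennreal_numeral add: ennreal_mult[symmetric])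
  finally show ?thesis .
qed

text \<open>With \<open>t\<^sup>2 A\<^sup>m = \<delta>\<close> fixed, the Duhamel term has size \<open>A\<close>, and the errors are smaller
  by a factor that depends on \<open>\<delta>\<close> and \<open>t\<close> only.\<close>

lemma inflation_parameters:
  fixes m :: nat and c B D \<rho> \<tau> \<eta> Y V :: real
  assumes m: "1 \<le> m" and c: "0 < c" and B: "0 < B" and D: "0 \<le> D" and \<tau>: "1 \<le> \<tau>" and \<eta>: "0 < \<eta>" and V: "0 \<le> V"
  shows "\<exists>A T. 1 \<le> A \<and> D \<le> A \<and> 0 < T \<and> T < \<eta> \<and>
    c * (T^2 * (18 * \<tau> * A) ^ Suc m) \<le> 9 * \<tau> * A \<and> c * (T^2 * (V * (18 * \<tau> * A) ^ m)) \<le> 1 / 2 \<and>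
    Y < c * (T^2 / 4 * (A ^ Suc m * real (Suc m) * B)) - D
      - c * (T^2 * (real (Suc m) * (18 * \<tau> * A) ^ m * (D + 6 * \<tau> * T * A + c * (T^2 * (18 * \<tau> * A) ^ Suc m))))"
proof -
  define \<rho> where "\<rho> = 18 * \<tau>"
  define k where "k = real (Suc m)"
  have \<rho>: "0 < \<rho>" using \<tau> by (simp add: \<rho>_def)
  have k: "1 \<le> k" by (simp add: k_def)
  \<comment> \<open>The reciprocal of \<gamma>: its first three summands secure \<gamma>1, \<gamma>2
    and \<gamma>3 in turn, and the 1 keeps it positive.\<close>
  define X where "X = 16 * (\<rho> ^ m * \<rho> ^ Suc m) / B + \<rho> ^ Suc m + 2 * (V * \<rho> ^ m) + 1"
  have nn: "0 \<le> 16 * (\<rho> ^ m * \<rho> ^ Suc m) / B" "0 \<le> \<rho> ^ Suc m" "0 \<le> V * \<rho> ^ m" using \<rho> B V by auto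
  have X: "0 < X" using nn unfolding X_def by linarith
  define \<gamma> where "\<gamma> = 1 / X"
  have \<gamma>: "0 < \<gamma>" using X by (simp add: \<gamma>_def)
  have \<gamma>_le: "\<gamma> * y \<le> 1" if "y \<le> X" for y using that X by (simp add: \<gamma>_def)
  have \<gamma>1: "\<gamma> * (\<rho> ^ m * \<rho> ^ Suc m) \<le> B / 16"
  proof -
    have "\<gamma> * (16 * (\<rho> ^ m * \<rho> ^ Suc m) / B) \<le> 1" using nn by (intro \<gamma>_le) (simp add: X_def)
    then show ?thesis using B by (simp add: field_simps)
  qed
  have \<gamma>2: "\<gamma> * \<rho> ^ Suc m \<le> 1" using nn by (intro \<gamma>_le) (simp add: X_def)
  have \<gamma>3: "\<gamma> * (V * \<rho> ^ m) \<le> 1 / 2" using \<gamma>_le[of "2 * (V * \<rho> ^ m)"] nn by (simp add: X_def)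
  define \<delta> where "\<delta> = \<gamma> / c"
  have \<delta>: "0 < \<delta>" "c * \<delta> = \<gamma>" using \<gamma> c by (auto simp: \<delta>_def)
  \<comment> \<open>The solution of \<open>t^2 * A ^ m = \<delta>\<close>. It tends to 0 as
    \<open>A\<close> grows because \<open>m \<ge> 1\<close>.\<close>
  define t where "t A = sqrt (\<delta> / A ^ m)" for A :: real
  have "filterlim (\<lambda>A :: real. A ^ m) at_top at_top" using m by (intro filterlim_pow_at_top filterlim_ident) simp
  then have "((\<lambda>A. \<delta> / A ^ m) \<longlongrightarrow> 0) at_top"
    by (intro tendsto_divide_0[OF tendsto_const] filterlim_at_top_imp_at_infinity)
  from tendsto_real_sqrt[OF this] have t0: "(t \<longlongrightarrow> 0) at_top" by (simp add: t_def[abs_def])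
  \<comment> \<open>The second bound limits the contribution of the half-wave error to
    \<open>B / 16\<close>, a quarter of the main term \<open>B / 4\<close> in the same
    units.\<close>
  define \<eta>' where "\<eta>' = min \<eta> (B / (16 * (6 * \<tau> * \<rho> ^ m)))"
  have \<eta>': "0 < \<eta>'" unfolding \<eta>'_def using \<eta> B \<tau> \<rho> by simp
  have "\<forall>\<^sub>F A in at_top. t A < \<eta>'" using t0 \<eta>' by (rule order_tendstoD)
  \<comment> \<open>The third lower bound solves the final inequality for \<open>A\<close> with a
    margin of 1, using that \<open>B / 4 - B / 16 - B / 16 = B / 8\<close> is left of the main
    term.\<close>
  then obtain A where A: "1 \<le> A" "D \<le> A" "(Y + D + D * (\<gamma> * k * \<rho> ^ m) + 1) / (\<gamma> * k * B / 8) \<le> A" and tA: "t A < \<eta>'"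
    using eventually_happens[OF eventually_conj[OF eventually_ge_at_top[of "max 1 (max D ((Y + D + D * (\<gamma> * k * \<rho> ^ m) + 1) / (\<gamma> * k * B / 8)))"]]]
    by (metis max.bounded_iff trivial_limit_at_top_linorder)
  define T where "T = t A"
  have A0: "0 < A" using A by simp
  have T: "0 < T" using \<delta> A0 by (simp add: T_def t_def)
  have "T^2 = \<delta> / A ^ m" using \<delta> A0 by (simp add: T_def t_def)
  then have TA: "T^2 * A ^ m = \<delta>" using A0 by simp
  have cTA: "c * (T^2 * (w * (18 * \<tau> * A) ^ m)) = \<gamma> * (w * \<rho> ^ m)" for w
  proof -
    have "c * (T^2 * (w * (18 * \<tau> * A) ^ m)) = c * (T^2 * A ^ m) * (w * \<rho> ^ m)"
      by (simp add: power_mult_distrib \<rho>_def mult_ac)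
    then show ?thesis by (simp only: TA \<delta>)
  qed
  have cTA': "c * (T^2 * (18 * \<tau> * A) ^ Suc m) = \<gamma> * \<rho> ^ Suc m * A"
    using cTA[of "18 * \<tau> * A"] by (simp add: \<rho>_def mult_ac)
  have T\<tau>: "\<rho> ^ m * (6 * \<tau> * T) \<le> B / 16"
  proof -
    have "T \<le> B / (16 * (6 * \<tau> * \<rho> ^ m))" using tA by (simp add: T_def \<eta>'_def)
    then have "T * (16 * (6 * \<tau> * \<rho> ^ m)) \<le> B" using \<tau> \<rho> by (simp add: pos_le_divide_eq)
    then show ?thesis by (simp add: mult_ac)
  qed
  have "Y < c * (T^2 / 4 * (A ^ Suc m * k * B)) - D - c * (T^2 * (k * (18 * \<tau> * A) ^ m * (D + 6 * \<tau> * T * A + c * (T^2 * (18 * \<tau> * A) ^ Suc m))))"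
  proof -
    have "c * (T^2 / 4 * (A ^ Suc m * k * B)) = c * (T^2 * A ^ m) * (k * B / 4) * A" by simp
    also have "... = \<gamma> * k * A * (B / 4)" by (simp add: TA \<delta>)
    finally have 1: "c * (T^2 / 4 * (A ^ Suc m * k * B)) = \<gamma> * k * A * (B / 4)" .
    have "c * (T^2 * (k * (18 * \<tau> * A) ^ m * (D + 6 * \<tau> * T * A + \<gamma> * \<rho> ^ Suc m * A))) = c * (T^2 * (k * (18 * \<tau> * A) ^ m)) * (D + 6 * \<tau> * T * A + \<gamma> * \<rho> ^ Suc m * A)"
      by (simp only: mult.assoc)
    also have "... = D * (\<gamma> * k * \<rho> ^ m) + \<gamma> * k * A * (\<rho> ^ m * (6 * \<tau> * T) + \<gamma> * (\<rho> ^ m * \<rho> ^ Suc m))"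
      unfolding cTA by (simp add: algebra_simps)
    also have "... \<le> D * (\<gamma> * k * \<rho> ^ m) + \<gamma> * k * A * (B / 16 + B / 16)"
      using \<gamma> k A0 by (intro add_left_mono mult_left_mono add_mono T\<tau> \<gamma>1) auto
    finally have 2: "c * (T^2 * (k * (18 * \<tau> * A) ^ m * (D + 6 * \<tau> * T * A + c * (T^2 * (18 * \<tau> * A) ^ Suc m)))) \<le> D * (\<gamma> * k * \<rho> ^ m) + \<gamma> * k * A * (B / 8)"
      unfolding cTA' by simp
    have "0 < \<gamma> * k * B / 8" using \<gamma> k B by simp
    then have 3: "Y + D + D * (\<gamma> * k * \<rho> ^ m) + 1 \<le> A * (\<gamma> * k * B / 8)" using A(3) by (simp only: pos_divide_le_eq)
    have "\<gamma> * k * A * (B / 4) = A * (\<gamma> * k * B / 8) + \<gamma> * k * A * (B / 8)" by simp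
    then show ?thesis using 1 2 3 by linarith
  qed
  moreover have "c * (T^2 * (18 * \<tau> * A) ^ Suc m) \<le> 9 * \<tau> * A"
  proof -
    have "\<gamma> * \<rho> ^ Suc m * A \<le> 1 * A" using \<gamma>2 A0 by (intro mult_right_mono) auto
    also have "... \<le> 9 * \<tau> * A" using \<tau> A0 by (intro mult_right_mono) auto
    finally show ?thesis unfolding cTA' .
  qed
  moreover have "c * (T^2 * (V * (18 * \<tau> * A) ^ m)) \<le> 1 / 2" unfolding cTA by (rule \<gamma>3)
  ultimately show ?thesis using A T tA unfolding k_def by (intro exI[of _ A] exI[of _ T]) (auto simp: T_def \<eta>'_def)
qed

theorem theorem1p7:
  fixes M :: base_space and k :: nat and p q :: ennreal and s \<epsilon> sg :: real
    and u0 u1 :: "'d::finite distr"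
  assumes "k \<ge> 2" and "1 \<le> p" and "1 \<le> q" and "s < 0"
    and "M = Torus \<longrightarrow> p = q"
    and "sg = 1 \<or> sg = - 1"
    and "(u0, u1) \<in> data_space M p q s"
    and "\<epsilon> > 0"
  shows "\<exists>u v0 v1 T t\<^sub>\<epsilon>.
    0 < t\<^sub>\<epsilon> \<and> t\<^sub>\<epsilon> < \<epsilon> \<and> t\<^sub>\<epsilon> \<le> T \<and>
    wave_solution M sg k T u v0 v1 \<and>
    (v0 - u0, v1 - u1) \<in> data_space M p q s \<and>
    data_norm M p q s (v0 - u0, v1 - u1) < ennreal \<epsilon> \<and>
    fdist M (u t\<^sub>\<epsilon>) \<in> X_space M p q s \<and>
    X_norm M p q s (fdist M (u t\<^sub>\<epsilon>)) > ennreal (1 / \<epsilon>)"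
proof -
  let ?d = "CARD('d)"
  \<comment> \<open>From \<open>k \<ge> 2\<close> comes \<open>m \<ge> 1\<close>, which lets the
    time tend to 0 as the amplitude grows and separates the resonant term from the others.\<close>
  obtain m where k: "k = Suc m" and m: "1 \<le> m" using assms(1) by (cases k) auto
  note p = assms(2) and q = assms(3) and s = assms(4) and \<epsilon> = assms(8)
  have u0: "u0 \<in> X_space M p q s" and u1: "u1 \<in> X_space M p q (s - 1)"
    using assms(7) by (auto simp: data_space_def)
  obtain f0 f1 where "is_fourier M u0 f0" "is_fourier M u1 f1"
    using u0 u1 by (auto simp: X_space_eq test_closure_def)
  then have f: "is_fourier M u0 (fourier M u0)" "is_fourier M u1 (fourier M u1)" by (auto intro: is_fourier_fourier)
  have fb: "M = Euclidean ==> fourier M u0 \<in> borel_measurable borel" "M = Euclidean ==> fourier M u1 \<in> borel_measurable borel"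
    using f is_fourier_borel by blast+
  \<comment> \<open>The decay order required of solutions. The data are approximated with one order
    more, which pays for the quadratic expansion in time.\<close>
  define n where "n = ?d + 2"
  have n: "?d \<le> n" "?d + 2 \<le> n" by (auto simp: n_def)
  have s0: "s \<le> 0" "s - 1 \<le> 0" and \<epsilon>': "0 < \<epsilon> / 2" "0 < \<epsilon> / 2 / 32" using s \<epsilon> by auto
  obtain \<phi>0 K0 where \<phi>0: "decay (Suc n) K0 \<phi>0" "XF_norm M p q s (\<lambda>z. \<phi>0 z - fourier M u0 z) < ennreal (\<epsilon> / 2 / 32)"
    using X_space_decay_approximation[OF u0 s0(1) p q \<epsilon>'(2)] by blast
  obtain \<phi>1 K1 where \<phi>1: "decay (Suc n) K1 \<phi>1" "XF_norm M p q (s - 1) (\<lambda>z. \<phi>1 z - fourier M u1 z) < ennreal (\<epsilon> / 2 / 32)"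
    using X_space_decay_approximation[OF u1 s0(2) p q \<epsilon>'(2)] by blast
  obtain b0 where b0: "\<And>z. cpow M (\<lambda>z. of_real (tent z)) m z = of_real (b0 z)" "\<And>z :: real ^ 'd. 0 \<le> b0 z"
    "integrable (dm M) (\<lambda>z. indicator (unit_cell 0) z * b0 z)" "0 < (LINT z|dm M. indicator (unit_cell 0) z * b0 z)"
    using cpow_tent_mass[where M=M and j=m] by blast
  define \<tau> where "\<tau> = 2 ^ n * dmK M TYPE('d) + 1"
  have \<tau>: "2 ^ n * dmK M TYPE('d) \<le> \<tau>" "1 \<le> \<tau>" by (auto simp: \<tau>_def)
  let ?D = "(K0 + K1) * dmK M TYPE('d)"
  have D: "0 \<le> ?D" using decay_nonneg[OF \<phi>0(1)] decay_nonneg[OF \<phi>1(1)] by simp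
  have c: "0 < gauss_const TYPE('d) ^ m" by simp
  have \<eta>: "0 < min \<epsilon> (1 / sqrt (real ?d))" using \<epsilon> by simp
  \<comment> \<open>Both are fixed before \<open>N\<close>. The target is
    \<open>2 / \<epsilon>\<close> because \<open>XF_norm_lower\<close> loses a factor 2, and the
    bound \<open>1 / sqrt d\<close> on \<open>T\<close>, with \<open>d\<close> the dimension,
    ensures \<open>T * norm z \<le> 1\<close> on the unit cell.\<close>
  obtain A T where A: "1 \<le> A" "?D \<le> A" and T: "0 < T" "T < min \<epsilon> (1 / sqrt (real ?d))"
    and small: "gauss_const TYPE('d) ^ m * (T^2 * (18 * \<tau> * A) ^ Suc m) \<le> 9 * \<tau> * A"
      "gauss_const TYPE('d) ^ m * (T^2 * (cpow_const n m * (18 * \<tau> * A) ^ m)) \<le> 1 / 2"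
    and large: "2 / \<epsilon> < gauss_const TYPE('d) ^ m * (T^2 / 4 * (A ^ Suc m * real (Suc m) * (LINT z|dm M. indicator (unit_cell 0) z * b0 z))) - ?D
      - gauss_const TYPE('d) ^ m * (T^2 * (real (Suc m) * (18 * \<tau> * A) ^ m * (?D + 6 * \<tau> * T * A + gauss_const TYPE('d) ^ m * (T^2 * (18 * \<tau> * A) ^ Suc m))))"
    using inflation_parameters[OF m c b0(4) D \<tau>(2) \<eta> cpow_const_nonneg[of n m], where Y="2 / \<epsilon>"] by blast
  have d1: "1 \<le> sqrt (real ?d)" by (simp add: Suc_leI)
  have T': "T < \<epsilon>" "T * sqrt (real ?d) \<le> 1" "T \<le> 1"
  proof -
    show "T < \<epsilon>" using T by simp
    have "T < 1 / sqrt (real ?d)" using T by simp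
    then show Td: "T * sqrt (real ?d) \<le> 1" using d1 by (simp add: field_simps)
    have "T * 1 \<le> T * sqrt (real ?d)" using d1 T by (intro mult_left_mono) auto
    then show "T \<le> 1" using Td by simp
  qed
  \<comment> \<open>A very negative \<open>s\<close> is raised to -1, so that \<open>r - 1\<close>
    stays within the range of \<open>bracket_peetre\<close>; still \<open>r < 0\<close>, which
    drives the pulses to 0 in the data norm.\<close>
  define r where "r = max s (- 1)"
  have r: "- 1 \<le> r" "r \<le> 0" "r < 0" "s \<le> r" using s by (auto simp: r_def)
  let ?C = "XF_const TYPE('d) * 2 ^ Suc ?d * A"
  have "((\<lambda>N. ?C * real N powr r) \<longlongrightarrow> ?C * 0) sequentially"
    by (intro tendsto_mult_left tendsto_neg_powr r filterlim_real_sequentially)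
  then have "\<forall>\<^sub>F N in sequentially. ?C * real N powr r < \<epsilon> / 2 / 2048"
    using \<epsilon> by (intro order_tendstoD(2)) auto
  moreover have "\<forall>\<^sub>F N in sequentially. sqrt (real ?d) + real (Suc m) \<le> real N"
    using filterlim_real_sequentially unfolding filterlim_at_top by (rule spec)
  ultimately have "\<forall>\<^sub>F N in sequentially. ?C * real N powr r < \<epsilon> / 2 / 2048 \<and> sqrt (real ?d) + real (Suc m) \<le> real N"
    by (rule eventually_conj)
  from eventually_happens'[OF sequentially_bot this]
  obtain N :: nat where N: "?C * real N powr r < \<epsilon> / 2 / 2048" "sqrt (real ?d) + real (Suc m) \<le> real N"
    by (elim exE conjE)
  \<comment> \<open>As \<open>N\<close> is a natural number, this is a lattice vector;
    \<open>undefined\<close> merely picks some coordinate direction.\<close>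
  define a where "a = real N *\<^sub>R axis (undefined :: 'd) (1 :: real)"
  have "axis (undefined :: 'd) (1 :: real) \<in> dgrp M" by (cases M) (auto simp: dgrp_def lattice_def axis_def)
  then have a: "a \<in> dgrp M" "norm a = real N" unfolding a_def by (auto intro: dgrp_scaleR_of_nat simp: norm_axis_real)
  let ?b = "- (real m *\<^sub>R a)"
  let ?g0 = "pulse_data0 m a A \<phi>0" and ?g1 = "pulse_data1 m (real N) a A \<phi>1"
  obtain U K where sol: "wave_solution M sg (Suc m) T (\<lambda>t. synth M (U t)) (fdist M (synth M ?g0)) (fdist M (synth M ?g1))"
    and U: "\<And>t. decay n K (U t)"
    and lower: "gauss_const TYPE('d) ^ m * (T^2 / 4 * (A ^ Suc m * real (Suc m) * (LINT z|dm M. indicator (unit_cell 0) z * b0 z))) - ?D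
      - gauss_const TYPE('d) ^ m * (T^2 * (real (Suc m) * (18 * \<tau> * A) ^ m * (?D + 6 * \<tau> * T * A + gauss_const TYPE('d) ^ m * (T^2 * (18 * \<tau> * A) ^ Suc m))))
      \<le> norm (LINT z|dm M. indicator (unit_cell 0) z * U T z)"
    using pulse_solution[OF n(2) \<phi>0(1) \<phi>1(1) m assms(6) a N(2) \<tau> A T(1) T'(3,2) small b0(1-3)] by blast
  obtain L0 L1 where g: "decay (Suc n) L0 ?g0" "decay (Suc n) L1 ?g1" using decay_pulse_data \<phi>0(1) \<phi>1(1) by meson
  have g': "decay (CARD('d) + 2) L0 ?g0" "decay (CARD('d) + 2) L1 ?g1" and U': "decay (CARD('d) + 2) K (U T)"
    using decay_mono[OF g(1) order_refl] decay_mono[OF g(2) order_refl] U by (auto simp: n_def)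
  have int: "integrable (dm M) ?g0" "integrable (dm M) ?g1" "integrable (dm M) (U T)"
    by (rule integrable_decay[OF g'(1)] integrable_decay[OF g'(2)] integrable_decay[OF U']; simp)+
  have N1: "1 \<le> real N" using N(2) d1 by linarith
  have Nb: "real N \<le> norm ?b" using mult_right_mono[of 1 "real m" "real N"] m by (simp add: a(2))
  have bracket_norm: "norm x \<le> bracket x" for x :: "real ^ 'd" by (simp add: bracket_def real_le_rsqrt)
  have bracket_pos: "0 < bracket x" for x :: "real ^ 'd" using bracket_ge_1[of x] by linarith
  have A0: "0 \<le> A" using A by simp
  have near0: "XF_norm M p q s (\<lambda>z. ?g0 z - fourier M u0 z) < ennreal (\<epsilon> / 2)"
    unfolding pulse_data0_def
  proof (rule XF_norm_pulse_perturbation[where r=r and l=0 and A=A and N="real N"])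
    show "norm (complex_of_real A) \<le> A * bracket a powr 0" "norm (complex_of_real A) \<le> A * bracket ?b powr 0"
      using A0 bracket_pos[of a] bracket_pos[of ?b] by simp_all
  qed (use r A0 N1 Nb p q \<phi>0(2) N(1) \<epsilon>' fb decay_borel[OF \<phi>0(1)] a in auto)
  have near1: "XF_norm M p q (s - 1) (\<lambda>z. ?g1 z - fourier M u1 z) < ennreal (\<epsilon> / 2)"
    unfolding pulse_data1_def
  proof (rule XF_norm_pulse_perturbation[where r=r and l=1 and A=A and N="real N"])
    show "norm (complex_of_real A * (\<i> * of_real (- real N))) \<le> A * bracket a powr 1"
      using mult_left_mono[OF bracket_norm[of a] A0] bracket_pos[of a] A0 by (simp add: norm_mult a(2))
    show "norm (complex_of_real A * (\<i> * of_real (real m * real N))) \<le> A * bracket ?b powr 1"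
      using mult_left_mono[OF bracket_norm[of ?b] A0] bracket_pos[of ?b] A0 by (simp add: norm_mult a(2))
  qed (use r A0 N1 Nb p q \<phi>1(2) N(1) \<epsilon>' fb decay_borel[OF \<phi>1(1)] a in auto)
  have "data_norm M p q s (fdist M (synth M ?g0) - u0, fdist M (synth M ?g1) - u1) < ennreal \<epsilon>"
  proof -
    have "data_norm M p q s (fdist M (synth M ?g0) - u0, fdist M (synth M ?g1) - u1)
        = XF_norm M p q s (\<lambda>z. ?g0 z - fourier M u0 z) + XF_norm M p q (s - 1) (\<lambda>z. ?g1 z - fourier M u1 z)"
      unfolding data_norm_def fst_conv snd_conv
        X_norm_eq[OF is_fourier_diff[OF is_fourier_synth[OF int(1)] f(1)] p] X_norm_eq[OF is_fourier_diff[OF is_fourier_synth[OF int(2)] f(2)] p] ..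
    also have "... < ennreal (\<epsilon> / 2) + ennreal (\<epsilon> / 2)" by (intro add_strict_mono near0 near1)
    also have "... = ennreal \<epsilon>" using \<epsilon> by (simp flip: ennreal_plus)
    finally show ?thesis .
  qed
  moreover have "(fdist M (synth M ?g0) - u0, fdist M (synth M ?g1) - u1) \<in> data_space M p q s"
    using X_space_diff[OF synth_X_space[OF g'(1) s0(1) p q] u0 p q] X_space_diff[OF synth_X_space[OF g'(2) s0(2) p q] u1 p q]
    by (simp add: data_space_def)
  moreover have "fdist M (synth M (U T)) \<in> X_space M p q s" by (rule synth_X_space[OF U' s0(1) p q])
  moreover have "X_norm M p q s (fdist M (synth M (U T))) > ennreal (1 / \<epsilon>)"
  proof (rule ccontr)
    assume "\<not> ?thesis"
    then have "XF_norm M p q s (U T) \<le> ennreal (1 / \<epsilon>)" using X_norm_eq[OF is_fourier_synth[OF int(3)] p, of q s] by simp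
    then have "2 * XF_norm M p q s (U T) \<le> 2 * ennreal (1 / \<epsilon>)" by (rule mult_left_mono) simp
    also have "... = ennreal (2 / \<epsilon>)" using \<epsilon> by (simp flip: ennreal_numeral add: ennreal_mult[symmetric])
    finally have "ennreal (norm (LINT z|dm M. indicator (unit_cell 0) z * U T z)) \<le> ennreal (2 / \<epsilon>)"
      using XF_norm_lower[OF decay_borel[OF U'] p q, of M s] by (rule order_trans[rotated])
    then have "norm (LINT z|dm M. indicator (unit_cell 0) z * U T z) \<le> 2 / \<epsilon>" using \<epsilon> by simp
    then show False using large lower by linarith
  qed
  ultimately show ?thesis using sol T(1) T'(1) unfolding k by blast
qed

end
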